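(* Let $n\ge1$, $\epsilon>0$, $M>0$ and $r>1$. There exist (explicit) constants $C=C(\epsilon,M,n)>0$ and $\beta=\beta(r)>0$ such that for every $f\in\mathcal{\tilde F}(\epsilon,M,r)$ on $\mathbb{R}^n$ with unit mass ($\int_{\mathbb{R}^n}f\,d\gamma=1$), zero barycenter ($\int_{\mathbb{R}^n}xf(x)\,d\gamma(x)=0$) and $\delta(f)\le1$, $$W_2(f\,d\gamma,\,d\gamma)\le C\,\delta(f)^{\beta}.$$ Moreover, one may take $\beta=\frac{r-1}{2(2r-1)}$.
   Context: $d\gamma:=(2\pi)^{-n/2}e^{-|x|^2/2}dx$ is the standard Gaussian measure on $\mathbb{R}^n$. For $\epsilon>0$, $M>0$, $r>1$, $$\mathcal{\tilde F}(\epsilon,M,r):=\Big\{f=e^{-h}:\ (-1+\epsilon)\le D^2h,\ \int_{\mathbb{R}^n}\|(D^2h+\mathrm{Id})_+\|^{r}f\,d\gamma\le M\Big\},$$ where $h:\mathbb{R}^n\to\mathbb{R}$ is smooth, the inequality means $(-1+\epsilon)\mathrm{Id}\le D^2h(x)$ as symmetric matrices for all $x$, $A_+$ denotes the positive part of a symmetric matrix $A$, and $\|\cdot\|$ is the standard induced (operator) matrix norm. For a positive function $f$ the Fisher information, entropy and log-Sobolev deficit are $$I(f)=\int_{\mathbb{R}^n}\frac{|\nabla f|^2}{f}\,d\gamma,\qquad Ent(f)=\int_{\mathbb{R}^n}f\log f\,d\gamma-\|f\|_{L^1(d\gamma)}\log\big(\|f\|_{L^1(d\gamma)}\big),\qquad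 \delta(f)=\tfrac12 I(f)-Ent(f).$$ $W_2$ is the quadratic Wasserstein distance between probability measures on $\mathbb{R}^n$: $W_2^2(\rho,\nu)=\inf_\pi\int|x-y|^2d\pi(x,y)$ over couplings $\pi$ of $\rho$ and $\nu$. *)

theory Defs
  imports "HOL-Analysis.Analysis"
begin

section \<open>Derivatives of functions on Euclidean space\<close>

definition partial_deriv :: "'n::finite \<Rightarrow> (real^'n \<Rightarrow> real) \<Rightarrow> real^'n \<Rightarrow> real" where
  "partial_deriv i h x = frechet_derivative h (at x) (axis i 1)"

text \<open>For \<open>k \<ge> 1\<close>, a function is \<open>C\<^sup>k\<close> iff it is differentiable and all its first-order partial
  derivatives are \<open>C\<^sup>k\<^sup>-\<^sup>1\<close>; \<open>C\<^sup>0\<close> means continuous.\<close>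

primrec Ck :: "nat \<Rightarrow> (real^'n::finite \<Rightarrow> real) \<Rightarrow> bool" where
  "Ck 0 h \<longleftrightarrow> continuous_on UNIV h"
| "Ck (Suc k) h \<longleftrightarrow> h differentiable_on UNIV \<and> (\<forall>i. Ck k (partial_deriv i h))"

definition smooth :: "(real^'n::finite \<Rightarrow> real) \<Rightarrow> bool" where
  "smooth h \<longleftrightarrow> (\<forall>k. Ck k h)"

definition grad :: "(real^'n::finite \<Rightarrow> real) \<Rightarrow> real^'n \<Rightarrow> real^'n" where
  "grad h x = (\<chi> i. partial_deriv i h x)"

definition hessian :: "(real^'n::finite \<Rightarrow> real) \<Rightarrow> real^'n \<Rightarrow> real^'n^'n" where
  "hessian h x = (\<chi> i j. partial_deriv j (partial_deriv i h) x)"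


section \<open>Symmetric matrices\<close>

definition loewner_le :: "real^'n^'n \<Rightarrow> real^'n^'n::finite \<Rightarrow> bool" where
  "loewner_le A B \<longleftrightarrow> (\<forall>v. v \<bullet> (A *v v) \<le> v \<bullet> (B *v v))"

definition diag_mat :: "real^'n \<Rightarrow> real^'n^'n::finite" where
  "diag_mat d = (\<chi> i j. if i = j then d $ i else 0)"

text \<open>Functional calculus: for symmetric \<open>A = Q diag(d) Q\<^sup>T\<close> with \<open>Q\<close> orthogonal,
  \<open>A\<^sub>+ = Q diag(max d 0) Q\<^sup>T\<close>. Such a decomposition exists by the spectral theorem, and the
  result does not depend on its choice. The value is only meaningful for symmetric \<open>A\<close>.\<close>

definition pos_part :: "real^'n^'n \<Rightarrow> real^'n^'n::finite" where
  "pos_part A = (THE B. \<exists>Q d. orthogonal_matrix Q \<and>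
      A = Q ** diag_mat d ** transpose Q \<and>
      B = Q ** diag_mat (\<chi> i. max (d $ i) 0) ** transpose Q)"

definition op_norm :: "real^'n^'n::finite \<Rightarrow> real" where
  "op_norm A = onorm ((*v) A)"


section \<open>Gaussian measure and functionals\<close>

definition gauss :: "(real^'n::finite) measure" where
  "gauss = density lborel
     (\<lambda>x. ennreal ((2 * pi) powr (- real CARD('n) / 2) * exp (- (norm x)\<^sup>2 / 2)))"

text \<open>The integral condition uses the nonnegative extended integral, so that it includes finiteness.\<close>

definition class_F :: "real \<Rightarrow> real \<Rightarrow> real \<Rightarrow> (real^'n::finite \<Rightarrow> real) set" where
  "class_F \<epsilon> M r = {f. \<exists>h. smooth h \<and> f = (\<lambda>x. exp (- h x)) \<and>
      (\<forall>x. loewner_le (mat (-1 + \<epsilon>)) (hessian h x)) \<and>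
      (\<integral>\<^sup>+x. ennreal (op_norm (pos_part (hessian h x + mat 1)) powr r * f x) \<partial>gauss) \<le> ennreal M}"

text \<open>The Fisher information may be infinite for a general positive \<open>f\<close>, hence so may the deficit.\<close>

definition fisher :: "(real^'n::finite \<Rightarrow> real) \<Rightarrow> ennreal" where
  "fisher f = (\<integral>\<^sup>+x. ennreal ((norm (grad f x))\<^sup>2 / f x) \<partial>gauss)"

text \<open>The Bochner integrals below are used only for \<open>f \<in> class_F \<epsilon> M r\<close> with \<open>\<epsilon> > 0\<close>. There
  \<open>f d\<gamma>\<close> has a density \<open>e\<^sup>-\<^sup>V\<close> with \<open>D\<^sup>2V \<ge> \<epsilon> Id\<close>, so \<open>f\<close> and \<open>f log f\<close> are integrable.\<close>

definition entropy :: "(real^'n::finite \<Rightarrow> real) \<Rightarrow> real" where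
  "entropy f = (\<integral>x. f x * ln (f x) \<partial>gauss) - (\<integral>x. \<bar>f x\<bar> \<partial>gauss) * ln (\<integral>x. \<bar>f x\<bar> \<partial>gauss)"

definition deficit :: "(real^'n::finite \<Rightarrow> real) \<Rightarrow> ereal" where
  "deficit f = ereal (1/2) * enn2ereal (fisher f) - ereal (entropy f)"


section \<open>Quadratic Wasserstein distance\<close>

definition couplings :: "'a measure \<Rightarrow> 'b measure \<Rightarrow> ('a \<times> 'b) measure set" where
  "couplings \<rho> \<nu> = {\<pi>. sets \<pi> = sets (\<rho> \<Otimes>\<^sub>M \<nu>) \<and> distr \<pi> \<rho> fst = \<rho> \<and> distr \<pi> \<nu> snd = \<nu>}"

definition W2_sq :: "(real^'n::finite) measure \<Rightarrow> (real^'n) measure \<Rightarrow> ennreal" where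
  "W2_sq \<rho> \<nu> = (INF \<pi>\<in>couplings \<rho> \<nu>. \<integral>\<^sup>+p. ennreal ((norm (fst p - snd p))\<^sup>2) \<partial>\<pi>)"

definition W2 :: "(real^'n::finite) measure \<Rightarrow> (real^'n) measure \<Rightarrow> ennreal" where
  "W2 \<rho> \<nu> = (if W2_sq \<rho> \<nu> = \<infinity> then \<infinity> else ennreal (sqrt (enn2real (W2_sq \<rho> \<nu>))))"

end

theory Submission imports Defs "HOL-Probability.Probability" begin

text \<open>Write delta for the deficit. The heart of the proof is that for centred f the whole
  Fisher information is at most a constant times delta. Small Fisher information then forces small
  W2 by elementary inequalities.

  The curvature bound makes f d\<gamma> more log-concave than a Gaussian of variance 1/\<epsilon>.
  The Prekopa-Leindler inequality relative to the Gaussian measure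
  (\<open>gaussian_PL_gauss\<close>) yields Maurey's property (tau) for such measures, and its
  second-order expansion is a Poincare inequality with constant 1/\<epsilon>
  (\<open>poincare_property_tau\<close>).

  In dimension one let T be the monotone map from f d\<gamma> to \<gamma> and s = f'/f the score.
  Integration by parts turns the deficit into half the squared L^2 norm of s + T - x plus the
  integral of T' - 1 - ln T' (\<open>deficit_transport\<close>). Caffarelli's bound T' >= sqrt
  \<epsilon> and the Gaussian Poincare inequality for the inverse of T show that the two terms
  control the L^2 distance of s from the barycentre (\<open>deficit_stability_real\<close>).

  In dimension n a coordinate k is singled out. The chain rule for entropy and the log-Sobolev
  inequality for the marginal in the other coordinates show (\<open>deficit_split\<close>) that
  delta bounds two quantities: the L^2 distance of the k-th score from the conditional mean b of
  x_k, and the Fisher information \<open>gap\<close> lost when x_k is averaged out. The gradient of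
  b is a conditional covariance of x_k with the other scores, hence is controlled by
  \<open>gap\<close>; since b has mean zero, the Poincare inequality makes b small. So the k-th
  score is small (\<open>fisher_component_le\<close>), and summing over k gives
  \<open>fisher_le_deficit\<close>.

  The Poincare inequality for sqrt f bounds the squared Hellinger distance of f d\<gamma> and
  \<gamma> by a multiple of delta. The growth conditions that the averaging argument needs are
  obtained by Ornstein-Uhlenbeck regularisation, which keeps the curvature bound and the zero
  barycentre and does not raise the Fisher information; the Hellinger bound passes to the limit
  (\<open>hellinger_le_deficit\<close>).

  Finally W2^2 is at most twice the integral of |x|^2 |f - 1| d\<gamma>
  (\<open>W2_sq_density_le\<close>), and Cauchy-Schwarz with fourth moments bounds that by a
  constant times sqrt delta (\<open>W2_sq_le_deficit\<close>). Thus W2 <= C delta^(1/4), and delta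
  <= 1 together with \<beta> <= 1/4 gives the claim.\<close>

section \<open>The Prekopa-Leindler inequality on the line\<close>

text \<open>One-dimensional Brunn-Minkowski for midpoints. For compact K and L the half-size copies
  (K + min L)/2 and (max K + L)/2 lie in C and meet in at most one point, so their measures add up
  inside C. Inner regularity passes from compact subsets to A and B.\<close>

lemma emeasure_midpoint_ge:
  fixes A B C :: "real set"
  assumes [measurable]: "A \<in> sets borel" "B \<in> sets borel" "C \<in> sets borel"
    and ne: "A \<noteq> {}" "B \<noteq> {}" and fin: "emeasure lborel A < \<infinity>" "emeasure lborel B < \<infinity>"
    and mid: "\<And>x y. x \<in> A \<Longrightarrow> y \<in> B \<Longrightarrow> (x + y) / 2 \<in> C"
  shows "emeasure lborel A + emeasure lborel B \<le> 2 * emeasure lborel C"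
proof -
  have comp: "emeasure lborel K + emeasure lborel L \<le> 2 * emeasure lborel C"
    if K: "compact K" "K \<subseteq> A" "K \<noteq> {}" and L: "compact L" "L \<subseteq> B" "L \<noteq> {}" for K L
  proof -
    obtain k where k: "k \<in> K" "\<And>x. x \<in> K \<Longrightarrow> x \<le> k"
      using compact_attains_sup[OF K(1) K(3)] by auto
    obtain l where l: "l \<in> L" "\<And>x. x \<in> L \<Longrightarrow> l \<le> x"
      using compact_attains_inf[OF L(1) L(3)] by auto
    have [measurable]: "K \<in> sets borel" "L \<in> sets borel"
      using K(1) L(1) by (auto intro: borel_closed compact_imp_closed)
    define K' where "K' = (\<lambda>x. (x + l) / 2) ` K"
    define L' where "L' = (\<lambda>y. (k + y) / 2) ` L"
    have eqK: "K' = (\<lambda>x. (l/2) + (1/2) *\<^sub>R x) ` K" unfolding K'_def by (auto simp: image_def field_simps)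
    have eqL: "L' = (\<lambda>x. (k/2) + (1/2) *\<^sub>R x) ` L" unfolding L'_def by (auto simp: image_def field_simps)
    have cK: "compact K'" "compact L'"
      unfolding K'_def L'_def by (intro compact_continuous_image continuous_intros K L; simp)+
    then have [measurable]: "K' \<in> sets borel" "L' \<in> sets borel"
      by (auto intro: borel_closed compact_imp_closed)
    have half: "emeasure lborel ((\<lambda>x. c + (1/2) *\<^sub>R x) ` S) = emeasure lborel S / 2"
      if "S \<in> sets borel" "(\<lambda>x. c + (1/2) *\<^sub>R x) ` S \<in> sets borel" for c :: real and S
    proof -
      have "emeasure lebesgue ((\<lambda>x. c + (1/2) *\<^sub>R x) ` S) = ennreal \<bar>1/2\<bar> ^ DIM(real) * emeasure lebesgue S"
        using emeasure_lebesgue_affine[of "1/2" c S] by (simp add: add.commute)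
      then have "emeasure lebesgue ((\<lambda>x. c + (1/2) *\<^sub>R x) ` S) = ennreal (1/2) * emeasure lebesgue S"
        by simp
      also have "ennreal (1/2) = 1 / 2"
        by (metis divide_ennreal ennreal_1 ennreal_numeral zero_le_numeral zero_le_one zero_less_numeral)
      finally have "emeasure lebesgue ((\<lambda>x. c + (1/2) *\<^sub>R x) ` S) = emeasure lebesgue S / 2"
        by (simp add: ennreal_times_divide mult.commute divide_ennreal_def)
      then show ?thesis using that by simp
    qed
    have hK: "emeasure lborel K' = emeasure lborel K / 2"
      using half[of K "l/2", folded eqK] by simp
    have hL: "emeasure lborel L' = emeasure lborel L / 2"
      using half[of L "k/2", folded eqL] by simp
    have "emeasure lborel K' + emeasure lborel L' = emeasure lborel (K' \<union> L') + emeasure lborel (K' \<inter> L')"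
      by (rule emeasure_Un_Int) auto
    moreover have "K' \<inter> L' \<subseteq> {(k + l) / 2}"
    proof
      fix z assume "z \<in> K' \<inter> L'"
      then obtain x y where xy: "x \<in> K" "y \<in> L" "z = (x + l) / 2" "z = (k + y) / 2" unfolding K'_def L'_def by auto
      then have "x \<le> k" "l \<le> y" using k l by auto
      then show "z \<in> {(k + l) / 2}" using xy(3,4) by simp
    qed
    then have "emeasure lborel (K' \<inter> L') = 0"
      by (intro emeasure_lborel_countable countable_finite) (rule finite_subset, auto)
    moreover have "emeasure lborel (K' \<union> L') \<le> emeasure lborel C"
    proof (rule emeasure_mono)
      show "K' \<union> L' \<subseteq> C"
        using mid[OF _ subsetD[OF L(2) l(1)]] mid[OF subsetD[OF K(2) k(1)]] K(2) L(2) unfolding K'_def L'_def by blast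
    qed simp
    ultimately have "emeasure lborel K / 2 + emeasure lborel L / 2 \<le> emeasure lborel C"
      using hK hL by simp
    then have "2 * (emeasure lborel K / 2 + emeasure lborel L / 2) \<le> 2 * emeasure lborel C"
      by (intro mult_left_mono) auto
    moreover have "2 * (a / 2) = a" for a :: ennreal
      by (simp add: ennreal_times_divide mult.commute[of 2] mult_divide_eq_ennreal)
    ultimately show ?thesis by (simp add: distrib_left)
  qed
  have sup: "emeasure lborel S = (SUP K\<in>{K. K \<subseteq> S \<and> compact K \<and> K \<noteq> {}}. emeasure lborel K)"
    if S: "S \<in> sets borel" "S \<noteq> {}" "emeasure lborel S < \<infinity>" for S :: "real set"
  proof (rule antisym)
    obtain s where s: "s \<in> S" using S by auto
    \<comment> \<open>Restricting Lebesgue measure to S makes it finite, as inner regularity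
      requires.\<close>
    have dens: "emeasure (density lborel (indicator S)) K = emeasure lborel K" if "K \<subseteq> S" "K \<in> sets borel" for K
      using that S by (subst emeasure_density)
        (auto simp: indicator_inter_arith[symmetric] Int_absorb1 simp flip: nn_integral_indicator intro!: nn_integral_cong split: split_indicator)
    have "emeasure lborel S = emeasure (density lborel (indicator S)) S" using dens[of S] S by simp
    also have "\<dots> = (SUP K\<in>{K. K \<subseteq> S \<and> compact K}. emeasure (density lborel (indicator S)) K)"
    proof (rule inner_regular)
      show "emeasure (density lborel (indicator S)) (space (density lborel (indicator S))) \<noteq> \<infinity>"
        using S by (subst emeasure_density) (auto simp: nn_integral_indicator)
    qed (use S in auto)
    also have "\<dots> = (SUP K\<in>{K. K \<subseteq> S \<and> compact K}. emeasure lborel K)"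
      by (intro SUP_cong refl dens) (auto intro: borel_closed compact_imp_closed)
    also have "\<dots> \<le> (SUP K\<in>{K. K \<subseteq> S \<and> compact K \<and> K \<noteq> {}}. emeasure lborel K)"
    proof (rule SUP_least)
      fix K assume "K \<in> {K. K \<subseteq> S \<and> compact K}"
      then show "emeasure lborel K \<le> (SUP K\<in>{K. K \<subseteq> S \<and> compact K \<and> K \<noteq> {}}. emeasure lborel K)"
        by (cases "K = {}") (auto intro!: SUP_upper)
    qed
    finally show "emeasure lborel S \<le> \<dots>" .
  next
    show "(SUP K\<in>{K. K \<subseteq> S \<and> compact K \<and> K \<noteq> {}}. emeasure lborel K) \<le> emeasure lborel S"
      by (intro SUP_least emeasure_mono) (use S in auto)
  qed
  have neK: "{K. K \<subseteq> A \<and> compact K \<and> K \<noteq> {}} \<noteq> {}" "{K. K \<subseteq> B \<and> compact K \<and> K \<noteq> {}} \<noteq> {}"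
  proof -
    obtain a b where "a \<in> A" "b \<in> B" using ne by auto
    then have "{a} \<in> {K. K \<subseteq> A \<and> compact K \<and> K \<noteq> {}}" "{b} \<in> {K. K \<subseteq> B \<and> compact K \<and> K \<noteq> {}}" by auto
    then show "{K. K \<subseteq> A \<and> compact K \<and> K \<noteq> {}} \<noteq> {}" "{K. K \<subseteq> B \<and> compact K \<and> K \<noteq> {}} \<noteq> {}"
      by (metis empty_iff)+
  qed
  show ?thesis
    unfolding sup[OF assms(1) ne(1) fin(1)] sup[OF assms(2) ne(2) fin(2)]
    unfolding ennreal_SUP_add_left[OF neK(1), symmetric] ennreal_SUP_add_right[OF neK(2)]
    by (intro SUP_least comp) auto
qed

lemma (in sigma_finite_measure) borel_measurable_superlevel_sets:
  fixes w :: "'a \<Rightarrow> ennreal"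
  assumes [measurable]: "w \<in> borel_measurable M"
  shows "(\<lambda>s. emeasure M {x \<in> space M. ennreal s < w x}) \<in> borel_measurable borel"
proof -
  have "(\<lambda>s. emeasure M {x \<in> space M. ennreal s < w x}) = (\<lambda>s. \<integral>\<^sup>+x. indicator {s. ennreal s < w x} s \<partial>M)"
  proof
    fix s
    have "emeasure M {x \<in> space M. ennreal s < w x} = (\<integral>\<^sup>+x. indicator {x \<in> space M. ennreal s < w x} x \<partial>M)"
      by simp
    also have "\<dots> = (\<integral>\<^sup>+x. indicator {s. ennreal s < w x} s \<partial>M)"
      by (intro nn_integral_cong) (auto simp: indicator_def)
    finally show "emeasure M {x \<in> space M. ennreal s < w x} = \<dots>" .
  qed
  also have "\<dots> \<in> borel_measurable borel"
    by (rule borel_measurable_nn_integral) (simp add: indicator_def case_prod_beta)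
  finally show ?thesis .
qed

text \<open>Layer-cake formula with levels cut at 1. After normalising suprema to 1, the levels in
  (0,1) are those at which the superlevel sets of both functions are nonempty.\<close>

lemma (in sigma_finite_measure) nn_integral_superlevel_sets:
  fixes w :: "'a \<Rightarrow> ennreal"
  assumes [measurable]: "w \<in> borel_measurable M"
  shows "(\<integral>\<^sup>+s. indicator {0<..<1} s * emeasure M {x \<in> space M. ennreal s < w x} \<partial>lborel) = (\<integral>\<^sup>+x. min 1 (w x) \<partial>M)"
proof -
  interpret L: pair_sigma_finite lborel M ..
  have "(\<integral>\<^sup>+s. indicator {0<..<1} s * emeasure M {x \<in> space M. ennreal s < w x} \<partial>lborel)
    = (\<integral>\<^sup>+s. (\<integral>\<^sup>+x. indicator {0<..<1} s * indicator {s. ennreal s < w x} s \<partial>M) \<partial>lborel)"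
  proof (intro nn_integral_cong)
    fix s :: real
    have "(\<integral>\<^sup>+x. indicator {s. ennreal s < w x} s \<partial>M) = (\<integral>\<^sup>+x. indicator {x \<in> space M. ennreal s < w x} x \<partial>M)"
      by (intro nn_integral_cong) (auto simp: indicator_def)
    also have "\<dots> = emeasure M {x \<in> space M. ennreal s < w x}" by simp
    finally show "indicator {0<..<1} s * emeasure M {x \<in> space M. ennreal s < w x}
        = (\<integral>\<^sup>+x. indicator {0<..<1} s * indicator {s. ennreal s < w x} s \<partial>M)"
      by (subst nn_integral_cmult) (auto simp: indicator_def)
  qed
  also have "\<dots> = (\<integral>\<^sup>+x. (\<integral>\<^sup>+s. indicator {0<..<1} s * indicator {s. ennreal s < w x} s \<partial>lborel) \<partial>M)"
    by (rule L.Fubini'[symmetric]) (simp add: indicator_def case_prod_beta)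
  also have "\<dots> = (\<integral>\<^sup>+x. min 1 (w x) \<partial>M)"
  proof (intro nn_integral_cong)
    fix x
    have "(\<integral>\<^sup>+s. indicator {0<..<1} s * indicator {s. ennreal s < w x} s \<partial>lborel)
        = (\<integral>\<^sup>+s. indicator {0<..<enn2real (min 1 (w x))} s \<partial>lborel)"
      by (intro nn_integral_cong)
        (cases "w x", auto simp: indicator_def min_def ennreal_less_iff top.not_eq_extremum)
    also have "\<dots> = min 1 (w x)"
      by (cases "w x") (auto simp: min_def)
    finally show "(\<integral>\<^sup>+s. indicator {0<..<1} s * indicator {s. ennreal s < w x} s \<partial>lborel) = min 1 (w x)" .
  qed
  finally show ?thesis .
qed

text \<open>With suprema equal to 1 an additive, hence stronger, inequality holds: for 0 < s < 1 the
  sets {u > s} and {v > s} are nonempty and their midpoints lie in {w > s}, so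
  \<open>emeasure_midpoint_ge\<close> applies at every level and is integrated over s. Bounded
  support keeps the superlevel sets of finite measure.\<close>

lemma prekopa_leindler_normalized:
  fixes u v w :: "real \<Rightarrow> ennreal"
  assumes [measurable]: "u \<in> borel_measurable borel" "v \<in> borel_measurable borel" "w \<in> borel_measurable borel"
    and le1: "\<And>x. u x \<le> 1" "\<And>x. v x \<le> 1"
    and near1: "\<And>s. s < 1 \<Longrightarrow> \<exists>x. ennreal s < u x" "\<And>s. s < 1 \<Longrightarrow> \<exists>x. ennreal s < v x"
    and supp: "\<And>x. \<bar>x\<bar> > R \<Longrightarrow> u x = 0" "\<And>x. \<bar>x\<bar> > R \<Longrightarrow> v x = 0"
    and mid: "\<And>x y. u x * v y \<le> (w ((x + y) / 2))\<^sup>2"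
  shows "(\<integral>\<^sup>+x. u x \<partial>lborel) + (\<integral>\<^sup>+x. v x \<partial>lborel) \<le> 2 * (\<integral>\<^sup>+x. w x \<partial>lborel)"
proof -
  have fin: "emeasure lborel {x. ennreal s < u x} < \<infinity>" if "\<And>x. \<bar>x\<bar> > R \<Longrightarrow> u x = 0" for s and u :: "real \<Rightarrow> ennreal"
  proof -
    have "emeasure lborel {x. ennreal s < u x} \<le> emeasure lborel {-R..R}"
    proof (rule emeasure_mono)
      have "\<bar>x\<bar> \<le> R" if "ennreal s < u x" for x
        using that \<open>\<And>x. \<bar>x\<bar> > R \<Longrightarrow> u x = 0\<close>[of x] by (cases "\<bar>x\<bar> > R") auto
      then show "{x. ennreal s < u x} \<subseteq> {-R..R}" by (force simp: abs_le_iff)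
    qed simp
    also have "\<dots> < \<infinity>" by (cases "-R \<le> R") auto
    finally show ?thesis .
  qed
  have key: "indicator {0<..<1} s * emeasure lborel {x. ennreal s < u x} + indicator {0<..<1} s * emeasure lborel {x. ennreal s < v x}
      \<le> 2 * (indicator {0<..<1} s * emeasure lborel {x. ennreal s < w x})" for s
  proof (cases "0 < s \<and> s < 1")
    case True
    have "emeasure lborel {x. ennreal s < u x} + emeasure lborel {x. ennreal s < v x} \<le> 2 * emeasure lborel {x. ennreal s < w x}"
    proof (rule emeasure_midpoint_ge)
      fix x y assume "x \<in> {x. ennreal s < u x}" "y \<in> {x. ennreal s < v x}"
      then have xy: "ennreal s < u x" "ennreal s < v y" by auto
      have "ennreal s * ennreal s < ennreal s * v y"
        using xy True by (intro ennreal_mult_strict_left_mono) auto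
      also have "\<dots> \<le> u x * v y" using xy by (intro mult_right_mono) auto
      also have "\<dots> \<le> (w ((x + y) / 2))\<^sup>2" by (rule mid)
      finally have "(ennreal s)\<^sup>2 < (w ((x + y) / 2))\<^sup>2" by (simp add: power2_eq_square)
      then show "(x + y) / 2 \<in> {x. ennreal s < w x}"
        using power_mono[of "w ((x + y) / 2)" "ennreal s" 2] by (auto simp: not_less[symmetric])
    qed (use near1 True fin supp in auto)
    then show ?thesis using True by simp
  qed simp
  have min1: "(\<integral>\<^sup>+x. min 1 (u x) \<partial>lborel) = (\<integral>\<^sup>+x. u x \<partial>lborel)" "(\<integral>\<^sup>+x. min 1 (v x) \<partial>lborel) = (\<integral>\<^sup>+x. v x \<partial>lborel)"
    using le1 by (simp_all add: min_absorb2)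
  have "(\<integral>\<^sup>+x. min 1 (u x) \<partial>lborel) + (\<integral>\<^sup>+x. min 1 (v x) \<partial>lborel) \<le> 2 * (\<integral>\<^sup>+x. min 1 (w x) \<partial>lborel)"
  proof -
    note L = lborel.nn_integral_superlevel_sets[simplified, symmetric]
    have [measurable]: "(\<lambda>s. emeasure lborel {x. ennreal s < f x}) \<in> borel_measurable borel"
      if "f \<in> borel_measurable borel" for f :: "real \<Rightarrow> ennreal"
      using lborel.borel_measurable_superlevel_sets[of f] that by simp
    show ?thesis
      unfolding L[OF assms(1)[folded measurable_lborel1]] L[OF assms(2)[folded measurable_lborel1]] L[OF assms(3)[folded measurable_lborel1]]
      by (subst nn_integral_add[symmetric], measurable, subst nn_integral_cmult[symmetric], measurable,
         intro nn_integral_mono key)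
  qed
  also have "\<dots> \<le> 2 * (\<integral>\<^sup>+x. w x \<partial>lborel)"
    by (intro mult_left_mono nn_integral_mono) auto
  finally show ?thesis by (simp add: min1)
qed

text \<open>Turns the additive inequality for normalised functions into the multiplicative
  form.\<close>

lemma ennreal_amgm:
  fixes a b c :: ennreal
  assumes "a + b \<le> 2 * c" shows "a * b \<le> c\<^sup>2"
proof (cases "c = \<top>")
  case False
  then obtain c' where c: "c = ennreal c'" "c' \<ge> 0" by (cases c) auto
  have "2 * c < \<top>" using c by (simp add: ennreal_mult_less_top)
  then have "a + b < \<top>" using assms by (rule order.strict_trans1[rotated])
  then obtain a' b' where ab: "a = ennreal a'" "a' \<ge> 0" "b = ennreal b'" "b' \<ge> 0" by (cases a; cases b) auto
  have "ennreal (a' + b') \<le> ennreal (2 * c')" using assms ab c by (simp add: ennreal_mult)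
  then have "a' + b' \<le> 2 * c'" using c by (subst (asm) ennreal_le_iff) auto
  then have "(a' + b')\<^sup>2 \<le> (2 * c')\<^sup>2" using ab by (intro power_mono) auto
  moreover have "0 \<le> (a' - b')\<^sup>2" by simp
  ultimately have "a' * b' \<le> c'\<^sup>2" by (simp add: power2_eq_square algebra_simps)
  then show ?thesis using ab c by (simp add: ennreal_mult[symmetric] ennreal_power)
qed (simp add: power2_eq_square)

text \<open>Dividing u and v by their suprema a and b, and w by sqrt (a b), keeps the midpoint
  hypothesis and reduces to the normalised case; the factors cancel in the multiplicative
  conclusion.\<close>

lemma prekopa_leindler_bounded:
  fixes u v w :: "real \<Rightarrow> ennreal"
  assumes [measurable]: "u \<in> borel_measurable borel" "v \<in> borel_measurable borel" "w \<in> borel_measurable borel"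
    and bnd: "\<And>x. u x \<le> ennreal B" "\<And>x. v x \<le> ennreal B"
    and supp: "\<And>x. \<bar>x\<bar> > R \<Longrightarrow> u x = 0" "\<And>x. \<bar>x\<bar> > R \<Longrightarrow> v x = 0"
    and mid: "\<And>x y. u x * v y \<le> (w ((x + y) / 2))\<^sup>2"
  shows "(\<integral>\<^sup>+x. u x \<partial>lborel) * (\<integral>\<^sup>+x. v x \<partial>lborel) \<le> (\<integral>\<^sup>+x. w x \<partial>lborel)\<^sup>2"
proof (cases "(SUP x. u x) = 0 \<or> (SUP x. v x) = 0")
  case True
  then have "(\<forall>x. u x = 0) \<or> (\<forall>x. v x = 0)" by (auto simp flip: bot_ennreal simp: SUP_bot_conv)
  then show ?thesis by auto
next
  case False
  have "(SUP x. u x) \<le> ennreal B" "(SUP x. v x) \<le> ennreal B" using bnd by (auto intro: SUP_least)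
  then have "(SUP x. u x) < \<top>" "(SUP x. v x) < \<top>" by (auto simp: le_less_trans)
  then obtain a b where ab: "(SUP x. u x) = ennreal a" "(SUP x. v x) = ennreal b" "a > 0" "b > 0"
    using False by (cases "SUP x. u x"; cases "SUP x. v x") (auto simp: less_le)
  define u' where "u' x = ennreal (1/a) * u x" for x
  define v' where "v' x = ennreal (1/b) * v x" for x
  define w' where "w' x = ennreal (1/sqrt (a*b)) * w x" for x
  have [measurable]: "u' \<in> borel_measurable borel" "v' \<in> borel_measurable borel" "w' \<in> borel_measurable borel"
    unfolding u'_def v'_def w'_def by measurable
  have le1: "ennreal (1/a) * u x \<le> 1" if "(SUP x. u x) = ennreal a" "a > 0" for a x and u :: "real \<Rightarrow> ennreal"
  proof -
    have "ennreal (1/a) * u x \<le> ennreal (1/a) * ennreal a"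
      using that by (intro mult_left_mono) (auto simp: that(1)[symmetric] intro: SUP_upper)
    also have "\<dots> = 1" using that by (simp flip: ennreal_mult)
    finally show ?thesis .
  qed
  have near1: "\<exists>x. ennreal s < ennreal (1/a) * u x" if su: "(SUP x. u x) = ennreal a" and "a > 0" "s < 1" for s a and u :: "real \<Rightarrow> ennreal"
  proof -
    have "ennreal (s * a) < ennreal a" using that by (intro ennreal_lessI) auto
    then obtain x where "ennreal (s * a) < u x" unfolding su[symmetric] by (auto simp: less_SUP_iff)
    then have "ennreal (1/a) * ennreal (s * a) < ennreal (1/a) * u x"
      using that by (intro ennreal_mult_strict_left_mono) auto
    moreover have "ennreal (1/a) * ennreal (s * a) = ennreal s" 
      using that by (simp add: ennreal_mult'[symmetric])
    ultimately show ?thesis by auto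
  qed
  have cu: "ennreal (1/a) * ennreal (1/b) = ennreal (1/(a*b))" using ab by (simp flip: ennreal_mult)
  have cw: "(ennreal (1/sqrt (a*b)))\<^sup>2 = ennreal (1/(a*b))" using ab by (simp add: ennreal_power power_divide)
  have "(\<integral>\<^sup>+x. u' x \<partial>lborel) + (\<integral>\<^sup>+x. v' x \<partial>lborel) \<le> 2 * (\<integral>\<^sup>+x. w' x \<partial>lborel)"
  proof (rule prekopa_leindler_normalized)
    fix x y
    have "u' x * v' y = ennreal (1/(a*b)) * (u x * v y)"
      unfolding u'_def v'_def cu[symmetric] by (simp add: mult_ac)
    also have "\<dots> \<le> ennreal (1/(a*b)) * (w ((x + y) / 2))\<^sup>2" by (intro mult_left_mono mid) simp
    also have "\<dots> = (w' ((x + y) / 2))\<^sup>2"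
      unfolding w'_def cw[symmetric] by (simp add: power_mult_distrib)
    finally show "u' x * v' y \<le> (w' ((x + y) / 2))\<^sup>2" .
  qed (use ab le1 near1 supp in \<open>auto simp: u'_def v'_def\<close>)
  then have "(\<integral>\<^sup>+x. u' x \<partial>lborel) * (\<integral>\<^sup>+x. v' x \<partial>lborel) \<le> (\<integral>\<^sup>+x. w' x \<partial>lborel)\<^sup>2"
    by (rule ennreal_amgm)
  moreover have "(\<integral>\<^sup>+x. u' x \<partial>lborel) = ennreal (1/a) * (\<integral>\<^sup>+x. u x \<partial>lborel)"
      "(\<integral>\<^sup>+x. v' x \<partial>lborel) = ennreal (1/b) * (\<integral>\<^sup>+x. v x \<partial>lborel)"
      "(\<integral>\<^sup>+x. w' x \<partial>lborel) = ennreal (1/sqrt (a*b)) * (\<integral>\<^sup>+x. w x \<partial>lborel)"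
    unfolding u'_def v'_def w'_def by (rule nn_integral_cmult; simp)+
  ultimately have "ennreal (1/(a*b)) * ((\<integral>\<^sup>+x. u x \<partial>lborel) * (\<integral>\<^sup>+x. v x \<partial>lborel)) \<le> ennreal (1/(a*b)) * (\<integral>\<^sup>+x. w x \<partial>lborel)\<^sup>2"
    by (simp only: power_mult_distrib cw cu[symmetric] mult_ac)
  then have "ennreal (a*b) * (ennreal (1/(a*b)) * ((\<integral>\<^sup>+x. u x \<partial>lborel) * (\<integral>\<^sup>+x. v x \<partial>lborel)))
      \<le> ennreal (a*b) * (ennreal (1/(a*b)) * (\<integral>\<^sup>+x. w x \<partial>lborel)\<^sup>2)"
    by (rule mult_left_mono) simp
  moreover have "ennreal (a*b) * (ennreal (1/(a*b)) * z) = z" for z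
  proof -
    have "ennreal (a*b) * ennreal (1/(a*b)) = 1" using ab by (simp flip: ennreal_mult)
    then show ?thesis by (simp only: mult.assoc[symmetric] mult_1)
  qed
  ultimately show ?thesis by (simp only:)
qed

text \<open>Truncating u and v in height and in support only lowers the left side of the hypothesis,
  and monotone convergence removes the truncation.\<close>

theorem prekopa_leindler_real:
  fixes u v w :: "real \<Rightarrow> ennreal"
  assumes [measurable]: "u \<in> borel_measurable borel" "v \<in> borel_measurable borel" "w \<in> borel_measurable borel"
    and mid: "\<And>x y. u x * v y \<le> (w ((x + y) / 2))\<^sup>2"
  shows "(\<integral>\<^sup>+x. u x \<partial>lborel) * (\<integral>\<^sup>+x. v x \<partial>lborel) \<le> (\<integral>\<^sup>+x. w x \<partial>lborel)\<^sup>2"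
proof -
  define tr where "tr u n x = min (u x) (of_nat n) * indicator {-real n..real n} x" for u :: "real \<Rightarrow> ennreal" and n x
  have [measurable]: "tr u n \<in> borel_measurable borel" if [measurable]: "u \<in> borel_measurable borel" for u n
    unfolding tr_def by measurable
  have le: "tr u n x \<le> u x" for u n x unfolding tr_def by (auto simp: indicator_def)
  have inc: "incseq (tr u)" for u
    unfolding tr_def incseq_def le_fun_def by (auto simp: indicator_def min.coboundedI2 intro!: min.mono)
  have sup: "(SUP n. tr u n x) = u x" for u x
  proof (rule antisym[OF SUP_least[OF le]])
    show "u x \<le> (SUP n. tr u n x)"
    proof (rule dense_le)
      fix y assume y: "y < u x"
      then have "y < \<top>" by (simp add: order.strict_trans2)
      then obtain m where m: "y < of_nat m" using ennreal_Ex_less_of_nat by blast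
      define n where "n = max m (nat \<lceil>\<bar>x\<bar>\<rceil>)"
      have "\<bar>x\<bar> \<le> real n" unfolding n_def by linarith
      moreover have "y \<le> of_nat n" using m unfolding n_def by (auto simp: max_def intro: order.trans less_imp_le)
      ultimately have "y \<le> tr u n x" using y unfolding tr_def by (auto simp: indicator_def)
      then show "y \<le> (SUP n. tr u n x)" by (rule SUP_upper2[rotated]) simp
    qed
  qed
  have int: "(\<integral>\<^sup>+x. u x \<partial>lborel) = (SUP n. \<integral>\<^sup>+x. tr u n x \<partial>lborel)" if [measurable]: "u \<in> borel_measurable borel" for u
  proof -
    have "(\<integral>\<^sup>+x. u x \<partial>lborel) = (\<integral>\<^sup>+x. (SUP n. tr u n x) \<partial>lborel)" by (simp only: sup)
    also have "\<dots> = (SUP n. \<integral>\<^sup>+x. tr u n x \<partial>lborel)"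
      by (rule nn_integral_monotone_convergence_SUP[OF inc]) simp
    finally show ?thesis .
  qed
  have "(\<integral>\<^sup>+x. tr u n x \<partial>lborel) * (\<integral>\<^sup>+x. tr v m x \<partial>lborel) \<le> (\<integral>\<^sup>+x. w x \<partial>lborel)\<^sup>2" for n m
  proof (rule prekopa_leindler_bounded)
    fix x y
    have "tr u n x * tr v m y \<le> u x * v y" by (intro mult_mono le) auto
    then show "tr u n x * tr v m y \<le> (w ((x + y) / 2))\<^sup>2" using mid order.trans by blast
  next
    show "tr u n x \<le> ennreal (real (max n m))" "tr v m x \<le> ennreal (real (max n m))" for x
      unfolding tr_def ennreal_of_nat_eq_real_of_nat by (auto simp: indicator_def min.coboundedI2)
    show "tr u n x = 0" "tr v m x = 0" if "\<bar>x\<bar> > real (max n m)" for x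
      using that unfolding tr_def by (auto simp: indicator_def)
  qed simp_all
  then have "(SUP m. SUP n. (\<integral>\<^sup>+x. tr u n x \<partial>lborel) * (\<integral>\<^sup>+x. tr v m x \<partial>lborel)) \<le> (\<integral>\<^sup>+x. w x \<partial>lborel)\<^sup>2"
    by (intro SUP_least)
  then show ?thesis
    unfolding int[OF assms(1)] int[OF assms(2)] by (simp only: SUP_mult_left_ennreal SUP_mult_right_ennreal)
qed

section \<open>The Gaussian Prekopa-Leindler inequality in every dimension\<close>

abbreviation gauss1 :: "real measure" where
  "gauss1 \<equiv> density lborel (\<lambda>x. ennreal (std_normal_density x))"

interpretation gauss1: prob_space gauss1
  by (rule prob_space_normal_density) simp

text \<open>The constant 4 makes the hypothesis equivalent to the one of the Prekopa--Leindler inequality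
  for the densities with respect to Lebesgue measure.\<close>

definition gaussian_PL :: "'a::euclidean_space measure \<Rightarrow> bool" where
  "gaussian_PL \<mu> \<longleftrightarrow> (\<forall>u v w.
     u \<in> borel_measurable borel \<longrightarrow> v \<in> borel_measurable borel \<longrightarrow> w \<in> borel_measurable borel \<longrightarrow>
     (\<forall>x y. u x * v y * ennreal (exp (- (norm (x - y))\<^sup>2 / 4)) \<le> (w ((1/2) *\<^sub>R (x + y)))\<^sup>2) \<longrightarrow>
     (\<integral>\<^sup>+x. u x \<partial>\<mu>) * (\<integral>\<^sup>+x. v x \<partial>\<mu>) \<le> (\<integral>\<^sup>+x. w x \<partial>\<mu>)\<^sup>2)"

text \<open>The parallelogram identity x^2 + y^2 = (x + y)^2 / 2 + (x - y)^2 / 2 in exponential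
  form. It is the source of the factor exp (-|x - y|^2 / 4) in \<open>gaussian_PL\<close>.\<close>

lemma std_normal_density_midpoint:
  "std_normal_density x * std_normal_density y = exp (- (x - y)\<^sup>2 / 4) * (std_normal_density ((x + y) / 2))\<^sup>2"
  by (simp add: std_normal_density_def power_mult_distrib power_divide exp_add[symmetric] exp_double[symmetric])
     (simp add: power2_eq_square field_simps exp_add[symmetric])

lemma gaussian_PL_gauss1: "gaussian_PL gauss1"
  unfolding gaussian_PL_def
proof (intro allI impI)
  fix u v w :: "real \<Rightarrow> ennreal"
  assume [measurable]: "u \<in> borel_measurable borel" "v \<in> borel_measurable borel" "w \<in> borel_measurable borel"
  assume mid: "\<forall>x y. u x * v y * ennreal (exp (- (norm (x - y))\<^sup>2 / 4)) \<le> (w ((1/2) *\<^sub>R (x + y)))\<^sup>2"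
  let ?g = "\<lambda>x. ennreal (std_normal_density x)"
  have "(\<integral>\<^sup>+x. ?g x * u x \<partial>lborel) * (\<integral>\<^sup>+x. ?g x * v x \<partial>lborel) \<le> (\<integral>\<^sup>+x. ?g x * w x \<partial>lborel)\<^sup>2"
  proof (rule prekopa_leindler_real)
    fix x y
    have "?g x * u x * (?g y * v y) = ennreal (std_normal_density x * std_normal_density y) * (u x * v y)"
      by (simp add: ennreal_mult mult_ac)
    also have "\<dots> = (?g ((x + y) / 2))\<^sup>2 * (u x * v y * ennreal (exp (- (norm (x - y))\<^sup>2 / 4)))"
      unfolding std_normal_density_midpoint by (simp add: ennreal_mult mult_ac ennreal_power)
    also have "\<dots> \<le> (?g ((x + y) / 2))\<^sup>2 * (w ((x + y) / 2))\<^sup>2"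
      using mid[rule_format, of x y] by (intro mult_left_mono) auto
    finally show "?g x * u x * (?g y * v y) \<le> (?g ((x + y) / 2) * w ((x + y) / 2))\<^sup>2"
      by (simp add: power_mult_distrib)
  qed auto
  then show "(\<integral>\<^sup>+x. u x \<partial>gauss1) * (\<integral>\<^sup>+x. v x \<partial>gauss1) \<le> (\<integral>\<^sup>+x. w x \<partial>gauss1)\<^sup>2"
    by (simp add: nn_integral_density)
qed

text \<open>Besides moving a point along coordinate k, \<open>upd k v 0\<close> serves throughout as
  the orthogonal projection of v onto the other coordinates.\<close>

definition upd :: "'n \<Rightarrow> real^'n \<Rightarrow> real \<Rightarrow> real^'n::finite" where
  "upd k x t = (\<chi> i. if i = k then t else x $ i)"

lemma upd_nth [simp]: "upd k x t $ i = (if i = k then t else x $ i)"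
  by (simp add: upd_def)

lemma upd_upd [simp]: "upd k (upd k x s) t = upd k x t"
  by (simp add: vec_eq_iff)

lemma upd_same [simp]: "upd k x (x $ k) = x"
  by (simp add: vec_eq_iff)

lemma upd_commute: "j \<noteq> k \<Longrightarrow> upd j (upd k x s) t = upd k (upd j x t) s"
  by (auto simp: vec_eq_iff)

lemma upd_eq: "upd k x t = x + (t - x $ k) *\<^sub>R axis k 1"
  by (auto simp: vec_eq_iff axis_def)

lemma continuous_on_upd [continuous_intros]:
  "continuous_on S f \<Longrightarrow> continuous_on S g \<Longrightarrow> continuous_on S (\<lambda>x. upd k (f x) (g x))"
  unfolding upd_eq by (intro continuous_intros)

lemma measurable_vec_nth [measurable (raw)]:
  fixes f :: "'a \<Rightarrow> real^'n::finite"
  assumes [measurable]: "f \<in> borel_measurable M"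
  shows "(\<lambda>x. f x $ k) \<in> borel_measurable M"
  unfolding cart_eq_inner_axis by measurable

lemma measurable_upd [measurable (raw)]:
  assumes [measurable]: "f \<in> borel_measurable M" "g \<in> borel_measurable M"
  shows "(\<lambda>x. upd k (f x) (g x)) \<in> borel_measurable M"
  unfolding upd_eq by (measurable; simp)

lemma norm_upd_sq: "(norm (upd k x t))\<^sup>2 = (norm (upd k x 0))\<^sup>2 + t\<^sup>2"
proof -
  have "(\<Sum>i\<in>UNIV. (upd k x t $ i)\<^sup>2) = t\<^sup>2 + (\<Sum>i\<in>UNIV - {k}. (upd k x t $ i)\<^sup>2)" for t
    by (subst sum.remove[of _ k]) auto
  then have "(\<Sum>i\<in>UNIV. (upd k x t $ i)\<^sup>2) = t\<^sup>2 + (\<Sum>i\<in>UNIV - {k}. (x $ i)\<^sup>2)" for t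
    by (simp add: sum.cong[OF refl, of "UNIV - {k}" "\<lambda>i. (upd k x t $ i)\<^sup>2" "\<lambda>i. (x $ i)\<^sup>2"])
  then show ?thesis by (simp add: norm_vec_def L2_set_def sum_nonneg del: upd_nth)
qed

lemma lborel_vec_eq: "(lborel :: (real^'n::finite) measure) = distr (\<Pi>\<^sub>M i\<in>(UNIV::'n set). lborel) borel (\<lambda>\<omega>. \<chi> i. \<omega> i)"
proof (rule lborel_eqI)
  interpret product_sigma_finite "\<lambda>_::'n. lborel :: real measure" ..
  have [measurable]: "(\<lambda>\<omega>. \<chi> i. \<omega> i) \<in> measurable (\<Pi>\<^sub>M i\<in>(UNIV::'n set). lborel) (borel :: (real^'n) measure)"
  proof (subst borel_measurable_euclidean_space, safe)
    fix b :: "real^'n" assume "b \<in> Basis"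
    then obtain i where "b = axis i 1" by (auto simp: Basis_vec_def)
    then show "(\<lambda>\<omega>. (\<chi> i. \<omega> i) \<bullet> b) \<in> borel_measurable (\<Pi>\<^sub>M i\<in>(UNIV::'n set). lborel)"
      by (simp add: inner_axis)
  qed
  fix l u :: "real^'n" assume le: "\<And>b. b \<in> Basis \<Longrightarrow> l \<bullet> b \<le> u \<bullet> b"
  have le': "l $ i \<le> u $ i" for i using le[of "axis i 1"] by (simp add: inner_axis axis_in_Basis_iff)
  have pre: "(\<lambda>\<omega>. \<chi> i. \<omega> i) -` box l u \<inter> space (\<Pi>\<^sub>M i\<in>(UNIV::'n set). lborel) = Pi\<^sub>E UNIV (\<lambda>i. {l $ i <..< u $ i})"
    by (auto simp: space_PiM mem_box_cart PiE_iff)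
  have "emeasure (distr (\<Pi>\<^sub>M i\<in>(UNIV::'n set). lborel) borel (\<lambda>\<omega>. \<chi> i. \<omega> i)) (box l u)
      = (\<Prod>i\<in>UNIV. emeasure lborel {l $ i <..< u $ i})"
    by (subst emeasure_distr) (auto simp: pre emeasure_PiM)
  also have "\<dots> = (\<Prod>i\<in>UNIV. ennreal (u $ i - l $ i))" using le' by (intro prod.cong) auto
  also have "\<dots> = ennreal (\<Prod>i\<in>UNIV. (u $ i - l $ i))" using le' by (intro prod_ennreal) auto
  also have "(\<Prod>i\<in>UNIV. (u $ i - l $ i)) = (\<Prod>b\<in>Basis. (u - l) \<bullet> b)"
    by (simp add: Basis_vec_def UNION_singleton_eq_range prod.reindex inj_on_def axis_eq_axis inner_axis image_comp)
  finally show "emeasure (distr (\<Pi>\<^sub>M i\<in>(UNIV::'n set). lborel) borel (\<lambda>\<omega>. \<chi> i. \<omega> i)) (box l u)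
      = ennreal (\<Prod>b\<in>Basis. (u - l) \<bullet> b)" .
qed simp

lemma measurable_vec_lambda_PiM [measurable]:
  "(\<lambda>\<omega>. \<chi> i. \<omega> i) \<in> measurable (\<Pi>\<^sub>M i\<in>(UNIV::'n::finite set). lborel) (borel :: (real^'n) measure)"
proof (subst borel_measurable_euclidean_space, safe)
  fix b :: "real^'n" assume "b \<in> Basis"
  then obtain i where "b = axis i 1" by (auto simp: Basis_vec_def)
  then show "(\<lambda>\<omega>. (\<chi> i. \<omega> i) \<bullet> b) \<in> borel_measurable (\<Pi>\<^sub>M i\<in>(UNIV::'n set). lborel)"
    by (simp add: inner_axis)
qed

lemma sets_PiM_gauss1: "sets (\<Pi>\<^sub>M i\<in>I. gauss1) = sets (\<Pi>\<^sub>M i\<in>I. lborel)"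
  by (intro sets_PiM_cong) auto

lemma measurable_vec_lambda_PiM_gauss1 [measurable]:
  "(\<lambda>\<omega>. \<chi> i. \<omega> i) \<in> measurable (\<Pi>\<^sub>M i\<in>(UNIV::'n::finite set). gauss1) (borel :: (real^'n) measure)"
  using measurable_vec_lambda_PiM measurable_cong_sets[OF sets_PiM_gauss1 refl] by blast

lemma gauss_density_prod:
  fixes x :: "real^'n::finite"
  shows "(2 * pi) powr (- real CARD('n) / 2) * exp (- (norm x)\<^sup>2 / 2) = (\<Prod>i\<in>UNIV. std_normal_density (x $ i))"
proof -
  have "(\<Prod>i\<in>(UNIV::'n set). std_normal_density (x $ i)) = (1 / sqrt (2 * pi)) ^ CARD('n) * exp (\<Sum>i\<in>UNIV. - (x $ i)\<^sup>2 / 2)"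
    by (simp add: std_normal_density_def prod.distrib exp_sum prod_dividef power_divide)
  also have "(\<Sum>i\<in>UNIV. - (x $ i)\<^sup>2 / 2) = - (norm x)\<^sup>2 / 2"
    by (simp add: norm_vec_def L2_set_def sum_nonneg sum_negf sum_divide_distrib)
  also have "(1 / sqrt (2 * pi)) ^ CARD('n) = (2 * pi) powr (- real CARD('n) / 2)"
  proof -
    have "(1 / sqrt (2 * pi)) ^ CARD('n) = ((2 * pi) powr (-1/2)) ^ CARD('n)"
      using powr_minus_divide[of "2 * pi" "1/2"] by (simp add: powr_half_sqrt)
    also have "\<dots> = (2 * pi) powr (- real CARD('n) / 2)"
      by (subst powr_realpow[symmetric]) (auto simp: powr_powr)
    finally show ?thesis .
  qed
  finally show ?thesis by simp
qed

text \<open>The product structure of the Gaussian measure, on which all coordinatewise arguments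
  rest.\<close>

lemma gauss_eq_distr: "(gauss :: (real^'n::finite) measure) = distr (\<Pi>\<^sub>M i\<in>(UNIV::'n set). gauss1) borel (\<lambda>\<omega>. \<chi> i. \<omega> i)"
proof -
  interpret L: product_sigma_finite "\<lambda>_::'n. lborel :: real measure" ..
  interpret G: product_sigma_finite "\<lambda>_::'n. gauss1" ..
  let ?L = "\<Pi>\<^sub>M i\<in>(UNIV::'n set). (lborel::real measure)"
  let ?D = "density ?L (\<lambda>\<omega>. \<Prod>i\<in>UNIV. ennreal (std_normal_density (\<omega> i)))"
  have D: "?D = (\<Pi>\<^sub>M i\<in>(UNIV::'n set). gauss1)"
  proof (rule G.PiM_eqI)
    fix A :: "'n \<Rightarrow> real set" assume A: "\<And>i. i \<in> UNIV \<Longrightarrow> A i \<in> sets gauss1"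
    then have [measurable]: "A i \<in> sets borel" for i by simp
    have "emeasure ?D (Pi\<^sub>E UNIV A) = (\<integral>\<^sup>+\<omega>. (\<Prod>i\<in>UNIV. ennreal (std_normal_density (\<omega> i))) * indicator (Pi\<^sub>E UNIV A) \<omega> \<partial>?L)"
    proof (rule emeasure_density)
      show "Pi\<^sub>E UNIV A \<in> sets ?L" by (rule sets_PiM_I_finite) auto
    qed measurable
    also have "\<dots> = (\<integral>\<^sup>+\<omega>. (\<Prod>i\<in>UNIV. ennreal (std_normal_density (\<omega> i)) * indicator (A i) (\<omega> i)) \<partial>?L)"
      by (intro nn_integral_cong) (auto simp: prod.distrib indicator_def PiE_iff space_PiM)
    also have "\<dots> = (\<Prod>i\<in>UNIV. \<integral>\<^sup>+x. ennreal (std_normal_density x) * indicator (A i) x \<partial>lborel)"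
      by (rule L.product_nn_integral_prod) auto
    also have "\<dots> = (\<Prod>i\<in>UNIV. emeasure gauss1 (A i))"
      by (intro prod.cong refl) (simp add: emeasure_density)
    finally show "emeasure ?D (Pi\<^sub>E UNIV A) = (\<Prod>i\<in>UNIV. emeasure gauss1 (A i))" .
  qed (auto simp: sets_PiM_gauss1)
  have "gauss = density (distr ?L borel (\<lambda>\<omega>. \<chi> i. \<omega> i)) (\<lambda>x::real^'n. \<Prod>i\<in>UNIV. ennreal (std_normal_density (x $ i)))"
    unfolding gauss_def gauss_density_prod by (subst lborel_vec_eq) (simp add: prod_ennreal)
  also have "\<dots> = distr ?D borel (\<lambda>\<omega>. \<chi> i. \<omega> i)"
    by (subst density_distr) auto
  finally show ?thesis unfolding D .
qed

lemma sets_gauss [simp, measurable_cong]: "sets gauss = sets borel"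
  by (simp add: gauss_def)

lemma space_gauss [simp]: "space gauss = UNIV"
  by (simp add: gauss_def)

interpretation gauss: prob_space "gauss :: (real^'n::finite) measure"
  unfolding gauss_eq_distr
  by (intro prob_space.prob_space_distr prob_space_PiM gauss1.prob_space_axioms measurable_vec_lambda_PiM_gauss1)

text \<open>Replacing one coordinate by an independent standard normal variable preserves the
  Gaussian measure. This is Fubini for one coordinate, phrased so that everything stays on the same
  space and inductions over coordinates never change the dimension.\<close>

lemma nn_integral_gauss_resample:
  fixes F :: "real^'n::finite \<Rightarrow> ennreal"
  assumes [measurable]: "F \<in> borel_measurable borel"
  shows "(\<integral>\<^sup>+x. \<integral>\<^sup>+t. F (upd k x t) \<partial>gauss1 \<partial>gauss) = (\<integral>\<^sup>+x. F x \<partial>gauss)"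
proof -
  interpret product_sigma_finite "\<lambda>_::'n. gauss1" ..
  have U: "insert k (UNIV - {k}) = (UNIV :: 'n set)" by auto
  have ins: "(\<integral>\<^sup>+x. H x \<partial>gauss) = (\<integral>\<^sup>+\<omega>. \<integral>\<^sup>+y. H (\<chi> i. fun_upd \<omega> k y i) \<partial>gauss1 \<partial>(\<Pi>\<^sub>M i\<in>UNIV - {k}. gauss1))"
    if [measurable]: "H \<in> borel_measurable borel" for H :: "real^'n \<Rightarrow> ennreal"
  proof -
    have "(\<integral>\<^sup>+x. H x \<partial>gauss) = (\<integral>\<^sup>+\<omega>. H (\<chi> i. \<omega> i) \<partial>(\<Pi>\<^sub>M i\<in>insert k (UNIV - {k}). gauss1))"
      unfolding gauss_eq_distr U by (rule nn_integral_distr) measurable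
    also have "\<dots> = (\<integral>\<^sup>+\<omega>. \<integral>\<^sup>+y. H (\<chi> i. fun_upd \<omega> k y i) \<partial>gauss1 \<partial>(\<Pi>\<^sub>M i\<in>UNIV - {k}. gauss1))"
    proof (rule product_nn_integral_insert)
      show "(\<lambda>\<omega>. H (\<chi> i. \<omega> i)) \<in> borel_measurable (\<Pi>\<^sub>M i\<in>insert k (UNIV - {k}). gauss1)"
        unfolding U by measurable
    qed auto
    finally show ?thesis .
  qed
  have u: "upd k (\<chi> i. fun_upd \<omega> k y i) t = (\<chi> i. fun_upd \<omega> k t i)" for \<omega> y t
    by (auto simp: vec_eq_iff)
  have "(\<integral>\<^sup>+x. \<integral>\<^sup>+t. F (upd k x t) \<partial>gauss1 \<partial>gauss)
      = (\<integral>\<^sup>+\<omega>. \<integral>\<^sup>+y. \<integral>\<^sup>+t. F (\<chi> i. fun_upd \<omega> k t i) \<partial>gauss1 \<partial>gauss1 \<partial>(\<Pi>\<^sub>M i\<in>UNIV - {k}. gauss1))"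
    by (subst ins) (simp_all only: u, measurable)
  also have "\<dots> = (\<integral>\<^sup>+\<omega>. \<integral>\<^sup>+t. F (\<chi> i. fun_upd \<omega> k t i) \<partial>gauss1 \<partial>(\<Pi>\<^sub>M i\<in>UNIV - {k}. gauss1))"
    using gauss1.emeasure_space_1 by simp
  also have "\<dots> = (\<integral>\<^sup>+x. F x \<partial>gauss)" by (simp only: ins[OF assms])
  finally show ?thesis .
qed

text \<open>The constant \<open>c\<close> carries the distance factor of the coordinates still to be
  integrated; it is absorbed into \<open>u\<close>.\<close>

lemma gaussian_PL_gauss1_const:
  fixes u v w :: "real \<Rightarrow> ennreal"
  assumes [measurable]: "u \<in> borel_measurable borel" "v \<in> borel_measurable borel" "w \<in> borel_measurable borel"
    and mid: "\<And>x y. u x * v y * (ennreal (exp (- (x - y)\<^sup>2 / 4)) * c) \<le> (w ((x + y) / 2))\<^sup>2"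
  shows "(\<integral>\<^sup>+x. u x \<partial>gauss1) * (\<integral>\<^sup>+x. v x \<partial>gauss1) * c \<le> (\<integral>\<^sup>+x. w x \<partial>gauss1)\<^sup>2"
proof -
  have "(\<integral>\<^sup>+x. c * u x \<partial>gauss1) * (\<integral>\<^sup>+x. v x \<partial>gauss1) \<le> (\<integral>\<^sup>+x. w x \<partial>gauss1)\<^sup>2"
    by (rule gaussian_PL_gauss1[unfolded gaussian_PL_def, rule_format])
      (use mid in \<open>auto simp: mult_ac\<close>)
  also have "(\<integral>\<^sup>+x. c * u x \<partial>gauss1) = c * (\<integral>\<^sup>+x. u x \<partial>gauss1)"
    by (rule nn_integral_cmult) simp
  finally show ?thesis by (simp add: mult_ac)
qed

text \<open>Induction on the set \<open>S\<close> of coordinates that have not yet been integrated out.\<close>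

lemma gaussian_PL_gauss_aux:
  fixes u v w :: "real^'n::finite \<Rightarrow> ennreal"
  assumes "finite S"
    and "u \<in> borel_measurable borel" "v \<in> borel_measurable borel" "w \<in> borel_measurable borel"
    and "\<And>x y. u x * v y * ennreal (exp (- (\<Sum>i\<in>S. (x $ i - y $ i)\<^sup>2) / 4)) \<le> (w ((1/2) *\<^sub>R (x + y)))\<^sup>2"
    and "\<And>k x t. k \<notin> S \<Longrightarrow> u (upd k x t) = u x" "\<And>k x t. k \<notin> S \<Longrightarrow> v (upd k x t) = v x" "\<And>k x t. k \<notin> S \<Longrightarrow> w (upd k x t) = w x"
  shows "(\<integral>\<^sup>+x. u x \<partial>gauss) * (\<integral>\<^sup>+x. v x \<partial>gauss) \<le> (\<integral>\<^sup>+x. w x \<partial>gauss)\<^sup>2"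
  using assms
proof (induction S arbitrary: u v w rule: finite_induct)
  case empty
  have const: "u x = u 0" if "\<And>k x t. u (upd k x t) = u x" for u :: "real^'n \<Rightarrow> ennreal" and x
  proof -
    have "u (\<chi> i. if i \<in> T then 0 else x $ i) = u x" if "finite T" for T
      using that
    proof (induction T rule: finite_induct)
      case (insert k T)
      have "(\<chi> i. if i \<in> insert k T then 0 else x $ i) = upd k (\<chi> i. if i \<in> T then 0 else x $ i) 0"
        by (auto simp: vec_eq_iff)
      then show ?case using insert.IH by (simp only: \<open>\<And>k x t. u (upd k x t) = u x\<close>)
    qed (simp add: vec_lambda_eta)
    from this[of UNIV] show ?thesis by (simp add: zero_vec_def)
  qed
  have "u = (\<lambda>_. u 0)" "v = (\<lambda>_. v 0)" "w = (\<lambda>_. w 0)"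
    using const[of u] const[of v] const[of w] empty.prems(5-7) by auto
  then have "(\<integral>\<^sup>+x. u x \<partial>gauss) = u 0" "(\<integral>\<^sup>+x. v x \<partial>gauss) = v 0" "(\<integral>\<^sup>+x. w x \<partial>gauss) = w 0"
    using gauss.emeasure_space_1
    by (metis mult.right_neutral nn_integral_const)+
  then show ?case using empty.prems(4)[of 0 0] by simp
next
  case (insert k S)
  note [measurable] = insert.prems(1-3)
  \<comment> \<open>Integrating out coordinate k keeps all total integrals. The one-dimensional
    inequality consumes the k-th square in the exponent, while the squares over \<open>S\<close>
    pass through as the constant \<open>c\<close>.\<close>
  define A where "A u x = (\<integral>\<^sup>+t. u (upd k x t) \<partial>gauss1)" for u :: "real^'n \<Rightarrow> ennreal" and x
  have [measurable]: "A u \<in> borel_measurable borel" if [measurable]: "u \<in> borel_measurable borel" for u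
    unfolding A_def by measurable
  have intA: "(\<integral>\<^sup>+x. A u x \<partial>gauss) = (\<integral>\<^sup>+x. u x \<partial>gauss)" if "u \<in> borel_measurable borel" for u
    unfolding A_def by (rule nn_integral_gauss_resample[OF that])
  have indep: "A u (upd j x t) = A u x" if "j \<notin> S" "\<And>j x t. j \<notin> insert k S \<Longrightarrow> u (upd j x t) = u x" for u j x t
  proof (cases "j = k")
    case False
    then show ?thesis using that unfolding A_def by (simp add: upd_commute[of k j])
  qed (simp add: A_def)
  have "(\<integral>\<^sup>+x. A u x \<partial>gauss) * (\<integral>\<^sup>+x. A v x \<partial>gauss) \<le> (\<integral>\<^sup>+x. A w x \<partial>gauss)\<^sup>2"
  proof (rule insert.IH)
    fix x y :: "real^'n"
    show "A u x * A v y * ennreal (exp (- (\<Sum>i\<in>S. (x $ i - y $ i)\<^sup>2) / 4)) \<le> (A w ((1/2) *\<^sub>R (x + y)))\<^sup>2"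
      unfolding A_def
    proof (rule gaussian_PL_gauss1_const)
      fix s t :: real
      have "(\<Sum>i\<in>insert k S. (upd k x s $ i - upd k y t $ i)\<^sup>2) = (s - t)\<^sup>2 + (\<Sum>i\<in>S. (upd k x s $ i - upd k y t $ i)\<^sup>2)"
        using insert.hyps by simp
      also have "(\<Sum>i\<in>S. (upd k x s $ i - upd k y t $ i)\<^sup>2) = (\<Sum>i\<in>S. (x $ i - y $ i)\<^sup>2)"
        using insert.hyps by (intro sum.cong) auto
      finally have "ennreal (exp (- (s - t)\<^sup>2 / 4)) * ennreal (exp (- (\<Sum>i\<in>S. (x $ i - y $ i)\<^sup>2) / 4))
          = ennreal (exp (- (\<Sum>i\<in>insert k S. (upd k x s $ i - upd k y t $ i)\<^sup>2) / 4))"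
        by (simp add: ennreal_mult[symmetric] exp_add[symmetric] add_divide_distrib diff_divide_distrib)
      moreover have "(1/2) *\<^sub>R (upd k x s + upd k y t) = upd k ((1/2) *\<^sub>R (x + y)) ((s + t) / 2)"
        by (auto simp: vec_eq_iff)
      ultimately show "u (upd k x s) * v (upd k y t) * (ennreal (exp (- (s - t)\<^sup>2 / 4)) * ennreal (exp (- (\<Sum>i\<in>S. (x $ i - y $ i)\<^sup>2) / 4)))
          \<le> (w (upd k ((1/2) *\<^sub>R (x + y)) ((s + t) / 2)))\<^sup>2"
        using insert.prems(4)[of "upd k x s" "upd k y t"] by simp
    qed measurable
  next
    show "A u (upd j x t) = A u x" "A v (upd j x t) = A v x" "A w (upd j x t) = A w x" if "j \<notin> S" for j x t
      using indep[of j u] indep[of j v] indep[of j w] that insert.prems(5-7) by blast+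
  qed simp_all
  then show ?case by (simp add: intA)
qed

lemma gaussian_PL_gauss: "gaussian_PL (gauss :: (real^'n::finite) measure)"
  unfolding gaussian_PL_def
proof (intro allI impI)
  fix u v w :: "real^'n \<Rightarrow> ennreal"
  assume [measurable]: "u \<in> borel_measurable borel" "v \<in> borel_measurable borel" "w \<in> borel_measurable borel"
  assume mid: "\<forall>x y. u x * v y * ennreal (exp (- (norm (x - y))\<^sup>2 / 4)) \<le> (w ((1/2) *\<^sub>R (x + y)))\<^sup>2"
  show "(\<integral>\<^sup>+x. u x \<partial>gauss) * (\<integral>\<^sup>+x. v x \<partial>gauss) \<le> (\<integral>\<^sup>+x. w x \<partial>gauss)\<^sup>2"
  proof (rule gaussian_PL_gauss_aux[of UNIV])
    show "u x * v y * ennreal (exp (- (\<Sum>i\<in>UNIV. (x $ i - y $ i)\<^sup>2) / 4)) \<le> (w ((1/2) *\<^sub>R (x + y)))\<^sup>2" for x y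
      using mid[rule_format, of x y] by (simp add: norm_vec_def L2_set_def sum_nonneg)
  qed auto
qed

section \<open>Property (tau) and the Poincare inequality\<close>

text \<open>Maurey's property (tau) for the cost \<epsilon>/4 |x - y|^2. Quantifying over pairs
  \<open>Q\<close>, \<open>u\<close> in place of an infimal convolution avoids the question whether
  the latter is measurable.\<close>

definition property_tau :: "real \<Rightarrow> 'a::euclidean_space measure \<Rightarrow> bool" where
  "property_tau \<epsilon> \<nu> \<longleftrightarrow> (\<forall>Q u :: 'a \<Rightarrow> real.
     Q \<in> borel_measurable borel \<longrightarrow> u \<in> borel_measurable borel \<longrightarrow>
     (\<forall>x y. Q x \<le> u y + \<epsilon> / 4 * (norm (x - y))\<^sup>2) \<longrightarrow>
     (\<integral>\<^sup>+x. ennreal (exp (Q x)) \<partial>\<nu>) * (\<integral>\<^sup>+x. ennreal (exp (- u x)) \<partial>\<nu>) \<le> 1)"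

text \<open>Gaussian Prekopa-Leindler applied to f exp Q, f exp (-u) and f. The exponents (1 -
  \<epsilon>)/4 from the curvature of f, \<epsilon>/4 from the cost and -1/4 from the Gaussian add
  up to zero.\<close>

lemma property_tau_density:
  fixes f :: "'a::euclidean_space \<Rightarrow> real"
  assumes PL: "gaussian_PL \<mu>" and [simp, measurable_cong]: "sets \<mu> = sets borel"
    and [measurable]: "f \<in> borel_measurable borel" and pos: "\<And>x. 0 \<le> f x" and mass: "(\<integral>\<^sup>+x. f x \<partial>\<mu>) = 1"
    and mid: "\<And>x y. f x * f y \<le> (f ((1/2) *\<^sub>R (x + y)))\<^sup>2 * exp ((1 - \<epsilon>) / 4 * (norm (x - y))\<^sup>2)"
  shows "property_tau \<epsilon> (density \<mu> (\<lambda>x. ennreal (f x)))"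
  unfolding property_tau_def
proof (intro allI impI)
  fix Q u :: "'a \<Rightarrow> real"
  assume [measurable]: "Q \<in> borel_measurable borel" "u \<in> borel_measurable borel"
  assume Qu: "\<forall>x y. Q x \<le> u y + \<epsilon> / 4 * (norm (x - y))\<^sup>2"
  have "(\<integral>\<^sup>+x. ennreal (f x * exp (Q x)) \<partial>\<mu>) * (\<integral>\<^sup>+x. ennreal (f x * exp (- u x)) \<partial>\<mu>) \<le> (\<integral>\<^sup>+x. ennreal (f x) \<partial>\<mu>)\<^sup>2"
  proof (rule PL[unfolded gaussian_PL_def, rule_format])
    fix x y :: 'a
    let ?d = "(norm (x - y))\<^sup>2" and ?m = "f ((1/2) *\<^sub>R (x + y))"
    have "f x * exp (Q x) * (f y * exp (- u y)) * exp (- ?d / 4) = f x * f y * exp (Q x - u y - ?d / 4)"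
      by (simp add: exp_add[symmetric] exp_diff exp_minus field_simps)
    also have "\<dots> \<le> f x * f y * exp (\<epsilon> / 4 * ?d - ?d / 4)"
    proof -
      have "Q x - u y \<le> \<epsilon> / 4 * ?d" using Qu[rule_format, of x y] by linarith
      then show ?thesis using pos by (intro mult_left_mono) auto
    qed
    also have "\<dots> \<le> ?m\<^sup>2 * exp ((1 - \<epsilon>) / 4 * ?d) * exp (\<epsilon> / 4 * ?d - ?d / 4)"
      by (intro mult_right_mono mid) auto
    also have "\<dots> = ?m\<^sup>2"
      by (simp add: mult.assoc exp_add[symmetric]) (simp add: field_simps)
    finally have "ennreal (f x * exp (Q x) * (f y * exp (- u y)) * exp (- ?d / 4)) \<le> ennreal (?m\<^sup>2)"
      by (rule ennreal_leI)
    then show "ennreal (f x * exp (Q x)) * ennreal (f y * exp (- u y)) * ennreal (exp (- ?d / 4)) \<le> (ennreal ?m)\<^sup>2"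
      using pos by (simp add: ennreal_mult[symmetric] ennreal_power)
  qed measurable
  then show "(\<integral>\<^sup>+x. ennreal (exp (Q x)) \<partial>density \<mu> (\<lambda>x. ennreal (f x))) * (\<integral>\<^sup>+x. ennreal (exp (- u x)) \<partial>density \<mu> (\<lambda>x. ennreal (f x))) \<le> 1"
    using pos by (simp add: nn_integral_density ennreal_mult mass)
qed

lemma exp_ge_cubic: "1 + z + z\<^sup>2 / 2 + z ^ 3 / 6 \<le> exp (z::real)"
proof -
  obtain s where "exp z = (\<Sum>m<4. z ^ m / fact m) + exp s / fact 4 * z ^ 4"
    using Maclaurin_exp_le[of z 4] by auto
  moreover have "exp s / fact 4 * z ^ 4 \<ge> 0" by (intro mult_nonneg_nonneg) auto
  ultimately show ?thesis by (simp add: numeral_eq_Suc fact_numeral)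
qed

text \<open>Second-order comparison as t tends to 0: writing the lower bounds as 1 + p and 1 + q,
  the product bound gives p + q <= -p q, where p + q is t^2 (v - C) up to order t^3 and p q is of
  order t^4.\<close>

lemma product_expansion_limit:
  fixes v C L T :: real
  assumes "T > 0" "v \<ge> 0" "C \<ge> 0" "L \<ge> 0"
    and le: "\<And>t. 0 < t \<Longrightarrow> t < T \<Longrightarrow> \<exists>a b. a * b \<le> 1 \<and> a \<ge> 0 \<and> b \<ge> 0 \<and>
        a \<ge> 1 + t\<^sup>2 * (v / 2 - C) - L * t ^ 3 \<and> b \<ge> 1 + t\<^sup>2 * (v / 2) - L * t ^ 3"
  shows "v \<le> C"
proof (rule ccontr)
  assume "\<not> v \<le> C"
  define P where "P = v + C + L"
  \<comment> \<open>In turn the entries give t < T, t^3 <= t^2, nonnegative 1 + p and 1 + q (their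
    deviations are at most t^2 P <= 1), and a total error below half of v - C.\<close>
  define t where "t = Min {T / 2, 1, 1 / (1 + P), (v - C) / (2 * (2 * L + P\<^sup>2 + 1))}"
  have P: "P \<ge> 0" using assms by (simp add: P_def)
  have KK: "2 * L + P\<^sup>2 + 1 > 0" using assms by (simp add: add_nonneg_pos)
  have t: "0 < t" "t < T" "t \<le> 1" "t \<le> 1 / (1 + P)" "t \<le> (v - C) / (2 * (2 * L + P\<^sup>2 + 1))"
  proof -
    have "t \<le> T / 2" "t \<le> 1" "t \<le> 1 / (1 + P)" "t \<le> (v - C) / (2 * (2 * L + P\<^sup>2 + 1))"
      unfolding t_def by (rule Min_le; simp)+
    then show "t < T" "t \<le> 1" "t \<le> 1 / (1 + P)" "t \<le> (v - C) / (2 * (2 * L + P\<^sup>2 + 1))"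
      using assms by auto
    show "0 < t" using assms P KK \<open>\<not> v \<le> C\<close> unfolding t_def by (subst Min_gr_iff) auto
  qed
  obtain a b where ab: "a * b \<le> 1" "a \<ge> 0" "b \<ge> 0" "a \<ge> 1 + t\<^sup>2 * (v / 2 - C) - L * t ^ 3" "b \<ge> 1 + t\<^sup>2 * (v / 2) - L * t ^ 3"
    using le[OF t(1,2)] by blast
  define p where "p = t\<^sup>2 * (v / 2 - C) - L * t ^ 3"
  define q where "q = t\<^sup>2 * (v / 2) - L * t ^ 3"
  have t3: "t ^ 3 \<le> t\<^sup>2" using t power_decreasing[of 2 3 t] by simp
  have p: "\<bar>p\<bar> \<le> t\<^sup>2 * P" and q: "\<bar>q\<bar> \<le> t\<^sup>2 * P"
  proof -
    have "L * t ^ 3 \<le> t\<^sup>2 * L" using t3 assms by (simp add: mult.commute mult_left_mono)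
    moreover have "0 \<le> L * t ^ 3" "0 \<le> t\<^sup>2 * v" "0 \<le> t\<^sup>2 * C" using t assms by simp_all
    ultimately show "\<bar>p\<bar> \<le> t\<^sup>2 * P" "\<bar>q\<bar> \<le> t\<^sup>2 * P" unfolding p_def q_def P_def abs_le_iff
      by (simp_all add: algebra_simps)
  qed
  have "t\<^sup>2 * P \<le> t * P" using t P by (simp add: power2_eq_square mult_right_mono)
  also have "\<dots> \<le> t * (1 + P)" using t by (simp add: distrib_left)
  also have "\<dots> \<le> 1" using t(4) P by (simp add: pos_le_divide_eq)
  finally have "t\<^sup>2 * P \<le> 1" .
  then have "1 + p \<ge> 0" "1 + q \<ge> 0" using p q by auto
  then have "(1 + p) * (1 + q) \<le> a * b" using ab unfolding p_def q_def by (intro mult_mono) auto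
  then have "p + q \<le> - (p * q)" using ab(1) by (simp add: algebra_simps)
  also have "\<dots> \<le> \<bar>p\<bar> * \<bar>q\<bar>" by (simp add: abs_mult[symmetric])
  also have "\<dots> \<le> (t\<^sup>2 * P) * (t\<^sup>2 * P)" using p q by (intro mult_mono) auto
  finally have "t\<^sup>2 * (v - C) \<le> t\<^sup>2 * (2 * L * t + t\<^sup>2 * P\<^sup>2)"
    unfolding p_def q_def by (simp add: algebra_simps power2_eq_square power3_eq_cube)
  then have "v - C \<le> 2 * L * t + t\<^sup>2 * P\<^sup>2" using t by simp
  also have "\<dots> \<le> 2 * L * t + t * P\<^sup>2" using t by (simp add: power2_eq_square mult_right_mono)
  also have "\<dots> < t * (2 * L + P\<^sup>2 + 1)" using t by (simp add: algebra_simps)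
  also have "\<dots> \<le> (v - C) / (2 * (2 * L + P\<^sup>2 + 1)) * (2 * L + P\<^sup>2 + 1)"
    using t KK by (intro mult_right_mono) auto
  also have "\<dots> = (v - C) / 2" using KK by (simp add: field_simps)
  finally show False using \<open>\<not> v \<le> C\<close> by simp
qed

text \<open>Property (tau) is tested with the pair t u - t^2 c and t u, where c = (|G| + \<eta>)^2 /
  \<epsilon>; expanding both exponentials to order t^2 leaves variance of u <= integral of c. The
  tolerance \<eta> is the error of a uniform first-order expansion of u at distances below
  d.\<close>

lemma poincare_bounded:
  fixes u :: "'a::euclidean_space \<Rightarrow> real" and G :: "'a \<Rightarrow> 'a"
  assumes tau: "property_tau \<epsilon> \<nu>" and "\<epsilon> > 0" and "prob_space \<nu>" and [simp, measurable_cong]: "sets \<nu> = sets borel"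
    and [measurable]: "u \<in> borel_measurable borel" "G \<in> borel_measurable borel"
    and bnd: "\<And>x. \<bar>u x\<bar> \<le> B" "\<And>x. norm (G x) \<le> B" and mean: "(\<integral>x. u x \<partial>\<nu>) = 0"
    and "\<eta> > 0" "d > 0"
    and diff: "\<And>x y. norm (y - x) < d \<Longrightarrow> u y - u x - G x \<bullet> (y - x) \<ge> - \<eta> * norm (y - x)"
  shows "(\<integral>x. (u x)\<^sup>2 \<partial>\<nu>) \<le> (\<integral>x. (norm (G x) + \<eta>)\<^sup>2 / \<epsilon> \<partial>\<nu>)"
proof -
  interpret prob_space \<nu> by fact
  have B: "B \<ge> 0" using bnd(1)[of 0] by linarith
  define c where "c x = (norm (G x) + \<eta>)\<^sup>2 / \<epsilon>" for x
  define K where "K = (B + \<eta>)\<^sup>2 / \<epsilon>"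
  have c: "0 \<le> c x" "c x \<le> K" for x
    unfolding c_def K_def using bnd(2)[of x] \<open>\<epsilon> > 0\<close> \<open>\<eta> > 0\<close> by (auto intro!: divide_right_mono power_mono)
  have K: "K \<ge> 0" using c[of 0] by linarith
  have [measurable]: "c \<in> borel_measurable borel" unfolding c_def by measurable
  have u2: "(u x)\<^sup>2 \<le> B\<^sup>2" for x using bnd(1)[of x] by (metis abs_ge_zero power2_abs power_mono)
  have intu: "integrable \<nu> u" by (rule integrable_const_bound[of _ B]) (use bnd in auto)
  have intu2: "integrable \<nu> (\<lambda>x. (u x)\<^sup>2)" by (rule integrable_const_bound[of _ "B\<^sup>2"]) (use u2 in auto)
  have intc: "integrable \<nu> c" by (rule integrable_const_bound[of _ K]) (use c in auto)
  have nn: "(\<integral>\<^sup>+x. ennreal (exp (h x)) \<partial>\<nu>) = ennreal (\<integral>x. exp (h x) \<partial>\<nu>)" "integrable \<nu> (\<lambda>x. exp (h x))"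
    if "h \<in> borel_measurable borel" "\<And>x. h x \<le> H" for h :: "'a \<Rightarrow> real" and H
  proof -
    show "integrable \<nu> (\<lambda>x. exp (h x))" by (rule integrable_const_bound[of _ "exp H"]) (use that in auto)
    then show "(\<integral>\<^sup>+x. ennreal (exp (h x)) \<partial>\<nu>) = ennreal (\<integral>x. exp (h x) \<partial>\<nu>)"
      by (rule nn_integral_eq_integral) simp
  qed
  \<comment> \<open>For t < T the far case |y - x| >= d is harmless, since 2 B t <= \<epsilon> d^2 /
    4; and t <= 1 keeps the exponents bounded by B.\<close>
  define T where "T = min 1 (\<epsilon> * d\<^sup>2 / (8 * (B + 1)))"
  have "T > 0" unfolding T_def using \<open>\<epsilon> > 0\<close> \<open>d > 0\<close> B by simp
  show ?thesis unfolding c_def[symmetric]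
  proof (rule product_expansion_limit[OF \<open>T > 0\<close>, where L = "B * K + (B + K) ^ 3 / 6 + B ^ 3 / 6"])
    show "0 \<le> (\<integral>x. (u x)\<^sup>2 \<partial>\<nu>)" by simp
    show "0 \<le> (\<integral>x. c x \<partial>\<nu>)" using c by simp
    show "0 \<le> B * K + (B + K) ^ 3 / 6 + B ^ 3 / 6" using B K by simp
  next
    fix t assume t: "0 < t" "t < T"
    then have t1: "t \<le> 1" "t * (2 * B) \<le> \<epsilon> * d\<^sup>2 / 4"
    proof -
      show "t \<le> 1" using t unfolding T_def by simp
      have "t * (8 * (B + 1)) \<le> \<epsilon> * d\<^sup>2" using t B unfolding T_def by (simp add: pos_less_divide_eq less_imp_le)
      then show "t * (2 * B) \<le> \<epsilon> * d\<^sup>2 / 4" using t by (simp add: algebra_simps)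
    qed
    define Q where "Q x = t * u x - t\<^sup>2 * c x" for x
    have [measurable]: "Q \<in> borel_measurable borel" unfolding Q_def by measurable
    have "(\<integral>\<^sup>+x. ennreal (exp (Q x)) \<partial>\<nu>) * (\<integral>\<^sup>+x. ennreal (exp (- (t * u x))) \<partial>\<nu>) \<le> 1"
    proof (rule tau[unfolded property_tau_def, rule_format])
      fix x y :: 'a
      let ?r = "norm (y - x)"
      have "- t\<^sup>2 * c x \<le> t * (u y - u x) + \<epsilon> / 4 * ?r\<^sup>2"
      \<comment> \<open>Near points: the first-order expansion of u and a completed square, which
        dictates the form of c. Far points: boundedness of u and the choice of T.\<close>
      proof (cases "?r < d")
        case True
        have "G x \<bullet> (y - x) \<ge> - (norm (G x) * ?r)" using Cauchy_Schwarz_ineq2[of "G x" "y - x"] by linarith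
        then have "u y - u x \<ge> - (norm (G x) + \<eta>) * ?r" using diff[OF True] by (simp add: algebra_simps)
        then have "t * (u y - u x) \<ge> t * (- (norm (G x) + \<eta>) * ?r)" using t by (intro mult_left_mono) auto
        moreover have "0 \<le> (t * (norm (G x) + \<eta>) / sqrt \<epsilon> - sqrt \<epsilon> / 2 * ?r)\<^sup>2" by simp
        then have "0 \<le> t\<^sup>2 * c x - t * (norm (G x) + \<eta>) * ?r + \<epsilon> / 4 * ?r\<^sup>2"
          using \<open>\<epsilon> > 0\<close> unfolding c_def by (simp add: power2_diff power_mult_distrib power_divide)
        ultimately show ?thesis by (simp add: algebra_simps)
      next
        case False
        have "u y - u x \<ge> - (2 * B)" using bnd(1)[of x] bnd(1)[of y] by linarith
        then have "t * (u y - u x) \<ge> t * (- (2 * B))" using t by (intro mult_left_mono) auto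
        moreover have "d\<^sup>2 \<le> ?r\<^sup>2" using False \<open>d > 0\<close> by (intro power_mono) auto
        then have "\<epsilon> * d\<^sup>2 / 4 \<le> \<epsilon> / 4 * ?r\<^sup>2" using \<open>\<epsilon> > 0\<close> by simp
        moreover have "0 \<le> t\<^sup>2 * c x" using c by simp
        ultimately show ?thesis using t1(2) by simp
      qed
      then show "Q x \<le> t * u y + \<epsilon> / 4 * (norm (x - y))\<^sup>2"
        unfolding Q_def by (simp add: algebra_simps norm_minus_commute)
    qed measurable
    moreover have Qle: "Q x \<le> B" for x
    proof -
      have "t * u x \<le> 1 * B" using t t1 bnd(1)[of x] B
        by (metis abs_le_D1 mult_left_mono mult_mono' mult_right_mono order.trans less_imp_le)
      moreover have "0 \<le> t\<^sup>2 * c x" using c by simp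
      ultimately show ?thesis unfolding Q_def by simp
    qed
    moreover have ule: "- (t * u x) \<le> B" for x
    proof -
      have "t * (- u x) \<le> 1 * B" using t t1 bnd(1)[of x] B
        by (metis abs_le_D2 mult_left_mono mult_right_mono order.trans less_imp_le)
      then show ?thesis by simp
    qed
    ultimately have prod: "(\<integral>x. exp (Q x) \<partial>\<nu>) * (\<integral>x. exp (- (t * u x)) \<partial>\<nu>) \<le> 1"
      by (simp add: nn(1)[of Q B] nn(1)[of "\<lambda>x. - (t * u x)" B] ennreal_mult[symmetric])
    have "1 + t\<^sup>2 * ((\<integral>x. (u x)\<^sup>2 \<partial>\<nu>) / 2) - B ^ 3 / 6 * t ^ 3
        = (\<integral>x. 1 + - t * u x + t\<^sup>2 / 2 * (u x)\<^sup>2 - B ^ 3 / 6 * t ^ 3 \<partial>\<nu>)"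
      using intu intu2 mean by (simp add: prob_space)
    also have "\<dots> \<le> (\<integral>x. exp (- (t * u x)) \<partial>\<nu>)"
    proof (rule integral_mono)
      fix x
      have "(u x) ^ 3 \<le> B ^ 3" using bnd(1)[of x] by (metis abs_ge_self abs_le_D1 power_mono_odd odd_numeral)
      then have "t ^ 3 * (u x) ^ 3 \<le> t ^ 3 * B ^ 3" using t by (intro mult_left_mono) auto
      then show "1 + - t * u x + t\<^sup>2 / 2 * (u x)\<^sup>2 - B ^ 3 / 6 * t ^ 3 \<le> exp (- (t * u x))"
        using exp_ge_cubic[of "- (t * u x)"] by (simp add: power_mult_distrib algebra_simps)
    qed (use intu intu2 nn(2)[of "\<lambda>x. - (t * u x)" B] ule in auto)
    finally have b: "1 + t\<^sup>2 * ((\<integral>x. (u x)\<^sup>2 \<partial>\<nu>) / 2) - B ^ 3 / 6 * t ^ 3 \<le> (\<integral>x. exp (- (t * u x)) \<partial>\<nu>)" .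
    have "1 + t\<^sup>2 * ((\<integral>x. (u x)\<^sup>2 \<partial>\<nu>) / 2 - (\<integral>x. c x \<partial>\<nu>)) - (B * K + (B + K) ^ 3 / 6) * t ^ 3
        = (\<integral>x. 1 + t * u x - t\<^sup>2 * c x + t\<^sup>2 / 2 * (u x)\<^sup>2 - (B * K + (B + K) ^ 3 / 6) * t ^ 3 \<partial>\<nu>)"
      using intu intu2 intc mean by (simp add: prob_space algebra_simps)
    also have "\<dots> \<le> (\<integral>x. exp (Q x) \<partial>\<nu>)"
    proof (rule integral_mono)
      fix x
      \<comment> \<open>The square and the cube of \<open>Q\<close> are bounded below by their
        leading terms up to order t^3, which is what the cubic Taylor bound needs.\<close>
      have "\<bar>u x * c x\<bar> \<le> B * K" unfolding abs_mult using bnd(1)[of x] c[of x] B by (intro mult_mono) auto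
      then have "t ^ 3 * (u x * c x) \<le> t ^ 3 * (B * K)" using t by (intro mult_left_mono) auto
      moreover have "0 \<le> t ^ 4 * (c x)\<^sup>2" by simp
      ultimately have Q2: "(Q x)\<^sup>2 \<ge> t\<^sup>2 * (u x)\<^sup>2 - 2 * (B * K) * t ^ 3"
        unfolding Q_def by (simp add: power2_eq_square power3_eq_cube power4_eq_xxxx algebra_simps)
      have "t * (c x) \<le> K" using t1 t c[of x] by (metis mult_left_le_one_le order.trans less_imp_le)
      then have "- (u x - t * c x) \<le> B + K" using bnd(1)[of x] by linarith
      then have "(- (u x - t * c x)) ^ 3 \<le> (B + K) ^ 3" by (rule power_mono_odd[OF odd_numeral])
      then have "t ^ 3 * (- (u x - t * c x)) ^ 3 \<le> t ^ 3 * (B + K) ^ 3" using t by (intro mult_left_mono) auto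
      also have "t ^ 3 * (- (u x - t * c x)) ^ 3 = - ((Q x) ^ 3)"
        unfolding Q_def by (simp add: power2_eq_square power3_eq_cube algebra_simps)
      finally have Q3: "(Q x) ^ 3 \<ge> - (t ^ 3 * (B + K) ^ 3)" by simp
      show "1 + t * u x - t\<^sup>2 * c x + t\<^sup>2 / 2 * (u x)\<^sup>2 - (B * K + (B + K) ^ 3 / 6) * t ^ 3 \<le> exp (Q x)"
        using exp_ge_cubic[of "Q x"] Q2 Q3 by (simp add: Q_def algebra_simps)
    qed (use intu intu2 intc nn(2)[of Q B] Qle in auto)
    finally have a: "1 + t\<^sup>2 * ((\<integral>x. (u x)\<^sup>2 \<partial>\<nu>) / 2 - (\<integral>x. c x \<partial>\<nu>)) - (B * K + (B + K) ^ 3 / 6) * t ^ 3 \<le> (\<integral>x. exp (Q x) \<partial>\<nu>)" .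
    have "0 \<le> (B * K + (B + K) ^ 3 / 6) * t ^ 3" "0 \<le> B ^ 3 / 6 * t ^ 3" using B K t by simp_all
    then show "\<exists>a b. a * b \<le> 1 \<and> a \<ge> 0 \<and> b \<ge> 0 \<and>
        a \<ge> 1 + t\<^sup>2 * ((\<integral>x. (u x)\<^sup>2 \<partial>\<nu>) / 2 - (\<integral>x. c x \<partial>\<nu>)) - (B * K + (B + K) ^ 3 / 6 + B ^ 3 / 6) * t ^ 3
        \<and> b \<ge> 1 + t\<^sup>2 * ((\<integral>x. (u x)\<^sup>2 \<partial>\<nu>) / 2) - (B * K + (B + K) ^ 3 / 6 + B ^ 3 / 6) * t ^ 3"
      using a b prod by (intro exI[of _ "\<integral>x. exp (Q x) \<partial>\<nu>"] exI[of _ "\<integral>x. exp (- (t * u x)) \<partial>\<nu>"])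
        (auto simp: distrib_right)
  qed
qed

lemma le_of_le_add_small:
  fixes a b p q :: real
  assumes "\<And>\<eta>. \<eta> > 0 \<Longrightarrow> a \<le> b + p * \<eta> + q * \<eta>\<^sup>2"
  shows "a \<le> b"
proof -
  have "((\<lambda>\<eta>. b + p * \<eta> + q * \<eta>\<^sup>2) \<longlongrightarrow> b + p * 0 + q * 0\<^sup>2) (at_right 0)"
    by (intro tendsto_intros)
  moreover have "eventually (\<lambda>\<eta>. a \<le> b + p * \<eta> + q * \<eta>\<^sup>2) (at_right 0)"
    using assms by (auto simp: eventually_at_filter)
  ultimately show ?thesis using tendsto_lowerbound by fastforce
qed

text \<open>A compactly supported continuous gradient is uniformly continuous, so first-order
  expansions hold with error \<eta> |y - x| at one common scale. \<open>poincare_bounded\<close>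
  applies to u minus its mean, and \<eta> tends to 0.\<close>

lemma poincare_compact_support:
  fixes u :: "'a::euclidean_space \<Rightarrow> real" and G :: "'a \<Rightarrow> 'a"
  assumes tau: "property_tau \<epsilon> \<nu>" and \<epsilon>: "\<epsilon> > 0" and "prob_space \<nu>" and [simp, measurable_cong]: "sets \<nu> = sets borel"
    and der: "\<And>x. (u has_derivative (\<lambda>v. G x \<bullet> v)) (at x)" and cont: "continuous_on UNIV G"
    and supp: "\<And>x. norm x > R \<Longrightarrow> u x = 0" "\<And>x. norm x > R \<Longrightarrow> G x = 0"
  shows "(\<integral>x. (u x)\<^sup>2 \<partial>\<nu>) - (\<integral>x. u x \<partial>\<nu>)\<^sup>2 \<le> (\<integral>x. (norm (G x))\<^sup>2 \<partial>\<nu>) / \<epsilon>"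
proof -
  interpret prob_space \<nu> by fact
  have contu: "continuous_on UNIV u" using der has_derivative_continuous_on[of UNIV u "\<lambda>x v. G x \<bullet> v"] by simp
  have [measurable]: "u \<in> borel_measurable borel" "G \<in> borel_measurable borel"
    using contu cont by (auto intro: borel_measurable_continuous_onI)
  have "bounded (u ` cball 0 R)" "bounded (G ` cball 0 R)"
    by (intro compact_imp_bounded compact_continuous_image continuous_on_subset[OF contu] continuous_on_subset[OF cont]; simp)+
  then obtain B1 B2 where "\<forall>y \<in> u ` cball 0 R. norm y \<le> B1" "\<forall>y \<in> G ` cball 0 R. norm y \<le> B2"
    unfolding bounded_iff by blast
  then have B12: "\<And>x. x \<in> cball 0 R \<Longrightarrow> norm (u x) \<le> B1" "\<And>x. x \<in> cball 0 R \<Longrightarrow> norm (G x) \<le> B2"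
    by auto
  define B where "B = max 0 (max B1 B2)"
  have bu: "\<bar>u x\<bar> \<le> B" and bG: "norm (G x) \<le> B" for x
    using B12[of x] supp[of x] by (cases "norm x > R"; force simp: B_def max_def)+
  define m where "m = (\<integral>x. u x \<partial>\<nu>)"
  have intu: "integrable \<nu> u" by (rule integrable_const_bound[of _ B]) (use bu in auto)
  have u2: "(u x)\<^sup>2 \<le> B\<^sup>2" for x using bu[of x] by (metis abs_ge_zero power2_abs power_mono)
  have intu2: "integrable \<nu> (\<lambda>x. (u x)\<^sup>2)" by (rule integrable_const_bound[of _ "B\<^sup>2"]) (use u2 in auto)
  have intG: "integrable \<nu> (\<lambda>x. norm (G x))" by (rule integrable_const_bound[of _ B]) (use bG in auto)
  have intG2: "integrable \<nu> (\<lambda>x. (norm (G x))\<^sup>2)" by (rule integrable_const_bound[of _ "B\<^sup>2"]) (use bG in \<open>auto intro!: AE_I2 power_mono\<close>)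
  \<comment> \<open>The margin 1 around the support ensures that two points at distance below 1 both
    lie in the larger ball or both lie off the support.\<close>
  have "uniformly_continuous_on (cball 0 (R + 1)) G"
    by (intro compact_uniformly_continuous continuous_on_subset[OF cont]) auto
  have var: "(\<integral>x. (u x - m)\<^sup>2 \<partial>\<nu>) = (\<integral>x. (u x)\<^sup>2 \<partial>\<nu>) - m\<^sup>2"
    using variance_eq[OF intu intu2] by (simp add: m_def)
  have "(\<integral>x. (u x - m)\<^sup>2 \<partial>\<nu>) \<le> (\<integral>x. (norm (G x))\<^sup>2 \<partial>\<nu>) / \<epsilon> + (2 * (\<integral>x. norm (G x) \<partial>\<nu>) / \<epsilon>) * \<eta> + (1 / \<epsilon>) * \<eta>\<^sup>2"
    if \<eta>: "\<eta> > 0" for \<eta>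
  proof -
    obtain d0 where d0: "d0 > 0" "\<And>x y. x \<in> cball 0 (R+1) \<Longrightarrow> y \<in> cball 0 (R+1) \<Longrightarrow> dist y x < d0 \<Longrightarrow> dist (G y) (G x) < \<eta>"
      using \<open>uniformly_continuous_on (cball 0 (R + 1)) G\<close> \<eta> unfolding uniformly_continuous_on_def by metis
    define d where "d = min d0 1"
    have d: "d > 0" using d0 by (simp add: d_def)
    have uc: "norm (G y - G x) \<le> \<eta>" if "norm (y - x) < d" for x y
    proof (cases "x \<in> cball 0 (R+1) \<and> y \<in> cball 0 (R+1)")
      case True
      then show ?thesis using d0(2)[of x y] that by (simp add: d_def dist_norm less_imp_le)
    next
      case False
      have "norm x \<le> norm y + norm (y - x)" "norm y \<le> norm x + norm (y - x)"
        using norm_triangle_sub[of x y] norm_triangle_sub[of y x] by (simp_all add: norm_minus_commute)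
      then have "norm x > R" "norm y > R" using False that by (auto simp: d_def)
      then show ?thesis using supp \<eta> by simp
    qed
    have diff: "u y - u x - G x \<bullet> (y - x) \<ge> - \<eta> * norm (y - x)" if "norm (y - x) < d" for x y
    proof -
      \<comment> \<open>Mean value inequality for u minus its linear part at x; the derivative of
        the difference is at most \<eta> along the segment.\<close>
      have "norm ((u y - G x \<bullet> y) - (u x - G x \<bullet> x)) \<le> \<eta> * norm (y - x)"
      proof (rule differentiable_bound[of "closed_segment x y" "\<lambda>z. u z - G x \<bullet> z" "\<lambda>z v. G z \<bullet> v - G x \<bullet> v"])
        fix z assume z: "z \<in> closed_segment x y"
        show "((\<lambda>z. u z - G x \<bullet> z) has_derivative (\<lambda>v. G z \<bullet> v - G x \<bullet> v)) (at z within closed_segment x y)"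
          by (intro derivative_intros has_derivative_at_withinI[OF der])
        have "norm (z - x) \<le> norm (y - x)" using segment_bound(1)[OF z] by (simp add: norm_minus_commute)
        then have "norm (G z - G x) \<le> \<eta>" using that by (intro uc) auto
        then show "onorm (\<lambda>v. G z \<bullet> v - G x \<bullet> v) \<le> \<eta>"
          by (intro onorm_le) (metis inner_diff_left Cauchy_Schwarz_ineq2 real_norm_def mult_right_mono norm_ge_zero order.trans)
      qed auto
      then show ?thesis by (simp add: inner_diff_right)
    qed
    have "(\<integral>x. (u x - m)\<^sup>2 \<partial>\<nu>) \<le> (\<integral>x. (norm (G x) + \<eta>)\<^sup>2 / \<epsilon> \<partial>\<nu>)"
    proof (rule poincare_bounded[OF tau \<epsilon> \<open>prob_space \<nu>\<close>, where B = "B + \<bar>m\<bar>"])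
      show "\<bar>u x - m\<bar> \<le> B + \<bar>m\<bar>" for x using bu[of x] by linarith
      show "norm (G x) \<le> B + \<bar>m\<bar>" for x using bG[of x] by linarith
      show "(\<integral>x. u x - m \<partial>\<nu>) = 0" using intu by (simp add: m_def prob_space)
      show "u y - m - (u x - m) - G x \<bullet> (y - x) \<ge> - \<eta> * norm (y - x)" if "norm (y - x) < d" for x y
        using diff[OF that] by simp
    qed (use \<eta> d in auto)
    also have "\<dots> = (\<integral>x. (norm (G x))\<^sup>2 / \<epsilon> + (2 * \<eta> / \<epsilon>) * norm (G x) + \<eta>\<^sup>2 / \<epsilon> \<partial>\<nu>)"
      by (simp add: power2_sum add_divide_distrib mult_ac add_ac)
    also have "\<dots> = (\<integral>x. (norm (G x))\<^sup>2 \<partial>\<nu>) / \<epsilon> + (2 * (\<integral>x. norm (G x) \<partial>\<nu>) / \<epsilon>) * \<eta> + (1 / \<epsilon>) * \<eta>\<^sup>2"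
      using intG intG2 by (simp add: prob_space)
    finally show ?thesis .
  qed
  then have "(\<integral>x. (u x - m)\<^sup>2 \<partial>\<nu>) \<le> (\<integral>x. (norm (G x))\<^sup>2 \<partial>\<nu>) / \<epsilon>"
    by (rule le_of_le_add_small)
  then show ?thesis unfolding var by (simp add: m_def)
qed

text \<open>Squaring removes the kink of the positive part, so the cut-off built from it is
  C^1.\<close>

lemma has_real_derivative_pos_part_sq:
  "((\<lambda>s. (max 0 s)\<^sup>2) has_real_derivative 2 * max 0 s) (at (s::real))"
proof -
  consider "s > 0" | "s < 0" | "s = 0" by linarith
  then show ?thesis
  proof cases
    case 1
    have "((\<lambda>s. s\<^sup>2) has_real_derivative 2 * max 0 s) (at s)"
      using 1 by (auto intro!: derivative_eq_intros)
    then show ?thesis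
      by (rule has_field_derivative_transform_within_open[where S = "{0<..}"]) (use 1 in auto)
  next
    case 2
    have "((\<lambda>s. 0) has_real_derivative 2 * max 0 s) (at s)"
      using 2 by (auto intro!: derivative_eq_intros)
    then show ?thesis
      by (rule has_field_derivative_transform_within_open[where S = "{..<0}"]) (use 2 in auto)
  next
    case 3
    have "((\<lambda>h. (max 0 h)\<^sup>2 / h) \<longlongrightarrow> 0) (at (0::real))"
    proof (rule Lim_null_comparison)
      show "eventually (\<lambda>h. norm ((max 0 h)\<^sup>2 / h) \<le> \<bar>h\<bar>) (at (0::real))"
        by (rule always_eventually) (auto simp: max_def power2_eq_square)
      show "((\<lambda>h. \<bar>h\<bar>) \<longlongrightarrow> 0) (at (0::real))" by (auto intro: tendsto_rabs_zero tendsto_ident_at)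
    qed
    then show ?thesis using 3 by (simp add: DERIV_def)
  qed
qed

text \<open>A cut-off to the ball of radius R whose gradient is at most 4 / R, so that the errors of
  localisation vanish as R grows.\<close>

definition bump :: "real \<Rightarrow> 'a::real_inner \<Rightarrow> real" where
  "bump R x = (max 0 (1 - (norm x)\<^sup>2 / R\<^sup>2))\<^sup>2"

definition bump_grad :: "real \<Rightarrow> 'a::real_inner \<Rightarrow> 'a" where
  "bump_grad R x = (- 4 / R\<^sup>2 * max 0 (1 - (norm x)\<^sup>2 / R\<^sup>2)) *\<^sub>R x"

lemma bump_has_derivative: "(bump R has_derivative (\<lambda>v. bump_grad R x \<bullet> v)) (at x)"
proof -
  define c where "c = inverse (R\<^sup>2)"
  have "((\<lambda>x. 1 - c * (x \<bullet> x)) has_derivative (\<lambda>v. - 2 * c * (x \<bullet> v))) (at x)"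
    by (auto intro!: derivative_eq_intros simp: inner_commute)
  then have "((\<lambda>x. (max 0 (1 - c * (x \<bullet> x)))\<^sup>2) has_derivative (\<lambda>v. 2 * max 0 (1 - c * (x \<bullet> x)) * (- 2 * c * (x \<bullet> v)))) (at x)"
    by (rule has_derivative_eq_rhs[OF has_derivative_compose[OF _ has_real_derivative_pos_part_sq[unfolded has_field_derivative_def]]])
      (simp add: mult_ac)
  then show ?thesis
    unfolding bump_def bump_grad_def power2_norm_eq_inner divide_inverse c_def[symmetric] by (simp add: mult_ac)
qed

lemma bump_bounds: "0 \<le> bump R x" "bump R x \<le> 1"
  unfolding bump_def by (auto intro!: power_le_one)

lemma bump_outside: "R > 0 \<Longrightarrow> norm x > R \<Longrightarrow> bump R x = 0" "R > 0 \<Longrightarrow> norm x > R \<Longrightarrow> bump_grad R x = 0"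
proof -
  assume "R > 0" "norm x > R"
  then have "R\<^sup>2 \<le> (norm x)\<^sup>2" by (intro power_mono) auto
  then have "1 \<le> (norm x)\<^sup>2 / R\<^sup>2" using \<open>R > 0\<close> by (simp add: pos_le_divide_eq)
  then show "bump R x = 0" "bump_grad R x = 0" by (simp_all add: bump_def bump_grad_def)
qed

lemma norm_bump_grad: "R > 0 \<Longrightarrow> norm (bump_grad R x) \<le> 4 / R"
proof (cases "norm x > R")
  case False
  assume "R > 0"
  have "norm (bump_grad R x) = 4 / R\<^sup>2 * max 0 (1 - (norm x)\<^sup>2 / R\<^sup>2) * norm x"
    by (simp add: bump_grad_def abs_mult)
  also have "\<dots> \<le> 4 / R\<^sup>2 * 1 * R"
    using False by (intro mult_mono) auto
  also have "\<dots> = 4 / R" using \<open>R > 0\<close> by (simp add: power2_eq_square)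
  finally show ?thesis .
qed (simp add: bump_outside)

lemma continuous_bump_grad [continuous_intros]: "continuous_on S (bump_grad R)"
  unfolding bump_grad_def divide_inverse by (intro continuous_intros)

lemma bump_tendsto: "(\<lambda>n. bump (real (Suc n)) x) \<longlonglongrightarrow> 1"
proof -
  have "(\<lambda>n. inverse (real (Suc n))) \<longlonglongrightarrow> 0" by (rule LIMSEQ_inverse_real_of_nat)
  then have "(\<lambda>n. (max 0 (1 - (norm x)\<^sup>2 * (inverse (real (Suc n)))\<^sup>2))\<^sup>2) \<longlonglongrightarrow> (max 0 (1 - (norm x)\<^sup>2 * 0\<^sup>2))\<^sup>2"
    by (intro tendsto_intros)
  then show ?thesis by (simp add: bump_def divide_inverse power_inverse del: of_nat_Suc)
qed

lemma bump_grad_tendsto: "(\<lambda>n. bump_grad (real (Suc n)) x) \<longlonglongrightarrow> 0"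
proof (rule Lim_null_comparison)
  show "eventually (\<lambda>n. norm (bump_grad (real (Suc n)) x) \<le> 4 * inverse (real (Suc n))) sequentially"
    using norm_bump_grad[of "real (Suc n)" x for n] by (intro always_eventually) (auto simp: divide_inverse)
  show "(\<lambda>n. 4 * inverse (real (Suc n))) \<longlonglongrightarrow> 0"
    using tendsto_mult_left[OF LIMSEQ_inverse_real_of_nat, of 4] by simp
qed

text \<open>Localisation by \<open>bump\<close> and dominated convergence; for radii at least 1 the
  gradient of the localised function is dominated by |G| + 4 |u|.\<close>

theorem poincare_property_tau:
  fixes u :: "'a::euclidean_space \<Rightarrow> real" and G :: "'a \<Rightarrow> 'a"
  assumes tau: "property_tau \<epsilon> \<nu>" and \<epsilon>: "\<epsilon> > 0" and "prob_space \<nu>" and [simp, measurable_cong]: "sets \<nu> = sets borel"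
    and der: "\<And>x. (u has_derivative (\<lambda>v. G x \<bullet> v)) (at x)" and cont: "continuous_on UNIV G"
    and int2: "integrable \<nu> (\<lambda>x. (u x)\<^sup>2)" "integrable \<nu> (\<lambda>x. (norm (G x))\<^sup>2)"
  shows "(\<integral>x. (u x)\<^sup>2 \<partial>\<nu>) - (\<integral>x. u x \<partial>\<nu>)\<^sup>2 \<le> (\<integral>x. (norm (G x))\<^sup>2 \<partial>\<nu>) / \<epsilon>"
proof -
  interpret prob_space \<nu> by fact
  have contu: "continuous_on UNIV u" using der has_derivative_continuous_on[of UNIV u "\<lambda>x v. G x \<bullet> v"] by simp
  have [measurable]: "u \<in> borel_measurable borel" "G \<in> borel_measurable borel"
    using contu cont by (auto intro: borel_measurable_continuous_onI)
  have contb: "continuous_on UNIV (bump R :: 'a \<Rightarrow> real)" for R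
    using has_derivative_continuous_on[of UNIV "bump R" "\<lambda>x v. bump_grad R x \<bullet> v"] bump_has_derivative by blast
  have [measurable]: "bump R \<in> borel_measurable (borel :: 'a measure)" "bump_grad R \<in> borel_measurable (borel :: 'a measure)" for R
    using contb continuous_bump_grad by (auto intro: borel_measurable_continuous_onI)
  have intu: "integrable \<nu> u" by (rule square_integrable_imp_integrable) (use int2 in auto)
  define r where "r n = real (Suc n)" for n
  have r: "r n \<ge> 1" for n by (simp add: r_def)
  define U where "U n x = bump (r n) x * u x" for n x
  define H where "H n x = bump (r n) x *\<^sub>R G x + u x *\<^sub>R bump_grad (r n) x" for n x
  have [measurable]: "U n \<in> borel_measurable borel" "H n \<in> borel_measurable borel" for n
    unfolding U_def H_def by measurable
  have le: "(\<integral>x. (U n x)\<^sup>2 \<partial>\<nu>) - (\<integral>x. U n x \<partial>\<nu>)\<^sup>2 \<le> (\<integral>x. (norm (H n x))\<^sup>2 \<partial>\<nu>) / \<epsilon>" for n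
  proof (rule poincare_compact_support[OF tau \<epsilon> \<open>prob_space \<nu>\<close>, where R = "r n"])
    show "(U n has_derivative (\<lambda>v. H n x \<bullet> v)) (at x)" for x
      unfolding U_def H_def
      by (rule has_derivative_eq_rhs[OF has_derivative_mult[OF bump_has_derivative der]])
        (auto simp: fun_eq_iff inner_add_left mult_ac)
    show "continuous_on UNIV (H n)"
      unfolding H_def by (intro continuous_intros contb cont contu)
    show "U n x = 0" "H n x = 0" if "norm x > r n" for x
      using bump_outside[OF _ that] r[of n] by (auto simp: U_def H_def)
  qed simp
  have absU: "\<bar>U n x\<bar> \<le> \<bar>u x\<bar>" for n x
    unfolding U_def abs_mult using bump_bounds[of "r n" x] by (simp add: mult_left_le_one_le)
  have normH: "norm (H n x) \<le> norm (G x) + 4 * \<bar>u x\<bar>" for n x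
  proof -
    have "norm (H n x) \<le> bump (r n) x * norm (G x) + \<bar>u x\<bar> * norm (bump_grad (r n) x)"
      unfolding H_def by (rule order.trans[OF norm_triangle_ineq]) (use bump_bounds[of "r n" x] in auto)
    also have "\<dots> \<le> 1 * norm (G x) + \<bar>u x\<bar> * 4"
    proof (intro add_mono mult_right_mono mult_left_mono)
      have "norm (bump_grad (r n) x) \<le> 4 / r n" using r[of n] by (intro norm_bump_grad) auto
      also have "\<dots> \<le> 4" using r[of n] by (simp add: divide_le_eq)
      finally show "norm (bump_grad (r n) x) \<le> 4" .
    qed (use bump_bounds in auto)
    finally show ?thesis by simp
  qed
  have limU: "(\<lambda>n. U n x) \<longlonglongrightarrow> u x" for x
    using tendsto_mult[OF bump_tendsto[of x] tendsto_const[of "u x"]] unfolding U_def r_def by simp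
  have limH: "(\<lambda>n. H n x) \<longlonglongrightarrow> G x" for x
    using tendsto_add[OF tendsto_scaleR[OF bump_tendsto[of x] tendsto_const[of "G x"]]
        tendsto_scaleR[OF tendsto_const[of "u x"] bump_grad_tendsto[of x]]]
    unfolding H_def r_def by simp
  have "(\<lambda>n. \<integral>x. (U n x)\<^sup>2 \<partial>\<nu>) \<longlonglongrightarrow> (\<integral>x. (u x)\<^sup>2 \<partial>\<nu>)"
  proof (rule integral_dominated_convergence[OF _ _ int2(1)])
    show "AE x in \<nu>. (\<lambda>n. (U n x)\<^sup>2) \<longlonglongrightarrow> (u x)\<^sup>2" by (intro AE_I2 tendsto_intros limU)
    show "AE x in \<nu>. norm ((U n x)\<^sup>2) \<le> (u x)\<^sup>2" for n
      using absU by (auto intro!: AE_I2 simp: abs_le_square_iff[symmetric])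
  qed measurable
  moreover have "(\<lambda>n. \<integral>x. U n x \<partial>\<nu>) \<longlonglongrightarrow> (\<integral>x. u x \<partial>\<nu>)"
  proof (rule integral_dominated_convergence[OF _ _ integrable_abs[OF intu]])
    show "AE x in \<nu>. (\<lambda>n. U n x) \<longlonglongrightarrow> u x" by (intro AE_I2 limU)
    show "AE x in \<nu>. norm (U n x) \<le> \<bar>u x\<bar>" for n using absU by auto
  qed measurable
  moreover have "(\<lambda>n. \<integral>x. (norm (H n x))\<^sup>2 \<partial>\<nu>) \<longlonglongrightarrow> (\<integral>x. (norm (G x))\<^sup>2 \<partial>\<nu>)"
  proof (rule integral_dominated_convergence[where w = "\<lambda>x. 2 * (norm (G x))\<^sup>2 + 32 * (u x)\<^sup>2"])
    show "integrable \<nu> (\<lambda>x. 2 * (norm (G x))\<^sup>2 + 32 * (u x)\<^sup>2)" using int2 by auto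
    show "AE x in \<nu>. (\<lambda>n. (norm (H n x))\<^sup>2) \<longlonglongrightarrow> (norm (G x))\<^sup>2" by (intro AE_I2 tendsto_intros limH)
    show "AE x in \<nu>. norm ((norm (H n x))\<^sup>2) \<le> 2 * (norm (G x))\<^sup>2 + 32 * (u x)\<^sup>2" for n
    proof (rule AE_I2)
      fix x
      have "(norm (H n x))\<^sup>2 \<le> (norm (G x) + 4 * \<bar>u x\<bar>)\<^sup>2" by (intro power_mono normH) auto
      also have "\<dots> \<le> 2 * (norm (G x))\<^sup>2 + 32 * (u x)\<^sup>2"
        using zero_le_power2[of "norm (G x) - 4 * \<bar>u x\<bar>"] by (simp add: power2_diff power2_sum power_mult_distrib)
      finally show "norm ((norm (H n x))\<^sup>2) \<le> 2 * (norm (G x))\<^sup>2 + 32 * (u x)\<^sup>2" by simp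
    qed
  qed measurable
  ultimately show ?thesis
    by (intro LIMSEQ_le[of "\<lambda>n. (\<integral>x. (U n x)\<^sup>2 \<partial>\<nu>) - (\<integral>x. U n x \<partial>\<nu>)\<^sup>2" _ "\<lambda>n. (\<integral>x. (norm (H n x))\<^sup>2 \<partial>\<nu>) / \<epsilon>"])
      (use \<epsilon> in \<open>auto intro!: tendsto_intros le\<close>)
qed

section \<open>Monotone transport on the line and the one-dimensional deficit\<close>

definition pos_density :: "(real \<Rightarrow> real) \<Rightarrow> bool" where
  "pos_density \<psi> \<longleftrightarrow> continuous_on UNIV \<psi> \<and> (\<forall>x. \<psi> x > 0) \<and> (\<integral>\<^sup>+x. ennreal (\<psi> x) \<partial>lborel) = 1"

lemma pos_densityD:
  assumes "pos_density \<psi>"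
  shows "continuous_on UNIV \<psi>" "\<And>x. \<psi> x > 0" "\<And>x. \<psi> x \<ge> 0" "\<psi> \<in> borel_measurable borel"
    "(\<integral>\<^sup>+x. ennreal (\<psi> x) \<partial>lborel) = 1"
  using assms by (auto simp: pos_density_def less_imp_le intro: borel_measurable_continuous_onI)

lemma pos_density_std_normal: "pos_density std_normal_density"
  unfolding pos_density_def
proof (intro conjI allI)
  show "continuous_on UNIV std_normal_density"
    unfolding std_normal_density_def by (intro continuous_intros) auto
  show "(\<integral>\<^sup>+x. ennreal (std_normal_density x) \<partial>lborel) = 1"
    using gauss1.emeasure_space_1 by (simp add: emeasure_density)
qed (simp add: normal_density_pos)

lemma real_distribution_density:
  assumes "pos_density \<psi>" shows "real_distribution (density lborel (\<lambda>x. ennreal (\<psi> x)))"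
proof -
  note [measurable] = pos_densityD(4)[OF assms]
  have "prob_space (density lborel (\<lambda>x. ennreal (\<psi> x)))"
    using pos_densityD(5)[OF assms] by (intro prob_spaceI) (simp add: emeasure_density)
  then show ?thesis by (simp add: real_distribution_def real_distribution_axioms_def)
qed

lemma cdf_density_diff:
  assumes "pos_density \<psi>" "a \<le> b"
  shows "cdf (density lborel (\<lambda>x. ennreal (\<psi> x))) b - cdf (density lborel (\<lambda>x. ennreal (\<psi> x))) a = integral {a..b} \<psi>"
proof -
  note [measurable] = pos_densityD(4)[OF assms(1)]
  note cont = pos_densityD(1)[OF assms(1)] and nn = pos_densityD(3)[OF assms(1)]
  interpret real_distribution "density lborel (\<lambda>x. ennreal (\<psi> x))" by (rule real_distribution_density[OF assms(1)])
  have int: "set_integrable lborel {a..b} \<psi>"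
    by (intro borel_integrable_atLeastAtMost') (rule continuous_on_subset[OF cont], simp)
  have "emeasure (density lborel (\<lambda>x. ennreal (\<psi> x))) {a<..b} = (\<integral>\<^sup>+x. ennreal (\<psi> x) * indicator {a<..b} x \<partial>lborel)"
    by (simp add: emeasure_density)
  also have "\<dots> = (\<integral>\<^sup>+x. ennreal (indicator {a..b} x *\<^sub>R \<psi> x) \<partial>lborel)"
    using AE_lborel_singleton[of a] by (intro nn_integral_cong_AE) (auto simp: indicator_def)
  also have "\<dots> = ennreal (LINT x:{a..b}|lborel. \<psi> x)"
    unfolding set_lebesgue_integral_def
    by (rule nn_integral_eq_integral) (use int nn in \<open>auto simp: set_integrable_def indicator_def\<close>)
  also have "(LINT x:{a..b}|lborel. \<psi> x) = integral {a..b} \<psi>" by (rule set_borel_integral_eq_integral(2)[OF int])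
  finally have "measure (density lborel (\<lambda>x. ennreal (\<psi> x))) {a<..b} = integral {a..b} \<psi>"
    using integral_nonneg[OF integrable_continuous_interval[OF continuous_on_subset[OF cont subset_UNIV]] nn, of a b]
    by (simp only: measure_def enn2real_ennreal)
  then show ?thesis using assms(2) cdf_diff_eq[of a b] by (cases "a = b") auto
qed

lemma cdf_density_deriv:
  assumes "pos_density \<psi>"
  shows "(cdf (density lborel (\<lambda>x. ennreal (\<psi> x))) has_real_derivative \<psi> x) (at x)"
proof -
  let ?F = "cdf (density lborel (\<lambda>x. ennreal (\<psi> x)))"
  have "((\<lambda>y. integral {x - 1..y} \<psi>) has_real_derivative \<psi> x) (at x within {x - 1..x + 1})"
    by (rule integral_has_real_derivative) (auto intro: continuous_on_subset[OF pos_densityD(1)[OF assms]])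
  then have "((\<lambda>y. integral {x - 1..y} \<psi>) has_real_derivative \<psi> x) (at x)"
    by (subst (asm) at_within_Icc_at) auto
  then have "((\<lambda>y. ?F (x - 1) + integral {x - 1..y} \<psi>) has_real_derivative \<psi> x) (at x)"
    by (auto intro!: derivative_eq_intros)
  then show ?thesis
    by (rule has_field_derivative_transform_within_open[where S = "{x - 1<..}"])
      (auto simp: cdf_density_diff[OF assms, of "x - 1", symmetric])
qed

lemma cdf_density_strict_mono:
  assumes "pos_density \<psi>" shows "strict_mono (cdf (density lborel (\<lambda>x. ennreal (\<psi> x))))"
proof (rule strict_monoI)
  fix x y :: real assume "x < y"
  then show "cdf (density lborel (\<lambda>x. ennreal (\<psi> x))) x < cdf (density lborel (\<lambda>x. ennreal (\<psi> x))) y"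
    by (rule DERIV_pos_imp_increasing) (use cdf_density_deriv[OF assms] pos_densityD(2)[OF assms] in blast)
qed

lemma cdf_density_surj:
  assumes "pos_density \<psi>" "0 < p" "p < 1"
  shows "\<exists>y. cdf (density lborel (\<lambda>x. ennreal (\<psi> x))) y = p"
proof -
  let ?F = "cdf (density lborel (\<lambda>x. ennreal (\<psi> x)))"
  interpret real_distribution "density lborel (\<lambda>x. ennreal (\<psi> x))" by (rule real_distribution_density[OF assms(1)])
  have "eventually (\<lambda>y. ?F y < p) at_bot" by (rule order_tendstoD(2)[OF cdf_lim_at_bot assms(2)])
  then obtain a where a: "?F a < p" by (auto simp: eventually_at_bot_linorder)
  have "eventually (\<lambda>y. p < ?F y) at_top" by (rule order_tendstoD(1)[OF cdf_lim_at_top_prob assms(3)])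
  then obtain b where b: "p < ?F b" by (auto simp: eventually_at_top_linorder)
  have "a \<le> b" using a b cdf_nondecreasing[of b a] by linarith
  moreover have "continuous_on {a..b} ?F"
    by (intro continuous_at_imp_continuous_on ballI DERIV_isCont[OF cdf_density_deriv[OF assms(1)]])
  ultimately show ?thesis
    using IVT'[of ?F a p b] a b by (meson less_imp_le)
qed

lemma cdf_density_range:
  assumes "pos_density \<psi>"
  shows "0 < cdf (density lborel (\<lambda>x. ennreal (\<psi> x))) x" "cdf (density lborel (\<lambda>x. ennreal (\<psi> x))) x < 1"
proof -
  interpret real_distribution "density lborel (\<lambda>x. ennreal (\<psi> x))" by (rule real_distribution_density[OF assms(1)])
  show "0 < cdf (density lborel (\<lambda>x. ennreal (\<psi> x))) x"
    using strict_monoD[OF cdf_density_strict_mono[OF assms], of "x - 1" x] cdf_nonneg[of "x - 1"] by linarith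
  show "cdf (density lborel (\<lambda>x. ennreal (\<psi> x))) x < 1"
    using strict_monoD[OF cdf_density_strict_mono[OF assms], of x "x + 1"] cdf_bounded_prob[of "x + 1"] by linarith
qed

text \<open>T is the distribution function of the source followed by the inverse distribution
  function of the target. Its derivative is the one-dimensional Monge-Ampere equation, and the image
  measure is identified through its distribution function.\<close>

lemma monotone_transport:
  assumes \<psi>: "pos_density \<psi>" and \<phi>: "pos_density \<phi>"
  obtains T where
    "\<And>x. cdf (density lborel (\<lambda>x. ennreal (\<phi> x))) (T x) = cdf (density lborel (\<lambda>x. ennreal (\<psi> x))) x"
    "\<And>x. (T has_real_derivative \<psi> x / \<phi> (T x)) (at x)"
    "distr (density lborel (\<lambda>x. ennreal (\<psi> x))) borel T = density lborel (\<lambda>x. ennreal (\<phi> x))"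
    "strict_mono T"
proof -
  define M where "M = density lborel (\<lambda>x. ennreal (\<psi> x))"
  define N where "N = density lborel (\<lambda>x. ennreal (\<phi> x))"
  note M = real_distribution_density[OF \<psi>, folded M_def] and N = real_distribution_density[OF \<phi>, folded N_def]
  note smM = cdf_density_strict_mono[OF \<psi>, folded M_def] and smN = cdf_density_strict_mono[OF \<phi>, folded N_def]
  note dM = cdf_density_deriv[OF \<psi>, folded M_def] and dN = cdf_density_deriv[OF \<phi>, folded N_def]
  note rM = cdf_density_range[OF \<psi>, folded M_def] and rN = cdf_density_range[OF \<phi>, folded N_def]
  define J where "J p = (SOME y. cdf N y = p)" for p
  have J: "cdf N (J p) = p" if "0 < p" "p < 1" for p
    unfolding J_def N_def by (rule someI_ex) (rule cdf_density_surj[OF \<phi> that])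
  have JN: "J (cdf N y) = y" for y
    using strict_mono_eq[OF smN] J[OF rN] by blast
  define T where "T x = J (cdf M x)" for x
  have T: "cdf N (T x) = cdf M x" for x unfolding T_def by (rule J[OF rM])
  have der: "(T has_real_derivative \<psi> x / \<phi> (T x)) (at x)" for x
  proof -
    have "isCont J (cdf N (T x))"
      by (rule isCont_inverse_function[of 1]) (auto simp: JN intro: DERIV_isCont[OF dN])
    then have "(J has_real_derivative inverse (\<phi> (T x))) (at (cdf M x))"
      unfolding T using rM[of x] pos_densityD(2)[OF \<phi>, of "T x"] J
      by (intro DERIV_inverse_function[where f = "cdf N" and a = 0 and b = 1])
        (auto simp: T_def[symmetric] intro: dN)
    then have "((\<lambda>x. J (cdf M x)) has_real_derivative inverse (\<phi> (T x)) * \<psi> x) (at x)"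
      by (rule DERIV_chain2[OF _ dM])
    then show ?thesis unfolding T_def[symmetric] by (simp add: divide_inverse mult.commute)
  qed
  have smT: "strict_mono T"
  proof (rule strict_monoI)
    fix x y :: real assume "x < y"
    then have "cdf N (T x) < cdf N (T y)" unfolding T using smM by (simp add: strict_monoD)
    then show "T x < T y" using strict_mono_less[OF smN] by blast
  qed
  have [measurable]: "T \<in> borel_measurable borel"
    by (rule borel_measurable_mono) (use smT in \<open>simp add: strict_mono_mono\<close>)
  interpret M: real_distribution M by fact
  have "distr M borel T = N"
  proof (rule cdf_unique[OF _ N])
    show "real_distribution (distr M borel T)"
      by (rule M.real_distribution_distr) (simp add: M_def)
    show "cdf (distr M borel T) = cdf N"
    proof
      fix y
      obtain s where s: "cdf M s = cdf N y" using cdf_density_surj[OF \<psi> rN] by (auto simp: M_def)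
      have "T s = y" using T[of s] s strict_mono_eq[OF smN] by simp
      then have "T -` {..y} = {..s}" using strict_mono_less_eq[OF smT] by auto
      then show "cdf (distr M borel T) y = cdf N y"
        using s unfolding cdf_def by (subst measure_distr) (auto simp: M_def)
    qed
  qed
  then show ?thesis using that[of T] T der smT unfolding M_def N_def by auto
qed

lemma abs_mult_le_sum_squares: "\<bar>x * y\<bar> \<le> x\<^sup>2 + (y::real)\<^sup>2"
proof -
  have "0 \<le> (\<bar>x\<bar> - \<bar>y\<bar>)\<^sup>2" "0 \<le> \<bar>x\<bar> * \<bar>y\<bar>" by simp_all
  then have "\<bar>x\<bar> * \<bar>y\<bar> \<le> x\<^sup>2 + y\<^sup>2" unfolding power2_diff power2_abs by linarith
  then show ?thesis by (simp add: abs_mult)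
qed


lemma abs_bump_le: "\<bar>bump R x\<bar> \<le> 1"
  using bump_bounds[of R x] by linarith

lemma abs_bump_grad_le: "R \<ge> 1 \<Longrightarrow> \<bar>bump_grad R x\<bar> \<le> (4::real)"
proof -
  assume R: "R \<ge> 1"
  then have "\<bar>bump_grad R x\<bar> \<le> 4 / R" using norm_bump_grad[of R x] by simp
  also have "\<dots> \<le> 4" using R by (simp add: divide_le_eq)
  finally show ?thesis .
qed

text \<open>Here a is minus the logarithmic derivative of the density. The formula is the
  fundamental theorem of calculus after multiplication by a cut-off, whose zeros at the end points
  kill the boundary terms. Monotonicity of w allows integrability of w' to be a conclusion.\<close>

lemma integral_by_parts_density:
  fixes a w w' \<psi> :: "real \<Rightarrow> real"
  assumes \<psi>: "pos_density \<psi>" and d\<psi>: "\<And>x. (\<psi> has_real_derivative - a x * \<psi> x) (at x)"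
    and ca: "continuous_on UNIV a"
    and w: "\<And>x. (w has_real_derivative w' x) (at x)" and cw': "continuous_on UNIV w'" and nn: "\<And>x. w' x \<ge> 0"
    and \<nu>: "\<nu> = density lborel (\<lambda>x. ennreal (\<psi> x))"
    and inta: "integrable \<nu> (\<lambda>x. (a x)\<^sup>2)" and intw: "integrable \<nu> (\<lambda>x. (w x)\<^sup>2)"
  shows "integrable \<nu> w'" "(\<integral>x. w' x \<partial>\<nu>) = (\<integral>x. a x * w x \<partial>\<nu>)"
proof -
  interpret real_distribution \<nu> unfolding \<nu> by (rule real_distribution_density[OF \<psi>])
  have cw: "continuous_on UNIV w" using w by (meson DERIV_isCont continuous_at_imp_continuous_on)
  note c\<psi> = pos_densityD(1)[OF \<psi>] and p\<psi> = pos_densityD(3)[OF \<psi>]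
  have [measurable]: "a \<in> borel_measurable borel" "w \<in> borel_measurable borel" "w' \<in> borel_measurable borel" "\<psi> \<in> borel_measurable borel"
    using ca cw cw' c\<psi> by (auto intro: borel_measurable_continuous_onI)
  have contb: "continuous_on UNIV (bump R :: real \<Rightarrow> real)" for R
    using has_derivative_continuous_on[of UNIV "bump R" "\<lambda>x v. bump_grad R x \<bullet> v"] bump_has_derivative by blast
  have [measurable]: "bump R \<in> borel_measurable (borel :: real measure)" "bump_grad R \<in> borel_measurable (borel :: real measure)" for R
    using contb continuous_bump_grad by (auto intro: borel_measurable_continuous_onI)
  have dens: "(\<integral>x. h x \<partial>\<nu>) = (\<integral>x. \<psi> x * h x \<partial>lborel)" "integrable \<nu> h \<longleftrightarrow> integrable lborel (\<lambda>x. \<psi> x * h x)"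
    if [measurable]: "h \<in> borel_measurable borel" for h :: "real \<Rightarrow> real"
    unfolding \<nu> using p\<psi> by (auto simp: integral_density integrable_density)
  have intaw: "integrable \<nu> (\<lambda>x. a x * w x)"
    by (rule Bochner_Integration.integrable_bound[OF Bochner_Integration.integrable_add[OF inta intw]])
      (auto intro!: AE_I2 abs_mult_le_sum_squares)
  have intw1: "integrable \<nu> w" by (rule square_integrable_imp_integrable) (use intw in auto)
  define r where "r n = real (Suc n)" for n
  have r: "r n \<ge> 1" for n by (simp add: r_def)
  have parts: "integrable \<nu> (\<lambda>x. bump (r n) x * w' x)"
      "(\<integral>x. bump (r n) x * w' x \<partial>\<nu>) = (\<integral>x. bump (r n) x * (a x * w x) - bump_grad (r n) x * w x \<partial>\<nu>)" for n
  proof -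
    let ?R = "r n"
    have z: "bump ?R x = 0" "bump_grad ?R x = 0" if "x \<notin> {-?R..?R}" for x
      using bump_outside[of ?R x] that r[of n] by auto
    have z': "bump ?R ?R = 0" "bump ?R (- ?R) = 0" using r[of n] by (auto simp: bump_def)
    have db: "(bump ?R has_real_derivative bump_grad ?R x) (at x)" for x :: real
      using bump_has_derivative[of ?R x] by (simp add: has_field_derivative_def inner_real_def mult_commute_abs)
    have F: "has_bochner_integral lborel (\<lambda>x. (bump_grad ?R x * (\<psi> x * w x) + bump ?R x * (- a x * \<psi> x * w x + \<psi> x * w' x)) * indicator {-?R..?R} x)
         (bump ?R ?R * (\<psi> ?R * w ?R) - bump ?R (-?R) * (\<psi> (-?R) * w (-?R)))"
    proof (rule has_bochner_integral_FTC_Icc_real)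
      show "((\<lambda>x. bump ?R x * (\<psi> x * w x)) has_real_derivative
          bump_grad ?R x * (\<psi> x * w x) + bump ?R x * (- a x * \<psi> x * w x + \<psi> x * w' x)) (at x)" for x
        by (auto intro!: derivative_eq_intros db d\<psi> w simp: algebra_simps)
      have "continuous_on UNIV (\<lambda>x. bump_grad ?R x * (\<psi> x * w x) + bump ?R x * (- a x * \<psi> x * w x + \<psi> x * w' x))"
        by (intro continuous_intros contb c\<psi> cw cw' ca)
      then show "isCont (\<lambda>x. bump_grad ?R x * (\<psi> x * w x) + bump ?R x * (- a x * \<psi> x * w x + \<psi> x * w' x)) x" for x
        by (simp add: continuous_on_eq_continuous_at)
    qed (use r[of n] in simp)
    have "(\<lambda>x. (bump_grad ?R x * (\<psi> x * w x) + bump ?R x * (- a x * \<psi> x * w x + \<psi> x * w' x)) * indicator {-?R..?R} x)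
        = (\<lambda>x. \<psi> x * (bump ?R x * w' x - (bump ?R x * (a x * w x) - bump_grad ?R x * w x)))"
      using z by (auto simp: fun_eq_iff indicator_def algebra_simps)
    then have "has_bochner_integral lborel (\<lambda>x. \<psi> x * (bump ?R x * w' x - (bump ?R x * (a x * w x) - bump_grad ?R x * w x))) 0"
      using F z' by simp
    then have i1: "integrable \<nu> (\<lambda>x. bump ?R x * w' x - (bump ?R x * (a x * w x) - bump_grad ?R x * w x))"
      and i0: "(\<integral>x. bump ?R x * w' x - (bump ?R x * (a x * w x) - bump_grad ?R x * w x) \<partial>\<nu>) = 0"
      by (auto simp: dens has_bochner_integral_iff)
    have i2: "integrable \<nu> (\<lambda>x. bump ?R x * (a x * w x))"
      by (rule Bochner_Integration.integrable_bound[OF intaw])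
        (auto intro!: AE_I2 mult_left_le_one_le simp: abs_mult abs_bump_le)
    have i3: "integrable \<nu> (\<lambda>x. bump_grad ?R x * w x)"
    proof (rule Bochner_Integration.integrable_bound[OF integrable_mult_right[OF intw1, of 4]])
      have "\<bar>bump_grad ?R x\<bar> \<le> 4" for x :: real
        by (rule abs_bump_grad_le[OF r])
      then show "AE x in \<nu>. norm (bump_grad ?R x * w x) \<le> norm (4 * w x)"
        by (auto intro!: AE_I2 mult_right_mono simp: abs_mult)
    qed measurable
    show "integrable \<nu> (\<lambda>x. bump ?R x * w' x)"
      using Bochner_Integration.integrable_add[OF i1 Bochner_Integration.integrable_diff[OF i2 i3]] by simp
    then show "(\<integral>x. bump ?R x * w' x \<partial>\<nu>) = (\<integral>x. bump ?R x * (a x * w x) - bump_grad ?R x * w x \<partial>\<nu>)"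
      using i0 i2 i3 by simp
  qed
  have lim1: "(\<lambda>n. \<integral>x. bump (r n) x * (a x * w x) - bump_grad (r n) x * w x \<partial>\<nu>) \<longlonglongrightarrow> (\<integral>x. a x * w x \<partial>\<nu>)"
  proof (rule integral_dominated_convergence[where w = "\<lambda>x. \<bar>a x * w x\<bar> + 4 * \<bar>w x\<bar>"])
    show "integrable \<nu> (\<lambda>x. \<bar>a x * w x\<bar> + 4 * \<bar>w x\<bar>)" using intaw intw1 by auto
    show "AE x in \<nu>. (\<lambda>n. bump (r n) x * (a x * w x) - bump_grad (r n) x * w x) \<longlonglongrightarrow> a x * w x"
      using tendsto_diff[OF tendsto_mult[OF bump_tendsto tendsto_const] tendsto_mult[OF bump_grad_tendsto tendsto_const]]
      unfolding r_def by (intro AE_I2) fastforce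
    show "AE x in \<nu>. norm (bump (r n) x * (a x * w x) - bump_grad (r n) x * w x) \<le> \<bar>a x * w x\<bar> + 4 * \<bar>w x\<bar>" for n
    proof (rule AE_I2)
      fix x :: real
      have "\<bar>bump_grad (r n) x\<bar> \<le> 4"
        by (rule abs_bump_grad_le[OF r])
      then have "\<bar>bump_grad (r n) x * w x\<bar> \<le> 4 * \<bar>w x\<bar>" by (simp add: abs_mult mult_right_mono)
      moreover have "\<bar>bump (r n) x * (a x * w x)\<bar> \<le> \<bar>a x * w x\<bar>"
        using bump_bounds[of "r n" x] by (simp add: abs_mult[of "bump _ _"] mult_left_le_one_le)
      ultimately show "norm (bump (r n) x * (a x * w x) - bump_grad (r n) x * w x) \<le> \<bar>a x * w x\<bar> + 4 * \<bar>w x\<bar>"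
        by (simp add: abs_le_iff)
    qed
  qed measurable
  \<comment> \<open>Fatou's lemma gives integrability of w'; dominated convergence is available only
    afterwards.\<close>
  have "(\<integral>\<^sup>+x. ennreal (w' x) \<partial>\<nu>) = (\<integral>\<^sup>+x. liminf (\<lambda>n. ennreal (bump (r n) x * w' x)) \<partial>\<nu>)"
  proof (rule nn_integral_cong)
    fix x
    have "(\<lambda>n. bump (r n) x * w' x) \<longlonglongrightarrow> 1 * w' x"
      unfolding r_def by (intro tendsto_intros bump_tendsto)
    then have "(\<lambda>n. ennreal (bump (r n) x * w' x)) \<longlonglongrightarrow> ennreal (w' x)" by (simp add: tendsto_ennrealI)
    then show "ennreal (w' x) = liminf (\<lambda>n. ennreal (bump (r n) x * w' x))"
      by (simp add: lim_imp_Liminf)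
  qed
  also have "\<dots> \<le> liminf (\<lambda>n. \<integral>\<^sup>+x. ennreal (bump (r n) x * w' x) \<partial>\<nu>)"
    by (rule nn_integral_liminf) measurable
  also have "\<dots> = liminf (\<lambda>n. ennreal (\<integral>x. bump (r n) x * w' x \<partial>\<nu>))"
    using parts(1) by (subst nn_integral_eq_integral) (auto intro!: AE_I2 mult_nonneg_nonneg bump_bounds nn)
  also have "\<dots> = ennreal (\<integral>x. a x * w x \<partial>\<nu>)"
    unfolding parts(2) by (intro lim_imp_Liminf tendsto_ennrealI lim1) simp
  finally have "(\<integral>\<^sup>+x. ennreal (w' x) \<partial>\<nu>) < \<infinity>" by (simp add: le_less_trans)
  then show intw': "integrable \<nu> w'"
    using nn by (intro integrableI_nonneg) auto
  have "(\<lambda>n. \<integral>x. bump (r n) x * w' x \<partial>\<nu>) \<longlonglongrightarrow> (\<integral>x. w' x \<partial>\<nu>)"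
  proof (rule integral_dominated_convergence[OF _ _ intw'])
    show "AE x in \<nu>. (\<lambda>n. bump (r n) x * w' x) \<longlonglongrightarrow> w' x"
      using tendsto_mult[OF bump_tendsto tendsto_const] unfolding r_def by (intro AE_I2) fastforce
    show "AE x in \<nu>. norm (bump (r n) x * w' x) \<le> w' x" for n
      using nn by (auto intro!: AE_I2 mult_left_le_one_le simp: abs_mult abs_bump_le)
  qed measurable
  then show "(\<integral>x. w' x \<partial>\<nu>) = (\<integral>x. a x * w x \<partial>\<nu>)"
    using lim1 unfolding parts(2) by (rule LIMSEQ_unique)
qed

text \<open>The Mills ratio of the Gaussian tail, as an extended nonnegative number.\<close>

definition mills :: "real \<Rightarrow> ennreal" where
  "mills \<alpha> = (\<integral>\<^sup>+t. ennreal (exp (- \<alpha> * t - t\<^sup>2 / 2)) * indicator {0<..} t \<partial>lborel)"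

lemma mills_antimono: "\<alpha> \<le> \<beta> \<Longrightarrow> mills \<beta> \<le> mills \<alpha>"
  unfolding mills_def by (intro nn_integral_mono) (auto simp: indicator_def intro!: ennreal_leI mult_right_mono)

text \<open>The sign \<open>\<sigma>\<close> selects the right or the left half-line, so both tails
  are treated at once.\<close>

lemma emeasure_halfline:
  assumes "\<bar>\<sigma>\<bar> = (1::real)" and [measurable]: "\<psi> \<in> borel_measurable borel"
  shows "emeasure (density lborel (\<lambda>x. ennreal (\<psi> x))) {z. \<sigma> * (z - x) > 0}
      = (\<integral>\<^sup>+t. ennreal (\<psi> (x + \<sigma> * t)) * indicator {0<..} t \<partial>lborel)"
proof -
  have [measurable]: "{z. \<sigma> * (z - x) > 0} \<in> sets borel" by measurable
  have \<sigma>: "\<sigma> \<noteq> 0" "\<sigma> * \<sigma> = 1" using assms(1) by (auto simp: abs_if split: if_splits)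
  have "emeasure (density lborel (\<lambda>x. ennreal (\<psi> x))) {z. \<sigma> * (z - x) > 0}
      = (\<integral>\<^sup>+z. ennreal (\<psi> z) * indicator {z. \<sigma> * (z - x) > 0} z \<partial>lborel)"
    by (rule emeasure_density) auto
  also have "\<dots> = ennreal \<bar>\<sigma>\<bar> * (\<integral>\<^sup>+t. ennreal (\<psi> (x + \<sigma> * t)) * indicator {z. \<sigma> * (z - x) > 0} (x + \<sigma> * t) \<partial>lborel)"
    by (rule nn_integral_real_affine) (use \<sigma> in auto)
  also have "\<dots> = (\<integral>\<^sup>+t. ennreal (\<psi> (x + \<sigma> * t)) * indicator {0<..} t \<partial>lborel)"
    unfolding assms(1) using \<sigma> by (auto simp: indicator_def mult.assoc[symmetric] intro!: nn_integral_cong)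
  finally show ?thesis .
qed

text \<open>Gaussian tail = density at the end point times Mills ratio, by expanding the square in
  the exponent.\<close>

lemma emeasure_halfline_normal:
  assumes "\<bar>\<sigma>\<bar> = (1::real)"
  shows "emeasure gauss1 {z. \<sigma> * (z - y) > 0} = ennreal (std_normal_density y) * mills (\<sigma> * y)"
proof -
  have \<sigma>: "\<sigma>\<^sup>2 = 1" using assms by (metis power2_abs power_one)
  have "std_normal_density (y + \<sigma> * t) = std_normal_density y * exp (- (\<sigma> * y) * t - t\<^sup>2 / 2)" for t
  proof -
    have "(y + \<sigma> * t)\<^sup>2 = y\<^sup>2 + 2 * (\<sigma> * y) * t + t\<^sup>2" using \<sigma> by (simp add: power2_sum power_mult_distrib mult_ac)
    then show ?thesis by (simp add: std_normal_density_def exp_add[symmetric] field_simps)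
  qed
  then have "emeasure gauss1 {z. \<sigma> * (z - y) > 0}
      = (\<integral>\<^sup>+t. ennreal (std_normal_density y) * (ennreal (exp (- (\<sigma> * y) * t - t\<^sup>2 / 2)) * indicator {0<..} t) \<partial>lborel)"
    by (subst emeasure_halfline[OF assms]) (auto simp: ennreal_mult normal_density_nonneg mult.assoc)
  also have "\<dots> = ennreal (std_normal_density y) * mills (\<sigma> * y)"
    unfolding mills_def by (rule nn_integral_cmult) measurable
  finally show ?thesis .
qed

text \<open>Dominating the density by the Gaussian profile of curvature \<epsilon> tangent at x and
  rescaling by sqrt \<epsilon> bounds its tail by a Mills ratio, the slope a playing the role of the
  end point.\<close>

lemma emeasure_halfline_log_concave:
  assumes "\<bar>\<sigma>\<bar> = (1::real)" and [measurable]: "\<psi> \<in> borel_measurable borel" and "\<epsilon> > 0" "\<psi> x \<ge> 0"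
    and bnd: "\<And>y. \<psi> y \<le> \<psi> x * exp (- a * (y - x) - \<epsilon> / 2 * (y - x)\<^sup>2)"
  shows "emeasure (density lborel (\<lambda>x. ennreal (\<psi> x))) {z. \<sigma> * (z - x) > 0}
      \<le> ennreal (\<psi> x / sqrt \<epsilon>) * mills (\<sigma> * (a / sqrt \<epsilon>))"
proof -
  have \<sigma>: "\<sigma>\<^sup>2 = 1" using assms(1) by (metis power2_abs power_one)
  have s: "sqrt \<epsilon> > 0" "(sqrt \<epsilon>)\<^sup>2 = \<epsilon>" using \<open>\<epsilon> > 0\<close> by auto
  have "emeasure (density lborel (\<lambda>x. ennreal (\<psi> x))) {z. \<sigma> * (z - x) > 0}
      = (\<integral>\<^sup>+t. ennreal (\<psi> (x + \<sigma> * t)) * indicator {0<..} t \<partial>lborel)"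
    by (rule emeasure_halfline) (use assms in auto)
  also have "\<dots> \<le> (\<integral>\<^sup>+t. ennreal (\<psi> x * exp (- a * \<sigma> * t - \<epsilon> / 2 * t\<^sup>2)) * indicator {0<..} t \<partial>lborel)"
    using bnd[of "x + \<sigma> * t" for t] \<sigma>
    by (intro nn_integral_mono mult_right_mono ennreal_leI) (auto simp: power_mult_distrib mult.assoc)
  also have "\<dots> = ennreal (1 / sqrt \<epsilon>) * (\<integral>\<^sup>+t. ennreal (\<psi> x * exp (- a * \<sigma> * (0 + 1 / sqrt \<epsilon> * t) - \<epsilon> / 2 * (0 + 1 / sqrt \<epsilon> * t)\<^sup>2)) * indicator {0<..} (0 + 1 / sqrt \<epsilon> * t) \<partial>lborel)"
    using s by (subst nn_integral_real_affine[where c = "1 / sqrt \<epsilon>" and t = 0]) auto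
  also have "(\<integral>\<^sup>+t. ennreal (\<psi> x * exp (- a * \<sigma> * (0 + 1 / sqrt \<epsilon> * t) - \<epsilon> / 2 * (0 + 1 / sqrt \<epsilon> * t)\<^sup>2)) * indicator {0<..} (0 + 1 / sqrt \<epsilon> * t) \<partial>lborel)
      = (\<integral>\<^sup>+t. ennreal (\<psi> x) * (ennreal (exp (- (\<sigma> * (a / sqrt \<epsilon>)) * t - t\<^sup>2 / 2)) * indicator {0<..} t) \<partial>lborel)"
  proof (rule nn_integral_cong)
    fix t
    have "- a * \<sigma> * (0 + 1 / sqrt \<epsilon> * t) - \<epsilon> / 2 * (0 + 1 / sqrt \<epsilon> * t)\<^sup>2 = - (\<sigma> * (a / sqrt \<epsilon>)) * t - t\<^sup>2 / 2"
      using s by (simp add: power_mult_distrib power_divide)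
    moreover have "indicator {0<..} (0 + 1 / sqrt \<epsilon> * t) = (indicator {0<..} t :: ennreal)"
      using s by (auto simp: indicator_def zero_less_divide_iff)
    ultimately show "ennreal (\<psi> x * exp (- a * \<sigma> * (0 + 1 / sqrt \<epsilon> * t) - \<epsilon> / 2 * (0 + 1 / sqrt \<epsilon> * t)\<^sup>2)) * indicator {0<..} (0 + 1 / sqrt \<epsilon> * t)
        = ennreal (\<psi> x) * (ennreal (exp (- (\<sigma> * (a / sqrt \<epsilon>)) * t - t\<^sup>2 / 2)) * indicator {0<..} t)"
      using \<open>\<psi> x \<ge> 0\<close> by (simp only: ennreal_mult exp_ge_zero mult.assoc)
  qed
  also have "\<dots> = ennreal (\<psi> x) * mills (\<sigma> * (a / sqrt \<epsilon>))"
    unfolding mills_def by (rule nn_integral_cmult) measurable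
  also have "ennreal (1 / sqrt \<epsilon>) * (ennreal (\<psi> x) * mills (\<sigma> * (a / sqrt \<epsilon>))) = ennreal (\<psi> x / sqrt \<epsilon>) * mills (\<sigma> * (a / sqrt \<epsilon>))"
    using s \<open>\<psi> x \<ge> 0\<close> by (simp add: mult.assoc[symmetric] ennreal_mult[symmetric])
  finally show ?thesis .
qed

text \<open>One-dimensional Caffarelli contraction: compare the tails of both measures on the side of the
  point where the Mills ratio helps.\<close>

lemma transport_deriv_lower_bound:
  assumes \<psi>: "pos_density \<psi>" and "\<epsilon> > 0"
    and bnd: "\<And>y. \<psi> y \<le> \<psi> x * exp (- a * (y - x) - \<epsilon> / 2 * (y - x)\<^sup>2)"
    and T: "distr (density lborel (\<lambda>x. ennreal (\<psi> x))) borel T = gauss1" "strict_mono T"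
  shows "sqrt \<epsilon> * std_normal_density (T x) \<le> \<psi> x"
proof -
  note [measurable] = pos_densityD(4)[OF \<psi>]
  have [measurable]: "T \<in> borel_measurable borel"
    by (rule borel_measurable_mono) (use T in \<open>simp add: strict_mono_mono\<close>)
  have main: "ennreal (std_normal_density (T x)) \<le> ennreal (\<psi> x / sqrt \<epsilon>)"
    if \<sigma>: "\<bar>\<sigma>\<bar> = 1" and le: "\<sigma> * T x \<le> \<sigma> * (a / sqrt \<epsilon>)" for \<sigma> :: real
  proof -
    have "\<sigma> = 1 \<or> \<sigma> = -1" using \<sigma> by linarith
    then have "T -` {z. \<sigma> * (z - T x) > 0} = {z. \<sigma> * (z - x) > 0}"
      using strict_mono_less[OF T(2)] by auto
    then have "emeasure gauss1 {z. \<sigma> * (z - T x) > 0} = emeasure (density lborel (\<lambda>x. ennreal (\<psi> x))) {z. \<sigma> * (z - x) > 0}"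
      unfolding T(1)[symmetric] by (subst emeasure_distr) auto
    also have "\<dots> \<le> ennreal (\<psi> x / sqrt \<epsilon>) * mills (\<sigma> * (a / sqrt \<epsilon>))"
      by (rule emeasure_halfline_log_concave[OF \<sigma> _ \<open>\<epsilon> > 0\<close> _ bnd]) (use pos_densityD(3)[OF \<psi>] in auto)
    also have "\<dots> \<le> ennreal (\<psi> x / sqrt \<epsilon>) * mills (\<sigma> * T x)"
      by (intro mult_left_mono mills_antimono le) simp
    finally have *: "ennreal (std_normal_density (T x)) * mills (\<sigma> * T x) \<le> ennreal (\<psi> x / sqrt \<epsilon>) * mills (\<sigma> * T x)"
      unfolding emeasure_halfline_normal[OF \<sigma>] .
    have g: "std_normal_density (T x) > 0" by (simp add: normal_density_pos)
    have "emeasure gauss1 {z. \<sigma> * (z - T x) > 0} < \<top>"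
      by (rule le_less_trans[OF gauss1.emeasure_le_1]) simp
    then have fin: "mills (\<sigma> * T x) < \<top>"
      unfolding emeasure_halfline_normal[OF \<sigma>] using g by (auto simp: ennreal_mult_less_top)
    have pos: "mills (\<sigma> * T x) \<noteq> 0"
    proof
      assume "mills (\<sigma> * T x) = 0"
      then have "AE t in lborel. ennreal (exp (- (\<sigma> * T x) * t - t\<^sup>2 / 2)) * indicator {0<..} t = 0"
        unfolding mills_def by (subst (asm) nn_integral_0_iff_AE) auto
      then have "AE t in lborel. (t::real) \<notin> {0<..<1}" by eventually_elim (auto simp: indicator_def)
      then have "{0<..<1::real} \<in> null_sets lborel" by (subst AE_iff_null_sets) auto
      then have "emeasure lborel {0<..<1::real} = 0" by (rule null_setsD1)
      then show False by simp
    qed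
    show ?thesis
    proof (rule ccontr)
      assume "\<not> ?thesis"
      then have "ennreal (\<psi> x / sqrt \<epsilon>) * mills (\<sigma> * T x) < ennreal (std_normal_density (T x)) * mills (\<sigma> * T x)"
        using fin pos by (auto simp: mult.commute[of _ "mills _"] not_le intro!: ennreal_mult_strict_left_mono simp: zero_less_iff_neq_zero)
      then show False using * by simp
    qed
  qed
  have "ennreal (std_normal_density (T x)) \<le> ennreal (\<psi> x / sqrt \<epsilon>)"
  \<comment> \<open>T carries tails to tails of equal mass, and the Mills ratio decreases: the right
    tails can be compared when T x <= a / sqrt \<epsilon>, the left tails otherwise.\<close>
  proof (cases "T x \<le> a / sqrt \<epsilon>")
    case True then show ?thesis using main[of 1] by simp
  next
    case False then show ?thesis using main[of "-1"] by simp
  qed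
  then have "std_normal_density (T x) \<le> \<psi> x / sqrt \<epsilon>"
    using pos_densityD(3)[OF \<psi>] \<open>\<epsilon> > 0\<close> by (subst (asm) ennreal_le_iff) auto
  then show ?thesis using \<open>\<epsilon> > 0\<close> by (simp add: pos_le_divide_eq mult.commute)
qed

text \<open>Used with \<sigma> = 1 / T', where the right side is T' - 1 - ln T'. The difference of
  the two sides has derivative (r - 1)(1 / r^2 - \<epsilon>), which has the sign of r - 1 up to 1 /
  sqrt \<epsilon>, so the difference is smallest at 1, where it vanishes.\<close>

lemma convex_defect_lower_bound:
  assumes "0 < \<epsilon>" "\<epsilon> \<le> 1" "0 < \<sigma>" "\<sigma> \<le> 1 / sqrt \<epsilon>"
  shows "\<epsilon> / 2 * (\<sigma> - 1)\<^sup>2 \<le> 1 / \<sigma> - 1 + ln \<sigma>"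
proof -
  define F where "F r = 1 / r - 1 + ln r - \<epsilon> / 2 * (r - 1)\<^sup>2" for r :: real
  have der: "(F has_real_derivative (r - 1) * (1 / r\<^sup>2 - \<epsilon>)) (at r)" if "r > 0" for r
  proof -
    have "(F has_real_derivative - (1 / r\<^sup>2) + 1 / r - \<epsilon> * (r - 1)) (at r)"
      unfolding F_def using that by (auto intro!: derivative_eq_intros simp: power2_eq_square)
    moreover have "(r - 1) * (1 / r\<^sup>2 - \<epsilon>) = - (1 / r\<^sup>2) + 1 / r - \<epsilon> * (r - 1)"
    proof -
      define i where "i = 1 / r"
      have "r * i = 1" "1 / r\<^sup>2 = i * i" using that by (simp_all add: i_def power2_eq_square)
      then show ?thesis unfolding i_def[symmetric] by algebra
    qed
    ultimately show ?thesis by (simp only:)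
  qed
  have s: "1 / sqrt \<epsilon> \<ge> 1" using assms by (subst le_divide_eq) auto
  have fac: "1 / r\<^sup>2 - \<epsilon> \<ge> 0" if "0 < r" "r \<le> 1 / sqrt \<epsilon>" for r
  proof -
    have "r\<^sup>2 \<le> (1 / sqrt \<epsilon>)\<^sup>2" using that by (intro power_mono) auto
    then have "r\<^sup>2 * \<epsilon> \<le> 1" using assms by (simp add: power_divide pos_le_divide_eq)
    moreover have "r\<^sup>2 > 0" using that by simp
    ultimately have "\<epsilon> \<le> 1 / r\<^sup>2" by (simp add: pos_le_divide_eq mult.commute)
    then show ?thesis by simp
  qed
  have "F \<sigma> \<ge> F 1"
  proof (cases "\<sigma> \<ge> 1")
    case True
    show ?thesis
    proof (rule DERIV_nonneg_imp_nondecreasing[OF True])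
      fix r assume "1 \<le> r" "r \<le> \<sigma>"
      then show "\<exists>y. (F has_real_derivative y) (at r) \<and> 0 \<le> y"
        using der[of r] fac[of r] assms by (intro exI[of _ "(r - 1) * (1 / r\<^sup>2 - \<epsilon>)"]) auto
    qed
  next
    case False
    then have "\<sigma> \<le> 1" by simp
    then show ?thesis
    proof (rule DERIV_nonpos_imp_nonincreasing)
      fix r assume "\<sigma> \<le> r" "r \<le> 1"
      then show "\<exists>y. (F has_real_derivative y) (at r) \<and> y \<le> 0"
        using der[of r] fac[of r] assms s
        by (intro exI[of _ "(r - 1) * (1 / r\<^sup>2 - \<epsilon>)"] conjI mult_nonpos_nonneg) auto
    qed
  qed
  then show ?thesis by (simp add: F_def)
qed

lemma density_gauss1:
  assumes [measurable]: "q \<in> borel_measurable borel" and "\<And>x. 0 \<le> q x"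
  shows "density gauss1 (\<lambda>x. ennreal (q x)) = density lborel (\<lambda>x. ennreal (std_normal_density x * q x))"
  by (subst density_density_eq) (auto simp: ennreal_mult assms)

text \<open>The log-Sobolev deficit of a density \<open>q\<close> with respect to \<open>gauss1\<close> is computed by
  transporting \<open>q\<close> to \<open>gauss1\<close> and integrating by parts; \<open>s\<close> is the score \<open>q' / q\<close>.\<close>

lemma deficit_transport:
  fixes q s :: "real \<Rightarrow> real"
  assumes pos: "\<And>x. q x > 0" and q': "\<And>x. (q has_real_derivative s x * q x) (at x)" and cs: "continuous_on UNIV s"
    and mass: "(\<integral>\<^sup>+x. ennreal (q x) \<partial>gauss1) = 1"
    and \<nu>: "\<nu> = density gauss1 (\<lambda>x. ennreal (q x))"
    and intx: "integrable \<nu> (\<lambda>x. x\<^sup>2)" and ints: "integrable \<nu> (\<lambda>x. (s x)\<^sup>2)" and intl: "integrable \<nu> (\<lambda>x. ln (q x))"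
  obtains T T' where
    "strict_mono T" "\<And>x. (T has_real_derivative T' x) (at x)" "\<And>x. T' x > 0"
    "\<And>x. T' x = std_normal_density x * q x / std_normal_density (T x)"
    "distr \<nu> borel T = gauss1"
    "integrable \<nu> (\<lambda>x. (s x + T x - x)\<^sup>2)" "integrable \<nu> (\<lambda>x. T' x - 1 - ln (T' x))"
    "(\<integral>x. (s x)\<^sup>2 \<partial>\<nu>) / 2 - (\<integral>x. ln (q x) \<partial>\<nu>) = (\<integral>x. (s x + T x - x)\<^sup>2 \<partial>\<nu>) / 2 + (\<integral>x. T' x - 1 - ln (T' x) \<partial>\<nu>)"
proof -
  let ?g = std_normal_density
  define \<psi> where "\<psi> x = ?g x * q x" for x
  have cq: "continuous_on UNIV q" using q' by (meson DERIV_isCont continuous_at_imp_continuous_on)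
  have [measurable]: "q \<in> borel_measurable borel" "s \<in> borel_measurable borel"
    using cq cs by (auto intro: borel_measurable_continuous_onI)
  have cg: "continuous_on UNIV ?g" by (rule pos_densityD(1)[OF pos_density_std_normal])
  have gpos: "?g x > 0" for x by (simp add: normal_density_pos)
  have \<nu>\<psi>: "\<nu> = density lborel (\<lambda>x. ennreal (\<psi> x))"
    unfolding \<nu> \<psi>_def by (rule density_gauss1) (use pos in \<open>auto simp: less_imp_le\<close>)
  have \<psi>: "pos_density \<psi>"
    unfolding pos_density_def
  proof (intro conjI allI)
    show "continuous_on UNIV \<psi>" unfolding \<psi>_def by (intro continuous_intros cg cq)
    show "\<psi> x > 0" for x using pos gpos by (simp add: \<psi>_def)
    show "(\<integral>\<^sup>+x. ennreal (\<psi> x) \<partial>lborel) = 1"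
      using mass gpos pos by (simp add: nn_integral_density \<psi>_def ennreal_mult less_imp_le)
  qed
  interpret real_distribution \<nu> unfolding \<nu>\<psi> by (rule real_distribution_density[OF \<psi>])
  have [simp]: "prob UNIV = 1" using prob_space by simp
  obtain T where T: "\<And>x. (T has_real_derivative \<psi> x / ?g (T x)) (at x)"
    "distr \<nu> borel T = gauss1" "strict_mono T"
    using monotone_transport[OF \<psi> pos_density_std_normal] unfolding \<nu>\<psi> by metis
  define T' where "T' x = \<psi> x / ?g (T x)" for x
  have T'pos: "T' x > 0" for x unfolding T'_def using pos_densityD(2)[OF \<psi>] gpos by simp
  have cT: "continuous_on UNIV T" using T(1) by (meson DERIV_isCont continuous_at_imp_continuous_on)
  have cT': "continuous_on UNIV T'"
    unfolding T'_def using gpos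
    by (intro continuous_intros pos_densityD(1)[OF \<psi>] continuous_on_compose2[OF cg cT]) (auto simp: less_imp_neq[symmetric])
  have [measurable]: "T \<in> borel_measurable borel" "T' \<in> borel_measurable borel"
    using cT cT' by (auto intro: borel_measurable_continuous_onI)
  \<comment> \<open>Minus the logarithmic derivative of the density of \<open>\<nu>\<close> with
    respect to Lebesgue measure.\<close>
  define a where "a x = x - s x" for x
  have ca: "continuous_on UNIV a" unfolding a_def by (intro continuous_intros cs)
  have d\<psi>: "(\<psi> has_real_derivative - a x * \<psi> x) (at x)" for x
  proof -
    have "(?g has_real_derivative - x * ?g x) (at x)"
      unfolding std_normal_density_def by (auto intro!: derivative_eq_intros simp: field_simps)
    from DERIV_mult[OF this q'[of x]] show ?thesis
      unfolding \<psi>_def a_def by (rule DERIV_cong) (simp add: algebra_simps)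
  qed
  have [measurable]: "a \<in> borel_measurable borel" unfolding a_def by measurable
  have intT: "integrable \<nu> (\<lambda>x. (T x)\<^sup>2)" and T2: "(\<integral>x. (T x)\<^sup>2 \<partial>\<nu>) = 1"
  proof -
    have m: "has_bochner_integral lborel (\<lambda>x. ?g x * x\<^sup>2) 1"
      using std_normal_moment_even[of 1] by simp
    have "integrable gauss1 (\<lambda>x. x\<^sup>2)" "(\<integral>x. x\<^sup>2 \<partial>gauss1) = 1"
      using m by (simp_all add: integrable_density integral_density has_bochner_integral_iff normal_density_nonneg)
    then show "integrable \<nu> (\<lambda>x. (T x)\<^sup>2)" "(\<integral>x. (T x)\<^sup>2 \<partial>\<nu>) = 1"
      unfolding T(2)[symmetric] by (auto simp: integrable_distr_eq integral_distr)
  qed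
  have mixed: "integrable \<nu> (\<lambda>x. u x * v x)" if "integrable \<nu> (\<lambda>x. (u x)\<^sup>2)" "integrable \<nu> (\<lambda>x. (v x)\<^sup>2)"
      "u \<in> borel_measurable borel" "v \<in> borel_measurable borel" for u v :: "real \<Rightarrow> real"
    by (rule Bochner_Integration.integrable_bound[OF Bochner_Integration.integrable_add[OF that(1,2)]])
      (use that(3,4) in \<open>auto intro!: AE_I2 abs_mult_le_sum_squares\<close>)
  have m1: "integrable \<nu> (\<lambda>x. s x * x)" and m2: "integrable \<nu> (\<lambda>x. x * T x)" and m3: "integrable \<nu> (\<lambda>x. s x * T x)"
    by (rule mixed; (intro ints intx intT | measurable))+
  have "(a x)\<^sup>2 = x\<^sup>2 + (s x)\<^sup>2 - 2 * (s x * x)" for x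
    by (simp add: a_def power2_eq_square algebra_simps)
  then have inta: "integrable \<nu> (\<lambda>x. (a x)\<^sup>2)" using m1 intx ints by simp
  \<comment> \<open>Integration by parts with w = T here, and with w = x below; together they remove
    the mixed terms of the expanded square of s + T - x.\<close>
  have ip1: "integrable \<nu> T'" "(\<integral>x. T' x \<partial>\<nu>) = (\<integral>x. a x * T x \<partial>\<nu>)"
    using integral_by_parts_density[OF \<psi> d\<psi> ca T(1)[folded T'_def] cT' less_imp_le[OF T'pos] \<nu>\<psi> inta intT] by auto
  have ip2: "1 = (\<integral>x. a x * x \<partial>\<nu>)"
    using integral_by_parts_density(2)[OF \<psi> d\<psi> ca DERIV_ident _ _ \<nu>\<psi> inta intx] prob_space by simp
  \<comment> \<open>The Monge-Ampere equation in logarithmic form; it turns the integral of ln T'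
    into an entropy plus second moments.\<close>
  have lnT: "ln (T' x) = ln (q x) - x\<^sup>2 / 2 + (T x)\<^sup>2 / 2" for x
    unfolding T'_def \<psi>_def using pos[of x] gpos
    by (simp add: ln_div ln_mult std_normal_density_def)
  have intlT: "integrable \<nu> (\<lambda>x. ln (T' x))" unfolding lnT using intl intx intT by auto
  have intphi: "integrable \<nu> (\<lambda>x. T' x - 1 - ln (T' x))" using ip1 intlT by auto
  have sq: "(s x + T x - x)\<^sup>2 = (s x)\<^sup>2 + (T x)\<^sup>2 + x\<^sup>2 + 2 * (s x * T x) - 2 * (s x * x) - 2 * (x * T x)" for x
    by (simp add: power2_eq_square algebra_simps)
  have intsq: "integrable \<nu> (\<lambda>x. (s x + T x - x)\<^sup>2)"
    unfolding sq using ints intT intx m1 m2 m3 by simp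
  have e1: "(\<integral>x. (s x + T x - x)\<^sup>2 \<partial>\<nu>) = (\<integral>x. (s x)\<^sup>2 \<partial>\<nu>) + 1 + (\<integral>x. x\<^sup>2 \<partial>\<nu>) + 2 * (\<integral>x. s x * T x \<partial>\<nu>) - 2 * (\<integral>x. s x * x \<partial>\<nu>) - 2 * (\<integral>x. x * T x \<partial>\<nu>)"
    unfolding sq using ints intT intx m1 m2 m3 T2 by simp
  have e2: "(\<integral>x. T' x - 1 - ln (T' x) \<partial>\<nu>) = (\<integral>x. T' x \<partial>\<nu>) - 1 - (\<integral>x. ln (q x) \<partial>\<nu>) + (\<integral>x. x\<^sup>2 \<partial>\<nu>) / 2 - 1 / 2"
    using ip1(1) intlT intl intx intT T2 by (simp add: prob_space lnT)
  have e3: "(\<integral>x. T' x \<partial>\<nu>) = (\<integral>x. x * T x \<partial>\<nu>) - (\<integral>x. s x * T x \<partial>\<nu>)"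
    unfolding ip1(2) a_def left_diff_distrib using m2 m3 by simp
  have e4: "1 = (\<integral>x. x\<^sup>2 \<partial>\<nu>) - (\<integral>x. s x * x \<partial>\<nu>)"
    using ip2 m1 intx unfolding a_def left_diff_distrib by (simp add: power2_eq_square)
  show ?thesis
  proof (rule that[of T T'])
    show "T' x = ?g x * q x / ?g (T x)" for x by (simp add: T'_def \<psi>_def)
    show "(\<integral>x. (s x)\<^sup>2 \<partial>\<nu>) / 2 - (\<integral>x. ln (q x) \<partial>\<nu>) = (\<integral>x. (s x + T x - x)\<^sup>2 \<partial>\<nu>) / 2 + (\<integral>x. T' x - 1 - ln (T' x) \<partial>\<nu>)"
      using e1 e2 e3 e4 by (simp add: field_simps)
  qed (use T T'pos intsq intphi in \<open>auto simp: T'_def\<close>)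
qed

text \<open>Both remainder terms in \<open>deficit_transport\<close> are nonnegative, the second one
  since ln z <= z - 1.\<close>

lemma log_sobolev_real:
  fixes q s :: "real \<Rightarrow> real"
  assumes pos: "\<And>x. q x > 0" and q': "\<And>x. (q has_real_derivative s x * q x) (at x)" and cs: "continuous_on UNIV s"
    and mass: "(\<integral>\<^sup>+x. ennreal (q x) \<partial>gauss1) = 1"
    and \<nu>: "\<nu> = density gauss1 (\<lambda>x. ennreal (q x))"
    and intx: "integrable \<nu> (\<lambda>x. x\<^sup>2)" and ints: "integrable \<nu> (\<lambda>x. (s x)\<^sup>2)" and intl: "integrable \<nu> (\<lambda>x. ln (q x))"
  shows "(\<integral>x. ln (q x) \<partial>\<nu>) \<le> (\<integral>x. (s x)\<^sup>2 \<partial>\<nu>) / 2"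
proof -
  obtain T T' where T: "\<And>x. T' x > (0::real)"
    "(\<integral>x. (s x)\<^sup>2 \<partial>\<nu>) / 2 - (\<integral>x. ln (q x) \<partial>\<nu>) = (\<integral>x. (s x + T x - x)\<^sup>2 \<partial>\<nu>) / 2 + (\<integral>x. T' x - 1 - ln (T' x) \<partial>\<nu>)"
    by (rule deficit_transport[OF pos q' cs mass \<nu> intx ints intl]) (rule that; assumption)
  have "0 \<le> (\<integral>x. T' x - 1 - ln (T' x) \<partial>\<nu>)"
    using ln_le_minus_one[OF T(1)] by (intro integral_nonneg_AE AE_I2) (simp add: algebra_simps)
  moreover have "0 \<le> (\<integral>x. (s x + T x - x)\<^sup>2 \<partial>\<nu>)" by simp
  ultimately show ?thesis using T(2) by linarith
qed

text \<open>The constant density 1 has the curvature required for parameter 1.\<close>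

lemma property_tau_gaussian:
  assumes "gaussian_PL \<mu>" "prob_space \<mu>" "sets \<mu> = sets borel"
  shows "property_tau 1 \<mu>"
proof -
  interpret prob_space \<mu> by fact
  have "property_tau 1 (density \<mu> (\<lambda>x. ennreal 1))"
  proof (rule property_tau_density[OF assms(1,3)])
    show "(\<integral>\<^sup>+x. ennreal 1 \<partial>\<mu>) = 1" using emeasure_space_1 by simp
  qed auto
  then show ?thesis by (simp add: density_1)
qed

text \<open>Split s - b, with b the mean of \<open>\<nu>\<close>, as (s + T - x) + (x - T - b). The
  first part is a term of the deficit. Seen through the inverse S of T, the second part is S y - y
  minus its Gaussian mean, so the Gaussian Poincare inequality bounds it by the L^2 norm of S' - 1,
  and \<open>convex_defect_lower_bound\<close> compares that with the integral of T' - 1 - ln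
  T'.\<close>

lemma deficit_stability_real:
  fixes q s :: "real \<Rightarrow> real"
  assumes pos: "\<And>x. q x > 0" and q': "\<And>x. (q has_real_derivative s x * q x) (at x)" and cs: "continuous_on UNIV s"
    and mass: "(\<integral>\<^sup>+x. ennreal (q x) \<partial>gauss1) = 1"
    and \<nu>: "\<nu> = density gauss1 (\<lambda>x. ennreal (q x))"
    and intx: "integrable \<nu> (\<lambda>x. x\<^sup>2)" and ints: "integrable \<nu> (\<lambda>x. (s x)\<^sup>2)" and intl: "integrable \<nu> (\<lambda>x. ln (q x))"
    and \<epsilon>: "0 < \<epsilon>" "\<epsilon> \<le> 1"
    and conc: "\<And>x y. q y \<le> q x * exp (s x * (y - x) + (1 - \<epsilon>) / 2 * (y - x)\<^sup>2)"
  shows "(\<integral>x. (s x - (\<integral>x. x \<partial>\<nu>))\<^sup>2 \<partial>\<nu>) \<le> 4 / \<epsilon> * ((\<integral>x. (s x)\<^sup>2 \<partial>\<nu>) / 2 - (\<integral>x. ln (q x) \<partial>\<nu>))"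
proof -
  let ?g = std_normal_density
  obtain T T' where T: "strict_mono T" "\<And>x. (T has_real_derivative T' x) (at x)" "\<And>x. T' x > 0"
    "\<And>x. T' x = ?g x * q x / ?g (T x)"
    "distr \<nu> borel T = gauss1"
    "integrable \<nu> (\<lambda>x. (s x + T x - x)\<^sup>2)" "integrable \<nu> (\<lambda>x. T' x - 1 - ln (T' x))"
    "(\<integral>x. (s x)\<^sup>2 \<partial>\<nu>) / 2 - (\<integral>x. ln (q x) \<partial>\<nu>) = (\<integral>x. (s x + T x - x)\<^sup>2 \<partial>\<nu>) / 2 + (\<integral>x. T' x - 1 - ln (T' x) \<partial>\<nu>)"
    by (rule deficit_transport[OF pos q' cs mass \<nu> intx ints intl]) (rule that; assumption)
  define \<psi> where "\<psi> x = ?g x * q x" for x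
  have cq: "continuous_on UNIV q" using q' by (meson DERIV_isCont continuous_at_imp_continuous_on)
  have [measurable]: "q \<in> borel_measurable borel" "s \<in> borel_measurable borel"
    using cq cs by (auto intro: borel_measurable_continuous_onI)
  have cg: "continuous_on UNIV ?g" by (rule pos_densityD(1)[OF pos_density_std_normal])
  have gpos: "?g x > 0" for x by (simp add: normal_density_pos)
  have \<nu>\<psi>: "\<nu> = density lborel (\<lambda>x. ennreal (\<psi> x))"
    unfolding \<nu> \<psi>_def by (rule density_gauss1) (use pos in \<open>auto simp: less_imp_le\<close>)
  have \<psi>: "pos_density \<psi>"
    unfolding pos_density_def
  proof (intro conjI allI)
    show "continuous_on UNIV \<psi>" unfolding \<psi>_def by (intro continuous_intros cg cq)
    show "\<psi> x > 0" for x using pos gpos by (simp add: \<psi>_def)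
    show "(\<integral>\<^sup>+x. ennreal (\<psi> x) \<partial>lborel) = 1"
      using mass gpos pos by (simp add: nn_integral_density \<psi>_def ennreal_mult less_imp_le)
  qed
  interpret real_distribution \<nu> unfolding \<nu>\<psi> by (rule real_distribution_density[OF \<psi>])
  have [simp, measurable_cong]: "sets \<nu> = sets borel" by (simp add: \<nu>)
  \<comment> \<open>The standard normal factor has curvature 1 and q loses at most 1 - \<epsilon> of
    it, which leaves \<epsilon>.\<close>
  have \<psi>bnd: "\<psi> y \<le> \<psi> x * exp (- (x - s x) * (y - x) - \<epsilon> / 2 * (y - x)\<^sup>2)" for x y
  proof -
    have "?g y = ?g x * exp (- x * (y - x) - (y - x)\<^sup>2 / 2)"
      by (simp add: std_normal_density_def exp_add[symmetric] power2_eq_square field_simps)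
    then have "\<psi> y \<le> ?g x * exp (- x * (y - x) - (y - x)\<^sup>2 / 2) * (q x * exp (s x * (y - x) + (1 - \<epsilon>) / 2 * (y - x)\<^sup>2))"
      unfolding \<psi>_def using conc[of y x] gpos[of x] by (auto intro!: mult_left_mono)
    also have "\<dots> = ?g x * q x * (exp (- x * (y - x) - (y - x)\<^sup>2 / 2) * exp (s x * (y - x) + (1 - \<epsilon>) / 2 * (y - x)\<^sup>2))"
      by (simp add: mult_ac)
    also have "exp (- x * (y - x) - (y - x)\<^sup>2 / 2) * exp (s x * (y - x) + (1 - \<epsilon>) / 2 * (y - x)\<^sup>2)
        = exp (- (x - s x) * (y - x) - \<epsilon> / 2 * (y - x)\<^sup>2)"
      unfolding exp_add[symmetric] by (rule arg_cong[of _ _ exp]) (simp add: field_simps)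
    finally show ?thesis unfolding \<psi>_def .
  qed
  \<comment> \<open>Caffarelli's bound in one dimension: T expands by at least sqrt \<epsilon>, so
    its inverse is Lipschitz with constant 1 / sqrt \<epsilon>.\<close>
  have T'ge: "sqrt \<epsilon> \<le> T' x" for x
    using transport_deriv_lower_bound[OF \<psi> \<epsilon>(1) \<psi>bnd T(5)[unfolded \<nu>\<psi>] T(1), of x] gpos[of "T x"]
    unfolding T(4) \<psi>_def by (simp add: pos_le_divide_eq)
  \<comment> \<open>The monotone map in the opposite direction; equality of distribution functions
    shows below that it inverts T.\<close>
  obtain S where S: "\<And>y. cdf \<nu> (S y) = cdf gauss1 y" "\<And>y. (S has_real_derivative ?g y / \<psi> (S y)) (at y)"
    "distr gauss1 borel S = \<nu>"
    by (rule monotone_transport[OF pos_density_std_normal \<psi>, folded \<nu>\<psi>]) (rule that; assumption)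
  have Tc: "cdf gauss1 (T x) = cdf \<nu> x" for x
  proof -
    have "T -` {..T x} = {..x}" using strict_mono_less_eq[OF T(1)] by auto
    moreover have "T \<in> borel_measurable borel"
      by (rule borel_measurable_mono) (use T(1) in \<open>simp add: strict_mono_mono\<close>)
    ultimately show ?thesis unfolding T(5)[symmetric] cdf_def by (subst measure_distr) auto
  qed
  have ST: "S (T x) = x" for x
    using S(1)[of "T x"] Tc[of x] strict_mono_eq[OF cdf_density_strict_mono[OF \<psi>]] unfolding \<nu>\<psi> by simp
  have TS: "T (S y) = y" for y
    using S(1)[of y] Tc[of "S y"] strict_mono_eq[OF cdf_density_strict_mono[OF pos_density_std_normal]] by simp
  have cS: "continuous_on UNIV S" using S(2) by (meson DERIV_isCont continuous_at_imp_continuous_on)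
  define S' where "S' y = ?g y / \<psi> (S y)" for y
  have S'T: "S' y = 1 / T' (S y)" for y
    unfolding S'_def T(4) TS \<psi>_def by simp
  have cS': "continuous_on UNIV S'"
    unfolding S'_def using pos_densityD(2)[OF \<psi>]
    by (intro continuous_intros cg continuous_on_compose2[OF pos_densityD(1)[OF \<psi>] cS]) (auto simp: less_imp_neq[symmetric])
  have S'b: "0 < S' y" "S' y \<le> 1 / sqrt \<epsilon>" for y
    unfolding S'T using T(3)[of "S y"] frac_le[OF _ order.refl _ T'ge[of "S y"], of 1] \<epsilon> by simp_all
  have [measurable]: "S \<in> borel_measurable borel" "S' \<in> borel_measurable borel"
    using cS cS' by (auto intro: borel_measurable_continuous_onI)
  have cT: "continuous_on UNIV T" using T(2) by (meson DERIV_isCont continuous_at_imp_continuous_on)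
  have [measurable]: "T \<in> borel_measurable borel" using cT by (auto intro: borel_measurable_continuous_onI)
  have "T' = (\<lambda>x. ?g x * q x / ?g (T x))" using T(4) by blast
  then have [measurable]: "T' \<in> borel_measurable borel" by simp
  define b where "b = (\<integral>x. x \<partial>\<nu>)"
  have g1: "integrable gauss1 (\<lambda>y. y)" "(\<integral>y. y \<partial>gauss1) = 0" "integrable gauss1 (\<lambda>y. y\<^sup>2)"
    using std_normal_moment_odd[of 0] std_normal_moment_even[of 1]
    by (simp_all add: integrable_density integral_density has_bochner_integral_iff normal_density_nonneg)
  have intx1: "integrable \<nu> (\<lambda>x. x)" by (rule square_integrable_imp_integrable[OF _ intx]) measurable
  have intS: "integrable gauss1 S" "(\<integral>y. S y \<partial>gauss1) = b" "integrable gauss1 (\<lambda>y. (S y)\<^sup>2)"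
  proof -
    have S1: "S \<in> measurable gauss1 borel" by measurable
    show "integrable gauss1 S"
      by (rule integrable_distr[OF S1]) (simp only: S(3) intx1)
    show "integrable gauss1 (\<lambda>y. (S y)\<^sup>2)"
      by (rule integrable_distr[OF S1]) (simp only: S(3) intx)
    show "(\<integral>y. S y \<partial>gauss1) = b"
      unfolding b_def S(3)[symmetric] by (rule integral_distr[OF S1, symmetric]) measurable
  qed
  have "(\<integral>y. (S y - y)\<^sup>2 \<partial>gauss1) - (\<integral>y. S y - y \<partial>gauss1)\<^sup>2 \<le> (\<integral>y. (norm (S' y - 1))\<^sup>2 \<partial>gauss1) / 1"
  proof (rule poincare_property_tau[OF property_tau_gaussian[OF gaussian_PL_gauss1]])
    show "((\<lambda>y. S y - y) has_derivative (\<lambda>v. (S' y - 1) \<bullet> v)) (at y)" for y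
    proof -
      have "((\<lambda>y. S y - y) has_real_derivative S' y - 1) (at y)"
        unfolding S'_def by (intro derivative_intros S(2))
      then show ?thesis by (simp add: has_field_derivative_def inner_real_def)
    qed
    show "continuous_on UNIV (\<lambda>y. S' y - 1)" by (intro continuous_intros cS')
    show "integrable gauss1 (\<lambda>y. (S y - y)\<^sup>2)"
    proof (rule Bochner_Integration.integrable_bound)
      show "integrable gauss1 (\<lambda>y. 2 * (S y)\<^sup>2 + 2 * y\<^sup>2)" using intS g1 by simp
      have "(S y - y)\<^sup>2 \<le> 2 * (S y)\<^sup>2 + 2 * y\<^sup>2" for y
        using zero_le_power2[of "S y + y"] by (simp add: power2_diff power2_sum)
      then show "AE y in gauss1. norm ((S y - y)\<^sup>2) \<le> norm (2 * (S y)\<^sup>2 + 2 * y\<^sup>2)" by simp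
    qed measurable
    show "integrable gauss1 (\<lambda>y. (norm (S' y - 1))\<^sup>2)"
    proof (rule gauss1.integrable_const_bound[of _ "(1 / sqrt \<epsilon> + 1)\<^sup>2"])
      have "\<bar>S' y - 1\<bar> \<le> 1 / sqrt \<epsilon> + 1" for y using S'b[of y] by (simp add: abs_le_iff)
      then show "AE y in gauss1. norm ((norm (S' y - 1))\<^sup>2) \<le> (1 / sqrt \<epsilon> + 1)\<^sup>2"
        by (intro AE_I2) (simp, metis abs_ge_zero power2_abs power_mono)
    qed measurable
  qed (auto intro: gauss1.prob_space_axioms)
  moreover have "(\<integral>y. S y - y \<partial>gauss1) = b" using intS g1 by simp
  moreover have "(\<integral>y. (S y - y - b)\<^sup>2 \<partial>gauss1) = (\<integral>y. (S y - y)\<^sup>2 \<partial>gauss1) - (\<integral>y. S y - y \<partial>gauss1)\<^sup>2"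
  proof -
    have i2: "integrable gauss1 (\<lambda>y. (S y - y)\<^sup>2)"
    proof (rule Bochner_Integration.integrable_bound)
      show "integrable gauss1 (\<lambda>y. 2 * (S y)\<^sup>2 + 2 * y\<^sup>2)" using intS g1 by simp
      have "(S y - y)\<^sup>2 \<le> 2 * (S y)\<^sup>2 + 2 * y\<^sup>2" for y
        using zero_le_power2[of "S y + y"] by (simp add: power2_diff power2_sum)
      then show "AE y in gauss1. norm ((S y - y)\<^sup>2) \<le> norm (2 * (S y)\<^sup>2 + 2 * y\<^sup>2)" by simp
    qed measurable
    have i1: "integrable gauss1 (\<lambda>y. S y - y)" using intS g1 by simp
    show ?thesis using gauss1.variance_eq[OF i1 i2] \<open>(\<integral>y. S y - y \<partial>gauss1) = b\<close> by simp
  qed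
  ultimately have var: "(\<integral>y. (S y - y - b)\<^sup>2 \<partial>gauss1) \<le> (\<integral>y. (S' y - 1)\<^sup>2 \<partial>gauss1)" by simp
  have cv1: "(\<integral>y. (S y - y - b)\<^sup>2 \<partial>gauss1) = (\<integral>x. (x - T x - b)\<^sup>2 \<partial>\<nu>)"
    unfolding T(5)[symmetric] by (subst integral_distr) (auto simp: ST)
  have cv2: "(\<integral>y. (S' y - 1)\<^sup>2 \<partial>gauss1) = (\<integral>x. (1 / T' x - 1)\<^sup>2 \<partial>\<nu>)"
    unfolding T(5)[symmetric] by (subst integral_distr) (auto simp: ST S'T)
  have T'bnd: "0 < 1 / T' x" "1 / T' x \<le> 1 / sqrt \<epsilon>" for x
    using S'b[of "T x"] by (simp_all add: S'T ST)
  have "\<epsilon> / 2 * (\<integral>x. (1 / T' x - 1)\<^sup>2 \<partial>\<nu>) \<le> (\<integral>x. T' x - 1 - ln (T' x) \<partial>\<nu>)"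
  proof -
    have le: "\<epsilon> / 2 * (1 / T' x - 1)\<^sup>2 \<le> T' x - 1 - ln (T' x)" for x
      using convex_defect_lower_bound[OF \<epsilon> T'bnd, of x] T(3)[of x] by (simp add: ln_div)
    have "(\<integral>x. \<epsilon> / 2 * (1 / T' x - 1)\<^sup>2 \<partial>\<nu>) \<le> (\<integral>x. T' x - 1 - ln (T' x) \<partial>\<nu>)"
    proof (rule integral_mono_AE'[OF T(7)])
      show "AE x in \<nu>. \<epsilon> / 2 * (1 / T' x - 1)\<^sup>2 \<le> T' x - 1 - ln (T' x)" using le by (intro AE_I2)
      show "AE x in \<nu>. 0 \<le> T' x - 1 - ln (T' x)" using ln_le_minus_one[OF T(3)] by (intro AE_I2) simp
    qed
    then show ?thesis by simp
  qed
  then have step: "\<epsilon> / 2 * (\<integral>x. (x - T x - b)\<^sup>2 \<partial>\<nu>) \<le> (\<integral>x. T' x - 1 - ln (T' x) \<partial>\<nu>)"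
    using var \<epsilon> unfolding cv1 cv2 by (smt (verit) mult_left_mono divide_pos_pos)
  have intT: "integrable \<nu> (\<lambda>x. (T x)\<^sup>2)"
    using g1(3) unfolding T(5)[symmetric] by (simp add: integrable_distr_eq)
  have i3: "integrable \<nu> (\<lambda>x. (x - T x - b)\<^sup>2)"
  proof (rule Bochner_Integration.integrable_bound)
    show "integrable \<nu> (\<lambda>x. 3 * x\<^sup>2 + 3 * (T x)\<^sup>2 + 3 * b\<^sup>2)" using intx intT by simp
    have "(x - T x - b)\<^sup>2 \<le> 3 * x\<^sup>2 + 3 * (T x)\<^sup>2 + 3 * b\<^sup>2" for x
      using zero_le_power2[of "x + T x"] zero_le_power2[of "x + b"] zero_le_power2[of "T x - b"]
      by (simp add: power2_eq_square algebra_simps)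
    then show "AE x in \<nu>. norm ((x - T x - b)\<^sup>2) \<le> norm (3 * x\<^sup>2 + 3 * (T x)\<^sup>2 + 3 * b\<^sup>2)" by simp
  qed measurable
  have "(\<integral>x. (s x - b)\<^sup>2 \<partial>\<nu>) \<le> (\<integral>x. 2 * (s x + T x - x)\<^sup>2 + 2 * (x - T x - b)\<^sup>2 \<partial>\<nu>)"
  proof (rule integral_mono_AE')
    show "integrable \<nu> (\<lambda>x. 2 * (s x + T x - x)\<^sup>2 + 2 * (x - T x - b)\<^sup>2)" using T(6) i3 by simp
    have "(s x - b)\<^sup>2 \<le> 2 * (s x + T x - x)\<^sup>2 + 2 * (x - T x - b)\<^sup>2" for x
      using zero_le_power2[of "(s x + T x - x) - (x - T x - b)"] by (simp add: power2_eq_square algebra_simps)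
    then show "AE x in \<nu>. (s x - b)\<^sup>2 \<le> 2 * (s x + T x - x)\<^sup>2 + 2 * (x - T x - b)\<^sup>2" by simp
  qed simp
  also have "\<dots> = 4 * ((\<integral>x. (s x + T x - x)\<^sup>2 \<partial>\<nu>) / 2) + 2 * (\<integral>x. (x - T x - b)\<^sup>2 \<partial>\<nu>)" using T(6) i3 by simp
  \<comment> \<open>The coefficient 4 may be raised to 4 / \<epsilon> because \<epsilon> <=
    1.\<close>
  also have "\<dots> \<le> 4 / \<epsilon> * ((\<integral>x. (s x + T x - x)\<^sup>2 \<partial>\<nu>) / 2) + 4 / \<epsilon> * (\<integral>x. T' x - 1 - ln (T' x) \<partial>\<nu>)"
  proof (rule add_mono)
    show "4 * ((\<integral>x. (s x + T x - x)\<^sup>2 \<partial>\<nu>) / 2) \<le> 4 / \<epsilon> * ((\<integral>x. (s x + T x - x)\<^sup>2 \<partial>\<nu>) / 2)"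
      using \<epsilon> by (intro mult_right_mono) (auto simp: le_divide_eq)
    show "2 * (\<integral>x. (x - T x - b)\<^sup>2 \<partial>\<nu>) \<le> 4 / \<epsilon> * (\<integral>x. T' x - 1 - ln (T' x) \<partial>\<nu>)"
      using mult_left_mono[OF step, of "4 / \<epsilon>"] \<epsilon> by simp
  qed
  also have "\<dots> = 4 / \<epsilon> * ((\<integral>x. (s x)\<^sup>2 \<partial>\<nu>) / 2 - (\<integral>x. ln (q x) \<partial>\<nu>))"
    unfolding T(8) by (simp add: distrib_left)
  finally show ?thesis unfolding b_def .
qed

section \<open>Growth conditions and averaging over one coordinate\<close>

text \<open>An exponent strictly below 1/2 makes functions integrable against the Gaussian and
  leaves room to absorb polynomial and logarithmic factors. The class is also stable under averaging
  over a coordinate, as the inductions need.\<close>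

definition subgaussian_growth :: "('a::real_normed_vector \<Rightarrow> 'b::real_normed_vector) \<Rightarrow> bool" where
  "subgaussian_growth u \<longleftrightarrow> (\<exists>C \<alpha>. 0 \<le> C \<and> 0 \<le> \<alpha> \<and> \<alpha> < 1/2 \<and> (\<forall>x. norm (u x) \<le> C * exp (\<alpha> * (norm x)\<^sup>2)))"

lemma subgaussian_growthI:
  assumes "0 \<le> \<alpha>" "\<alpha> < 1/2" "\<And>x. norm (u x) \<le> C * exp (\<alpha> * (norm x)\<^sup>2)"
  shows "subgaussian_growth u"
proof -
  have "0 \<le> C * exp (\<alpha> * (norm (0::'a))\<^sup>2)" using assms(3)[of 0] norm_ge_zero[of "u 0"] by linarith
  then have "0 \<le> C" by simp
  then show ?thesis using assms unfolding subgaussian_growth_def by blast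
qed

lemma subgaussian_growth_mono:
  fixes u :: "'a::real_normed_vector \<Rightarrow> 'b::real_normed_vector"
  assumes "subgaussian_growth u" "\<And>x. norm (v x) \<le> norm (u x)"
  shows "subgaussian_growth v"
  using assms unfolding subgaussian_growth_def by (meson order.trans)

lemma subgaussian_growth_const [simp]: "subgaussian_growth (\<lambda>x. c)"
  by (rule subgaussian_growthI[of 0 _ "norm c"]) auto

lemma subgaussian_growth_add:
  fixes u v :: "'a::real_normed_vector \<Rightarrow> 'b::real_normed_vector"
  assumes "subgaussian_growth u" "subgaussian_growth v"
  shows "subgaussian_growth (\<lambda>x. u x + v x)"
proof -
  obtain C \<alpha> C' \<alpha>' where u: "0 \<le> C" "0 \<le> \<alpha>" "\<alpha> < 1/2" "\<And>x. norm (u x) \<le> C * exp (\<alpha> * (norm x)\<^sup>2)"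
    and v: "0 \<le> C'" "0 \<le> \<alpha>'" "\<alpha>' < 1/2" "\<And>x. norm (v x) \<le> C' * exp (\<alpha>' * (norm x)\<^sup>2)"
    using assms unfolding subgaussian_growth_def by blast
  show ?thesis
  proof (rule subgaussian_growthI[of "max \<alpha> \<alpha>'" _ "C + C'"])
    fix x :: 'a
    have "C * exp (\<alpha> * (norm x)\<^sup>2) \<le> C * exp (max \<alpha> \<alpha>' * (norm x)\<^sup>2)"
      "C' * exp (\<alpha>' * (norm x)\<^sup>2) \<le> C' * exp (max \<alpha> \<alpha>' * (norm x)\<^sup>2)"
      using u(1) v(1) by (auto intro!: mult_left_mono mult_right_mono)
    then show "norm (u x + v x) \<le> (C + C') * exp (max \<alpha> \<alpha>' * (norm x)\<^sup>2)"
      using norm_triangle_ineq[of "u x" "v x"] u(4)[of x] v(4)[of x] unfolding distrib_right by linarith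
  qed (use u v in auto)
qed

lemma subgaussian_growth_cmult:
  fixes u :: "'a::real_normed_vector \<Rightarrow> 'b::real_normed_vector"
  assumes "subgaussian_growth u"
  shows "subgaussian_growth (\<lambda>x. c *\<^sub>R u x)"
proof -
  obtain C \<alpha> where u: "0 \<le> C" "0 \<le> \<alpha>" "\<alpha> < 1/2" "\<And>x. norm (u x) \<le> C * exp (\<alpha> * (norm x)\<^sup>2)"
    using assms unfolding subgaussian_growth_def by blast
  show ?thesis
    by (rule subgaussian_growthI[of \<alpha> _ "\<bar>c\<bar> * C"]) (use u in \<open>auto simp: mult.assoc intro!: mult_left_mono\<close>)
qed

text \<open>Half of the distance from \<alpha> to 1/2 is spent on the quadratic factor.\<close>

lemma subgaussian_growth_weight:
  fixes u :: "'a::real_normed_vector \<Rightarrow> 'b::real_normed_vector"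
  assumes "subgaussian_growth u"
  shows "subgaussian_growth (\<lambda>x. (1 + (norm x)\<^sup>2) *\<^sub>R u x)"
proof -
  obtain C \<alpha> where u: "0 \<le> C" "0 \<le> \<alpha>" "\<alpha> < 1/2" "\<And>x. norm (u x) \<le> C * exp (\<alpha> * (norm x)\<^sup>2)"
    using assms unfolding subgaussian_growth_def by blast
  define \<beta> where "\<beta> = (1/2 - \<alpha>) / 2"
  have \<beta>: "0 < \<beta>" "\<beta> \<le> 1" "\<alpha> + \<beta> < 1/2" using u unfolding \<beta>_def by (auto simp: field_simps)
  show ?thesis
  proof (rule subgaussian_growthI[of "\<alpha> + \<beta>" _ "C / \<beta>"])
    fix x :: 'a
    have "\<beta> * (1 + (norm x)\<^sup>2) \<le> 1 + \<beta> * (norm x)\<^sup>2" using \<beta> by (simp add: distrib_left)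
    also have "\<dots> \<le> exp (\<beta> * (norm x)\<^sup>2)" by (rule exp_ge_add_one_self)
    finally have "1 + (norm x)\<^sup>2 \<le> exp (\<beta> * (norm x)\<^sup>2) / \<beta>" using \<beta> by (simp add: pos_le_divide_eq mult.commute)
    then have "(1 + (norm x)\<^sup>2) * norm (u x) \<le> exp (\<beta> * (norm x)\<^sup>2) / \<beta> * (C * exp (\<alpha> * (norm x)\<^sup>2))"
      using u \<beta> by (intro mult_mono) auto
    also have "\<dots> = C / \<beta> * exp ((\<alpha> + \<beta>) * (norm x)\<^sup>2)" by (simp add: distrib_right exp_add)
    finally show "norm ((1 + (norm x)\<^sup>2) *\<^sub>R u x) \<le> C / \<beta> * exp ((\<alpha> + \<beta>) * (norm x)\<^sup>2)"
      by (simp add: add_nonneg_nonneg)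
  qed (use u \<beta> in auto)
qed

lemma abs_mult_ln_le:
  fixes y Z :: real
  assumes "0 < y" "y \<le> Z" "1 \<le> Z"
  shows "\<bar>y * ln y\<bar> \<le> 1 + Z * ln Z"
proof (cases "y \<le> 1")
  case True
  have "ln (1 / y) \<le> 1 / y - 1" using assms by (intro ln_le_minus_one) simp
  then have "y * ln (1 / y) \<le> y * (1 / y - 1)" using assms by (intro mult_left_mono) auto
  also have "\<dots> \<le> 1" using assms by (simp add: right_diff_distrib)
  finally have "- (y * ln y) \<le> 1" using assms by (simp add: ln_div)
  moreover have "y * ln y \<le> 0" using assms True by (simp add: mult_le_0_iff)
  moreover have "0 \<le> Z * ln Z" using assms by simp
  ultimately show ?thesis by linarith
next
  case False
  then have "0 \<le> y * ln y" "y * ln y \<le> Z * ln Z" using assms by (auto intro!: mult_mono)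
  then show ?thesis by linarith
qed

text \<open>On y <= 1 the function y ln y is bounded, so F ln F is dominated through a Gaussian
  majorant Z >= 1 of F, and ln Z is only quadratic.\<close>

lemma subgaussian_growth_mult_ln:
  fixes F :: "'a::real_normed_vector \<Rightarrow> real"
  assumes "subgaussian_growth F" and pos: "\<And>x. F x > 0"
  shows "subgaussian_growth (\<lambda>x. F x * ln (F x))"
proof -
  obtain C \<alpha> where u: "0 \<le> C" "0 \<le> \<alpha>" "\<alpha> < 1/2" "\<And>x. norm (F x) \<le> C * exp (\<alpha> * (norm x)\<^sup>2)"
    using assms unfolding subgaussian_growth_def by blast
  define Z where "Z x = max C 1 * exp (\<alpha> * (norm x)\<^sup>2)" for x :: 'a
  have Z: "subgaussian_growth Z" by (rule subgaussian_growthI[of \<alpha> _ "max C 1"]) (use u in \<open>auto simp: Z_def\<close>)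
  have Z1: "1 \<le> Z x" for x
  proof -
    have "1 * 1 \<le> max C 1 * exp (\<alpha> * (norm x)\<^sup>2)" using u by (intro mult_mono) auto
    then show ?thesis by (simp add: Z_def)
  qed
  have "subgaussian_growth (\<lambda>x. 1 + (ln (max C 1) + 1) *\<^sub>R ((1 + (norm x)\<^sup>2) *\<^sub>R Z x))"
    by (intro subgaussian_growth_add subgaussian_growth_const subgaussian_growth_cmult subgaussian_growth_weight Z)
  then show ?thesis
  proof (rule subgaussian_growth_mono)
    fix x
    have "F x \<le> Z x"
    proof -
      have "F x \<le> C * exp (\<alpha> * (norm x)\<^sup>2)" using u(4)[of x] by simp
      also have "\<dots> \<le> Z x" unfolding Z_def by (intro mult_right_mono) auto
      finally show ?thesis .
    qed
    then have "\<bar>F x * ln (F x)\<bar> \<le> 1 + Z x * ln (Z x)" using pos Z1 by (intro abs_mult_ln_le) auto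
    also have "ln (Z x) = ln (max C 1) + \<alpha> * (norm x)\<^sup>2" unfolding Z_def by (subst ln_mult_pos) auto
    also have "\<dots> \<le> (ln (max C 1) + 1) * (1 + (norm x)\<^sup>2)"
    proof -
      have "\<alpha> * (norm x)\<^sup>2 \<le> 1 * (norm x)\<^sup>2" using u by (intro mult_right_mono) auto
      moreover have "0 \<le> ln (max C 1) * (norm x)\<^sup>2" by (intro mult_nonneg_nonneg) auto
      moreover have "(ln (max C 1) + 1) * (1 + (norm x)\<^sup>2) = ln (max C 1) + 1 + ln (max C 1) * (norm x)\<^sup>2 + (norm x)\<^sup>2"
        by (simp add: algebra_simps)
      ultimately show ?thesis by linarith
    qed
    finally have "\<bar>F x * ln (F x)\<bar> \<le> 1 + Z x * ((ln (max C 1) + 1) * (1 + (norm x)\<^sup>2))"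
      using Z1[of x] by (simp add: mult_left_mono)
    then show "norm (F x * ln (F x)) \<le> norm (1 + (ln (max C 1) + 1) *\<^sub>R ((1 + (norm x)\<^sup>2) *\<^sub>R Z x))"
      by (simp add: mult_ac)
  qed
qed

lemma nn_integral_gauss1_exp_sq:
  assumes "\<alpha> < 1/2"
  shows "(\<integral>\<^sup>+t. ennreal (exp (\<alpha> * t\<^sup>2)) \<partial>gauss1) = ennreal (1 / sqrt (1 - 2 * \<alpha>))"
proof -
  define \<sigma> where "\<sigma> = 1 / sqrt (1 - 2 * \<alpha>)"
  have \<sigma>: "\<sigma> > 0" "1 / \<sigma>\<^sup>2 = 1 - 2 * \<alpha>" using assms by (auto simp: \<sigma>_def power_divide)
  have "std_normal_density t * exp (\<alpha> * t\<^sup>2) = \<sigma> * normal_density 0 \<sigma> t" for t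
  proof -
    have "- t\<^sup>2 / 2 + \<alpha> * t\<^sup>2 = - (t\<^sup>2 / 2) * (1 - 2 * \<alpha>)" by (simp add: right_diff_distrib)
    also have "\<dots> = - (t\<^sup>2 / (2 * \<sigma>\<^sup>2))" unfolding \<sigma>(2)[symmetric] by simp
    finally have "exp (- t\<^sup>2 / 2) * exp (\<alpha> * t\<^sup>2) = exp (- (t\<^sup>2 / (2 * \<sigma>\<^sup>2)))" by (simp add: exp_add[symmetric])
    moreover have "sqrt (2 * pi * \<sigma>\<^sup>2) = sqrt (2 * pi) * \<sigma>" using \<sigma> by (simp add: real_sqrt_mult)
    ultimately show ?thesis using \<sigma> unfolding std_normal_density_def normal_density_def by simp
  qed
  then have "(\<integral>\<^sup>+t. ennreal (exp (\<alpha> * t\<^sup>2)) \<partial>gauss1) = (\<integral>\<^sup>+t. ennreal \<sigma> * ennreal (normal_density 0 \<sigma> t) \<partial>lborel)"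
    using \<sigma> by (simp add: nn_integral_density ennreal_mult[symmetric])
  also have "\<dots> = ennreal \<sigma> * (\<integral>\<^sup>+t. ennreal (normal_density 0 \<sigma> t) \<partial>lborel)"
    by (rule nn_integral_cmult) measurable
  also have "(\<integral>\<^sup>+t. ennreal (normal_density 0 \<sigma> t) \<partial>lborel) = 1"
    using prob_space.emeasure_space_1[OF prob_space_normal_density[OF \<sigma>(1), of 0]] by (simp add: emeasure_density)
  finally show ?thesis by (simp add: \<sigma>_def)
qed

lemma integrable_gauss1_exp_sq: "\<alpha> < 1/2 \<Longrightarrow> integrable gauss1 (\<lambda>t. exp (\<alpha> * t\<^sup>2))"
  by (rule integrableI_nonneg) (auto simp: nn_integral_gauss1_exp_sq)

lemma integral_gauss1_exp_sq:
  assumes "\<alpha> < 1/2" shows "(\<integral>t. exp (\<alpha> * t\<^sup>2) \<partial>gauss1) = 1 / sqrt (1 - 2 * \<alpha>)"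
proof -
  have "ennreal (\<integral>t. exp (\<alpha> * t\<^sup>2) \<partial>gauss1) = ennreal (1 / sqrt (1 - 2 * \<alpha>))"
    using nn_integral_eq_integral[OF integrable_gauss1_exp_sq[OF assms]] nn_integral_gauss1_exp_sq[OF assms] by simp
  then show ?thesis using assms by (subst (asm) ennreal_inj) auto
qed

lemma integrable_gauss_exp_sq:
  assumes "\<alpha> < 1/2" shows "integrable gauss (\<lambda>x::real^'n::finite. exp (\<alpha> * (norm x)\<^sup>2))"
proof (rule integrableI_nonneg)
  interpret product_sigma_finite "\<lambda>_::'n. gauss1" ..
  have "(\<integral>\<^sup>+x. ennreal (exp (\<alpha> * (norm (x::real^'n))\<^sup>2)) \<partial>gauss)
      = (\<integral>\<^sup>+\<omega>. ennreal (exp (\<alpha> * (norm ((\<chi> i. \<omega> i) :: real^'n))\<^sup>2)) \<partial>(\<Pi>\<^sub>M i\<in>(UNIV::'n set). gauss1))"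
    unfolding gauss_eq_distr by (rule nn_integral_distr) measurable
  also have "\<dots> = (\<integral>\<^sup>+\<omega>. (\<Prod>i\<in>UNIV. ennreal (exp (\<alpha> * (\<omega> i)\<^sup>2))) \<partial>(\<Pi>\<^sub>M i\<in>(UNIV::'n set). gauss1))"
    by (intro nn_integral_cong) (simp add: norm_vec_def L2_set_def sum_nonneg sum_distrib_left exp_sum prod_ennreal)
  also have "\<dots> = (\<Prod>i\<in>(UNIV::'n set). \<integral>\<^sup>+t. ennreal (exp (\<alpha> * t\<^sup>2)) \<partial>gauss1)"
    by (rule product_nn_integral_prod) auto
  also have "\<dots> = ennreal ((1 / sqrt (1 - 2 * \<alpha>)) ^ CARD('n))"
    unfolding nn_integral_gauss1_exp_sq[OF assms] using assms by (simp add: ennreal_power)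
  also have "\<dots> < \<infinity>" by (rule ennreal_less_top[folded infinity_ennreal_def])
  finally show "(\<integral>\<^sup>+x. ennreal (exp (\<alpha> * (norm (x::real^'n))\<^sup>2)) \<partial>gauss) < \<infinity>" .
qed auto

lemma integrable_gauss_growth:
  fixes u :: "real^'n::finite \<Rightarrow> 'b::{banach, second_countable_topology}"
  assumes "subgaussian_growth u" and [measurable]: "u \<in> borel_measurable borel"
  shows "integrable gauss u"
proof -
  obtain C \<alpha> where u: "0 \<le> C" "0 \<le> \<alpha>" "\<alpha> < 1/2" "\<And>x. norm (u x) \<le> C * exp (\<alpha> * (norm x)\<^sup>2)"
    using assms(1) unfolding subgaussian_growth_def by blast
  show ?thesis
    by (rule Bochner_Integration.integrable_bound[OF integrable_mult_right[OF integrable_gauss_exp_sq[OF u(3)], of C]])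
      (use u in \<open>auto intro!: AE_I2\<close>)
qed

lemma norm_upd_0_le: "norm (upd k x 0) \<le> norm x"
proof -
  have "(norm (upd k x 0))\<^sup>2 \<le> (norm x)\<^sup>2" using norm_upd_sq[of k x "x $ k"] by simp
  then show ?thesis by (simp add: power2_le_iff_abs_le)
qed

text \<open>The conditional expectation under the Gaussian given the coordinates other than k, kept
  as a function on the whole space that is constant in direction k.\<close>

definition avg :: "'n::finite \<Rightarrow> (real^'n \<Rightarrow> 'b::{banach, second_countable_topology}) \<Rightarrow> real^'n \<Rightarrow> 'b" where
  "avg k F x = (\<integral>t. F (upd k x t) \<partial>gauss1)"

lemma avg_upd [simp]: "avg k F (upd k x t) = avg k F x"
  by (simp add: avg_def)

lemma subgaussian_growth_slices:
  fixes u :: "real^'n::finite \<Rightarrow> 'b::{banach, second_countable_topology}"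
  assumes "subgaussian_growth u"
  obtains C \<alpha> where "0 \<le> C" "0 \<le> \<alpha>" "\<alpha> < 1/2"
    "\<And>k x t. norm (u (upd k x t)) \<le> C * exp (\<alpha> * (norm (upd k x 0))\<^sup>2) * exp (\<alpha> * t\<^sup>2)"
proof -
  obtain C \<alpha> where u: "0 \<le> C" "0 \<le> \<alpha>" "\<alpha> < 1/2" "\<And>x. norm (u x) \<le> C * exp (\<alpha> * (norm x)\<^sup>2)"
    using assms(1) unfolding subgaussian_growth_def by blast
  have "norm (u (upd k x t)) \<le> C * exp (\<alpha> * (norm (upd k x 0))\<^sup>2) * exp (\<alpha> * t\<^sup>2)" for k x t
    using u(4)[of "upd k x t"] unfolding norm_upd_sq[of k x t] by (simp add: distrib_left exp_add mult.assoc)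
  then show ?thesis using that u by blast
qed

lemma subgaussian_growth_dominated:
  fixes u :: "real^'n::finite \<Rightarrow> 'b::{banach, second_countable_topology}"
  assumes "subgaussian_growth u"
  obtains B where "integrable gauss1 B" "\<And>x t. norm x \<le> R \<Longrightarrow> norm (u (upd k x t)) \<le> B t"
proof -
  obtain C \<alpha> where u: "0 \<le> C" "0 \<le> \<alpha>" "\<alpha> < 1/2"
    "\<And>k x t. norm (u (upd k x t)) \<le> C * exp (\<alpha> * (norm (upd k x 0))\<^sup>2) * exp (\<alpha> * t\<^sup>2)"
    by (rule subgaussian_growth_slices[OF assms]) (rule that; assumption)
  show ?thesis
  proof (rule that[of "\<lambda>t. C * exp (\<alpha> * R\<^sup>2) * exp (\<alpha> * t\<^sup>2)"])
    show "integrable gauss1 (\<lambda>t. C * exp (\<alpha> * R\<^sup>2) * exp (\<alpha> * t\<^sup>2))"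
      using integrable_gauss1_exp_sq[OF u(3)] by simp
    fix x t assume "norm (x::real^'n) \<le> R"
    then have "(norm (upd k x 0))\<^sup>2 \<le> R\<^sup>2" using norm_upd_0_le[of k x] by (intro power_mono) auto
    then have "C * exp (\<alpha> * (norm (upd k x 0))\<^sup>2) * exp (\<alpha> * t\<^sup>2) \<le> C * exp (\<alpha> * R\<^sup>2) * exp (\<alpha> * t\<^sup>2)"
      using u by (intro mult_right_mono mult_left_mono) (auto intro: mult_left_mono)
    then show "norm (u (upd k x t)) \<le> C * exp (\<alpha> * R\<^sup>2) * exp (\<alpha> * t\<^sup>2)" using u(4)[of k x t] by linarith
  qed
qed

lemma integrable_slice:
  fixes u :: "real^'n::finite \<Rightarrow> 'b::{banach, second_countable_topology}"
  assumes "subgaussian_growth u" and [measurable]: "u \<in> borel_measurable borel"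
  shows "integrable gauss1 (\<lambda>t. u (upd k x t))"
proof -
  obtain B where B: "integrable gauss1 B" "\<And>y t. norm y \<le> norm x \<Longrightarrow> norm (u (upd k y t)) \<le> B t"
    by (rule subgaussian_growth_dominated[OF assms(1), where R = "norm x"]) (rule that; assumption)
  show ?thesis
  proof (rule Bochner_Integration.integrable_bound[OF B(1)])
    have "norm (u (upd k x t)) \<le> norm (B t)" for t using B(2)[of x t] by (simp add: order.trans[OF _ abs_ge_self])
    then show "AE t in gauss1. norm (u (upd k x t)) \<le> norm (B t)" by (intro AE_I2)
  qed measurable
qed

lemma subgaussian_growth_avg:
  fixes u :: "real^'n::finite \<Rightarrow> 'b::{banach, second_countable_topology}"
  assumes "subgaussian_growth u" and [measurable]: "u \<in> borel_measurable borel"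
  shows "subgaussian_growth (avg k u)"
proof -
  obtain C \<alpha> where u: "0 \<le> C" "0 \<le> \<alpha>" "\<alpha> < 1/2"
    "\<And>k x t. norm (u (upd k x t)) \<le> C * exp (\<alpha> * (norm (upd k x 0))\<^sup>2) * exp (\<alpha> * t\<^sup>2)"
    by (rule subgaussian_growth_slices[OF assms(1)]) (rule that; assumption)
  show ?thesis
  proof (rule subgaussian_growthI[OF u(2,3)])
    fix x
    have "norm (avg k u x) \<le> (\<integral>t. C * exp (\<alpha> * (norm (upd k x 0))\<^sup>2) * exp (\<alpha> * t\<^sup>2) \<partial>gauss1)"
      unfolding avg_def
      by (rule Bochner_Integration.integral_norm_bound_integral) (use integrable_slice[OF assms] integrable_gauss1_exp_sq[OF u(3)] u(4) in auto)
    also have "\<dots> = C * (1 / sqrt (1 - 2 * \<alpha>)) * exp (\<alpha> * (norm (upd k x 0))\<^sup>2)"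
      using integral_gauss1_exp_sq[OF u(3)] by simp
    also have "\<dots> \<le> C * (1 / sqrt (1 - 2 * \<alpha>)) * exp (\<alpha> * (norm x)\<^sup>2)"
      using u norm_upd_0_le[of k x] by (intro mult_left_mono) (auto intro!: mult_left_mono power_mono)
    finally show "norm (avg k u x) \<le> C * (1 / sqrt (1 - 2 * \<alpha>)) * exp (\<alpha> * (norm x)\<^sup>2)" .
  qed
qed

lemma continuous_on_avg:
  fixes u :: "real^'n::finite \<Rightarrow> 'b::{banach, second_countable_topology}"
  assumes "subgaussian_growth u" and cont: "continuous_on UNIV u"
  shows "continuous_on UNIV (avg k u)"
proof -
  have [measurable]: "u \<in> borel_measurable borel" using cont by (rule borel_measurable_continuous_onI)
  have "(\<lambda>n. avg k u (X n)) \<longlonglongrightarrow> avg k u x" if X: "X \<longlonglongrightarrow> x" for X x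
  proof -
    obtain R where R: "\<And>n. norm (X n) \<le> R" using convergent_imp_Bseq[OF convergentI[OF X]] by (auto simp: Bseq_def)
    obtain B where B: "integrable gauss1 B" "\<And>y t. norm y \<le> R \<Longrightarrow> norm (u (upd k y t)) \<le> B t"
      by (rule subgaussian_growth_dominated[OF assms(1), where R = R]) (rule that; assumption)
    show ?thesis unfolding avg_def
    proof (rule integral_dominated_convergence[OF _ _ B(1)])
      show "AE t in gauss1. (\<lambda>n. u (upd k (X n) t)) \<longlonglongrightarrow> u (upd k x t)"
      proof (rule AE_I2)
        fix t
        have "continuous_on UNIV (\<lambda>x. u (upd k x t))"
          by (intro continuous_on_compose2[OF cont] continuous_intros) auto
        then show "(\<lambda>n. u (upd k (X n) t)) \<longlonglongrightarrow> u (upd k x t)"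
          using X by (auto simp: continuous_on_sequentially comp_def)
      qed
      show "AE t in gauss1. norm (u (upd k (X n) t)) \<le> B t" for n using B(2) R by auto
    qed measurable
  qed
  then show ?thesis by (auto simp: continuous_on_sequentially comp_def)
qed

lemma distr_gauss_resample:
  "distr (gauss \<Otimes>\<^sub>M gauss1) borel (\<lambda>(x, t). upd k x t) = (gauss :: (real^'n::finite) measure)"
proof (rule measure_eqI)
  fix A :: "(real^'n) set" assume "A \<in> sets (distr (gauss \<Otimes>\<^sub>M gauss1) borel (\<lambda>(x, t). upd k x t))"
  then have [measurable]: "A \<in> sets borel" by simp
  have "emeasure (distr (gauss \<Otimes>\<^sub>M gauss1) borel (\<lambda>(x, t). upd k x t)) A
      = (\<integral>\<^sup>+y. indicator A y \<partial>distr (gauss \<Otimes>\<^sub>M gauss1) borel (\<lambda>(x, t). upd k x t))" by simp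
  also have "\<dots> = (\<integral>\<^sup>+z. indicator A (case z of (x, t) \<Rightarrow> upd k x t) \<partial>(gauss \<Otimes>\<^sub>M gauss1))"
    by (rule nn_integral_distr) measurable
  also have "\<dots> = (\<integral>\<^sup>+x. \<integral>\<^sup>+t. indicator A (upd k x t) \<partial>gauss1 \<partial>gauss)"
    by (subst gauss1.nn_integral_fst[symmetric]) (auto simp: case_prod_beta)
  also have "\<dots> = (\<integral>\<^sup>+x. indicator A x \<partial>gauss)" by (rule nn_integral_gauss_resample) measurable
  finally show "emeasure (distr (gauss \<Otimes>\<^sub>M gauss1) borel (\<lambda>(x, t). upd k x t)) A = emeasure gauss A" by simp
qed simp

lemma integral_avg:
  fixes u :: "real^'n::finite \<Rightarrow> 'b::{banach, second_countable_topology}"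
  assumes "integrable gauss u"
  shows "(\<integral>x. avg k u x \<partial>gauss) = (\<integral>x. u x \<partial>gauss)"
proof -
  interpret pair_sigma_finite "gauss :: (real^'n) measure" gauss1 ..
  have [measurable]: "u \<in> borel_measurable borel" using borel_measurable_integrable[OF assms] by simp
  have m: "(\<lambda>(x, t). upd k x t) \<in> measurable (gauss \<Otimes>\<^sub>M gauss1) borel" by measurable
  have i: "integrable (gauss \<Otimes>\<^sub>M gauss1) (\<lambda>z. u (case z of (x, t) \<Rightarrow> upd k x t))"
    by (rule integrable_distr[OF m]) (simp add: distr_gauss_resample assms)
  have "(\<integral>x. u x \<partial>gauss) = (\<integral>z. u (case z of (x, t) \<Rightarrow> upd k x t) \<partial>(gauss \<Otimes>\<^sub>M gauss1))"
    by (subst distr_gauss_resample[symmetric, of k], rule integral_distr[OF m]) measurable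
  also have "\<dots> = (\<integral>x. avg k u x \<partial>gauss)"
    using integral_fst'[OF i] by (simp add: avg_def)
  finally show ?thesis ..
qed

lemma avg_mono:
  fixes u v :: "real^'n::finite \<Rightarrow> real"
  assumes "integrable gauss1 (\<lambda>t. u (upd k x t))" "integrable gauss1 (\<lambda>t. v (upd k x t))" "\<And>x. u x \<le> v x"
  shows "avg k u x \<le> avg k v x"
  unfolding avg_def by (rule integral_mono) (use assms in auto)

definition c1_growth :: "(real^'n::finite \<Rightarrow> real) \<Rightarrow> (real^'n \<Rightarrow> real^'n) \<Rightarrow> bool" where
  "c1_growth F D \<longleftrightarrow> (\<forall>x. (F has_derivative (\<lambda>v. D x \<bullet> v)) (at x)) \<and> continuous_on UNIV D
     \<and> subgaussian_growth F \<and> subgaussian_growth D"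

lemma c1_growthD:
  assumes "c1_growth F D"
  shows "(F has_derivative (\<lambda>v. D x \<bullet> v)) (at x)" "continuous_on UNIV D" "continuous_on UNIV F"
    "subgaussian_growth F" "subgaussian_growth D" "F \<in> borel_measurable borel" "D \<in> borel_measurable borel"
proof -
  show "continuous_on UNIV F"
    using assms has_derivative_continuous_on[of UNIV F "\<lambda>x v. D x \<bullet> v"] by (simp add: c1_growth_def)
  then show "F \<in> borel_measurable borel" by (rule borel_measurable_continuous_onI)
  show "D \<in> borel_measurable borel" using assms by (intro borel_measurable_continuous_onI) (simp add: c1_growth_def)
qed (use assms in \<open>auto simp: c1_growth_def\<close>)

lemma inner_upd_0: "upd k v 0 \<bullet> w = v \<bullet> upd k w 0"
  unfolding inner_vec_def by (intro sum.cong) auto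

lemma upd_add_0: "upd k (v + w) 0 = upd k v 0 + upd k w 0"
  and upd_scaleR_0: "upd k (c *\<^sub>R v) 0 = c *\<^sub>R upd k v 0"
  and upd_diff: "upd k v t - upd k w t = upd k (v - w) 0"
  by (auto simp: vec_eq_iff)

lemma integral_upd_0:
  fixes w :: "real \<Rightarrow> real^'n::finite"
  assumes "integrable gauss1 w"
  shows "upd k (\<integral>t. w t \<partial>gauss1) 0 \<bullet> v = (\<integral>t. upd k (w t) 0 \<bullet> v \<partial>gauss1)"
  unfolding inner_upd_0 using assms by simp

text \<open>Differentiation under the integral: growth of D gives a majorant that is uniform for x
  in a ball, and the mean value inequality carries it to the difference quotients. The k-th
  component of the gradient disappears because the average is constant in that direction.\<close>

lemma c1_growth_avg:
  fixes F :: "real^'n::finite \<Rightarrow> real"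
  assumes "c1_growth F D"
  shows "c1_growth (avg k F) (\<lambda>x. upd k (avg k D x) 0)"
  unfolding c1_growth_def
proof (intro conjI allI)
  note FD = c1_growthD[OF assms]
  note [measurable] = FD(6,7)
  show "continuous_on UNIV (\<lambda>x. upd k (avg k D x) 0)"
    by (intro continuous_intros continuous_on_avg FD)
  show "subgaussian_growth (avg k F)" by (intro subgaussian_growth_avg FD)
  have "subgaussian_growth (avg k D)" by (intro subgaussian_growth_avg FD)
  then show "subgaussian_growth (\<lambda>x. upd k (avg k D x) 0)"
    by (rule subgaussian_growth_mono) (rule norm_upd_0_le)
  fix x
  let ?D' = "\<lambda>v. upd k (avg k D x) 0 \<bullet> v"
  have "((\<lambda>y. (avg k F y - avg k F x - ?D' (y - x)) /\<^sub>R norm (y - x)) \<longlongrightarrow> 0) (at x)"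
  proof (subst tendsto_at_iff_sequentially, intro allI impI)
    fix X assume X: "\<forall>i. X i \<in> UNIV - {x}" "X \<longlonglongrightarrow> x"
    obtain R0 where R0: "\<And>n. norm (X n) \<le> R0" using convergent_imp_Bseq[OF convergentI[OF X(2)]] by (auto simp: Bseq_def)
    define R where "R = max R0 (norm x)"
    have R: "norm (X n) \<le> R" "norm x \<le> R" for n using R0[of n] by (auto simp: R_def)
    obtain B where B: "integrable gauss1 B" "\<And>y t. norm y \<le> R \<Longrightarrow> norm (D (upd k y t)) \<le> B t"
      by (rule subgaussian_growth_dominated[OF FD(5), where R = R]) (rule that; assumption)
    define h where "h y t = (F (upd k y t) - F (upd k x t) - upd k (D (upd k x t)) 0 \<bullet> (y - x)) / norm (y - x)" for y t
    have hi: "(avg k F y - avg k F x - ?D' (y - x)) /\<^sub>R norm (y - x) = (\<integral>t. h y t \<partial>gauss1)" for y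
      unfolding h_def avg_def
      by (subst integral_upd_0) (auto simp: integrable_slice FD inner_upd_0 divide_inverse mult.commute)
    have der: "((\<lambda>y. F (upd k y t)) has_derivative (\<lambda>v. upd k (D (upd k y t)) 0 \<bullet> v)) (at y)" for y t
    proof -
      have "((\<lambda>y. upd k y t) has_derivative (\<lambda>v. upd k v 0)) (at y)"
        unfolding upd_eq[abs_def] by (auto intro!: derivative_eq_intros bounded_linear.has_derivative[OF bounded_linear_vec_nth] simp: upd_eq)
      from has_derivative_compose[OF this FD(1)] show ?thesis by (simp add: inner_upd_0)
    qed
    have "(\<lambda>n. \<integral>t. h (X n) t \<partial>gauss1) \<longlonglongrightarrow> (\<integral>t. 0 \<partial>gauss1)"
    proof (rule integral_dominated_convergence[where w = "\<lambda>t. 2 * B t"])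
      show "integrable gauss1 (\<lambda>t. 2 * B t)" using B by simp
      show "AE t in gauss1. (\<lambda>n. h (X n) t) \<longlonglongrightarrow> 0"
      proof (rule AE_I2)
        fix t
        have "((\<lambda>y. (F (upd k y t) - F (upd k x t) - upd k (D (upd k x t)) 0 \<bullet> (y - x)) /\<^sub>R norm (y - x)) \<longlongrightarrow> 0) (at x)"
          using der[of t x] unfolding has_derivative_at_within by blast
        then show "(\<lambda>n. h (X n) t) \<longlonglongrightarrow> 0"
          using X by (auto simp: tendsto_at_iff_sequentially h_def comp_def divide_inverse mult.commute)
      qed
      show "AE t in gauss1. norm (h (X n) t) \<le> 2 * B t" for n
      proof (rule AE_I2)
        fix t
        have b: "norm (upd k (D (upd k y t)) 0) \<le> B t" if "norm y \<le> R" for y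
          using norm_upd_0_le[of k "D (upd k y t)"] B(2)[OF that, of t] by linarith
        have "norm (F (upd k (X n) t) - F (upd k x t)) \<le> B t * norm (X n - x)"
        proof (rule differentiable_bound[of "cball 0 R" "\<lambda>y. F (upd k y t)" "\<lambda>y v. upd k (D (upd k y t)) 0 \<bullet> v"])
          fix y assume "y \<in> cball (0::real^'n) R"
          then have y: "norm y \<le> R" by simp
          show "((\<lambda>y. F (upd k y t)) has_derivative (\<lambda>v. upd k (D (upd k y t)) 0 \<bullet> v)) (at y within cball 0 R)"
            by (rule has_derivative_at_withinI[OF der])
          show "onorm (\<lambda>v. upd k (D (upd k y t)) 0 \<bullet> v) \<le> B t"
          proof (rule onorm_le)
            fix v
            have "\<bar>upd k (D (upd k y t)) 0 \<bullet> v\<bar> \<le> norm (upd k (D (upd k y t)) 0) * norm v" by (rule Cauchy_Schwarz_ineq2)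
            also have "\<dots> \<le> B t * norm v" by (intro mult_right_mono b y) simp
            finally show "norm (upd k (D (upd k y t)) 0 \<bullet> v) \<le> B t * norm v" by simp
          qed
        qed (use R in auto)
        moreover have "\<bar>upd k (D (upd k x t)) 0 \<bullet> (X n - x)\<bar> \<le> B t * norm (X n - x)"
        proof -
          have "\<bar>upd k (D (upd k x t)) 0 \<bullet> (X n - x)\<bar> \<le> norm (upd k (D (upd k x t)) 0) * norm (X n - x)" by (rule Cauchy_Schwarz_ineq2)
          also have "\<dots> \<le> B t * norm (X n - x)" by (intro mult_right_mono b R) simp
          finally show ?thesis .
        qed
        ultimately have "\<bar>F (upd k (X n) t) - F (upd k x t) - upd k (D (upd k x t)) 0 \<bullet> (X n - x)\<bar> \<le> 2 * B t * norm (X n - x)"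
          by simp
        moreover have "norm (X n - x) > 0" using X by auto
        ultimately show "norm (h (X n) t) \<le> 2 * B t" unfolding h_def by (simp add: divide_le_eq)
      qed
      show "h (X n) \<in> borel_measurable gauss1" for n unfolding h_def inner_upd_0 by measurable
    qed simp
    then show "((\<lambda>y. (avg k F y - avg k F x - ?D' (y - x)) /\<^sub>R norm (y - x)) \<circ> X) \<longlonglongrightarrow> 0"
      unfolding comp_def hi by simp
  qed
  then show "(avg k F has_derivative ?D') (at x)"
    by (subst has_derivative_at_within) (rule conjI[OF bounded_linear_inner_right])
qed

section \<open>Slices, and the log-Sobolev inequality in dimension n\<close>

text \<open>Growth of the Fisher integrand is asked for separately, since bounds on F and D say
  nothing where F is small.\<close>

definition nice :: "(real^'n::finite \<Rightarrow> real) \<Rightarrow> (real^'n \<Rightarrow> real^'n) \<Rightarrow> bool" where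
  "nice F D \<longleftrightarrow> c1_growth F D \<and> (\<forall>x. 0 < F x) \<and> subgaussian_growth (\<lambda>x. (norm (D x))\<^sup>2 / F x)"

lemma niceD:
  assumes "nice F D"
  shows "c1_growth F D" "\<And>x. 0 < F x" "subgaussian_growth (\<lambda>x. (norm (D x))\<^sup>2 / F x)"
    "F \<in> borel_measurable borel" "D \<in> borel_measurable borel" "subgaussian_growth F" "subgaussian_growth D"
  using assms c1_growthD[of F D] by (auto simp: nice_def)

lemma integral_pos_of_pos:
  fixes F :: "'a \<Rightarrow> real"
  assumes "integrable M F" "\<And>x. F x > 0" "prob_space M"
  shows "0 < (\<integral>x. F x \<partial>M)"
proof -
  interpret prob_space M by fact
  have "(\<integral>x. F x \<partial>M) \<noteq> 0"
  proof
    assume "(\<integral>x. F x \<partial>M) = 0"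
    then have "AE x in M. F x = 0"
      using integral_nonneg_eq_0_iff_AE[OF assms(1)] assms(2) by (auto simp: less_imp_le)
    then have "AE x in M. False" by eventually_elim (use assms(2) in \<open>auto simp: less_le\<close>)
    then show False by simp
  qed
  moreover have "0 \<le> (\<integral>x. F x \<partial>M)" using assms(2) by (simp add: less_imp_le)
  ultimately show ?thesis by simp
qed

text \<open>Cauchy-Schwarz, obtained by expanding the integral of (|u| - c F)^2 / F at the optimal
  c. It expresses the joint convexity of |u|^2 / F, by which averaging lowers Fisher
  information.\<close>

lemma norm_integral_sq_le:
  fixes u :: "'a \<Rightarrow> 'b::{banach, second_countable_topology}" and F :: "'a \<Rightarrow> real"
  assumes F: "integrable M F" "\<And>x. F x > 0" "prob_space M" and u: "integrable M u" "integrable M (\<lambda>x. (norm (u x))\<^sup>2 / F x)"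
  shows "(norm (\<integral>x. u x \<partial>M))\<^sup>2 \<le> (\<integral>x. F x \<partial>M) * (\<integral>x. (norm (u x))\<^sup>2 / F x \<partial>M)"
proof -
  define m where "m = (\<integral>x. F x \<partial>M)"
  define a where "a = (\<integral>x. norm (u x) \<partial>M)"
  have m: "m > 0" unfolding m_def by (rule integral_pos_of_pos[OF F])
  have i: "integrable M (\<lambda>x. norm (u x))" using u(1) by simp
  have "(norm (u x) - c * F x)\<^sup>2 / F x = (norm (u x))\<^sup>2 / F x - 2 * c * norm (u x) + c\<^sup>2 * F x" for c x
    using F(2)[of x] by (simp add: power2_eq_square field_simps)
  note sq = this[of _ "a / m"]
  have "0 \<le> (\<integral>x. (norm (u x) - a / m * F x)\<^sup>2 / F x \<partial>M)" using F(2) by (simp add: less_imp_le)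
  also have "\<dots> = (\<integral>x. (norm (u x))\<^sup>2 / F x \<partial>M) - 2 * (a / m) * a + (a / m)\<^sup>2 * m"
    unfolding sq using u(2) i F(1) by (simp add: a_def m_def)
  also have "\<dots> = (\<integral>x. (norm (u x))\<^sup>2 / F x \<partial>M) - a\<^sup>2 / m" using m by (simp add: power2_eq_square)
  finally have "a\<^sup>2 \<le> m * (\<integral>x. (norm (u x))\<^sup>2 / F x \<partial>M)" using m by (simp add: pos_divide_le_eq mult.commute)
  moreover have "(norm (\<integral>x. u x \<partial>M))\<^sup>2 \<le> a\<^sup>2" unfolding a_def by (intro power_mono integral_norm_bound) auto
  ultimately show ?thesis unfolding m_def by linarith
qed

lemma bounded_linear_upd_0: "bounded_linear (\<lambda>v. upd k v 0)"
  by (rule bounded_linear_intro[of _ 1]) (auto simp: upd_add_0 upd_scaleR_0 norm_upd_0_le)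

lemma upd_0_avg:
  assumes "integrable gauss1 (\<lambda>t. D (upd k x t))"
  shows "upd k (avg k D x) 0 = (\<integral>t. upd k (D (upd k x t)) 0 \<partial>gauss1)"
  unfolding avg_def using integral_bounded_linear[OF bounded_linear_upd_0 assms] by simp

lemma subgaussian_growth_fisher_part:
  assumes "nice F D" "\<And>x. norm (v x) \<le> norm (D x)"
  shows "subgaussian_growth (\<lambda>x. (norm (v x))\<^sup>2 / F x)"
  by (rule subgaussian_growth_mono[OF niceD(3)[OF assms(1)]])
    (use assms(2) niceD(2)[OF assms(1)] in \<open>auto intro!: divide_right_mono power_mono simp: less_imp_le\<close>)

lemma avg_pos: "nice F D \<Longrightarrow> 0 < avg k F x"
  unfolding avg_def
  by (rule integral_pos_of_pos) (auto intro: integrable_slice niceD gauss1.prob_space_axioms)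

text \<open>Fisher information does not increase under averaging; this is also what keeps the third
  condition of \<open>nice\<close> alive in \<open>nice_avg\<close>.\<close>

lemma avg_fisher_le:
  assumes "nice F D"
  shows "(norm (upd k (avg k D x) 0))\<^sup>2 / avg k F x \<le> avg k (\<lambda>y. (norm (upd k (D y) 0))\<^sup>2 / F y) x"
proof -
  note [measurable] = niceD(4,5)[OF assms]
  have i: "integrable gauss1 (\<lambda>t. D (upd k x t))" by (rule integrable_slice[OF niceD(7)[OF assms]]) simp
  have "(norm (upd k (avg k D x) 0))\<^sup>2 \<le> avg k F x * avg k (\<lambda>y. (norm (upd k (D y) 0))\<^sup>2 / F y) x"
    unfolding upd_0_avg[OF i] unfolding avg_def
  proof (rule norm_integral_sq_le)
    show "integrable gauss1 (\<lambda>t. F (upd k x t))" by (rule integrable_slice[OF niceD(6)[OF assms]]) simp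
    show "integrable gauss1 (\<lambda>t. upd k (D (upd k x t)) 0)"
      by (rule integrable_bounded_linear[OF bounded_linear_upd_0 i])
    show "integrable gauss1 (\<lambda>t. (norm (upd k (D (upd k x t)) 0))\<^sup>2 / F (upd k x t))"
      by (rule integrable_slice[OF subgaussian_growth_fisher_part[OF assms norm_upd_0_le]]) measurable
  qed (use niceD(2)[OF assms] gauss1.prob_space_axioms in auto)
  then show ?thesis using avg_pos[OF assms, of k x] by (simp add: pos_divide_le_eq mult.commute)
qed

lemma nice_avg:
  assumes "nice F D"
  shows "nice (avg k F) (\<lambda>x. upd k (avg k D x) 0)"
  unfolding nice_def
proof (intro conjI allI)
  note [measurable] = niceD(4,5)[OF assms]
  show "c1_growth (avg k F) (\<lambda>x. upd k (avg k D x) 0)" by (intro c1_growth_avg niceD assms)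
  show "0 < avg k F x" for x by (rule avg_pos[OF assms])
  have "subgaussian_growth (avg k (\<lambda>y. (norm (upd k (D y) 0))\<^sup>2 / F y))"
    by (rule subgaussian_growth_avg[OF subgaussian_growth_fisher_part[OF assms norm_upd_0_le]]) measurable
  then show "subgaussian_growth (\<lambda>x. (norm (upd k (avg k D x) 0))\<^sup>2 / avg k F x)"
    by (rule subgaussian_growth_mono)
      (use avg_fisher_le[OF assms] avg_pos[OF assms] in \<open>auto intro: order.trans[OF _ abs_ge_self] simp: less_imp_le\<close>)
qed

lemma subgaussian_growth_coord:
  fixes u :: "real^'n::finite \<Rightarrow> 'b::real_normed_vector"
  assumes "subgaussian_growth u"
  shows "subgaussian_growth (\<lambda>y. (y $ k) *\<^sub>R u y)" "subgaussian_growth (\<lambda>y. (y $ k)\<^sup>2 *\<^sub>R u y)"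
proof -
  have le: "\<bar>y $ k\<bar> \<le> 1 + (norm y)\<^sup>2" "(y $ k)\<^sup>2 \<le> 1 + (norm y)\<^sup>2" for y :: "real^'n"
  proof -
    have "\<bar>y $ k\<bar> \<le> norm y" by (rule component_le_norm_cart)
    then have "\<bar>y $ k\<bar>\<^sup>2 \<le> (norm y)\<^sup>2" by (intro power_mono) auto
    then show "(y $ k)\<^sup>2 \<le> 1 + (norm y)\<^sup>2" by simp
    have "0 \<le> (norm y)\<^sup>2 - norm y + 1/4" using zero_le_power2[of "norm y - 1/2"] by (simp add: power2_diff power_divide)
    then have "norm y \<le> 1 + (norm y)\<^sup>2" by linarith
    then show "\<bar>y $ k\<bar> \<le> 1 + (norm y)\<^sup>2" using \<open>\<bar>y $ k\<bar> \<le> norm y\<close> by linarith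
  qed
  show "subgaussian_growth (\<lambda>y. (y $ k) *\<^sub>R u y)" "subgaussian_growth (\<lambda>y. (y $ k)\<^sup>2 *\<^sub>R u y)"
    by (rule subgaussian_growth_mono[OF subgaussian_growth_weight[OF assms]],
        use le in \<open>auto intro!: mult_right_mono intro: order.trans[OF _ abs_ge_self]\<close>)+
qed

text \<open>The slice of \<open>F\<close> in direction \<open>k\<close> through \<open>x\<close>, normalised to mass one.\<close>

locale slice =
  fixes F :: "real^'n::finite \<Rightarrow> real" and D :: "real^'n \<Rightarrow> real^'n" and k :: 'n and x :: "real^'n"
  assumes nice: "nice F D"
begin

definition "m = avg k F x"
definition "q t = F (upd k x t) / m"
definition "s t = D (upd k x t) $ k / F (upd k x t)"
definition "\<nu> = density gauss1 (\<lambda>t. ennreal (q t))"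

lemma meas [measurable]: "F \<in> borel_measurable borel" "D \<in> borel_measurable borel"
  by (rule niceD[OF nice])+

lemma m_pos: "m > 0" unfolding m_def by (rule avg_pos[OF nice])

lemma q_pos: "q t > 0" unfolding q_def using m_pos niceD(2)[OF nice] by simp

lemma q_meas [measurable]: "q \<in> borel_measurable borel" "s \<in> borel_measurable borel"
  unfolding q_def s_def by measurable

lemma integral_\<nu>:
  assumes [measurable]: "h \<in> borel_measurable borel" and i: "integrable gauss1 (\<lambda>t. h t * F (upd k x t))"
  shows "integrable \<nu> h" "(\<integral>t. h t \<partial>\<nu>) = (\<integral>t. h t * F (upd k x t) \<partial>gauss1) / m"
  using i q_pos unfolding \<nu>_def
  by (auto simp: integrable_density integral_density less_imp_le q_def mult.commute)

lemma slice_integrable: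
  "integrable gauss1 (\<lambda>t. F (upd k x t))"
  "integrable gauss1 (\<lambda>t. t * F (upd k x t))"
  "integrable gauss1 (\<lambda>t. t\<^sup>2 * F (upd k x t))"
  "integrable gauss1 (\<lambda>t. (D (upd k x t) $ k)\<^sup>2 / F (upd k x t))"
  "integrable gauss1 (\<lambda>t. F (upd k x t) * ln (F (upd k x t)))"
  "integrable gauss1 (\<lambda>t. D (upd k x t))"
  "integrable gauss1 (\<lambda>t. t *\<^sub>R D (upd k x t))"
proof -
  note g = niceD(6)[OF nice] and gD = niceD(7)[OF nice]
  show "integrable gauss1 (\<lambda>t. F (upd k x t))" by (rule integrable_slice[OF g]) measurable
  show "integrable gauss1 (\<lambda>t. D (upd k x t))" by (rule integrable_slice[OF gD]) measurable
  show "integrable gauss1 (\<lambda>t. t * F (upd k x t))"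
    using integrable_slice[OF subgaussian_growth_coord(1)[OF g, of k], of k x] by simp
  show "integrable gauss1 (\<lambda>t. t\<^sup>2 * F (upd k x t))"
    using integrable_slice[OF subgaussian_growth_coord(2)[OF g, of k], of k x] by simp
  show "integrable gauss1 (\<lambda>t. t *\<^sub>R D (upd k x t))"
    using integrable_slice[OF subgaussian_growth_coord(1)[OF gD, of k], of k x] by simp
  show "integrable gauss1 (\<lambda>t. F (upd k x t) * ln (F (upd k x t)))"
    by (rule integrable_slice[OF subgaussian_growth_mult_ln[OF g niceD(2)[OF nice]]]) measurable
  have "subgaussian_growth (\<lambda>y. (D y $ k)\<^sup>2 / F y)"
  proof -
    have "norm (D y $ k) \<le> norm (D y)" for y by (simp add: component_le_norm_cart)
    from subgaussian_growth_fisher_part[OF nice this] show ?thesis by simp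
  qed
  then show "integrable gauss1 (\<lambda>t. (D (upd k x t) $ k)\<^sup>2 / F (upd k x t))"
    by (rule integrable_slice) measurable
qed

lemma has_real_derivative_slice: "((\<lambda>t. F (upd k x t)) has_real_derivative D (upd k x t) $ k) (at t)"
proof -
  have "((\<lambda>t. upd k x t) has_derivative (\<lambda>v. v *\<^sub>R axis k 1)) (at t)"
    unfolding upd_eq by (auto intro!: derivative_eq_intros)
  from has_derivative_compose[OF this c1_growthD(1)[OF niceD(1)[OF nice]]]
  show ?thesis by (simp add: has_field_derivative_def inner_axis mult_commute_abs)
qed

lemma q_deriv: "(q has_real_derivative s t * q t) (at t)"
  unfolding q_def[abs_def] s_def using niceD(2)[OF nice, of "upd k x t"] m_pos
  by (auto intro!: derivative_eq_intros has_real_derivative_slice)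

lemma s_cont: "continuous_on UNIV s"
  unfolding s_def using niceD(2)[OF nice]
  by (intro continuous_intros continuous_on_compose2[OF c1_growthD(2)[OF niceD(1)[OF nice]]]
      continuous_on_compose2[OF c1_growthD(3)[OF niceD(1)[OF nice]]]) (auto simp: less_imp_neq[symmetric])

lemma q_mass: "(\<integral>\<^sup>+t. ennreal (q t) \<partial>gauss1) = 1"
proof -
  have "(\<integral>\<^sup>+t. ennreal (q t) \<partial>gauss1) = ennreal (\<integral>t. q t \<partial>gauss1)"
    by (rule nn_integral_eq_integral) (use slice_integrable(1) q_pos in \<open>auto simp: q_def less_imp_le\<close>)
  also have "(\<integral>t. q t \<partial>gauss1) = 1" using m_pos by (simp add: q_def m_def avg_def)
  finally show ?thesis by simp
qed

lemma prob_\<nu>: "prob_space \<nu>"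
  by (rule prob_spaceI) (simp add: \<nu>_def emeasure_density q_mass)

lemma \<nu>_second_moment: "integrable \<nu> (\<lambda>t. t\<^sup>2)"
  by (rule integral_\<nu>) (auto intro: slice_integrable)

lemma \<nu>_score: "integrable \<nu> (\<lambda>t. (s t)\<^sup>2)"
  "(\<integral>t. (s t)\<^sup>2 \<partial>\<nu>) = avg k (\<lambda>y. (D y $ k)\<^sup>2 / F y) x / m"
proof -
  have eq: "(s t)\<^sup>2 * F (upd k x t) = (D (upd k x t) $ k)\<^sup>2 / F (upd k x t)" for t
    using niceD(2)[OF nice, of "upd k x t"] by (simp add: s_def power_divide power2_eq_square)
  show "integrable \<nu> (\<lambda>t. (s t)\<^sup>2)" "(\<integral>t. (s t)\<^sup>2 \<partial>\<nu>) = avg k (\<lambda>y. (D y $ k)\<^sup>2 / F y) x / m"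
    using integral_\<nu>[of "\<lambda>t. (s t)\<^sup>2"] slice_integrable(4) by (auto simp: eq avg_def)
qed

lemma \<nu>_ln: "integrable \<nu> (\<lambda>t. ln (q t))"
  "(\<integral>t. ln (q t) \<partial>\<nu>) = avg k (\<lambda>y. F y * ln (F y)) x / m - ln m"
proof -
  have eq: "ln (q t) * F (upd k x t) = F (upd k x t) * ln (F (upd k x t)) - ln m * F (upd k x t)" for t
    using niceD(2)[OF nice, of "upd k x t"] m_pos by (simp add: q_def ln_div algebra_simps)
  have i: "integrable gauss1 (\<lambda>t. ln (q t) * F (upd k x t))"
    unfolding eq using slice_integrable by simp
  show "integrable \<nu> (\<lambda>t. ln (q t))" by (rule integral_\<nu>[OF _ i]) measurable
  have "(\<integral>t. ln (q t) \<partial>\<nu>) = (\<integral>t. ln (q t) * F (upd k x t) \<partial>gauss1) / m" by (rule integral_\<nu>[OF _ i]) measurable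
  also have "\<dots> = avg k (\<lambda>y. F y * ln (F y)) x / m - ln m"
    unfolding eq using slice_integrable m_pos by (simp add: avg_def m_def diff_divide_distrib)
  finally show "(\<integral>t. ln (q t) \<partial>\<nu>) = avg k (\<lambda>y. F y * ln (F y)) x / m - ln m" .
qed

lemma \<nu>_mean: "(\<integral>t. t \<partial>\<nu>) = avg k (\<lambda>y. y $ k * F y) x / m"
  using integral_\<nu>(2)[of "\<lambda>t. t"] slice_integrable(2) by (simp add: avg_def)

lemma log_sobolev:
  "avg k (\<lambda>y. F y * ln (F y)) x - m * ln m \<le> avg k (\<lambda>y. (D y $ k)\<^sup>2 / F y) x / 2"
proof -
  have "(\<integral>t. ln (q t) \<partial>\<nu>) \<le> (\<integral>t. (s t)\<^sup>2 \<partial>\<nu>) / 2"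
    by (rule log_sobolev_real[OF q_pos q_deriv s_cont q_mass \<nu>_def \<nu>_second_moment \<nu>_score(1) \<nu>_ln(1)])
  then have "m * (avg k (\<lambda>y. F y * ln (F y)) x / m - ln m) \<le> m * (avg k (\<lambda>y. (D y $ k)\<^sup>2 / F y) x / m / 2)"
    unfolding \<nu>_score(2) \<nu>_ln(2) using m_pos by (intro mult_left_mono) auto
  then show ?thesis using m_pos by (simp add: right_diff_distrib)
qed

context
  fixes \<epsilon> :: real
  assumes \<epsilon>: "0 < \<epsilon>" "\<epsilon> \<le> 1"
    and conc: "\<And>x y. F y \<le> F x * exp (D x \<bullet> (y - x) / F x + (1 - \<epsilon>) / 2 * (norm (y - x))\<^sup>2)"
begin

lemma q_conc: "q t' \<le> q t * exp (s t * (t' - t) + (1 - \<epsilon>) / 2 * (t' - t)\<^sup>2)"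
proof -
  have e: "upd k x t' - upd k x t = (t' - t) *\<^sub>R axis k 1" by (simp add: upd_eq scaleR_diff_left)
  have "F (upd k x t') \<le> F (upd k x t) * exp (s t * (t' - t) + (1 - \<epsilon>) / 2 * (t' - t)\<^sup>2)"
    using conc[of "upd k x t'" "upd k x t"] unfolding e by (simp add: inner_axis s_def power_mult_distrib mult.commute)
  then show ?thesis unfolding q_def using m_pos by (simp add: divide_right_mono)
qed

text \<open>\<open>deficit_stability_real\<close> for the normalised slice, multiplied by the mass
  \<open>m\<close> so that it can be integrated over the remaining coordinates. The inner quotient
  of averages is the mean of the slice.\<close>

lemma stability:
  "avg k (\<lambda>y. (D y $ k - avg k (\<lambda>y. y $ k * F y) y / avg k F y * F y)\<^sup>2 / F y) x
    \<le> 4 / \<epsilon> * (avg k (\<lambda>y. (D y $ k)\<^sup>2 / F y) x / 2 - (avg k (\<lambda>y. F y * ln (F y)) x - m * ln m))"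
proof -
  define b where "b = (\<integral>t. t \<partial>\<nu>)"
  have b: "b = avg k (\<lambda>y. y $ k * F y) x / avg k F x" unfolding b_def \<nu>_mean m_def ..
  have "(\<integral>t. (s t - b)\<^sup>2 \<partial>\<nu>) \<le> 4 / \<epsilon> * ((\<integral>t. (s t)\<^sup>2 \<partial>\<nu>) / 2 - (\<integral>t. ln (q t) \<partial>\<nu>))"
    unfolding b_def
    by (rule deficit_stability_real[OF q_pos q_deriv s_cont q_mass \<nu>_def \<nu>_second_moment \<nu>_score(1) \<nu>_ln(1) \<epsilon> q_conc])
  moreover have "(\<integral>t. (s t - b)\<^sup>2 \<partial>\<nu>) = avg k (\<lambda>y. (D y $ k - avg k (\<lambda>y. y $ k * F y) y / avg k F y * F y)\<^sup>2 / F y) x / m"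
  proof -
    have eq: "(s t - b)\<^sup>2 * F (upd k x t) = (D (upd k x t) $ k - b * F (upd k x t))\<^sup>2 / F (upd k x t)" for t
      using niceD(2)[OF nice, of "upd k x t"] by (simp add: s_def power2_eq_square field_simps)
    have eq2: "(D (upd k x t) $ k - b * F (upd k x t))\<^sup>2 / F (upd k x t)
        = (D (upd k x t) $ k)\<^sup>2 / F (upd k x t) - 2 * b * D (upd k x t) $ k + b\<^sup>2 * F (upd k x t)" for t
      using niceD(2)[OF nice, of "upd k x t"] by (simp add: power2_eq_square field_simps)
    have "integrable gauss1 (\<lambda>t. D (upd k x t) $ k)"
      using integrable_inner_left[OF slice_integrable(6), of "axis k 1"] by (simp add: inner_axis)
    then have "integrable gauss1 (\<lambda>t. (s t - b)\<^sup>2 * F (upd k x t))"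
      unfolding eq eq2 using slice_integrable(1,4) by simp
    then show ?thesis using integral_\<nu>(2)[of "\<lambda>t. (s t - b)\<^sup>2"] unfolding eq by (simp add: avg_def b)
  qed
  ultimately have "avg k (\<lambda>y. (D y $ k - avg k (\<lambda>y. y $ k * F y) y / avg k F y * F y)\<^sup>2 / F y) x / m
      \<le> 4 / \<epsilon> * (avg k (\<lambda>y. (D y $ k)\<^sup>2 / F y) x / m / 2 - (avg k (\<lambda>y. F y * ln (F y)) x / m - ln m))"
    unfolding \<nu>_score(2) \<nu>_ln(2) by simp
  then have "m * (avg k (\<lambda>y. (D y $ k - avg k (\<lambda>y. y $ k * F y) y / avg k F y * F y)\<^sup>2 / F y) x / m)
      \<le> m * (4 / \<epsilon> * (avg k (\<lambda>y. (D y $ k)\<^sup>2 / F y) x / m / 2 - (avg k (\<lambda>y. F y * ln (F y)) x / m - ln m)))"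
    using m_pos by (intro mult_left_mono) auto
  also have "\<dots> = 4 / \<epsilon> * (avg k (\<lambda>y. (D y $ k)\<^sup>2 / F y) x / 2 - (avg k (\<lambda>y. F y * ln (F y)) x - m * ln m))"
  proof -
    have "m * (A / m / 2 - (B / m - L)) = A / 2 - (B - m * L)" for A B L using m_pos by (simp add: algebra_simps)
    then show ?thesis unfolding mult.left_commute[of m] by (simp only:)
  qed
  finally show ?thesis using m_pos by simp
qed

text \<open>The Poincare inequality for the identity function on the slice. The slice inherits the
  curvature bound, hence property (tau) with the same \<epsilon>.\<close>

lemma variance:
  "(\<integral>t. (t - avg k (\<lambda>y. y $ k * F y) x / m)\<^sup>2 * F (upd k x t) \<partial>gauss1) \<le> m / \<epsilon>"
proof -
  interpret prob_space \<nu> by (rule prob_\<nu>)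
  define b where "b = (\<integral>t. t \<partial>\<nu>)"
  have b: "b = avg k (\<lambda>y. y $ k * F y) x / m" unfolding b_def \<nu>_mean ..
  have tau: "property_tau \<epsilon> \<nu>"
    unfolding \<nu>_def
  proof (rule property_tau_density[OF gaussian_PL_gauss1])
    fix t t' :: real
    let ?z = "(1/2) *\<^sub>R (t + t')"
    have d: "t - ?z = (t - t') / 2" "t' - ?z = - ((t - t') / 2)" by (simp_all add: field_simps)
    have "q t * q t' \<le> (q ?z * exp (s ?z * (t - ?z) + (1 - \<epsilon>) / 2 * (t - ?z)\<^sup>2)) * (q ?z * exp (s ?z * (t' - ?z) + (1 - \<epsilon>) / 2 * (t' - ?z)\<^sup>2))"
      using q_conc[of t ?z] q_conc[of t' ?z] q_pos by (intro mult_mono) (auto simp: less_imp_le)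
    also have "\<dots> = (q ?z)\<^sup>2 * exp ((s ?z * (t - ?z) + (1 - \<epsilon>) / 2 * (t - ?z)\<^sup>2) + (s ?z * (t' - ?z) + (1 - \<epsilon>) / 2 * (t' - ?z)\<^sup>2))"
      unfolding exp_add by (simp add: power2_eq_square mult_ac)
    also have "(s ?z * (t - ?z) + (1 - \<epsilon>) / 2 * (t - ?z)\<^sup>2) + (s ?z * (t' - ?z) + (1 - \<epsilon>) / 2 * (t' - ?z)\<^sup>2) = (1 - \<epsilon>) / 4 * (norm (t - t'))\<^sup>2"
      unfolding d by (simp add: power_divide field_simps)
    finally show "q t * q t' \<le> (q ?z)\<^sup>2 * exp ((1 - \<epsilon>) / 4 * (norm (t - t'))\<^sup>2)" .
  qed (use q_pos q_mass in \<open>auto simp: less_imp_le\<close>)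
  have i1: "integrable \<nu> (\<lambda>t. t)"
    by (rule integral_\<nu>) (auto intro: slice_integrable)
  have "(\<integral>t. t\<^sup>2 \<partial>\<nu>) - (\<integral>t. t \<partial>\<nu>)\<^sup>2 \<le> (\<integral>t. (norm (1::real))\<^sup>2 \<partial>\<nu>) / \<epsilon>"
  proof (rule poincare_property_tau[OF tau \<epsilon>(1) prob_\<nu>])
    show "sets \<nu> = sets borel" by (simp add: \<nu>_def)
  qed (use \<nu>_second_moment in \<open>auto simp: inner_real_def\<close>)
  then have "(\<integral>t. (t - b)\<^sup>2 \<partial>\<nu>) \<le> 1 / \<epsilon>"
    using variance_eq[OF i1 \<nu>_second_moment] prob_space by (simp add: b_def)
  moreover have "(\<integral>t. (t - b)\<^sup>2 \<partial>\<nu>) = (\<integral>t. (t - b)\<^sup>2 * F (upd k x t) \<partial>gauss1) / m"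
  proof (rule integral_\<nu>)
    have "(t - b)\<^sup>2 * F (upd k x t) = t\<^sup>2 * F (upd k x t) - 2 * b * (t * F (upd k x t)) + b\<^sup>2 * F (upd k x t)" for t
      by (simp add: power2_eq_square algebra_simps)
    then show "integrable gauss1 (\<lambda>t. (t - b)\<^sup>2 * F (upd k x t))" using slice_integrable(1-3) by simp
  qed measurable
  ultimately show ?thesis using m_pos unfolding b by (simp add: pos_divide_le_eq mult.commute)
qed

end

end

lemma upd_invariant_imp_const:
  fixes F :: "real^'n::finite \<Rightarrow> 'b"
  assumes "\<And>k x t. F (upd k x t) = F x"
  shows "F x = F 0"
proof -
  have "F (\<chi> i. if i \<in> T then 0 else x $ i) = F x" if "finite T" for T
    using that
  proof (induction T rule: finite_induct)
    case (insert k T)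
    have "(\<chi> i. if i \<in> insert k T then 0 else x $ i) = upd k (\<chi> i. if i \<in> T then 0 else x $ i) 0"
      by (auto simp: vec_eq_iff)
    then show ?case using insert.IH by (simp only: assms)
  qed (simp add: vec_lambda_eta)
  from this[of UNIV] show ?thesis by (simp add: zero_vec_def)
qed

lemma nice_integrable:
  fixes F :: "real^'n::finite \<Rightarrow> real"
  assumes "nice F D"
  shows "integrable gauss F" "integrable gauss (\<lambda>x. F x * ln (F x))" "integrable gauss (\<lambda>x. (norm (D x))\<^sup>2 / F x)"
    "integrable gauss (\<lambda>x. (norm (upd k (D x) 0))\<^sup>2 / F x)" "integrable gauss (\<lambda>x. (D x $ k)\<^sup>2 / F x)"
    "integrable gauss (\<lambda>x. x $ k * F x)" "integrable gauss (\<lambda>x. (x $ k)\<^sup>2 * F x)"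
    "integrable gauss D"
proof -
  note [measurable] = niceD(4,5)[OF assms]
  note g = niceD(6)[OF assms]
  show "integrable gauss F" by (rule integrable_gauss_growth[OF g]) measurable
  show "integrable gauss D" by (rule integrable_gauss_growth[OF niceD(7)[OF assms]]) measurable
  show "integrable gauss (\<lambda>x. F x * ln (F x))"
    by (rule integrable_gauss_growth[OF subgaussian_growth_mult_ln[OF g niceD(2)[OF assms]]]) measurable
  show "integrable gauss (\<lambda>x. (norm (D x))\<^sup>2 / F x)"
    by (rule integrable_gauss_growth[OF niceD(3)[OF assms]]) measurable
  show "integrable gauss (\<lambda>x. (norm (upd k (D x) 0))\<^sup>2 / F x)"
    by (rule integrable_gauss_growth[OF subgaussian_growth_fisher_part[OF assms norm_upd_0_le]]) measurable
  have "norm (D y $ k) \<le> norm (D y)" for y by (simp add: component_le_norm_cart)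
  from subgaussian_growth_fisher_part[OF assms this] have "subgaussian_growth (\<lambda>x. (D x $ k)\<^sup>2 / F x)" by simp
  then show "integrable gauss (\<lambda>x. (D x $ k)\<^sup>2 / F x)" by (rule integrable_gauss_growth) measurable
  show "integrable gauss (\<lambda>x. x $ k * F x)"
    using integrable_gauss_growth[OF subgaussian_growth_coord(1)[OF g]] by simp
  show "integrable gauss (\<lambda>x. (x $ k)\<^sup>2 * F x)"
    using integrable_gauss_growth[OF subgaussian_growth_coord(2)[OF g]] by simp
qed

lemma integrable_avg:
  fixes u :: "real^'n::finite \<Rightarrow> 'b::{banach, second_countable_topology}"
  assumes "subgaussian_growth u" and [measurable]: "u \<in> borel_measurable borel"
  shows "integrable gauss (avg k u)"
proof (rule integrable_gauss_growth[OF subgaussian_growth_avg[OF assms]])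
  show "avg k u \<in> borel_measurable borel" unfolding avg_def by measurable
qed

lemma measurable_avg [measurable]:
  fixes u :: "real^'n::finite \<Rightarrow> 'b::{banach, second_countable_topology}"
  assumes [measurable]: "u \<in> borel_measurable borel"
  shows "avg k u \<in> borel_measurable borel"
  unfolding avg_def by measurable

text \<open>Chain rule for entropy: the integrated entropies of the slices are the difference
  between the entropy of F and that of its average, so the one-dimensional log-Sobolev inequality
  integrates to this bound.\<close>

lemma slice_log_sobolev_integrated:
  fixes F :: "real^'n::finite \<Rightarrow> real"
  assumes "nice F D"
  shows "(\<integral>x. F x * ln (F x) \<partial>gauss) - (\<integral>x. avg k F x * ln (avg k F x) \<partial>gauss) \<le> (\<integral>x. (D x $ k)\<^sup>2 / F x \<partial>gauss) / 2"
proof -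
  note [measurable] = niceD(4,5)[OF assms]
  have "norm (D y $ k) \<le> norm (D y)" for y by (simp add: component_le_norm_cart)
  from subgaussian_growth_fisher_part[OF assms this] have gk: "subgaussian_growth (\<lambda>x. (D x $ k)\<^sup>2 / F x)" by simp
  have gl: "subgaussian_growth (\<lambda>x. F x * ln (F x))" by (rule subgaussian_growth_mult_ln[OF niceD(6,2)[OF assms]])
  have i1: "integrable gauss (avg k (\<lambda>y. F y * ln (F y)))" by (rule integrable_avg[OF gl]) measurable
  have i2: "integrable gauss (avg k (\<lambda>y. (D y $ k)\<^sup>2 / F y))" by (rule integrable_avg[OF gk]) measurable
  note i3 = nice_integrable(2)[OF nice_avg[OF assms, of k]]
  have "(\<integral>x. avg k (\<lambda>y. F y * ln (F y)) x - avg k F x * ln (avg k F x) \<partial>gauss) \<le> (\<integral>x. avg k (\<lambda>y. (D y $ k)\<^sup>2 / F y) x / 2 \<partial>gauss)"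
  proof (rule integral_mono)
    fix x :: "real^'n"
    interpret slice F D k x by unfold_locales (rule assms)
    show "avg k (\<lambda>y. F y * ln (F y)) x - avg k F x * ln (avg k F x) \<le> avg k (\<lambda>y. (D y $ k)\<^sup>2 / F y) x / 2"
      using log_sobolev by (simp add: m_def)
  qed (use i1 i2 i3 in auto)
  then show ?thesis
    using i1 i2 i3 integral_avg[OF nice_integrable(2)[OF assms], of k] integral_avg[OF nice_integrable(5)[OF assms], of k k] by simp
qed

lemma norm_upd_0_sq: "(norm (upd k v 0))\<^sup>2 = (norm v)\<^sup>2 - (v $ k)\<^sup>2"
  using norm_upd_sq[of k v "v $ k"] by simp

text \<open>Tensorisation by removing one active coordinate at a time. The k-th partial derivative
  pays for the entropy lost in averaging over k, and the others still dominate the Fisher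
  information of the average by \<open>avg_fisher_le\<close>. With no active coordinate left F is
  constant.\<close>

lemma log_sobolev_gauss_aux:
  fixes F :: "real^'n::finite \<Rightarrow> real"
  assumes "finite S" "nice F D" "\<And>k x t. k \<notin> S \<Longrightarrow> F (upd k x t) = F x"
  shows "(\<integral>x. F x * ln (F x) \<partial>gauss) - (\<integral>x. F x \<partial>gauss) * ln (\<integral>x. F x \<partial>gauss) \<le> (\<integral>x. (norm (D x))\<^sup>2 / F x \<partial>gauss) / 2"
  using assms
proof (induction S arbitrary: F D rule: finite_induct)
  case empty
  have c: "F x = F 0" for x by (rule upd_invariant_imp_const) (use empty in auto)
  obtain c0 where "F = (\<lambda>_. c0)" using c by (metis ext)
  then have "(\<integral>x. F x * ln (F x) \<partial>gauss) = c0 * ln c0" "(\<integral>x. F x \<partial>gauss) = c0"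
    using gauss.prob_space[where 'n='n] by simp_all
  moreover have "0 \<le> (\<integral>x. (norm (D x))\<^sup>2 / F x \<partial>gauss)" using niceD(2)[OF empty(1)] by (simp add: less_imp_le)
  ultimately show ?case by simp
next
  case (insert k S)
  note N = insert.prems(1)
  note [measurable] = niceD(4,5)[OF N]
  have "(\<integral>x. avg k F x * ln (avg k F x) \<partial>gauss) - (\<integral>x. avg k F x \<partial>gauss) * ln (\<integral>x. avg k F x \<partial>gauss)
      \<le> (\<integral>x. (norm (upd k (avg k D x) 0))\<^sup>2 / avg k F x \<partial>gauss) / 2"
  proof (rule insert.IH[OF nice_avg[OF N]])
    fix j x t assume "j \<notin> S"
    show "avg k F (upd j x t) = avg k F x"
    proof (cases "j = k")
      case False
      then show ?thesis using insert.prems(2)[of j] \<open>j \<notin> S\<close> by (simp add: avg_def upd_commute[of k j])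
    qed simp
  qed
  moreover have "(\<integral>x. avg k F x \<partial>gauss) = (\<integral>x. F x \<partial>gauss)" by (rule integral_avg[OF nice_integrable(1)[OF N]])
  moreover have "(\<integral>x. (norm (upd k (avg k D x) 0))\<^sup>2 / avg k F x \<partial>gauss) \<le> (\<integral>x. avg k (\<lambda>y. (norm (upd k (D y) 0))\<^sup>2 / F y) x \<partial>gauss)"
    by (rule integral_mono[OF nice_integrable(3)[OF nice_avg[OF N]] integrable_avg[OF subgaussian_growth_fisher_part[OF N norm_upd_0_le]] avg_fisher_le[OF N]]) measurable
  moreover have "(\<integral>x. avg k (\<lambda>y. (norm (upd k (D y) 0))\<^sup>2 / F y) x \<partial>gauss) = (\<integral>x. (norm (D x))\<^sup>2 / F x \<partial>gauss) - (\<integral>x. (D x $ k)\<^sup>2 / F x \<partial>gauss)"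
  proof -
    have "(\<integral>x. avg k (\<lambda>y. (norm (upd k (D y) 0))\<^sup>2 / F y) x \<partial>gauss) = (\<integral>x. (norm (upd k (D x) 0))\<^sup>2 / F x \<partial>gauss)"
      by (rule integral_avg[OF nice_integrable(4)[OF N]])
    also have "\<dots> = (\<integral>x. (norm (D x))\<^sup>2 / F x \<partial>gauss) - (\<integral>x. (D x $ k)\<^sup>2 / F x \<partial>gauss)"
      unfolding norm_upd_0_sq diff_divide_distrib
      by (rule Bochner_Integration.integral_diff[OF nice_integrable(3)[OF N] nice_integrable(5)[OF N]])
    finally show ?thesis .
  qed
  ultimately show ?case using slice_log_sobolev_integrated[OF N, of k] by simp
qed

theorem log_sobolev_gauss:
  fixes F :: "real^'n::finite \<Rightarrow> real"
  assumes "nice F D" "(\<integral>x. F x \<partial>gauss) = 1"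
  shows "(\<integral>x. F x * ln (F x) \<partial>gauss) \<le> (\<integral>x. (norm (D x))\<^sup>2 / F x \<partial>gauss) / 2"
  using log_sobolev_gauss_aux[OF _ assms(1), of UNIV] assms(2) by simp

text \<open>Conditioning on the coordinates other than k, under which h is a constant. Working with
  nonnegative integrals makes integrability part of the conclusion.\<close>

lemma integral_invariant_factor:
  fixes F h :: "real^'n::finite \<Rightarrow> real"
  assumes "nice F D" and [measurable]: "h \<in> borel_measurable borel" and nn: "\<And>x. 0 \<le> h x" and inv: "\<And>x t. h (upd k x t) = h x"
    and int: "integrable gauss (\<lambda>x. avg k F x * h x)"
  shows "integrable gauss (\<lambda>x. F x * h x)" "(\<integral>x. F x * h x \<partial>gauss) = (\<integral>x. avg k F x * h x \<partial>gauss)"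
proof -
  note [measurable] = niceD(4,5)[OF assms(1)]
  have pos: "0 \<le> F x" "0 \<le> avg k F x" for x using niceD(2)[OF assms(1), of x] avg_pos[OF assms(1), of k x] by auto
  have "(\<integral>\<^sup>+x. ennreal (F x * h x) \<partial>gauss) = (\<integral>\<^sup>+x. \<integral>\<^sup>+t. ennreal (F (upd k x t) * h (upd k x t)) \<partial>gauss1 \<partial>gauss)"
    by (rule nn_integral_gauss_resample[symmetric]) measurable
  also have "\<dots> = (\<integral>\<^sup>+x. ennreal (avg k F x * h x) \<partial>gauss)"
  proof (rule nn_integral_cong)
    fix x
    have "integrable gauss1 (\<lambda>t. F (upd k x t) * h x)" using integrable_slice[OF niceD(6)[OF assms(1)]] by simp
    then have "(\<integral>\<^sup>+t. ennreal (F (upd k x t) * h x) \<partial>gauss1) = ennreal (\<integral>t. F (upd k x t) * h x \<partial>gauss1)"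
      by (rule nn_integral_eq_integral) (use pos nn in auto)
    then show "(\<integral>\<^sup>+t. ennreal (F (upd k x t) * h (upd k x t)) \<partial>gauss1) = ennreal (avg k F x * h x)"
      by (simp add: inv avg_def)
  qed
  also have "\<dots> = ennreal (\<integral>x. avg k F x * h x \<partial>gauss)"
    by (rule nn_integral_eq_integral[OF int]) (use pos nn in auto)
  finally have e: "(\<integral>\<^sup>+x. ennreal (F x * h x) \<partial>gauss) = ennreal (\<integral>x. avg k F x * h x \<partial>gauss)" .
  have ge: "0 \<le> (\<integral>x. avg k F x * h x \<partial>gauss)" using pos nn by simp
  show "integrable gauss (\<lambda>x. F x * h x)"
    by (rule integrableI_nonneg) (use e pos nn in auto)
  show "(\<integral>x. F x * h x \<partial>gauss) = (\<integral>x. avg k F x * h x \<partial>gauss)"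
    by (rule integral_eq_nn_integral[THEN trans]) (use e ge pos nn in auto)
qed

lemma integrable_avg':
  fixes u :: "real^'n::finite \<Rightarrow> 'b::{banach, second_countable_topology}"
  assumes "integrable gauss u"
  shows "integrable gauss (avg k u)"
proof -
  interpret pair_sigma_finite "gauss :: (real^'n) measure" gauss1 ..
  have m: "(\<lambda>(x, t). upd k x t) \<in> measurable (gauss \<Otimes>\<^sub>M gauss1) borel" by measurable
  have "integrable (gauss \<Otimes>\<^sub>M gauss1) (\<lambda>z. u (case z of (x, t) \<Rightarrow> upd k x t))"
    by (rule integrable_distr[OF m]) (simp add: distr_gauss_resample assms)
  from integrable_fst'[OF this] show ?thesis by (simp add: avg_def[abs_def])
qed

lemma norm_mono_real: "0 \<le> a \<Longrightarrow> a \<le> b \<Longrightarrow> norm a \<le> norm (b::real)"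
  by simp

text \<open>Cauchy-Schwarz with weights F and 1 / F, stated with an upper bound X in place of the
  first integral.\<close>

lemma norm_integral_weighted_sq_le:
  fixes v :: "'a \<Rightarrow> 'b::{banach, second_countable_topology}" and F w :: "'a \<Rightarrow> real"
  assumes pos: "\<And>x. F x > 0" and i1: "integrable M (\<lambda>x. (w x)\<^sup>2 * F x)" and i2: "integrable M (\<lambda>x. (norm (v x))\<^sup>2 / F x)"
    and X: "(\<integral>x. (w x)\<^sup>2 * F x \<partial>M) \<le> X" "0 < X"
  shows "(norm (\<integral>x. w x *\<^sub>R v x \<partial>M))\<^sup>2 \<le> X * (\<integral>x. (norm (v x))\<^sup>2 / F x \<partial>M)"
proof -
  define N where "N = norm (\<integral>x. w x *\<^sub>R v x \<partial>M)"
  define Y where "Y = (\<integral>x. (norm (v x))\<^sup>2 / F x \<partial>M)"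
  have Y: "Y \<ge> 0" unfolding Y_def using pos by (simp add: less_imp_le)
  show ?thesis
  proof (cases "N = 0")
    case True then show ?thesis using Y X unfolding N_def[symmetric] Y_def[symmetric] by simp
  next
    case False
    then have N: "N > 0" unfolding N_def by simp
    \<comment> \<open>With this parameter in Young's inequality the first term becomes N / 2, which
      is absorbed into the left side.\<close>
    define l where "l = N / X"
    have l: "l > 0" using N X by (simp add: l_def)
    define P where "P x = (w x)\<^sup>2 * F x" for x
    define Q where "Q x = (norm (v x))\<^sup>2 / F x" for x
    have PQ: "integrable M P" "integrable M Q" "0 \<le> P x" "0 \<le> Q x" for x
      using i1 i2 pos[of x] by (auto simp: P_def[abs_def] Q_def[abs_def])
    have le: "\<bar>w x\<bar> * norm (v x) \<le> l / 2 * P x + 1 / (2 * l) * Q x" for x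
    proof -
      have "0 \<le> (l * (\<bar>w x\<bar> * F x) - norm (v x))\<^sup>2 / (2 * l * F x)" using l pos[of x] by simp
      also have "\<dots> = l / 2 * P x + 1 / (2 * l) * Q x - \<bar>w x\<bar> * norm (v x)"
        using l pos[of x] unfolding P_def Q_def
        by (simp add: power2_diff power_mult_distrib add_divide_distrib diff_divide_distrib) (simp add: power2_eq_square)
      finally show ?thesis by simp
    qed
    have iPQ: "integrable M (\<lambda>x. l / 2 * P x + 1 / (2 * l) * Q x)"
      by (intro Bochner_Integration.integrable_add integrable_mult_right PQ)
    have "N \<le> (\<integral>x. norm (w x *\<^sub>R v x) \<partial>M)" unfolding N_def by (rule integral_norm_bound)
    also have "\<dots> \<le> (\<integral>x. l / 2 * P x + 1 / (2 * l) * Q x \<partial>M)"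
    proof (rule integral_mono_AE'[OF iPQ])
      show "AE x in M. 0 \<le> l / 2 * P x + 1 / (2 * l) * Q x"
        using l PQ by (intro AE_I2 add_nonneg_nonneg mult_nonneg_nonneg) auto
    qed (use le in auto)
    also have "\<dots> = l / 2 * (\<integral>x. P x \<partial>M) + 1 / (2 * l) * (\<integral>x. Q x \<partial>M)" using PQ by simp
    also have "\<dots> = l / 2 * (\<integral>x. (w x)\<^sup>2 * F x \<partial>M) + 1 / (2 * l) * Y" by (simp add: P_def[abs_def] Q_def[abs_def] Y_def)
    also have "\<dots> \<le> l / 2 * X + 1 / (2 * l) * Y" using X l by (intro add_right_mono mult_left_mono) auto
    also have "\<dots> = N / 2 + X * Y / (2 * N)" using X by (simp add: l_def)
    finally have "N / 2 \<le> X * Y / (2 * N)" by simp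
    then have "N * N \<le> X * Y" using N by (simp add: field_simps)
    then show ?thesis unfolding N_def[symmetric] Y_def[symmetric] by (simp add: power2_eq_square)
  qed
qed

section \<open>Fisher information is controlled by the deficit\<close>

text \<open>Both end points are compared with the midpoint: the linear terms cancel and two
  quadratic terms at half the distance remain.\<close>

lemma semiconcave_midpoint:
  fixes F :: "'a::real_inner \<Rightarrow> real"
  assumes nn: "\<And>x. 0 \<le> F x" and conc: "\<And>x y. F y \<le> F x * exp (s x \<bullet> (y - x) + (1 - \<epsilon>) / 2 * (norm (y - x))\<^sup>2)"
  shows "F x * F y \<le> (F ((1/2) *\<^sub>R (x + y)))\<^sup>2 * exp ((1 - \<epsilon>) / 4 * (norm (x - y))\<^sup>2)"
proof -
  let ?z = "(1/2) *\<^sub>R (x + y)"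
  define w where "w = (1/2) *\<^sub>R (x - y)"
  have "w + ?z = (1/2) *\<^sub>R (x + x)" "?z - w = (1/2) *\<^sub>R (y + y)"
    unfolding w_def scaleR_add_right[symmetric] scaleR_diff_right[symmetric] by simp_all
  then have "w + ?z = x" "?z - w = y" by (simp_all only: scaleR_half_double)
  then have d: "x - ?z = w" "y - ?z = - w" by (auto simp: algebra_simps)
  have nw: "(norm w)\<^sup>2 = (norm (x - y))\<^sup>2 / 4" unfolding w_def by (simp add: power_mult_distrib power_divide)
  have "F x * F y \<le> (F ?z * exp (s ?z \<bullet> (x - ?z) + (1 - \<epsilon>) / 2 * (norm (x - ?z))\<^sup>2)) * (F ?z * exp (s ?z \<bullet> (y - ?z) + (1 - \<epsilon>) / 2 * (norm (y - ?z))\<^sup>2))"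
    using nn by (intro mult_mono conc) auto
  also have "\<dots> = (F ?z)\<^sup>2 * exp ((s ?z \<bullet> (x - ?z) + (1 - \<epsilon>) / 2 * (norm (x - ?z))\<^sup>2) + (s ?z \<bullet> (y - ?z) + (1 - \<epsilon>) / 2 * (norm (y - ?z))\<^sup>2))"
    unfolding exp_add by (simp add: power2_eq_square mult_ac)
  also have "(s ?z \<bullet> (x - ?z) + (1 - \<epsilon>) / 2 * (norm (x - ?z))\<^sup>2) + (s ?z \<bullet> (y - ?z) + (1 - \<epsilon>) / 2 * (norm (y - ?z))\<^sup>2) = (1 - \<epsilon>) / 4 * (norm (x - y))\<^sup>2"
    unfolding d norm_minus_cancel nw inner_minus_right by (simp add: field_simps)
  finally show ?thesis .
qed

lemma borel_measurable_gauss: "borel_measurable (gauss :: (real^'n::finite) measure) = borel_measurable borel"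
  by (rule measurable_cong_sets) simp_all

lemma weighted_poincare:
  fixes f u :: "real^'n::finite \<Rightarrow> real" and G :: "real^'n \<Rightarrow> real^'n"
  assumes [measurable]: "f \<in> borel_measurable borel" and nn: "\<And>x. 0 \<le> f x" and mass: "(\<integral>\<^sup>+x. ennreal (f x) \<partial>gauss) = 1" and \<epsilon>: "0 < \<epsilon>"
    and mid: "\<And>x y. f x * f y \<le> (f ((1/2) *\<^sub>R (x + y)))\<^sup>2 * exp ((1 - \<epsilon>) / 4 * (norm (x - y))\<^sup>2)"
    and der: "\<And>x. (u has_derivative (\<lambda>v. G x \<bullet> v)) (at x)" and cont: "continuous_on UNIV G"
    and i: "integrable gauss (\<lambda>x. f x * (u x)\<^sup>2)" "integrable gauss (\<lambda>x. f x * (norm (G x))\<^sup>2)"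
  shows "(\<integral>x. f x * (u x)\<^sup>2 \<partial>gauss) - (\<integral>x. f x * u x \<partial>gauss)\<^sup>2 \<le> (\<integral>x. f x * (norm (G x))\<^sup>2 \<partial>gauss) / \<epsilon>"
proof -
  define \<nu> where "\<nu> = density gauss (\<lambda>x. ennreal (f x))"
  have \<nu>: "prob_space \<nu>" "sets \<nu> = sets borel"
    by (auto intro!: prob_spaceI simp: \<nu>_def emeasure_density mass)
  have tau: "property_tau \<epsilon> \<nu>"
    unfolding \<nu>_def
  proof (rule property_tau_density[OF gaussian_PL_gauss])
    show "f x * f y \<le> (f ((1/2) *\<^sub>R (x + y)))\<^sup>2 * exp ((1 - \<epsilon>) / 4 * (norm (x - y))\<^sup>2)" for x y by (rule mid)
  qed (simp_all add: nn mass)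
  have int: "integrable \<nu> h \<longleftrightarrow> integrable gauss (\<lambda>x. f x * h x)" "(\<integral>x. h x \<partial>\<nu>) = (\<integral>x. f x * h x \<partial>gauss)"
    if [measurable]: "h \<in> borel_measurable borel" for h :: "real^'n \<Rightarrow> real"
  proof -
    have m: "h \<in> borel_measurable gauss" "f \<in> borel_measurable gauss"
      unfolding borel_measurable_gauss by (rule that, rule assms(1))
    have p: "AE x in gauss. 0 \<le> f x" by (rule AE_I2) (rule nn)
    show "integrable \<nu> h \<longleftrightarrow> integrable gauss (\<lambda>x. f x * h x)" "(\<integral>x. h x \<partial>\<nu>) = (\<integral>x. f x * h x \<partial>gauss)"
      using integrable_density[OF m p] integral_density[OF m p] by (simp_all add: \<nu>_def)
  qed
  have contu: "continuous_on UNIV u" using der has_derivative_continuous_on[of UNIV u "\<lambda>x v. G x \<bullet> v"] by simp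
  have [measurable]: "u \<in> borel_measurable borel" "G \<in> borel_measurable borel"
    using contu cont by (auto intro: borel_measurable_continuous_onI)
  have "integrable \<nu> (\<lambda>x. (u x)\<^sup>2)" "integrable \<nu> (\<lambda>x. (norm (G x))\<^sup>2)"
    by (subst int(1); use i in simp)+
  from poincare_property_tau[OF tau \<epsilon> \<nu> der cont this]
  show ?thesis by (simp add: int(2))
qed

text \<open>The condition \<open>conc\<close> says that - log f has Hessian at least -(1 -
  \<epsilon>), in integrated form and hence without second derivatives.\<close>

locale semiconcave_density =
  fixes f :: "real^'n::finite \<Rightarrow> real" and D :: "real^'n \<Rightarrow> real^'n" and \<epsilon> :: real
  assumes nice: "nice f D" and \<epsilon>: "0 < \<epsilon>" "\<epsilon> \<le> 1"
    and conc: "\<And>x y. f y \<le> f x * exp (D x \<bullet> (y - x) / f x + (1 - \<epsilon>) / 2 * (norm (y - x))\<^sup>2)"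
    and mass: "(\<integral>x. f x \<partial>gauss) = 1"
begin

definition "deficit_value = (\<integral>x. (norm (D x))\<^sup>2 / f x \<partial>gauss) / 2 - (\<integral>x. f x * ln (f x) \<partial>gauss)"

lemma meas [measurable]: "f \<in> borel_measurable borel" "D \<in> borel_measurable borel"
  by (rule niceD[OF nice])+

lemma pos: "0 < f x" "0 \<le> f x" "f x \<noteq> 0"
  using niceD(2)[OF nice, of x] by auto

lemma avg_f_pos: "0 < avg k f x" "0 \<le> avg k f x" "avg k f x \<noteq> 0"
  using avg_pos[OF nice, of k x] by auto

lemma mass_nn: "(\<integral>\<^sup>+x. ennreal (f x) \<partial>gauss) = 1"
  using nn_integral_eq_integral[OF nice_integrable(1)[OF nice]] pos mass by simp

lemma midpoint: "f x * f y \<le> (f ((1/2) *\<^sub>R (x + y)))\<^sup>2 * exp ((1 - \<epsilon>) / 4 * (norm (x - y))\<^sup>2)"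
proof (rule semiconcave_midpoint)
  show "f y \<le> f x * exp ((D x /\<^sub>R f x) \<bullet> (y - x) + (1 - \<epsilon>) / 2 * (norm (y - x))\<^sup>2)" for x y
  proof -
    have "(D x /\<^sub>R f x) \<bullet> (y - x) = D x \<bullet> (y - x) / f x" unfolding inner_scaleR_left by (rule divide_inverse_commute[symmetric])
    then show ?thesis using conc[of y x] by simp
  qed
qed (rule pos)

lemma poincare:
  fixes u :: "real^'n \<Rightarrow> real" and G :: "real^'n \<Rightarrow> real^'n"
  assumes der: "\<And>x. (u has_derivative (\<lambda>v. G x \<bullet> v)) (at x)" and cont: "continuous_on UNIV G"
    and i: "integrable gauss (\<lambda>x. f x * (u x)\<^sup>2)" "integrable gauss (\<lambda>x. f x * (norm (G x))\<^sup>2)"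
  shows "(\<integral>x. f x * (u x)\<^sup>2 \<partial>gauss) - (\<integral>x. f x * u x \<partial>gauss)\<^sup>2 \<le> (\<integral>x. f x * (norm (G x))\<^sup>2 \<partial>gauss) / \<epsilon>"
  by (rule weighted_poincare[OF meas(1) pos(2) mass_nn \<epsilon>(1) midpoint der cont i])

text \<open>The conditional mean of coordinate k under f d\<gamma>, given the other
  coordinates.\<close>

definition "b k x = avg k (\<lambda>y. y $ k * f y) x / avg k f x"

text \<open>The score (logarithmic gradient) of the marginal of f in the other coordinates. It is
  also the conditional expectation of the corresponding part of the score of f.\<close>

definition "\<sigma> k x = (1 / avg k f x) *\<^sub>R upd k (avg k D x) 0"

text \<open>f times the squared deviation of the score in the other directions from its conditional
  expectation.\<close>

definition "gap k x = (norm (upd k (D x) 0 - f x *\<^sub>R \<sigma> k x))\<^sup>2 / f x"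

lemma meas_b [measurable]: "b k \<in> borel_measurable borel" "\<sigma> k \<in> borel_measurable borel"
proof -
  have "avg k f \<in> borel_measurable borel" "avg k D \<in> borel_measurable borel" "avg k (\<lambda>y. y $ k * f y) \<in> borel_measurable borel"
    by (rule measurable_avg, simp)+
  then show "b k \<in> borel_measurable borel" "\<sigma> k \<in> borel_measurable borel"
    unfolding b_def[abs_def] \<sigma>_def[abs_def]
    by (intro borel_measurable_divide borel_measurable_scaleR measurable_upd borel_measurable_const; simp)+
qed

lemma meas_gap [measurable]: "gap k \<in> borel_measurable borel"
  unfolding gap_def[abs_def] by measurable

lemma b_upd [simp]: "b k (upd k x t) = b k x" "\<sigma> k (upd k x t) = \<sigma> k x"
  by (simp_all add: b_def \<sigma>_def)

lemma integrable_avg_b_sq: "integrable gauss (\<lambda>x. avg k f x * (b k x)\<^sup>2)"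
proof (rule Bochner_Integration.integrable_bound)
  show "integrable gauss (avg k (\<lambda>y. (y $ k)\<^sup>2 * f y))" by (rule integrable_avg'[OF nice_integrable(7)[OF nice]])
  show "AE x in gauss. norm (avg k f x * (b k x)\<^sup>2) \<le> norm (avg k (\<lambda>y. (y $ k)\<^sup>2 * f y) x)"
  proof (rule AE_I2)
    fix x :: "real^'n"
    interpret slice f D k x by unfold_locales (rule nice)
    have sq: "(norm (t * f (upd k x t)))\<^sup>2 / f (upd k x t) = t\<^sup>2 * f (upd k x t)" for t
      using pos(3)[of "upd k x t"] by (simp add: power2_eq_square)
    have "(norm (\<integral>t. t * f (upd k x t) \<partial>gauss1))\<^sup>2 \<le> (\<integral>t. f (upd k x t) \<partial>gauss1) * (\<integral>t. (norm (t * f (upd k x t)))\<^sup>2 / f (upd k x t) \<partial>gauss1)"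
    proof (rule norm_integral_sq_le[OF slice_integrable(1) pos(1) gauss1.prob_space_axioms slice_integrable(2)])
      show "integrable gauss1 (\<lambda>t. (norm (t * f (upd k x t)))\<^sup>2 / f (upd k x t))"
        using slice_integrable(3) unfolding sq .
    qed
    also have "(\<integral>t. (norm (t * f (upd k x t)))\<^sup>2 / f (upd k x t) \<partial>gauss1) = avg k (\<lambda>y. (y $ k)\<^sup>2 * f y) x"
      unfolding avg_def sq by simp
    finally have "(avg k (\<lambda>y. y $ k * f y) x)\<^sup>2 \<le> avg k f x * avg k (\<lambda>y. (y $ k)\<^sup>2 * f y) x" by (simp add: avg_def)
    then have "avg k f x * (b k x)\<^sup>2 \<le> avg k (\<lambda>y. (y $ k)\<^sup>2 * f y) x"
      unfolding b_def using avg_f_pos[of k x] by (simp add: power_divide power2_eq_square pos_divide_le_eq mult_ac)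
    then show "norm (avg k f x * (b k x)\<^sup>2) \<le> norm (avg k (\<lambda>y. (y $ k)\<^sup>2 * f y) x)"
      using avg_f_pos[of k x] by simp
  qed
qed measurable

lemma integrable_b_sq: "integrable gauss (\<lambda>x. f x * (b k x)\<^sup>2)"
  by (rule integral_invariant_factor(1)[OF nice]) (auto intro: integrable_avg_b_sq)

lemma mean_b:
  shows "(\<integral>x. f x * b k x \<partial>gauss) = (\<integral>x. x $ k * f x \<partial>gauss)"
proof -
  have i: "integrable gauss (\<lambda>x. f x * b k x)"
  proof (rule Bochner_Integration.integrable_bound)
    show "integrable gauss (\<lambda>x. f x + f x * (b k x)\<^sup>2)" using nice_integrable(1)[OF nice] integrable_b_sq by simp
    have "\<bar>b k x\<bar> \<le> 1 + (b k x)\<^sup>2" for x using abs_mult_le_sum_squares[of 1 "b k x"] by simp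
    then have "f x * \<bar>b k x\<bar> \<le> f x * (1 + (b k x)\<^sup>2)" for x using pos by (intro mult_left_mono) auto
    then show "AE x in gauss. norm (f x * b k x) \<le> norm (f x + f x * (b k x)\<^sup>2)"
      using pos by (intro AE_I2) (simp add: abs_mult distrib_left)
  qed measurable
  have "(\<integral>x. f x * b k x \<partial>gauss) = (\<integral>x. avg k (\<lambda>y. f y * b k y) x \<partial>gauss)" by (rule integral_avg[OF i, symmetric])
  also have "(\<lambda>x. avg k (\<lambda>y. f y * b k y) x) = (\<lambda>x. avg k (\<lambda>y. y $ k * f y) x)"
  proof
    fix x
    have "avg k (\<lambda>y. f y * b k y) x = avg k f x * b k x" by (simp add: avg_def[of k "\<lambda>y. f y * b k y"] avg_def[of k f])
    also have "\<dots> = avg k (\<lambda>y. y $ k * f y) x" using avg_f_pos[of k x] by (simp add: b_def)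
    finally show "avg k (\<lambda>y. f y * b k y) x = avg k (\<lambda>y. y $ k * f y) x" .
  qed
  also have "(\<integral>x. avg k (\<lambda>y. y $ k * f y) x \<partial>gauss) = (\<integral>x. x $ k * f x \<partial>gauss)"
    by (rule integral_avg[OF nice_integrable(6)[OF nice]])
  finally show ?thesis .
qed

lemma integrable_score_defect: "integrable gauss (\<lambda>x. (D x $ k - b k x * f x)\<^sup>2 / f x)"
proof (rule Bochner_Integration.integrable_bound)
  show "integrable gauss (\<lambda>x. 2 * ((D x $ k)\<^sup>2 / f x) + 2 * (f x * (b k x)\<^sup>2))"
    by (intro Bochner_Integration.integrable_add integrable_mult_right nice_integrable(5)[OF nice] integrable_b_sq)
  have le: "(D x $ k - b k x * f x)\<^sup>2 / f x \<le> 2 * ((D x $ k)\<^sup>2 / f x) + 2 * (f x * (b k x)\<^sup>2)" for x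
  proof -
    have "(D x $ k - b k x * f x)\<^sup>2 \<le> 2 * (D x $ k)\<^sup>2 + 2 * (b k x * f x)\<^sup>2"
      using zero_le_power2[of "D x $ k + b k x * f x"] by (simp add: power2_diff power2_sum)
    then have "(D x $ k - b k x * f x)\<^sup>2 / f x \<le> (2 * (D x $ k)\<^sup>2 + 2 * (b k x * f x)\<^sup>2) / f x"
      by (rule divide_right_mono) (rule pos)
    also have "\<dots> = 2 * ((D x $ k)\<^sup>2 / f x) + 2 * (f x * (b k x)\<^sup>2)"
      using pos[of x] by (simp add: add_divide_distrib power2_eq_square mult_ac)
    finally show ?thesis .
  qed
  show "AE x in gauss. norm ((D x $ k - b k x * f x)\<^sup>2 / f x) \<le> norm (2 * ((D x $ k)\<^sup>2 / f x) + 2 * (f x * (b k x)\<^sup>2))"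
    by (rule AE_I2, rule norm_mono_real[OF _ le]) (simp add: pos(2))
qed measurable

text \<open>The slice estimate integrated over the other coordinates; the entropy terms combine by
  the chain rule.\<close>

lemma score_defect_le:
  "(\<integral>x. (D x $ k - b k x * f x)\<^sup>2 / f x \<partial>gauss) \<le> 4 / \<epsilon> * ((\<integral>x. (D x $ k)\<^sup>2 / f x \<partial>gauss) / 2
     - ((\<integral>x. f x * ln (f x) \<partial>gauss) - (\<integral>x. avg k f x * ln (avg k f x) \<partial>gauss)))"
proof -
  note i1 = nice_integrable(5)[OF nice, of k] and i2 = nice_integrable(2)[OF nice] and i3 = nice_integrable(2)[OF nice_avg[OF nice, of k]]
  have "(\<integral>x. (D x $ k - b k x * f x)\<^sup>2 / f x \<partial>gauss) = (\<integral>x. avg k (\<lambda>y. (D y $ k - b k y * f y)\<^sup>2 / f y) x \<partial>gauss)"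
    by (rule integral_avg[OF integrable_score_defect, symmetric])
  also have "\<dots> \<le> (\<integral>x. 4 / \<epsilon> * (avg k (\<lambda>y. (D y $ k)\<^sup>2 / f y) x / 2 - (avg k (\<lambda>y. f y * ln (f y)) x - avg k f x * ln (avg k f x))) \<partial>gauss)"
  proof (rule integral_mono)
    fix x :: "real^'n"
    interpret slice f D k x by unfold_locales (rule nice)
    show "avg k (\<lambda>y. (D y $ k - b k y * f y)\<^sup>2 / f y) x \<le> 4 / \<epsilon> * (avg k (\<lambda>y. (D y $ k)\<^sup>2 / f y) x / 2 - (avg k (\<lambda>y. f y * ln (f y)) x - avg k f x * ln (avg k f x)))"
      unfolding b_def using stability[OF \<epsilon> conc] unfolding m_def .
  qed (use integrable_avg'[OF i1] integrable_avg'[OF i2] integrable_avg'[OF integrable_score_defect] i3 in auto)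
  also have "\<dots> = 4 / \<epsilon> * ((\<integral>x. (D x $ k)\<^sup>2 / f x \<partial>gauss) / 2
     - ((\<integral>x. f x * ln (f x) \<partial>gauss) - (\<integral>x. avg k f x * ln (avg k f x) \<partial>gauss)))"
    using integrable_avg'[OF i1] integrable_avg'[OF i2] i3 by (simp add: integral_avg[OF i1] integral_avg[OF i2])
  finally show ?thesis .
qed

end

lemma norm_diff_scaleR_sq_divide:
  fixes p s :: "'a::real_inner"
  assumes "c \<noteq> 0"
  shows "(norm (p - c *\<^sub>R s))\<^sup>2 / c = (norm p)\<^sup>2 / c - 2 * (s \<bullet> p) + c * (norm s)\<^sup>2"
proof -
  have "(norm (p - c *\<^sub>R s))\<^sup>2 = (norm p)\<^sup>2 - 2 * (c * (s \<bullet> p)) + c * (c * (norm s)\<^sup>2)"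
    unfolding power2_norm_eq_inner inner_diff_left inner_diff_right inner_scaleR_left inner_scaleR_right
    by (simp add: inner_commute[of p s] right_diff_distrib)
  then show ?thesis using assms by (simp add: add_divide_distrib diff_divide_distrib)
qed

context semiconcave_density
begin

lemma integrable_avg_sigma_sq:
  "integrable gauss (\<lambda>x. avg k f x * (norm (\<sigma> k x))\<^sup>2)"
  "(\<integral>x. avg k f x * (norm (\<sigma> k x))\<^sup>2 \<partial>gauss) = (\<integral>x. (norm (upd k (avg k D x) 0))\<^sup>2 / avg k f x \<partial>gauss)"
proof -
  have "avg k f x * (norm (\<sigma> k x))\<^sup>2 = (norm (upd k (avg k D x) 0))\<^sup>2 / avg k f x" for x
    using avg_f_pos[of k x] by (simp add: \<sigma>_def power_mult_distrib power_divide power2_eq_square[of "avg k f x"])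
  then show "integrable gauss (\<lambda>x. avg k f x * (norm (\<sigma> k x))\<^sup>2)"
    "(\<integral>x. avg k f x * (norm (\<sigma> k x))\<^sup>2 \<partial>gauss) = (\<integral>x. (norm (upd k (avg k D x) 0))\<^sup>2 / avg k f x \<partial>gauss)"
    using nice_integrable(3)[OF nice_avg[OF nice, of k]] by simp_all
qed

lemma integral_sigma_sq:
  "integrable gauss (\<lambda>x. f x * (norm (\<sigma> k x))\<^sup>2)"
  "(\<integral>x. f x * (norm (\<sigma> k x))\<^sup>2 \<partial>gauss) = (\<integral>x. (norm (upd k (avg k D x) 0))\<^sup>2 / avg k f x \<partial>gauss)"
proof -
  have m: "(\<lambda>x. (norm (\<sigma> k x))\<^sup>2) \<in> borel_measurable borel" by measurable
  note F = integral_invariant_factor[OF nice m zero_le_power2 _ integrable_avg_sigma_sq(1), simplified]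
  show "integrable gauss (\<lambda>x. f x * (norm (\<sigma> k x))\<^sup>2)" by (rule F(1))
  show "(\<integral>x. f x * (norm (\<sigma> k x))\<^sup>2 \<partial>gauss) = (\<integral>x. (norm (upd k (avg k D x) 0))\<^sup>2 / avg k f x \<partial>gauss)"
    unfolding integrable_avg_sigma_sq(2)[symmetric] by (rule F(2))
qed

lemma integral_sigma_inner:
  "integrable gauss (\<lambda>x. \<sigma> k x \<bullet> upd k (D x) 0)"
  "(\<integral>x. \<sigma> k x \<bullet> upd k (D x) 0 \<partial>gauss) = (\<integral>x. (norm (upd k (avg k D x) 0))\<^sup>2 / avg k f x \<partial>gauss)"
proof -
  show i: "integrable gauss (\<lambda>x. \<sigma> k x \<bullet> upd k (D x) 0)"
  proof (rule Bochner_Integration.integrable_bound)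
    show "integrable gauss (\<lambda>x. f x * (norm (\<sigma> k x))\<^sup>2 + (norm (upd k (D x) 0))\<^sup>2 / f x)"
      by (intro Bochner_Integration.integrable_add integral_sigma_sq(1) nice_integrable(4)[OF nice])
    have "\<bar>\<sigma> k x \<bullet> upd k (D x) 0\<bar> \<le> f x * (norm (\<sigma> k x))\<^sup>2 + (norm (upd k (D x) 0))\<^sup>2 / f x" for x
    proof -
      have s: "sqrt (f x) > 0" "(sqrt (f x))\<^sup>2 = f x" using pos[of x] by simp_all
      have "\<bar>\<sigma> k x \<bullet> upd k (D x) 0\<bar> \<le> norm (\<sigma> k x) * norm (upd k (D x) 0)" by (rule Cauchy_Schwarz_ineq2)
      also have "\<dots> = \<bar>(sqrt (f x) * norm (\<sigma> k x)) * (norm (upd k (D x) 0) / sqrt (f x))\<bar>" using s(1) by simp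
      also have "\<dots> \<le> (sqrt (f x) * norm (\<sigma> k x))\<^sup>2 + (norm (upd k (D x) 0) / sqrt (f x))\<^sup>2" by (rule abs_mult_le_sum_squares)
      also have "\<dots> = f x * (norm (\<sigma> k x))\<^sup>2 + (norm (upd k (D x) 0))\<^sup>2 / f x"
        unfolding power_mult_distrib power_divide s(2) ..
      finally show ?thesis .
    qed
    then show "AE x in gauss. norm (\<sigma> k x \<bullet> upd k (D x) 0) \<le> norm (f x * (norm (\<sigma> k x))\<^sup>2 + (norm (upd k (D x) 0))\<^sup>2 / f x)"
      by (intro AE_I2 order.trans[OF _ norm_ge_zero[THEN abs_of_nonneg, THEN eq_refl]]) (metis abs_ge_self order.trans real_norm_def)
  qed measurable
  have "(\<integral>x. \<sigma> k x \<bullet> upd k (D x) 0 \<partial>gauss) = (\<integral>x. avg k (\<lambda>y. \<sigma> k y \<bullet> upd k (D y) 0) x \<partial>gauss)"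
    by (rule integral_avg[OF i, symmetric])
  also have "(\<lambda>x. avg k (\<lambda>y. \<sigma> k y \<bullet> upd k (D y) 0) x) = (\<lambda>x. (norm (upd k (avg k D x) 0))\<^sup>2 / avg k f x)"
  proof
    fix x
    have iD: "integrable gauss1 (\<lambda>t. D (upd k x t))" by (rule integrable_slice[OF niceD(7)[OF nice] meas(2)])
    have "avg k (\<lambda>y. \<sigma> k y \<bullet> upd k (D y) 0) x = \<sigma> k x \<bullet> (\<integral>t. upd k (D (upd k x t)) 0 \<partial>gauss1)"
      unfolding avg_def[of k "\<lambda>y. \<sigma> k y \<bullet> upd k (D y) 0"] b_upd
      by (rule integral_inner_right) (rule integrable_bounded_linear[OF bounded_linear_upd_0 iD])
    also have "\<dots> = \<sigma> k x \<bullet> upd k (avg k D x) 0" by (simp only: upd_0_avg[OF iD])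
    also have "\<dots> = (norm (upd k (avg k D x) 0))\<^sup>2 / avg k f x" by (simp add: \<sigma>_def power2_norm_eq_inner)
    finally show "avg k (\<lambda>y. \<sigma> k y \<bullet> upd k (D y) 0) x = (norm (upd k (avg k D x) 0))\<^sup>2 / avg k f x" .
  qed
  finally show "(\<integral>x. \<sigma> k x \<bullet> upd k (D x) 0 \<partial>gauss) = (\<integral>x. (norm (upd k (avg k D x) 0))\<^sup>2 / avg k f x \<partial>gauss)" .
qed

text \<open>Pythagoras: as \<open>\<sigma>\<close> is a conditional expectation, the mean squared
  deviation from it is the Fisher information in the other directions minus that of the
  marginal.\<close>

lemma integral_gap:
  "integrable gauss (gap k)"
  "(\<integral>x. gap k x \<partial>gauss) = (\<integral>x. (norm (upd k (D x) 0))\<^sup>2 / f x \<partial>gauss) - (\<integral>x. (norm (upd k (avg k D x) 0))\<^sup>2 / avg k f x \<partial>gauss)"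
proof -
  have e: "gap k x = (norm (upd k (D x) 0))\<^sup>2 / f x - 2 * (\<sigma> k x \<bullet> upd k (D x) 0) + f x * (norm (\<sigma> k x))\<^sup>2" for x
    unfolding gap_def by (rule norm_diff_scaleR_sq_divide[OF pos(3)])
  then have e': "gap k = (\<lambda>x. (norm (upd k (D x) 0))\<^sup>2 / f x - 2 * (\<sigma> k x \<bullet> upd k (D x) 0) + f x * (norm (\<sigma> k x))\<^sup>2)" by auto
  note i = nice_integrable(4)[OF nice, of k] integrable_mult_right[OF integral_sigma_inner(1), of 2 k] integral_sigma_sq(1)[of k]
  show "integrable gauss (gap k)"
    unfolding e' by (intro Bochner_Integration.integrable_add Bochner_Integration.integrable_diff i)
  have "(\<integral>x. gap k x \<partial>gauss) = (\<integral>x. (norm (upd k (D x) 0))\<^sup>2 / f x \<partial>gauss) - (\<integral>x. 2 * (\<sigma> k x \<bullet> upd k (D x) 0) \<partial>gauss) + (\<integral>x. f x * (norm (\<sigma> k x))\<^sup>2 \<partial>gauss)"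
    unfolding e by (simp only: Bochner_Integration.integral_add[OF Bochner_Integration.integrable_diff[OF i(1,2)] i(3)] Bochner_Integration.integral_diff[OF i(1,2)])
  then show "(\<integral>x. gap k x \<partial>gauss) = (\<integral>x. (norm (upd k (D x) 0))\<^sup>2 / f x \<partial>gauss) - (\<integral>x. (norm (upd k (avg k D x) 0))\<^sup>2 / avg k f x \<partial>gauss)"
    unfolding integral_sigma_sq(2) by (simp add: integral_sigma_inner(2))
qed

text \<open>Splitting off the direction \<open>k\<close>: the log-Sobolev inequality for the marginal of \<open>f\<close> in the
  other directions leaves the two terms on the left.\<close>

lemma deficit_split:
  "\<epsilon> / 4 * (\<integral>x. (D x $ k - b k x * f x)\<^sup>2 / f x \<partial>gauss) + (\<integral>x. gap k x \<partial>gauss) / 2 \<le> deficit_value"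
proof -
  have ms: "(\<integral>x. avg k f x \<partial>gauss) = 1" using integral_avg[OF nice_integrable(1)[OF nice], of k] mass by simp
  have 1: "(\<integral>x. avg k f x * ln (avg k f x) \<partial>gauss) \<le> (\<integral>x. (norm (upd k (avg k D x) 0))\<^sup>2 / avg k f x \<partial>gauss) / 2"
    by (rule log_sobolev_gauss[OF nice_avg[OF nice] ms])
  have 2: "\<epsilon> / 4 * (\<integral>x. (D x $ k - b k x * f x)\<^sup>2 / f x \<partial>gauss) \<le> (\<integral>x. (D x $ k)\<^sup>2 / f x \<partial>gauss) / 2
     - ((\<integral>x. f x * ln (f x) \<partial>gauss) - (\<integral>x. avg k f x * ln (avg k f x) \<partial>gauss))"
    using mult_left_mono[OF score_defect_le[of k], of "\<epsilon> / 4"] \<epsilon> by simp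
  have 3: "(\<integral>x. (norm (D x))\<^sup>2 / f x \<partial>gauss) = (\<integral>x. (norm (upd k (D x) 0))\<^sup>2 / f x \<partial>gauss) + (\<integral>x. (D x $ k)\<^sup>2 / f x \<partial>gauss)"
    unfolding norm_upd_0_sq diff_divide_distrib
    by (simp add: Bochner_Integration.integral_diff[OF nice_integrable(3)[OF nice] nice_integrable(5)[OF nice]])
  have lin: "E + (Q - P) / 2 \<le> (Q + R) / 2 - L" if "a \<le> P / 2" "E \<le> R / 2 - (L - a)" for a E L P Q R :: real
    using that by (simp add: field_simps)
  show ?thesis unfolding deficit_value_def 3 integral_gap(2) by (rule lin[OF 1 2])
qed

lemma score_defect_nonneg: "0 \<le> (\<integral>x. (D x $ k - b k x * f x)\<^sup>2 / f x \<partial>gauss)"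
  using pos(2) by simp

lemma gap_nonneg: "0 \<le> gap k x"
  unfolding gap_def using pos(2) by simp

text \<open>The quotient rule for \<open>b\<close>. The term with \<open>axis k 1\<close>, the
  derivative of the factor y_k, is annihilated by the projection.\<close>

definition "grad_b k x = (1 / avg k f x) *\<^sub>R (upd k (avg k (\<lambda>y. (y $ k) *\<^sub>R D y + f y *\<^sub>R axis k 1) x) 0 - b k x *\<^sub>R upd k (avg k D x) 0)"

lemma c1_growth_coord: "c1_growth (\<lambda>y. y $ k * f y) (\<lambda>y. (y $ k) *\<^sub>R D y + f y *\<^sub>R axis k 1)"
  unfolding c1_growth_def
proof (intro conjI allI)
  note c = c1_growthD[OF niceD(1)[OF nice]]
  fix x
  show "((\<lambda>y. y $ k * f y) has_derivative (\<lambda>v. ((x $ k) *\<^sub>R D x + f x *\<^sub>R axis k 1) \<bullet> v)) (at x)"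
    by (rule has_derivative_eq_rhs[OF has_derivative_mult[OF bounded_linear.has_derivative[OF bounded_linear_vec_nth has_derivative_ident] c(1)]])
      (auto simp: fun_eq_iff inner_add_left inner_axis' mult_ac)
next
  note c = c1_growthD[OF niceD(1)[OF nice]]
  show "continuous_on UNIV (\<lambda>y. (y $ k) *\<^sub>R D y + f y *\<^sub>R axis k 1)"
    by (intro continuous_intros c)
  show "subgaussian_growth (\<lambda>y. y $ k * f y)" using subgaussian_growth_coord(1)[OF c(4), of k] by simp
  have "subgaussian_growth (\<lambda>y. f y *\<^sub>R axis k (1::real))"
    by (rule subgaussian_growth_mono[OF c(4)]) simp
  then show "subgaussian_growth (\<lambda>y. (y $ k) *\<^sub>R D y + f y *\<^sub>R axis k 1)"
    by (intro subgaussian_growth_add subgaussian_growth_coord c)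
qed

lemma b_has_derivative: "(b k has_derivative (\<lambda>v. grad_b k x \<bullet> v)) (at x)"
proof -
  note n = c1_growthD(1)[OF c1_growth_avg[OF c1_growth_coord[of k]], of k x]
  note d = c1_growthD(1)[OF c1_growth_avg[OF niceD(1)[OF nice]], of k x]
  show ?thesis unfolding b_def[abs_def]
    by (rule has_derivative_eq_rhs[OF has_derivative_divide'[OF n d avg_f_pos(3)]])
      (use avg_f_pos(3)[of k x] in \<open>simp add: fun_eq_iff grad_b_def b_def inner_diff_left power2_eq_square field_simps\<close>)
qed

lemma continuous_on_grad_b: "continuous_on UNIV (grad_b k)"
proof -
  note n = c1_growthD[OF c1_growth_avg[OF c1_growth_coord[of k]], of k]
  note d = c1_growthD[OF c1_growth_avg[OF niceD(1)[OF nice]], of k]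
  have "continuous_on UNIV (b k)" using b_has_derivative has_derivative_continuous_on[of UNIV "b k" "\<lambda>x v. grad_b k x \<bullet> v"] by simp
  then show ?thesis unfolding grad_b_def[abs_def]
    by (intro continuous_intros n d) (use avg_f_pos in auto)
qed

text \<open>The gradient of the conditional mean is the conditional covariance of \<open>y $ k\<close> and the score.\<close>

lemma norm_grad_b_le: "avg k f x * (norm (grad_b k x))\<^sup>2 \<le> avg k (gap k) x / \<epsilon>"
proof -
  interpret slice f D k x by unfold_locales (rule nice)
  let ?w = "\<lambda>t. t - b k x"
  let ?v = "\<lambda>t. upd k (D (upd k x t)) 0 - f (upd k x t) *\<^sub>R \<sigma> k x"
  have iD: "integrable gauss1 (\<lambda>t. upd k (D (upd k x t)) 0)"
    by (rule integrable_bounded_linear[OF bounded_linear_upd_0 slice_integrable(6)])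
  have itD: "integrable gauss1 (\<lambda>t. t *\<^sub>R upd k (D (upd k x t)) 0)"
    using integrable_bounded_linear[OF bounded_linear_upd_0 slice_integrable(7), of k] by (simp add: upd_scaleR_0)
  have if': "integrable gauss1 (\<lambda>t. f (upd k x t) *\<^sub>R \<sigma> k x)" "integrable gauss1 (\<lambda>t. (t * f (upd k x t)) *\<^sub>R \<sigma> k x)"
    using slice_integrable(1,2) by simp_all
  \<comment> \<open>Because the weight is centred on the slice, the multiple of f may be subtracted
    from the gradient without changing the covariance; this brings in \<open>gap\<close>.\<close>
  have mean0: "(\<integral>t. ?w t * f (upd k x t) \<partial>gauss1) = 0"
  proof -
    have "(\<integral>t. ?w t * f (upd k x t) \<partial>gauss1) = (\<integral>t. t * f (upd k x t) \<partial>gauss1) - b k x * (\<integral>t. f (upd k x t) \<partial>gauss1)"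
      unfolding left_diff_distrib using slice_integrable(1,2) by simp
    also have "\<dots> = avg k (\<lambda>y. y $ k * f y) x - b k x * avg k f x" by (simp add: avg_def)
    also have "\<dots> = 0" using avg_f_pos(3)[of k x] by (simp add: b_def)
    finally show ?thesis .
  qed
  have "(\<integral>t. ?w t *\<^sub>R ?v t \<partial>gauss1) = (\<integral>t. ?w t *\<^sub>R upd k (D (upd k x t)) 0 \<partial>gauss1)"
  proof -
    have s: "?w t *\<^sub>R ?v t = ?w t *\<^sub>R upd k (D (upd k x t)) 0 - (?w t * f (upd k x t)) *\<^sub>R \<sigma> k x" for t
      by (simp add: scaleR_diff_right)
    have "integrable gauss1 (\<lambda>t. ?w t *\<^sub>R upd k (D (upd k x t)) 0)"
      unfolding scaleR_diff_left by (intro Bochner_Integration.integrable_diff itD integrable_scaleR_right iD)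
    moreover have wi: "integrable gauss1 (\<lambda>t. ?w t * f (upd k x t))"
      unfolding left_diff_distrib by (intro Bochner_Integration.integrable_diff slice_integrable integrable_mult_right)
    moreover have "(\<integral>t. (?w t * f (upd k x t)) *\<^sub>R \<sigma> k x \<partial>gauss1) = 0"
      by (subst integral_scaleR_left) (use wi mean0 in auto)
    ultimately show ?thesis unfolding s
      by (subst Bochner_Integration.integral_diff) (auto intro: integrable_scaleR_left)
  qed
  also have "\<dots> = (\<integral>t. t *\<^sub>R upd k (D (upd k x t)) 0 \<partial>gauss1) - b k x *\<^sub>R (\<integral>t. upd k (D (upd k x t)) 0 \<partial>gauss1)"
    unfolding scaleR_diff_left using itD iD by simp
  also have "\<dots> = avg k f x *\<^sub>R grad_b k x"
  proof -
    have a: "upd k (t *\<^sub>R D (upd k x t) + f (upd k x t) *\<^sub>R axis k 1) 0 = t *\<^sub>R upd k (D (upd k x t)) 0" for t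
      by (auto simp: vec_eq_iff axis_def)
    have i: "integrable gauss1 (\<lambda>t. (\<lambda>y. (y $ k) *\<^sub>R D y + f y *\<^sub>R axis k (1::real)) (upd k x t))"
      using slice_integrable(1,7) by simp
    show ?thesis unfolding grad_b_def upd_0_avg[OF i] upd_0_avg[OF slice_integrable(6)] using avg_f_pos(3)[of k x] by (simp add: a)
  qed
  finally have g: "avg k f x *\<^sub>R grad_b k x = (\<integral>t. ?w t *\<^sub>R ?v t \<partial>gauss1)" ..
  have sv: "(norm (?v t))\<^sup>2 / f (upd k x t) = gap k (upd k x t)" for t unfolding gap_def by simp
  have ig: "integrable gauss1 (\<lambda>t. gap k (upd k x t))"
  proof -
    have e: "gap k (upd k x t) = (norm (upd k (D (upd k x t)) 0))\<^sup>2 / f (upd k x t) - 2 * (\<sigma> k x \<bullet> upd k (D (upd k x t)) 0) + f (upd k x t) * (norm (\<sigma> k x))\<^sup>2" for t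
      unfolding gap_def b_upd by (rule norm_diff_scaleR_sq_divide[OF pos(3)])
    have "integrable gauss1 (\<lambda>t. (norm (upd k (D (upd k x t)) 0))\<^sup>2 / f (upd k x t))"
      by (rule integrable_slice[OF subgaussian_growth_fisher_part[OF nice norm_upd_0_le]]) measurable
    then show ?thesis unfolding e
      by (intro Bochner_Integration.integrable_add Bochner_Integration.integrable_diff integrable_mult_right integrable_mult_left integrable_inner_right iD slice_integrable)
  qed
  \<comment> \<open>Cauchy-Schwarz for the covariance, with the conditional variance bounded by 1 /
    \<epsilon> through \<open>variance\<close>.\<close>
  have "(norm (\<integral>t. ?w t *\<^sub>R ?v t \<partial>gauss1))\<^sup>2 \<le> avg k f x / \<epsilon> * (\<integral>t. (norm (?v t))\<^sup>2 / f (upd k x t) \<partial>gauss1)"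
  proof (rule norm_integral_weighted_sq_le[OF pos(1)])
    have "?w t ^ 2 * f (upd k x t) = t\<^sup>2 * f (upd k x t) - 2 * b k x * (t * f (upd k x t)) + (b k x)\<^sup>2 * f (upd k x t)" for t
      by (simp add: power2_eq_square algebra_simps)
    then show "integrable gauss1 (\<lambda>t. ?w t ^ 2 * f (upd k x t))" using slice_integrable(1-3) by simp
    show "(\<integral>t. ?w t ^ 2 * f (upd k x t) \<partial>gauss1) \<le> avg k f x / \<epsilon>"
      using variance[OF \<epsilon> conc] unfolding m_def b_def .
    show "0 < avg k f x / \<epsilon>" using avg_f_pos \<epsilon> by simp
    show "integrable gauss1 (\<lambda>t. (norm (?v t))\<^sup>2 / f (upd k x t))" unfolding sv by (rule ig)
  qed
  then have "(avg k f x)\<^sup>2 * (norm (grad_b k x))\<^sup>2 \<le> avg k f x * (avg k (gap k) x / \<epsilon>)"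
    unfolding g[symmetric] sv by (simp add: power_mult_distrib avg_def[of k "gap k"])
  then have "avg k f x * (avg k f x * (norm (grad_b k x))\<^sup>2) \<le> avg k f x * (avg k (gap k) x / \<epsilon>)"
    by (simp add: power2_eq_square mult.assoc)
  then show ?thesis using avg_f_pos(1)[of k x] by (rule mult_left_le_imp_le)
qed

lemma grad_b_upd [simp]: "grad_b k (upd k x t) = grad_b k x"
  by (simp add: grad_b_def)

lemma integral_grad_b_le:
  "integrable gauss (\<lambda>x. f x * (norm (grad_b k x))\<^sup>2)"
  "(\<integral>x. f x * (norm (grad_b k x))\<^sup>2 \<partial>gauss) \<le> (\<integral>x. gap k x \<partial>gauss) / \<epsilon>"
proof -
  have mb [measurable]: "grad_b k \<in> borel_measurable borel" by (rule borel_measurable_continuous_onI[OF continuous_on_grad_b])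
  have mf: "avg k f \<in> borel_measurable gauss" unfolding borel_measurable_gauss by (rule measurable_avg[OF meas(1)])
  have i: "integrable gauss (\<lambda>x. avg k f x * (norm (grad_b k x))\<^sup>2)"
  proof (rule Bochner_Integration.integrable_bound)
    show "integrable gauss (\<lambda>x. avg k (gap k) x / \<epsilon>)" using integrable_avg'[OF integral_gap(1)] by simp
    show "AE x in gauss. norm (avg k f x * (norm (grad_b k x))\<^sup>2) \<le> norm (avg k (gap k) x / \<epsilon>)"
      by (rule AE_I2, rule norm_mono_real[OF _ norm_grad_b_le]) (simp add: avg_f_pos(2))
    show "(\<lambda>x. avg k f x * (norm (grad_b k x))\<^sup>2) \<in> borel_measurable gauss"
      using mf mb by (intro borel_measurable_times borel_measurable_power borel_measurable_norm) (simp_all add: borel_measurable_gauss)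
  qed
  have m2: "(\<lambda>x. (norm (grad_b k x))\<^sup>2) \<in> borel_measurable borel" by measurable
  note F = integral_invariant_factor[OF nice m2 zero_le_power2 _ i, simplified]
  show "integrable gauss (\<lambda>x. f x * (norm (grad_b k x))\<^sup>2)" by (rule F(1))
  have "(\<integral>x. f x * (norm (grad_b k x))\<^sup>2 \<partial>gauss) = (\<integral>x. avg k f x * (norm (grad_b k x))\<^sup>2 \<partial>gauss)" by (rule F(2))
  also have "\<dots> \<le> (\<integral>x. avg k (gap k) x / \<epsilon> \<partial>gauss)"
    using integrable_avg'[OF integral_gap(1)] by (intro integral_mono i norm_grad_b_le) simp
  also have "\<dots> = (\<integral>x. gap k x \<partial>gauss) / \<epsilon>" by (simp add: integral_avg[OF integral_gap(1)])
  finally show "(\<integral>x. f x * (norm (grad_b k x))\<^sup>2 \<partial>gauss) \<le> (\<integral>x. gap k x \<partial>gauss) / \<epsilon>" .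
qed

lemma deficit_nonneg: "0 \<le> deficit_value"
proof -
  \<comment> \<open>Any coordinate will do; \<open>undefined\<close> picks one.\<close>
  have "0 \<le> (\<integral>x. gap (undefined::'n) x \<partial>gauss)" using gap_nonneg by simp
  then show ?thesis using deficit_split[of undefined] score_defect_nonneg[of undefined] \<epsilon> by (smt (verit) mult_nonneg_nonneg divide_nonneg_nonneg)
qed

text \<open>The k-th score is its deviation from \<open>b\<close> plus \<open>b\<close>. By
  \<open>deficit_split\<close> the deviation costs 4/\<epsilon> deficits. For \<open>b\<close>,
  which has mean zero, the Poincare inequality and the gradient bound cost 1/\<epsilon>^2 times the
  integral of \<open>gap\<close>, that is 2/\<epsilon>^2 deficits. Both are doubled by squaring a
  sum.\<close>

lemma fisher_component_le:
  assumes centred: "(\<integral>x. x $ k * f x \<partial>gauss) = 0"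
  shows "(\<integral>x. (D x $ k)\<^sup>2 / f x \<partial>gauss) \<le> (8 / \<epsilon> + 4 / \<epsilon>\<^sup>2) * deficit_value"
proof -
  define A where "A = (\<integral>x. (D x $ k - b k x * f x)\<^sup>2 / f x \<partial>gauss)"
  define G where "G = (\<integral>x. gap k x \<partial>gauss)"
  define B where "B = (\<integral>x. f x * (b k x)\<^sup>2 \<partial>gauss)"
  have AG: "0 \<le> A" "0 \<le> G" unfolding A_def G_def using score_defect_nonneg gap_nonneg by simp_all
  have split: "\<epsilon> / 4 * A + G / 2 \<le> deficit_value" unfolding A_def G_def by (rule deficit_split)
  have "0 \<le> \<epsilon> / 4 * A" using AG \<epsilon> by simp
  then have "G \<le> 2 * deficit_value" "\<epsilon> / 4 * A \<le> deficit_value" using split AG by linarith+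
  then have A: "A \<le> 4 / \<epsilon> * deficit_value" using \<epsilon> by (simp add: field_simps)
  \<comment> \<open>The second Poincare inequality in the argument: the first, on slices, has turned
    \<open>gap\<close> into a bound for the gradient of \<open>b\<close>.\<close>
  have "B - (\<integral>x. f x * b k x \<partial>gauss)\<^sup>2 \<le> (\<integral>x. f x * (norm (grad_b k x))\<^sup>2 \<partial>gauss) / \<epsilon>"
    unfolding B_def by (rule poincare[OF b_has_derivative continuous_on_grad_b integrable_b_sq integral_grad_b_le(1)])
  also have "\<dots> \<le> G / \<epsilon> / \<epsilon>" unfolding G_def using \<epsilon> by (intro divide_right_mono integral_grad_b_le) auto
  also have "\<dots> \<le> 2 * deficit_value / \<epsilon> / \<epsilon>" using \<open>G \<le> 2 * deficit_value\<close> \<epsilon> by (intro divide_right_mono) auto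
  finally have B: "B \<le> 2 / \<epsilon>\<^sup>2 * deficit_value" using mean_b[of k] centred by (simp add: power2_eq_square)
  have le: "(D x $ k)\<^sup>2 / f x \<le> 2 * ((D x $ k - b k x * f x)\<^sup>2 / f x) + 2 * (f x * (b k x)\<^sup>2)" for x
  proof -
    have "(D x $ k)\<^sup>2 \<le> 2 * (D x $ k - b k x * f x)\<^sup>2 + 2 * (b k x * f x)\<^sup>2"
      using zero_le_power2[of "(D x $ k - b k x * f x) - b k x * f x"] by (simp add: power2_eq_square algebra_simps)
    then have "(D x $ k)\<^sup>2 / f x \<le> (2 * (D x $ k - b k x * f x)\<^sup>2 + 2 * (b k x * f x)\<^sup>2) / f x"
      by (rule divide_right_mono) (rule pos)
    also have "\<dots> = 2 * ((D x $ k - b k x * f x)\<^sup>2 / f x) + 2 * (f x * (b k x)\<^sup>2)"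
      using pos(3)[of x] by (simp add: add_divide_distrib power2_eq_square)
    finally show ?thesis .
  qed
  note i = integrable_mult_right[OF integrable_score_defect, of 2 k] integrable_mult_right[OF integrable_b_sq, of 2 k]
  have "(\<integral>x. (D x $ k)\<^sup>2 / f x \<partial>gauss) \<le> (\<integral>x. 2 * ((D x $ k - b k x * f x)\<^sup>2 / f x) + 2 * (f x * (b k x)\<^sup>2) \<partial>gauss)"
    by (rule integral_mono[OF nice_integrable(5)[OF nice] Bochner_Integration.integrable_add[OF i] le])
  also have "\<dots> = 2 * A + 2 * B" unfolding Bochner_Integration.integral_add[OF i] A_def B_def by (simp only: integral_mult_right_zero)
  also have "\<dots> \<le> 2 * (4 / \<epsilon> * deficit_value) + 2 * (2 / \<epsilon>\<^sup>2 * deficit_value)" using A B by linarith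
  also have "\<dots> = (8 / \<epsilon> + 4 / \<epsilon>\<^sup>2) * deficit_value" by (simp add: distrib_right)
  finally show ?thesis .
qed

theorem fisher_le_deficit:
  assumes "\<And>k. (\<integral>x. x $ k * f x \<partial>gauss) = 0"
  shows "(\<integral>x. (norm (D x))\<^sup>2 / f x \<partial>gauss) \<le> real CARD('n) * (8 / \<epsilon> + 4 / \<epsilon>\<^sup>2) * deficit_value"
proof -
  have e: "(norm (D x))\<^sup>2 / f x = (\<Sum>k\<in>UNIV. (D x $ k)\<^sup>2 / f x)" for x
    by (simp add: norm_vec_def L2_set_def sum_nonneg sum_divide_distrib)
  have "(\<integral>x. (norm (D x))\<^sup>2 / f x \<partial>gauss) = (\<Sum>k\<in>UNIV. \<integral>x. (D x $ k)\<^sup>2 / f x \<partial>gauss)"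
    unfolding e by (rule Bochner_Integration.integral_sum) (rule nice_integrable(5)[OF nice])
  also have "\<dots> \<le> (\<Sum>k\<in>(UNIV::'n set). (8 / \<epsilon> + 4 / \<epsilon>\<^sup>2) * deficit_value)"
    by (rule sum_mono) (rule fisher_component_le[OF assms])
  also have "\<dots> = real CARD('n) * (8 / \<epsilon> + 4 / \<epsilon>\<^sup>2) * deficit_value" by simp
  finally show ?thesis .
qed

end

section \<open>The Ornstein-Uhlenbeck semigroup and Gaussian integration by parts\<close>

text \<open>One time of the semigroup: c = exp (-t) and s = sqrt (1 - exp (-2 t)).\<close>

locale ornstein_uhlenbeck =
  fixes c s :: real
  assumes c: "0 < c" and s: "0 < s" and cs: "c\<^sup>2 + s\<^sup>2 = 1"
begin

text \<open>The Mehler kernel: the density, relative to the Gaussian, of c x + s z with z Gaussian.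
  Its symmetry in x and y makes the semigroup reversible.\<close>

definition kern :: "real^'n::finite \<Rightarrow> real^'n \<Rightarrow> real" where
  "kern x y = (1 / s) ^ CARD('n) * exp ((2 * c * (x \<bullet> y) - c\<^sup>2 * (norm x)\<^sup>2 - c\<^sup>2 * (norm y)\<^sup>2) / (2 * s\<^sup>2))"

lemma kern_commute: "kern x y = kern y x"
  by (simp add: kern_def inner_commute algebra_simps)

lemma kern_pos: "0 < kern x y" "0 \<le> kern x y"
  using s by (simp_all add: kern_def)

lemma kern_measurable [measurable]: "kern x \<in> borel_measurable borel" "(\<lambda>y. kern y x) \<in> borel_measurable borel"
  "(\<lambda>(x, y). kern x y) \<in> borel_measurable (borel \<Otimes>\<^sub>M borel)"
  unfolding kern_def[abs_def] by measurable

lemma distr_gauss_kern: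
  "distr gauss borel (\<lambda>z. c *\<^sub>R x + s *\<^sub>R z) = density gauss (\<lambda>y::real^'n::finite. ennreal (kern x y))"
proof (rule measure_eqI)
  fix A :: "(real^'n) set" assume "A \<in> sets (distr gauss borel (\<lambda>z. c *\<^sub>R x + s *\<^sub>R z))"
  then have [measurable]: "A \<in> sets borel" by simp
  define K where "K = (2 * pi) powr (- real CARD('n) / 2)"
  define G where "G z = K * exp (- (norm z)\<^sup>2 / 2)" for z :: "real^'n"
  have G: "gauss = density lborel (\<lambda>z. ennreal (G z))" unfolding gauss_def G_def K_def ..
  have [measurable]: "G \<in> borel_measurable borel" unfolding G_def[abs_def] by measurable
  have Gnn: "0 \<le> G z" for z unfolding G_def K_def by simp
  \<comment> \<open>The Jacobian s^n cancels the prefactor of the kernel, and c^2 + s^2 = 1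
    collapses the exponent.\<close>
  have k: "G (c *\<^sub>R x + s *\<^sub>R z) * kern x (c *\<^sub>R x + s *\<^sub>R z) * s ^ CARD('n) = G z" for z
  proof -
    let ?y = "c *\<^sub>R x + s *\<^sub>R z"
    have n: "(norm ?y)\<^sup>2 = c\<^sup>2 * (norm x)\<^sup>2 + 2 * c * s * (x \<bullet> z) + s\<^sup>2 * (norm z)\<^sup>2"
      unfolding power2_norm_eq_inner by (simp add: inner_add_left inner_add_right inner_commute power2_eq_square algebra_simps)
    have i: "x \<bullet> ?y = c * (norm x)\<^sup>2 + s * (x \<bullet> z)" by (simp add: inner_add_right power2_norm_eq_inner)
    have c2: "c\<^sup>2 = 1 - s\<^sup>2" using cs by simp
    have "- (norm ?y)\<^sup>2 / 2 + (2 * c * (x \<bullet> ?y) - c\<^sup>2 * (norm x)\<^sup>2 - c\<^sup>2 * (norm ?y)\<^sup>2) / (2 * s\<^sup>2) = - (norm z)\<^sup>2 / 2"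
    proof -
      have "s\<^sup>2 * (norm ?y)\<^sup>2 - (2 * c * (x \<bullet> ?y) - c\<^sup>2 * (norm x)\<^sup>2 - c\<^sup>2 * (norm ?y)\<^sup>2) = s\<^sup>2 * (norm z)\<^sup>2"
      proof -
        have "s\<^sup>2 * (norm ?y)\<^sup>2 + c\<^sup>2 * (norm ?y)\<^sup>2 = (norm ?y)\<^sup>2" using cs by (simp add: distrib_right[symmetric] add.commute)
        then show ?thesis unfolding i using n by (simp add: power2_eq_square algebra_simps)
      qed
      then have "(2 * c * (x \<bullet> ?y) - c\<^sup>2 * (norm x)\<^sup>2 - c\<^sup>2 * (norm ?y)\<^sup>2) = s\<^sup>2 * ((norm ?y)\<^sup>2 - (norm z)\<^sup>2)"
        by (simp add: right_diff_distrib)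
      then show ?thesis using s by (simp add: field_simps)
    qed
    moreover have "(1 / s) ^ CARD('n) * s ^ CARD('n) = 1" using s by (simp add: power_mult_distrib[symmetric])
    ultimately show ?thesis unfolding G_def kern_def by (simp add: exp_add[symmetric] mult_ac)
  qed
  have "emeasure (density gauss (\<lambda>y. ennreal (kern x y))) A = (\<integral>\<^sup>+y. ennreal (G y * kern x y) * indicator A y \<partial>lborel)"
  proof -
    have "emeasure (density gauss (\<lambda>y. ennreal (kern x y))) A = (\<integral>\<^sup>+y. ennreal (G y) * (ennreal (kern x y) * indicator A y) \<partial>lborel)"
      by (simp add: emeasure_density G nn_integral_density)
    then show ?thesis by (simp only: ennreal_mult[OF Gnn kern_pos(2)] mult.assoc)
  qed
  also have "\<dots> = (\<integral>\<^sup>+z. ennreal (s ^ CARD('n)) * (ennreal (G (c *\<^sub>R x + s *\<^sub>R z) * kern x (c *\<^sub>R x + s *\<^sub>R z)) * indicator A (c *\<^sub>R x + s *\<^sub>R z)) \<partial>lborel)"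
  proof -
    have [measurable]: "(\<lambda>y. ennreal (G y * kern x y) * indicator A y) \<in> borel_measurable borel" by measurable
    show ?thesis
      using s by (subst lborel_affine[of s "c *\<^sub>R x"]) (simp_all add: nn_integral_density nn_integral_distr)
  qed
  also have "\<dots> = (\<integral>\<^sup>+z. ennreal (G z) * indicator A (c *\<^sub>R x + s *\<^sub>R z) \<partial>lborel)"
  proof (rule nn_integral_cong)
    fix z
    have "ennreal (s ^ CARD('n)) * ennreal (G (c *\<^sub>R x + s *\<^sub>R z) * kern x (c *\<^sub>R x + s *\<^sub>R z)) = ennreal (G z)"
      unfolding k[of z, symmetric]
      by (subst ennreal_mult[symmetric]) (use s Gnn kern_pos(2) in \<open>auto intro!: mult_nonneg_nonneg simp: mult_ac\<close>)
    then show "ennreal (s ^ CARD('n)) * (ennreal (G (c *\<^sub>R x + s *\<^sub>R z) * kern x (c *\<^sub>R x + s *\<^sub>R z)) * indicator A (c *\<^sub>R x + s *\<^sub>R z))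
        = ennreal (G z) * indicator A (c *\<^sub>R x + s *\<^sub>R z)"
      by (simp only: mult.assoc[symmetric])
  qed
  also have "\<dots> = (\<integral>\<^sup>+z. indicator A (c *\<^sub>R x + s *\<^sub>R z) \<partial>gauss)"
    by (simp add: G nn_integral_density)
  also have "\<dots> = emeasure (distr gauss borel (\<lambda>z. c *\<^sub>R x + s *\<^sub>R z)) A"
  proof -
    have "(\<integral>\<^sup>+z. indicator A (c *\<^sub>R x + s *\<^sub>R z) \<partial>gauss) = (\<integral>\<^sup>+y. indicator A y \<partial>distr gauss borel (\<lambda>z. c *\<^sub>R x + s *\<^sub>R z))"
      by (rule nn_integral_distr[symmetric]) measurable
    then show ?thesis by simp
  qed
  finally show "emeasure (distr gauss borel (\<lambda>z. c *\<^sub>R x + s *\<^sub>R z)) A = emeasure (density gauss (\<lambda>y. ennreal (kern x y))) A" ..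
qed simp

lemma nn_integral_kern:
  assumes [measurable]: "\<phi> \<in> borel_measurable borel"
  shows "(\<integral>\<^sup>+z. \<phi> (c *\<^sub>R x + s *\<^sub>R z) \<partial>gauss) = (\<integral>\<^sup>+y. ennreal (kern x y) * \<phi> y \<partial>gauss)"
proof -
  have "(\<integral>\<^sup>+z. \<phi> (c *\<^sub>R x + s *\<^sub>R z) \<partial>gauss) = (\<integral>\<^sup>+y. \<phi> y \<partial>distr gauss borel (\<lambda>z. c *\<^sub>R x + s *\<^sub>R z))"
    by (subst nn_integral_distr) simp_all
  also have "\<dots> = (\<integral>\<^sup>+y. ennreal (kern x y) * \<phi> y \<partial>gauss)"
    unfolding distr_gauss_kern by (subst nn_integral_density) simp_all
  finally show ?thesis .
qed

lemma integral_kern: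
  fixes \<phi> :: "real^'n::finite \<Rightarrow> 'b::{banach, second_countable_topology}"
  assumes [measurable]: "\<phi> \<in> borel_measurable borel"
  shows "(\<integral>z. \<phi> (c *\<^sub>R x + s *\<^sub>R z) \<partial>gauss) = (\<integral>y. kern x y *\<^sub>R \<phi> y \<partial>gauss)"
    "integrable gauss (\<lambda>z. \<phi> (c *\<^sub>R x + s *\<^sub>R z)) \<longleftrightarrow> integrable gauss (\<lambda>y. kern x y *\<^sub>R \<phi> y)"
proof -
  have m: "(\<lambda>z. c *\<^sub>R x + s *\<^sub>R z) \<in> measurable gauss borel" by measurable
  have p: "AE y in gauss. 0 \<le> kern x y" by (rule AE_I2) (rule kern_pos)
  have km: "kern x \<in> borel_measurable gauss" "\<phi> \<in> borel_measurable gauss" by simp_all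
  show "(\<integral>z. \<phi> (c *\<^sub>R x + s *\<^sub>R z) \<partial>gauss) = (\<integral>y. kern x y *\<^sub>R \<phi> y \<partial>gauss)"
    using integral_distr[OF m assms] integral_density[OF km(2,1) p] unfolding distr_gauss_kern by simp
  show "integrable gauss (\<lambda>z. \<phi> (c *\<^sub>R x + s *\<^sub>R z)) \<longleftrightarrow> integrable gauss (\<lambda>y. kern x y *\<^sub>R \<phi> y)"
    using integrable_distr_eq[OF m assms] integrable_density[OF km(2,1) p] unfolding distr_gauss_kern by simp
qed

lemma nn_integral_kern_1: "(\<integral>\<^sup>+y. ennreal (kern (x :: real^'n::finite) y) \<partial>gauss) = 1"
proof -
  have "(\<integral>\<^sup>+z. 1 \<partial>(gauss :: (real^'n) measure)) = 1"
    using gauss.emeasure_space_1[where 'n='n] by simp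
  then show ?thesis using nn_integral_kern[of "\<lambda>_. 1" x] by (simp only: mult_1_right borel_measurable_const)
qed

text \<open>By symmetry the kernel also has mass 1 in its other variable, so Fubini gives invariance
  of the Gaussian measure.\<close>

lemma nn_integral_ou_invariant:
  fixes \<phi> :: "real^'n::finite \<Rightarrow> ennreal"
  assumes [measurable]: "\<phi> \<in> borel_measurable borel"
  shows "(\<integral>\<^sup>+x. \<integral>\<^sup>+z. \<phi> (c *\<^sub>R x + s *\<^sub>R z) \<partial>gauss \<partial>gauss) = (\<integral>\<^sup>+y. \<phi> y \<partial>gauss)"
proof -
  interpret pair_sigma_finite "gauss :: (real^'n) measure" "gauss :: (real^'n) measure" ..
  have "(\<integral>\<^sup>+x. \<integral>\<^sup>+z. \<phi> (c *\<^sub>R x + s *\<^sub>R z) \<partial>gauss \<partial>gauss) = (\<integral>\<^sup>+x. \<integral>\<^sup>+y. ennreal (kern x y) * \<phi> y \<partial>gauss \<partial>gauss)"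
    by (simp only: nn_integral_kern[OF assms])
  also have "\<dots> = (\<integral>\<^sup>+y. \<integral>\<^sup>+x. ennreal (kern x y) * \<phi> y \<partial>gauss \<partial>gauss)"
    by (rule Fubini'[symmetric]) (simp add: case_prod_beta)
  also have "\<dots> = (\<integral>\<^sup>+y. (\<integral>\<^sup>+x. ennreal (kern y x) \<partial>gauss) * \<phi> y \<partial>gauss)"
    by (intro nn_integral_cong) (subst nn_integral_multc, simp_all add: kern_commute[of _ y for y])
  also have "\<dots> = (\<integral>\<^sup>+y. \<phi> y \<partial>gauss)" by (simp add: nn_integral_kern_1)
  finally show ?thesis .
qed

text \<open>The map taking (x, z) to (c x + s z, s x - c z) is an isometry, and one component is
  dropped.\<close>

lemma norm_mix_sq_le: "(norm (c *\<^sub>R x + s *\<^sub>R z))\<^sup>2 \<le> (norm x)\<^sup>2 + (norm (z::real^'n::finite))\<^sup>2"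
proof -
  have "(norm (c *\<^sub>R x + s *\<^sub>R z))\<^sup>2 + (norm (s *\<^sub>R x - c *\<^sub>R z))\<^sup>2 = (c\<^sup>2 + s\<^sup>2) * ((norm x)\<^sup>2 + (norm z)\<^sup>2)"
    unfolding power2_norm_eq_inner
    by (simp add: inner_add_left inner_add_right inner_diff_left inner_diff_right inner_commute power2_eq_square algebra_simps)
  then have "(norm (c *\<^sub>R x + s *\<^sub>R z))\<^sup>2 + (norm (s *\<^sub>R x - c *\<^sub>R z))\<^sup>2 = (norm x)\<^sup>2 + (norm z)\<^sup>2" by (simp add: cs)
  then show ?thesis using zero_le_power2[of "norm (s *\<^sub>R x - c *\<^sub>R z)"] by linarith
qed

end

text \<open>Dominated convergence for the difference quotients, which the mean value inequality on a
  ball bounds by 2 B.\<close>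

lemma has_derivative_parametric_integral:
  fixes F :: "'a::euclidean_space \<Rightarrow> 't \<Rightarrow> real" and D :: "'a \<Rightarrow> 't \<Rightarrow> 'a"
  assumes der: "\<And>y t. ((\<lambda>y. F y t) has_derivative (\<lambda>v. D y t \<bullet> v)) (at y)"
    and B: "\<And>R. \<exists>B. integrable M B \<and> (\<forall>y t. norm y \<le> R \<longrightarrow> norm (D y t) \<le> B t)"
    and iF: "\<And>y. integrable M (F y)" and iD: "\<And>y. integrable M (D y)"
  shows "((\<lambda>y. \<integral>t. F y t \<partial>M) has_derivative (\<lambda>v. (\<integral>t. D x t \<partial>M) \<bullet> v)) (at x)"
proof -
  let ?D' = "\<lambda>v. (\<integral>t. D x t \<partial>M) \<bullet> v"
  have [measurable]: "F y \<in> borel_measurable M" "D y \<in> borel_measurable M" for y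
    using borel_measurable_integrable[OF iF] borel_measurable_integrable[OF iD] by auto
  have "((\<lambda>y. ((\<integral>t. F y t \<partial>M) - (\<integral>t. F x t \<partial>M) - ?D' (y - x)) /\<^sub>R norm (y - x)) \<longlongrightarrow> 0) (at x)"
  proof (subst tendsto_at_iff_sequentially, intro allI impI)
    fix X assume X: "\<forall>i. X i \<in> UNIV - {x}" "X \<longlonglongrightarrow> x"
    obtain R0 where R0: "\<And>n. norm (X n) \<le> R0" using convergent_imp_Bseq[OF convergentI[OF X(2)]] by (auto simp: Bseq_def)
    define R where "R = max R0 (norm x)"
    have R: "norm (X n) \<le> R" "norm x \<le> R" for n using R0[of n] by (auto simp: R_def)
    obtain B where B: "integrable M B" "\<And>y t. norm y \<le> R \<Longrightarrow> norm (D y t) \<le> B t" using B[of R] by blast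
    define h where "h y t = (F y t - F x t - D x t \<bullet> (y - x)) / norm (y - x)" for y t
    have hi: "((\<integral>t. F y t \<partial>M) - (\<integral>t. F x t \<partial>M) - ?D' (y - x)) /\<^sub>R norm (y - x) = (\<integral>t. h y t \<partial>M)" for y
    proof -
      have "(\<integral>t. h y t \<partial>M) = (\<integral>t. F y t - F x t - D x t \<bullet> (y - x) \<partial>M) / norm (y - x)"
        unfolding h_def by (rule integral_divide_zero)
      also have "(\<integral>t. F y t - F x t - D x t \<bullet> (y - x) \<partial>M) = (\<integral>t. F y t \<partial>M) - (\<integral>t. F x t \<partial>M) - ?D' (y - x)"
        using iF[of y] iF[of x] iD[of x] by simp
      finally show ?thesis by (simp add: divide_inverse_commute)
    qed
    have "(\<lambda>n. \<integral>t. h (X n) t \<partial>M) \<longlonglongrightarrow> (\<integral>t. 0 \<partial>M)"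
    proof (rule integral_dominated_convergence[where w = "\<lambda>t. 2 * B t"])
      show "integrable M (\<lambda>t. 2 * B t)" using B by simp
      show "AE t in M. (\<lambda>n. h (X n) t) \<longlonglongrightarrow> 0"
      proof (rule AE_I2)
        fix t
        have "((\<lambda>y. (F y t - F x t - D x t \<bullet> (y - x)) /\<^sub>R norm (y - x)) \<longlongrightarrow> 0) (at x)"
          using der[of t x] unfolding has_derivative_at_within by blast
        then show "(\<lambda>n. h (X n) t) \<longlonglongrightarrow> 0"
          using X by (auto simp: tendsto_at_iff_sequentially h_def comp_def divide_inverse mult.commute)
      qed
      show "AE t in M. norm (h (X n) t) \<le> 2 * B t" for n
      proof (rule AE_I2)
        fix t
        have bound: "\<bar>D y t \<bullet> v\<bar> \<le> B t * norm v" if "norm y \<le> R" for y v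
        proof -
          have "\<bar>D y t \<bullet> v\<bar> \<le> norm (D y t) * norm v" by (rule Cauchy_Schwarz_ineq2)
          also have "\<dots> \<le> B t * norm v" by (intro mult_right_mono B that) simp
          finally show ?thesis .
        qed
        have "norm (F (X n) t - F x t) \<le> B t * norm (X n - x)"
        proof (rule differentiable_bound[of "cball 0 R" "\<lambda>y. F y t" "\<lambda>y v. D y t \<bullet> v"])
          fix y assume "y \<in> cball (0::'a) R"
          then have y: "norm y \<le> R" by simp
          show "((\<lambda>y. F y t) has_derivative (\<lambda>v. D y t \<bullet> v)) (at y within cball 0 R)"
            by (rule has_derivative_at_withinI[OF der])
          show "onorm (\<lambda>v. D y t \<bullet> v) \<le> B t" by (rule onorm_le) (use bound[OF y] in simp)
        qed (use R in auto)
        then have "\<bar>F (X n) t - F x t - D x t \<bullet> (X n - x)\<bar> \<le> 2 * B t * norm (X n - x)"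
          using bound[OF R(2), of "X n - x"] by simp
        moreover have "norm (X n - x) > 0" using X by auto
        ultimately show "norm (h (X n) t) \<le> 2 * B t" unfolding h_def by (simp add: divide_le_eq)
      qed
      show "h (X n) \<in> borel_measurable M" for n unfolding h_def[abs_def] by measurable
    qed simp
    then show "((\<lambda>y. ((\<integral>t. F y t \<partial>M) - (\<integral>t. F x t \<partial>M) - ?D' (y - x)) /\<^sub>R norm (y - x)) \<circ> X) \<longlonglongrightarrow> 0"
      unfolding comp_def hi by simp
  qed
  then show ?thesis
    by (subst has_derivative_at_within) (rule conjI[OF bounded_linear_inner_right])
qed

text \<open>On each line in direction k the integrand times the normal density is the derivative of
  density times g, which vanishes at both ends.\<close>

lemma gauss_parts_compact:
  fixes g :: "real^'n::finite \<Rightarrow> real" and Dg :: "real^'n \<Rightarrow> real^'n"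
  assumes der: "\<And>x. (g has_derivative (\<lambda>v. Dg x \<bullet> v)) (at x)" and cont: "continuous_on UNIV Dg"
    and supp: "\<And>x. norm x \<ge> R \<Longrightarrow> g x = 0" "\<And>x. norm x \<ge> R \<Longrightarrow> Dg x = 0" and "R > 0"
    and int: "integrable gauss (\<lambda>x. Dg x $ k - x $ k * g x)"
  shows "(\<integral>x. Dg x $ k - x $ k * g x \<partial>gauss) = 0"
proof -
  let ?\<phi> = std_normal_density
  have contg: "continuous_on UNIV g" using der has_derivative_continuous_on[of UNIV g "\<lambda>x v. Dg x \<bullet> v"] by simp
  have [measurable]: "g \<in> borel_measurable borel" "Dg \<in> borel_measurable borel"
    using contg cont by (auto intro: borel_measurable_continuous_onI)
  have "avg k (\<lambda>x. Dg x $ k - x $ k * g x) x = 0" for x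
  proof -
    define u where "u t = Dg (upd k x t) $ k - t * g (upd k x t)" for t
    have nu: "\<bar>t\<bar> \<le> norm (upd k x t)" for t using component_le_norm_cart[of "upd k x t" k] by simp
    have sl: "((\<lambda>t. g (upd k x t)) has_real_derivative Dg (upd k x t) $ k) (at t)" for t
    proof -
      have "((\<lambda>t. upd k x t) has_derivative (\<lambda>v. v *\<^sub>R axis k 1)) (at t)"
        unfolding upd_eq by (auto intro!: derivative_eq_intros)
      from has_derivative_compose[OF this der]
      show ?thesis by (simp add: has_field_derivative_def inner_axis mult_commute_abs)
    qed
    have d\<phi>: "(?\<phi> has_real_derivative - t * ?\<phi> t) (at t)" for t
      unfolding std_normal_density_def by (auto intro!: derivative_eq_intros simp: field_simps)
    have cu: "continuous_on UNIV (\<lambda>t. upd k x t)" by (intro continuous_intros)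
    have "has_bochner_integral lborel (\<lambda>t. (?\<phi> t * u t) * indicator {-R..R} t) (?\<phi> R * g (upd k x R) - ?\<phi> (-R) * g (upd k x (-R)))"
    proof (rule has_bochner_integral_FTC_Icc_real)
      show "((\<lambda>t. ?\<phi> t * g (upd k x t)) has_real_derivative ?\<phi> t * u t) (at t)" for t
        by (rule DERIV_cong[OF DERIV_mult[OF d\<phi> sl]]) (simp add: u_def algebra_simps)
      have "continuous_on UNIV (\<lambda>t. ?\<phi> t * u t)" unfolding u_def
        by (intro continuous_intros pos_densityD(1)[OF pos_density_std_normal] continuous_on_compose2[OF cont cu] continuous_on_compose2[OF contg cu]) auto
      then show "isCont (\<lambda>t. ?\<phi> t * u t) t" for t by (simp add: continuous_on_eq_continuous_at)
    qed (use \<open>R > 0\<close> in simp)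
    moreover have "g (upd k x R) = 0" "g (upd k x (-R)) = 0" using supp(1) nu[of R] nu[of "-R"] \<open>R > 0\<close> by auto
    moreover have "(?\<phi> t * u t) * indicator {-R..R} t = ?\<phi> t * u t" for t
    proof (cases "t \<in> {-R..R}")
      case False
      then have "R \<le> norm (upd k x t)" using nu[of t] by auto
      then show ?thesis using supp by (simp add: u_def)
    qed simp
    ultimately have "(\<integral>t. ?\<phi> t * u t \<partial>lborel) = 0" by (simp add: has_bochner_integral_iff)
    moreover have [measurable]: "u \<in> borel_measurable borel" unfolding u_def by measurable
    ultimately show ?thesis unfolding avg_def by (simp add: integral_density u_def[symmetric])
  qed
  then show ?thesis using integral_avg[OF int, of k] by simp
qed

text \<open>Stein's identity. The compactly supported case is applied to g times a cut-off, and the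
  cut-off is removed by dominated convergence.\<close>

lemma gauss_parts:
  fixes g :: "real^'n::finite \<Rightarrow> real" and Dg :: "real^'n \<Rightarrow> real^'n"
  assumes der: "\<And>x. (g has_derivative (\<lambda>v. Dg x \<bullet> v)) (at x)" and cont: "continuous_on UNIV Dg"
    and int: "integrable gauss g" "integrable gauss (\<lambda>x. g x *\<^sub>R x)" "integrable gauss Dg"
  shows "(\<integral>x. Dg x \<partial>gauss) = (\<integral>x. g x *\<^sub>R x \<partial>gauss)"
proof -
  have contg: "continuous_on UNIV g" using der has_derivative_continuous_on[of UNIV g "\<lambda>x v. Dg x \<bullet> v"] by simp
  have [measurable]: "g \<in> borel_measurable borel" "Dg \<in> borel_measurable borel"
    using contg cont by (auto intro: borel_measurable_continuous_onI)
  have contb: "continuous_on UNIV (bump R :: real^'n \<Rightarrow> real)" for R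
    using has_derivative_continuous_on[of UNIV "bump R" "\<lambda>x v. bump_grad R x \<bullet> v"] bump_has_derivative by blast
  have [measurable]: "bump R \<in> borel_measurable (borel :: (real^'n) measure)" "bump_grad R \<in> borel_measurable (borel :: (real^'n) measure)" for R
    using contb continuous_bump_grad by (auto intro: borel_measurable_continuous_onI)
  define r where "r n = real (Suc n)" for n
  have r: "r n \<ge> 1" for n by (simp add: r_def)
  have gr: "norm (bump_grad (r n) x) \<le> 4" for n and x :: "real^'n"
  proof -
    have "norm (bump_grad (r n) x) \<le> 4 / r n" using r[of n] by (intro norm_bump_grad) auto
    also have "\<dots> \<le> 4" using r[of n] by (simp add: divide_le_eq)
    finally show ?thesis .
  qed
  have int_k: "(\<integral>x. Dg x $ k - x $ k * g x \<partial>gauss) = 0" for k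
  proof -
    have iD: "integrable gauss (\<lambda>x. Dg x $ k)"
      using integrable_inner_left[OF int(3), of "axis k 1"] by (simp add: inner_axis)
    have ix: "integrable gauss (\<lambda>x. x $ k * g x)"
      using integrable_inner_left[OF int(2), of "axis k 1"] by (simp add: inner_axis mult.commute)
    define G where "G n x = bump (r n) x * g x" for n x
    define H where "H n x = bump (r n) x *\<^sub>R Dg x + g x *\<^sub>R bump_grad (r n) x" for n x
    have [measurable]: "G n \<in> borel_measurable borel" "H n \<in> borel_measurable borel" for n
      unfolding G_def H_def by measurable
    let ?w = "\<lambda>x. \<bar>Dg x $ k\<bar> + 4 * \<bar>g x\<bar> + \<bar>x $ k * g x\<bar>"
    have iw: "integrable gauss ?w" using iD ix int(1) by simp
    have bound: "\<bar>H n x $ k - x $ k * G n x\<bar> \<le> ?w x" for n x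
    proof -
      have "\<bar>bump (r n) x * Dg x $ k\<bar> \<le> \<bar>Dg x $ k\<bar>" using abs_bump_le[of "r n" x] by (simp add: abs_mult mult_left_le_one_le)
      moreover have "\<bar>g x * bump_grad (r n) x $ k\<bar> \<le> \<bar>g x\<bar> * 4" unfolding abs_mult
        by (intro mult_left_mono order.trans[OF component_le_norm_cart gr]) simp
      moreover have "\<bar>bump (r n) x * (x $ k * g x)\<bar> \<le> \<bar>x $ k * g x\<bar>" unfolding abs_mult[of "bump (r n) x"]
        using abs_bump_le[of "r n" x] by (simp add: mult_left_le_one_le)
      moreover have "H n x $ k - x $ k * G n x = bump (r n) x * Dg x $ k + g x * bump_grad (r n) x $ k - bump (r n) x * (x $ k * g x)"
        by (simp add: H_def G_def)
      ultimately show ?thesis by linarith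
    qed
    have i: "integrable gauss (\<lambda>x. H n x $ k - x $ k * G n x)" for n
    proof (rule Bochner_Integration.integrable_bound[OF iw])
      show "AE x in gauss. norm (H n x $ k - x $ k * G n x) \<le> norm (?w x)"
      proof (rule AE_I2)
        fix x :: "real^'n"
        have "?w x \<le> norm (?w x)" by simp
        then show "norm (H n x $ k - x $ k * G n x) \<le> norm (?w x)" using bound[of n x] unfolding real_norm_def by linarith
      qed
    qed measurable
    have z: "(\<integral>x. H n x $ k - x $ k * G n x \<partial>gauss) = 0" for n
    proof (rule gauss_parts_compact[where R = "r n"])
      show "(G n has_derivative (\<lambda>v. H n x \<bullet> v)) (at x)" for x
        unfolding G_def H_def
        by (rule has_derivative_eq_rhs[OF has_derivative_mult[OF bump_has_derivative der]])
          (auto simp: fun_eq_iff inner_add_left mult_ac)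
      show "continuous_on UNIV (H n)"
        unfolding H_def by (intro continuous_intros contb cont contg)
      have "bump (r n) x = 0" "bump_grad (r n) x = 0" if "norm x \<ge> r n" for x :: "real^'n"
        using bump_outside[of "r n" x] that r[of n] by (cases "norm x = r n"; auto simp: bump_def bump_grad_def)+
      then show "G n x = 0" "H n x = 0" if "norm x \<ge> r n" for x using that by (auto simp: G_def H_def)
    qed (use r[of n] i in auto)
    have "(\<lambda>n. \<integral>x. H n x $ k - x $ k * G n x \<partial>gauss) \<longlonglongrightarrow> (\<integral>x. Dg x $ k - x $ k * g x \<partial>gauss)"
    proof (rule integral_dominated_convergence[OF _ _ iw])
      show "AE x in gauss. (\<lambda>n. H n x $ k - x $ k * G n x) \<longlonglongrightarrow> Dg x $ k - x $ k * g x"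
      proof (rule AE_I2)
        fix x :: "real^'n"
        have "(\<lambda>n. H n x) \<longlonglongrightarrow> 1 *\<^sub>R Dg x + g x *\<^sub>R 0" "(\<lambda>n. G n x) \<longlonglongrightarrow> 1 * g x"
          unfolding H_def G_def r_def by (intro tendsto_intros bump_tendsto bump_grad_tendsto)+
        then have "(\<lambda>n. H n x $ k - x $ k * G n x) \<longlonglongrightarrow> (1 *\<^sub>R Dg x + g x *\<^sub>R 0) $ k - x $ k * (1 * g x)"
          by (intro tendsto_intros)
        then show "(\<lambda>n. H n x $ k - x $ k * G n x) \<longlonglongrightarrow> Dg x $ k - x $ k * g x" by simp
      qed
      show "AE x in gauss. norm (H n x $ k - x $ k * G n x) \<le> ?w x" for n
        using bound by (intro AE_I2) simp
    qed measurable
    then show ?thesis unfolding z by (simp add: LIMSEQ_const_iff)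
  qed
  show ?thesis
  proof (rule vec_eq_iff[THEN iffD2, rule_format])
    fix k
    have iD: "integrable gauss (\<lambda>x. Dg x $ k)"
      using integrable_inner_left[OF int(3), of "axis k 1"] by (simp add: inner_axis)
    have ix: "integrable gauss (\<lambda>x. x $ k * g x)"
      using integrable_inner_left[OF int(2), of "axis k 1"] by (simp add: inner_axis mult.commute)
    have "(\<integral>x. Dg x \<partial>gauss) $ k = (\<integral>x. Dg x $ k \<partial>gauss)"
      using integral_inner_left[OF int(3), of "axis k 1"] by (simp add: inner_axis)
    moreover have "(\<integral>x. g x *\<^sub>R x \<partial>gauss) $ k = (\<integral>x. x $ k * g x \<partial>gauss)"
      using integral_inner_left[OF int(2), of "axis k 1"] by (simp add: inner_axis mult.commute)
    ultimately show "(\<integral>x. Dg x \<partial>gauss) $ k = (\<integral>x. g x *\<^sub>R x \<partial>gauss) $ k" using int_k[of k] iD ix by simp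
  qed
qed

text \<open>Repeated halving towards x shows that the difference quotients at step 2^(-n) never
  exceed g (x + w) - g x; their limit is the derivative.\<close>

lemma midpoint_convex_tangent:
  fixes g :: "'a::real_normed_vector \<Rightarrow> real"
  assumes mid: "\<And>x y. g ((1/2) *\<^sub>R (x + y)) \<le> (g x + g y) / 2" and der: "(g has_derivative g') (at x)"
  shows "g x + g' w \<le> g (x + w)"
proof -
  have step: "g (x + (1/2) ^ n *\<^sub>R w) \<le> (1 - (1/2) ^ n) * g x + (1/2) ^ n * g (x + w)" for n
  proof (induction n)
    case (Suc n)
    have "x + (1/2) ^ Suc n *\<^sub>R w = (1/2) *\<^sub>R (x + (x + (1/2) ^ n *\<^sub>R w))"
      by (simp add: scaleR_add_right) (metis scaleR_half_double scaleR_add_right add.assoc)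
    then have "g (x + (1/2) ^ Suc n *\<^sub>R w) \<le> (g x + g (x + (1/2) ^ n *\<^sub>R w)) / 2" using mid by metis
    also have "\<dots> \<le> (g x + ((1 - (1/2) ^ n) * g x + (1/2) ^ n * g (x + w))) / 2" using Suc by simp
    also have "\<dots> = (1 - (1/2) ^ Suc n) * g x + (1/2) ^ Suc n * g (x + w)" by (simp add: field_simps)
    finally show ?case .
  qed simp
  have lin: "bounded_linear g'" using der by (rule has_derivative_bounded_linear)
  have "((\<lambda>h. x + h *\<^sub>R w) has_derivative (\<lambda>h. h *\<^sub>R w)) (at 0)" by (auto intro!: derivative_eq_intros)
  then have "((\<lambda>h. g (x + h *\<^sub>R w)) has_derivative (\<lambda>h. g' (h *\<^sub>R w))) (at 0)"
    by (rule has_derivative_compose) (use der in simp)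
  then have "((\<lambda>h. g (x + h *\<^sub>R w)) has_real_derivative g' w) (at 0)"
    by (simp add: has_field_derivative_def linear_cmul[OF bounded_linear.linear[OF lin]] mult_commute_abs)
  then have "((\<lambda>h. (g (x + h *\<^sub>R w) - g x) / h) \<longlongrightarrow> g' w) (at 0)" by (simp add: DERIV_def)
  moreover have "filterlim (\<lambda>n. (1/2::real) ^ n) (at 0) sequentially"
    by (rule filterlim_atI) (auto intro: LIMSEQ_power_zero)
  ultimately have "(\<lambda>n. (g (x + (1/2) ^ n *\<^sub>R w) - g x) / (1/2) ^ n) \<longlonglongrightarrow> g' w"
    by (rule filterlim_compose)
  moreover have "(g (x + (1/2) ^ n *\<^sub>R w) - g x) / (1/2) ^ n \<le> g (x + w) - g x" for n
    using step[of n] by (simp add: field_simps)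
  ultimately have "g' w \<le> g (x + w) - g x" by (intro LIMSEQ_le_const2) auto
  then show ?thesis by simp
qed

text \<open>Converse of \<open>semiconcave_midpoint\<close> for differentiable F. The midpoint
  inequality says exactly that - ln F + (1 - \<epsilon>)/2 |x|^2 is midpoint convex, so this
  function lies above its tangents.\<close>

lemma semiconcave_first_order:
  fixes F :: "'a::real_inner \<Rightarrow> real"
  assumes pos: "\<And>x. 0 < F x" and der: "\<And>x. (F has_derivative (\<lambda>v. D x \<bullet> v)) (at x)"
    and mid: "\<And>x y. F x * F y \<le> (F ((1/2) *\<^sub>R (x + y)))\<^sup>2 * exp ((1 - \<epsilon>) / 4 * (norm (x - y))\<^sup>2)"
  shows "F y \<le> F x * exp (D x \<bullet> (y - x) / F x + (1 - \<epsilon>) / 2 * (norm (y - x))\<^sup>2)"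
proof -
  define g where "g x = - ln (F x) + (1 - \<epsilon>) / 2 * (x \<bullet> x)" for x
  have "g x + (- (D x \<bullet> (y - x) / F x) + (1 - \<epsilon>) * (x \<bullet> (y - x))) \<le> g (x + (y - x))"
  proof (rule midpoint_convex_tangent)
    fix x y :: 'a
    let ?z = "(1/2) *\<^sub>R (x + y)"
    have "ln (F x * F y) \<le> ln ((F ?z)\<^sup>2 * exp ((1 - \<epsilon>) / 4 * (norm (x - y))\<^sup>2))"
      using pos mid[of x y] by (intro ln_mono) auto
    then have lnle: "ln (F x) + ln (F y) \<le> 2 * ln (F ?z) + (1 - \<epsilon>) / 4 * (norm (x - y))\<^sup>2"
      using pos[of x] pos[of y] pos[of ?z] by (simp add: ln_mult ln_realpow)
    have nn: "(norm (x - y))\<^sup>2 = x \<bullet> x - 2 * (x \<bullet> y) + y \<bullet> y"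
      unfolding power2_norm_eq_inner by (simp add: inner_diff_left inner_diff_right inner_commute)
    have zz: "?z \<bullet> ?z = (x \<bullet> x + 2 * (x \<bullet> y) + y \<bullet> y) / 4"
      by (simp add: inner_add_left inner_add_right inner_commute field_simps)
    have id: "a / 4 * (b - 2 * p + d) = a / 2 * b + a / 2 * d - 2 * (a / 2 * ((b + 2 * p + d) / 4))" for a b p d :: real
      by (simp add: field_simps)
    have ide: "(1 - \<epsilon>) / 4 * (norm (x - y))\<^sup>2 = (1 - \<epsilon>) / 2 * (x \<bullet> x) + (1 - \<epsilon>) / 2 * (y \<bullet> y) - 2 * ((1 - \<epsilon>) / 2 * (?z \<bullet> ?z))"
      unfolding nn zz by (rule id)
    have gen: "- lz + d \<le> (- lx + a + (- ly + b)) / 2" if "lx + ly \<le> 2 * lz + q" "q = a + b - 2 * d" for lx ly lz a b d q :: real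
      using that by simp
    have "- ln (F ?z) + (1 - \<epsilon>) / 2 * (?z \<bullet> ?z)
        \<le> (- ln (F x) + (1 - \<epsilon>) / 2 * (x \<bullet> x) + (- ln (F y) + (1 - \<epsilon>) / 2 * (y \<bullet> y))) / 2"
      by (rule gen[OF lnle ide])
    then show "g ?z \<le> (g x + g y) / 2" unfolding g_def .
  next
    have d1: "((\<lambda>x. ln (F x)) has_derivative (\<lambda>w. D x \<bullet> w * inverse (F x))) (at x)"
      by (rule has_derivative_ln[where g = F and x = x and s = UNIV, OF pos[of x] der[of x]])
    have d2: "((\<lambda>x. x \<bullet> x) has_derivative (\<lambda>w. x \<bullet> w + w \<bullet> x)) (at x)"
      using has_derivative_inner[OF has_derivative_ident has_derivative_ident, of x UNIV] .
    have geq: "g = (\<lambda>x. - ln (F x) + (1 - \<epsilon>) / 2 * (x \<bullet> x))" by (rule ext) (rule g_def)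
    have d3: "((\<lambda>x. - ln (F x)) has_derivative (\<lambda>w. - (D x \<bullet> w * inverse (F x)))) (at x)"
      by (rule has_derivative_minus[OF d1])
    have d4: "((\<lambda>x. (1 - \<epsilon>) / 2 * (x \<bullet> x)) has_derivative (\<lambda>w. (1 - \<epsilon>) / 2 * (x \<bullet> w + w \<bullet> x))) (at x)"
      by (rule has_derivative_mult_right[OF d2])
    have "- (D x \<bullet> w * inverse (F x)) + (1 - \<epsilon>) / 2 * (x \<bullet> w + w \<bullet> x) = - (D x \<bullet> w / F x) + (1 - \<epsilon>) * (x \<bullet> w)" for w
      unfolding inner_commute[of w x] divide_inverse by simp
    then show "(g has_derivative (\<lambda>w. - (D x \<bullet> w / F x) + (1 - \<epsilon>) * (x \<bullet> w))) (at x)"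
      unfolding geq using has_derivative_add[OF d3 d4] by presburger
  qed
  then have t: "- ln (F x) + (1 - \<epsilon>) / 2 * (x \<bullet> x) + (- (D x \<bullet> (y - x) / F x) + (1 - \<epsilon>) * (x \<bullet> (y - x)))
      \<le> - ln (F y) + (1 - \<epsilon>) / 2 * (y \<bullet> y)"
    unfolding g_def by simp
  have nn: "(norm (y - x))\<^sup>2 = y \<bullet> y - x \<bullet> x - 2 * (x \<bullet> (y - x))"
    unfolding power2_norm_eq_inner by (simp add: inner_diff_left inner_diff_right inner_commute)
  have ide: "(1 - \<epsilon>) / 2 * (norm (y - x))\<^sup>2 = (1 - \<epsilon>) / 2 * (y \<bullet> y) - (1 - \<epsilon>) / 2 * (x \<bullet> x) - (1 - \<epsilon>) * (x \<bullet> (y - x))"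
    unfolding nn right_diff_distrib by simp
  have gen: "ly \<le> lx + p + q" if "- lx + a + (- p + r) \<le> - ly + b" "q = b - a - r" for lx ly p q a b r :: real
    using that by simp
  have "ln (F y) \<le> ln (F x) + D x \<bullet> (y - x) / F x + (1 - \<epsilon>) / 2 * (norm (y - x))\<^sup>2"
    by (rule gen[OF t ide])
  then have "exp (ln (F y)) \<le> exp (ln (F x) + (D x \<bullet> (y - x) / F x + (1 - \<epsilon>) / 2 * (norm (y - x))\<^sup>2))" by simp
  then show ?thesis using pos by (simp add: exp_add)
qed

section \<open>Regularising densities of finite Fisher information\<close>

text \<open>What a function of the class with unit mass and finite Fisher information provides.
  Growth is known for \<open>f\<close> alone, whereas \<open>nice\<close> also asks for it of the
  gradient and of the Fisher integrand; the regularisation supplies that.\<close>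

locale rough_density =
  fixes f :: "real^'n::finite \<Rightarrow> real" and Df :: "real^'n \<Rightarrow> real^'n" and B \<alpha> \<epsilon> :: real
  assumes f_pos: "\<And>x. 0 < f x"
    and f_der: "\<And>x. (f has_derivative (\<lambda>v. Df x \<bullet> v)) (at x)" and cont_Df: "continuous_on UNIV Df"
    and growth: "\<And>x. f x \<le> B * exp (\<alpha> * (norm x)\<^sup>2)" and \<alpha>: "0 \<le> \<alpha>" "\<alpha> < 1/2"
    and \<epsilon>: "0 < \<epsilon>" "\<epsilon> \<le> 1"
    and mid: "\<And>x y. f x * f y \<le> (f ((1/2) *\<^sub>R (x + y)))\<^sup>2 * exp ((1 - \<epsilon>) / 4 * (norm (x - y))\<^sup>2)"
    and mass: "(\<integral>x. f x \<partial>gauss) = 1"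
    and fisher_int: "integrable gauss (\<lambda>x. (norm (Df x))\<^sup>2 / f x)"
begin

lemma cont_f: "continuous_on UNIV f"
  using f_der has_derivative_continuous_on[of UNIV f "\<lambda>x v. Df x \<bullet> v"] by simp

lemma meas_f [measurable]: "f \<in> borel_measurable borel" "Df \<in> borel_measurable borel"
  using cont_f cont_Df by (auto intro: borel_measurable_continuous_onI)

lemma B_pos: "0 < B"
  using less_le_trans[OF f_pos[of 0] growth[of 0]] by simp

lemma growth_f: "subgaussian_growth f"
  by (rule subgaussian_growthI[OF \<alpha>, of _ B]) (use growth f_pos in \<open>simp add: less_imp_le\<close>)

lemma integrable_f: "integrable gauss f"
  by (rule integrable_gauss_growth[OF growth_f]) measurable

text \<open>One majorant in z for the integrands f, f z and f |z|^2 at the point c x + s z.\<close>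

definition weight :: "real^'n \<Rightarrow> real" where "weight z = (1 + (norm z)\<^sup>2) * exp (\<alpha> * (norm z)\<^sup>2)"

lemma weight_ge: "exp (\<alpha> * (norm z)\<^sup>2) \<le> weight z" "norm z * exp (\<alpha> * (norm z)\<^sup>2) \<le> weight z"
  "(norm z)\<^sup>2 * exp (\<alpha> * (norm z)\<^sup>2) \<le> weight z" "0 \<le> weight z"
proof -
  have "norm z \<le> 1 + (norm z)\<^sup>2" using abs_mult_le_sum_squares[of 1 "norm z"] by simp
  then show "norm z * exp (\<alpha> * (norm z)\<^sup>2) \<le> weight z" unfolding weight_def by (rule mult_right_mono) simp
qed (simp_all add: weight_def distrib_right)

lemma integrable_weight: "integrable gauss weight"
proof (rule integrable_gauss_growth)
  have "subgaussian_growth (\<lambda>z::real^'n. exp (\<alpha> * (norm z)\<^sup>2))"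
    by (rule subgaussian_growthI[OF \<alpha>, of _ 1]) simp
  from subgaussian_growth_weight[OF this] show "subgaussian_growth weight" by (simp add: weight_def[abs_def])
  show "weight \<in> borel_measurable borel" unfolding weight_def[abs_def] by measurable
qed

lemma integrable_weight_bound:
  fixes \<phi> :: "real^'n \<Rightarrow> 'b::{banach, second_countable_topology}"
  assumes "\<phi> \<in> borel_measurable borel" "\<And>z. norm (\<phi> z) \<le> K * weight z"
  shows "integrable gauss \<phi>"
proof (rule Bochner_Integration.integrable_bound)
  show "integrable gauss (\<lambda>z. K * weight z)" using integrable_weight by simp
  show "\<phi> \<in> borel_measurable gauss" using assms(1) unfolding borel_measurable_gauss .
  show "AE z in gauss. norm (\<phi> z) \<le> norm (K * weight z)"
    using assms(2) by (intro AE_I2 order.trans[OF assms(2)]) simp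
qed

end

locale regularised = rough_density f Df B \<alpha> \<epsilon> + ornstein_uhlenbeck c s
  for f :: "real^'n::finite \<Rightarrow> real" and Df :: "real^'n \<Rightarrow> real^'n" and B \<alpha> \<epsilon> c s :: real
begin

definition "ft x = (\<integral>z. f (c *\<^sub>R x + s *\<^sub>R z) \<partial>gauss)"

text \<open>The gradient of \<open>ft\<close> with the derivative moved onto the Gaussian, so that
  growth of \<open>f\<close> suffices to control it.\<close>

definition "G x = (c / s) *\<^sub>R (\<integral>z. f (c *\<^sub>R x + s *\<^sub>R z) *\<^sub>R z \<partial>gauss)"

lemma f_mix_le: "f (c *\<^sub>R x + s *\<^sub>R z) \<le> B * exp (\<alpha> * (norm x)\<^sup>2) * exp (\<alpha> * (norm z)\<^sup>2)"
proof -
  have "\<alpha> * (norm (c *\<^sub>R x + s *\<^sub>R z))\<^sup>2 \<le> \<alpha> * ((norm x)\<^sup>2 + (norm z)\<^sup>2)"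
    by (rule mult_left_mono[OF norm_mix_sq_le \<alpha>(1)])
  then have "exp (\<alpha> * (norm (c *\<^sub>R x + s *\<^sub>R z))\<^sup>2) \<le> exp (\<alpha> * (norm x)\<^sup>2) * exp (\<alpha> * (norm z)\<^sup>2)"
    by (simp add: exp_add[symmetric] distrib_left)
  then have "B * exp (\<alpha> * (norm (c *\<^sub>R x + s *\<^sub>R z))\<^sup>2) \<le> B * (exp (\<alpha> * (norm x)\<^sup>2) * exp (\<alpha> * (norm z)\<^sup>2))"
    by (rule mult_left_mono) (use B_pos in simp)
  then show ?thesis using growth[of "c *\<^sub>R x + s *\<^sub>R z"] by (simp add: mult.assoc)
qed

lemma mix_bounds:
  "norm (f (c *\<^sub>R x + s *\<^sub>R z)) \<le> B * exp (\<alpha> * (norm x)\<^sup>2) * weight z"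
  "norm (f (c *\<^sub>R x + s *\<^sub>R z) *\<^sub>R z) \<le> B * exp (\<alpha> * (norm x)\<^sup>2) * weight z"
  "norm (f (c *\<^sub>R x + s *\<^sub>R z) * (norm z)\<^sup>2) \<le> B * exp (\<alpha> * (norm x)\<^sup>2) * weight z"
proof -
  let ?K = "B * exp (\<alpha> * (norm x)\<^sup>2)" and ?f = "f (c *\<^sub>R x + s *\<^sub>R z)"
  have K: "0 \<le> ?K" using B_pos by simp
  have n: "norm ?f = ?f" using f_pos by (simp add: less_imp_le)
  have le: "?f * a \<le> ?K * weight z" if "0 \<le> a" "a * exp (\<alpha> * (norm z)\<^sup>2) \<le> weight z" for a
  proof -
    have "?f * a \<le> ?K * exp (\<alpha> * (norm z)\<^sup>2) * a" by (rule mult_right_mono[OF f_mix_le that(1)])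
    also have "\<dots> = ?K * (a * exp (\<alpha> * (norm z)\<^sup>2))" by (simp only: mult_ac)
    also have "\<dots> \<le> ?K * weight z" by (rule mult_left_mono[OF that(2) K])
    finally show ?thesis .
  qed
  show "norm ?f \<le> ?K * weight z" unfolding n using le[of 1] weight_ge(1) by simp
  show "norm (?f *\<^sub>R z) \<le> ?K * weight z" unfolding norm_scaleR using n le[of "norm z"] weight_ge(2) by simp
  show "norm (?f * (norm z)\<^sup>2) \<le> ?K * weight z" unfolding norm_mult using n le[of "(norm z)\<^sup>2"] weight_ge(3) by simp
qed

lemma meas_mix [measurable]:
  "(\<lambda>z. f (c *\<^sub>R x + s *\<^sub>R z)) \<in> borel_measurable borel" "(\<lambda>z. f (c *\<^sub>R x + s *\<^sub>R z) *\<^sub>R z) \<in> borel_measurable borel"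
  "(\<lambda>z. f (c *\<^sub>R x + s *\<^sub>R z) * (norm z)\<^sup>2) \<in> borel_measurable borel"
  by measurable

lemma integrable_mix:
  "integrable gauss (\<lambda>z. f (c *\<^sub>R x + s *\<^sub>R z))" "integrable gauss (\<lambda>z. f (c *\<^sub>R x + s *\<^sub>R z) *\<^sub>R z)"
  "integrable gauss (\<lambda>z. f (c *\<^sub>R x + s *\<^sub>R z) * (norm z)\<^sup>2)"
  by (rule integrable_weight_bound[OF meas_mix(1) mix_bounds(1)] integrable_weight_bound[OF meas_mix(2) mix_bounds(2)]
      integrable_weight_bound[OF meas_mix(3) mix_bounds(3)])+

lemma ft_pos: "0 < ft x" "0 \<le> ft x"
  using integral_pos_of_pos[OF integrable_mix(1) f_pos gauss.prob_space_axioms, of x] by (simp_all add: ft_def)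

lemma ft_le: "ft x \<le> B * (\<integral>z. exp (\<alpha> * (norm z)\<^sup>2) \<partial>(gauss :: (real^'n) measure)) * exp (\<alpha> * (norm x)\<^sup>2)"
proof -
  have "ft x \<le> (\<integral>z. B * exp (\<alpha> * (norm x)\<^sup>2) * exp (\<alpha> * (norm z)\<^sup>2) \<partial>(gauss :: (real^'n) measure))"
    unfolding ft_def
    by (rule integral_mono[OF integrable_mix(1) integrable_mult_right[OF integrable_gauss_exp_sq[OF \<alpha>(2)]] f_mix_le])
  then show ?thesis by (simp add: mult_ac)
qed

text \<open>Completing the square gives a bound uniform in y, hence domination that is locally
  uniform in x.\<close>

lemma kern_le: "kern x (y::real^'n) \<le> (1 / s) ^ CARD('n) * exp ((norm x)\<^sup>2 / 2)"
proof -
  have "0 \<le> (norm (x - c *\<^sub>R y))\<^sup>2" by simp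
  then have "2 * c * (x \<bullet> y) - c\<^sup>2 * (norm y)\<^sup>2 \<le> (norm x)\<^sup>2"
    unfolding power2_norm_eq_inner by (simp add: inner_diff_left inner_diff_right inner_commute power2_eq_square mult_ac)
  moreover have "(norm x)\<^sup>2 - c\<^sup>2 * (norm x)\<^sup>2 = s\<^sup>2 * (norm x)\<^sup>2"
  proof -
    have "1 - c\<^sup>2 = s\<^sup>2" using cs by simp
    then show ?thesis by (metis left_diff_distrib mult_1)
  qed
  ultimately have "2 * c * (x \<bullet> y) - c\<^sup>2 * (norm x)\<^sup>2 - c\<^sup>2 * (norm y)\<^sup>2 \<le> s\<^sup>2 * (norm x)\<^sup>2" by linarith
  then have "(2 * c * (x \<bullet> y) - c\<^sup>2 * (norm x)\<^sup>2 - c\<^sup>2 * (norm y)\<^sup>2) / (2 * s\<^sup>2) \<le> (norm x)\<^sup>2 / 2"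
    using s by (simp add: pos_divide_le_eq mult_ac)
  then show ?thesis unfolding kern_def using s by (intro mult_left_mono) auto
qed

text \<open>In kernel form x occurs only in the Mehler kernel, so the derivative falls on the kernel
  and not on \<open>f\<close>. Substituting y = c x + s z back turns the result into
  \<open>G\<close>.\<close>

lemma ft_has_derivative: "(ft has_derivative (\<lambda>v. G x \<bullet> v)) (at x)"
proof -
  define D where "D x y = (kern x y * f y * (c / s\<^sup>2)) *\<^sub>R (y - c *\<^sub>R x)" for x y :: "real^'n"
  have [measurable]: "D x \<in> borel_measurable borel" for x unfolding D_def by measurable
  define K where "K R = (1 / s) ^ CARD('n) * exp (R\<^sup>2 / 2) * (c / s\<^sup>2) * B * (1 + \<bar>R\<bar>)" for R :: real
  have bD: "norm (D x y) \<le> K R * weight y" if "norm x \<le> R" for x y R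
  proof -
    have R: "0 \<le> R" using that norm_ge_zero[of x] by linarith
    have k: "kern x y \<le> (1 / s) ^ CARD('n) * exp (R\<^sup>2 / 2)"
    proof (rule order.trans[OF kern_le mult_left_mono])
      show "exp ((norm x)\<^sup>2 / 2) \<le> exp (R\<^sup>2 / 2)" using power_mono[OF that norm_ge_zero, of 2] by simp
    qed (use s in simp)
    have "c\<^sup>2 \<le> 1\<^sup>2" unfolding one_power2 using cs zero_le_power2[of s] by linarith
    then have c1: "c \<le> 1" by (rule power2_le_imp_le) simp
    have "norm (c *\<^sub>R x) \<le> 1 * R" unfolding norm_scaleR by (rule mult_mono) (use c c1 that R in auto)
    then have n: "norm (y - c *\<^sub>R x) \<le> norm y + R" using norm_triangle_ineq4[of y "c *\<^sub>R x"] by linarith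
    have "norm (D x y) = kern x y * (c / s\<^sup>2) * (f y * norm (y - c *\<^sub>R x))"
      using kern_pos(2)[of x y] f_pos[of y] c s by (simp add: D_def abs_mult)
    also have "\<dots> \<le> ((1 / s) ^ CARD('n) * exp (R\<^sup>2 / 2)) * (c / s\<^sup>2) * ((B * exp (\<alpha> * (norm y)\<^sup>2)) * (norm y + R))"
    proof (rule mult_mono[OF mult_right_mono[OF k] mult_mono[OF growth n]])
      show "0 \<le> (1 / s) ^ CARD('n) * exp (R\<^sup>2 / 2) * (c / s\<^sup>2)" "0 \<le> c / s\<^sup>2" using c s by simp_all
      show "0 \<le> f y * norm (y - c *\<^sub>R x)" using f_pos[of y] by simp
      show "0 \<le> B * exp (\<alpha> * (norm y)\<^sup>2)" using B_pos by simp
    qed simp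
    also have "(B * exp (\<alpha> * (norm y)\<^sup>2)) * (norm y + R) = B * (norm y * exp (\<alpha> * (norm y)\<^sup>2) + R * exp (\<alpha> * (norm y)\<^sup>2))"
      by (simp add: algebra_simps)
    also have "((1 / s) ^ CARD('n) * exp (R\<^sup>2 / 2)) * (c / s\<^sup>2) * (B * (norm y * exp (\<alpha> * (norm y)\<^sup>2) + R * exp (\<alpha> * (norm y)\<^sup>2)))
       \<le> ((1 / s) ^ CARD('n) * exp (R\<^sup>2 / 2)) * (c / s\<^sup>2) * (B * (weight y + R * weight y))"
    proof (rule mult_left_mono[OF mult_left_mono[OF add_mono[OF weight_ge(2) mult_left_mono[OF weight_ge(1) R]]]])
      show "0 \<le> (1 / s) ^ CARD('n) * exp (R\<^sup>2 / 2) * (c / s\<^sup>2)" using c s by simp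
    qed (use B_pos in simp)
    also have "\<dots> = K R * weight y" using R by (simp add: K_def algebra_simps)
    finally show ?thesis .
  qed
  have ker: "((\<lambda>x. kern x y) has_derivative (\<lambda>v. kern x y * (c / s\<^sup>2) * ((y - c *\<^sub>R x) \<bullet> v))) (at x)" for x y :: "real^'n"
  proof -
    let ?e = "\<lambda>x. (2 * c * (x \<bullet> y) - c\<^sup>2 * (x \<bullet> x) - c\<^sup>2 * (y \<bullet> y)) / (2 * s\<^sup>2)"
    have q: "((\<lambda>x. x \<bullet> x) has_derivative (\<lambda>v. x \<bullet> v + v \<bullet> x)) (at x)"
      using has_derivative_inner[OF has_derivative_ident has_derivative_ident, of x UNIV] .
    have l: "((\<lambda>x. x \<bullet> y) has_derivative (\<lambda>v. v \<bullet> y)) (at x)"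
      by (rule bounded_linear_imp_has_derivative[OF bounded_linear_inner_left])
    have "((\<lambda>x. 2 * c * (x \<bullet> y) - c\<^sup>2 * (x \<bullet> x) - c\<^sup>2 * (y \<bullet> y)) has_derivative (\<lambda>v. 2 * c * (v \<bullet> y) - c\<^sup>2 * (x \<bullet> v + v \<bullet> x) - 0)) (at x)"
      by (intro has_derivative_diff has_derivative_mult_right has_derivative_const q l)
    from bounded_linear.has_derivative[OF bounded_linear_divide this, of "2 * s\<^sup>2"]
    have "(?e has_derivative (\<lambda>v. (2 * c * (v \<bullet> y) - c\<^sup>2 * (x \<bullet> v + v \<bullet> x) - 0) / (2 * s\<^sup>2))) (at x)" .
    from has_derivative_mult_right[OF has_derivative_exp[OF this], of "(1 / s) ^ CARD('n)"]
    have d: "((\<lambda>x. (1 / s) ^ CARD('n) * exp (?e x)) has_derivative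
      (\<lambda>v. (1 / s) ^ CARD('n) * ((2 * c * (v \<bullet> y) - c\<^sup>2 * (x \<bullet> v + v \<bullet> x) - 0) / (2 * s\<^sup>2) * exp (?e x)))) (at x)" .
    have "(2 * c * (v \<bullet> y) - c\<^sup>2 * (x \<bullet> v + v \<bullet> x) - 0) / (2 * s\<^sup>2) = (c / s\<^sup>2) * ((y - c *\<^sub>R x) \<bullet> v)" for v
    proof -
      have "2 * c * (v \<bullet> y) - c\<^sup>2 * (x \<bullet> v + v \<bullet> x) - 0 = 2 * (c * ((y - c *\<^sub>R x) \<bullet> v))"
        by (simp add: inner_diff_left inner_commute[of v] power2_eq_square right_diff_distrib)
      then show ?thesis by simp
    qed
    from d[unfolded this] show ?thesis unfolding kern_def power2_norm_eq_inner
      by (rule has_derivative_eq_rhs) (simp only: mult_ac)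
  qed
  have "((\<lambda>x. \<integral>y. kern x y * f y \<partial>gauss) has_derivative (\<lambda>v. (\<integral>y. D x y \<partial>gauss) \<bullet> v)) (at x)" for x :: "real^'n"
  proof (rule has_derivative_parametric_integral)
    show "((\<lambda>x. kern x y * f y) has_derivative (\<lambda>v. D x y \<bullet> v)) (at x)" for x y
      by (rule has_derivative_eq_rhs[OF has_derivative_mult_left[OF ker]]) (simp add: D_def mult_ac)
    show "\<exists>B. integrable gauss B \<and> (\<forall>x y. norm x \<le> R \<longrightarrow> norm (D x y) \<le> B y)" for R
      using bD integrable_weight by (intro exI[of _ "\<lambda>y. K R * weight y"]) simp
    show "integrable gauss (\<lambda>y. kern x y * f y)" for x
      using integrable_mix(1)[of x] integral_kern(2)[OF meas_f(1), of x] by simp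
    show "integrable gauss (D x)" for x
      by (rule integrable_weight_bound[OF _ bD[of x "norm x"]]) simp_all
  qed
  moreover have "(\<integral>y. kern x y * f y \<partial>gauss) = ft x" for x
    using integral_kern(1)[OF meas_f(1), of x] by (simp add: ft_def)
  moreover have "(\<integral>y. D x y \<partial>gauss) = G x" for x
  proof -
    have p: "(\<integral>z. (c / s\<^sup>2 * f (c *\<^sub>R x + s *\<^sub>R z)) *\<^sub>R ((c *\<^sub>R x + s *\<^sub>R z) - c *\<^sub>R x) \<partial>gauss)
      = (\<integral>y. kern x y *\<^sub>R ((c / s\<^sup>2 * f y) *\<^sub>R (y - c *\<^sub>R x)) \<partial>gauss)"
      by (rule integral_kern(1)) measurable
    have q: "(c / s\<^sup>2 * f (c *\<^sub>R x + s *\<^sub>R z)) *\<^sub>R ((c *\<^sub>R x + s *\<^sub>R z) - c *\<^sub>R x) = (c / s) *\<^sub>R (f (c *\<^sub>R x + s *\<^sub>R z) *\<^sub>R z)" for z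
      using s by (simp add: power2_eq_square)
    have Dx: "D x y = kern x y *\<^sub>R ((c / s\<^sup>2 * f y) *\<^sub>R (y - c *\<^sub>R x))" for y by (simp add: D_def mult_ac)
    show ?thesis unfolding Dx p[unfolded q, symmetric] G_def by (rule integral_scaleR_right)
  qed
  ultimately show ?thesis by simp
qed

lemma cont_G: "continuous_on UNIV G"
proof -
  have "isCont G x" for x
    unfolding continuous_at_sequentially comp_def
  proof (intro allI impI)
    fix X assume X: "X \<longlonglongrightarrow> x"
    obtain R where R: "\<And>n. norm (X n) \<le> R" using convergent_imp_Bseq[OF convergentI[OF X]] by (auto simp: Bseq_def)
    have "(\<lambda>n. \<integral>z. f (c *\<^sub>R X n + s *\<^sub>R z) *\<^sub>R z \<partial>gauss) \<longlonglongrightarrow> (\<integral>z. f (c *\<^sub>R x + s *\<^sub>R z) *\<^sub>R z \<partial>gauss)"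
    proof (rule integral_dominated_convergence[where w = "\<lambda>z. B * exp (\<alpha> * R\<^sup>2) * weight z"])
      show "integrable gauss (\<lambda>z. B * exp (\<alpha> * R\<^sup>2) * weight z)" using integrable_weight by simp
      show "AE z in gauss. norm (f (c *\<^sub>R X n + s *\<^sub>R z) *\<^sub>R z) \<le> B * exp (\<alpha> * R\<^sup>2) * weight z" for n
      proof (rule AE_I2, rule order.trans[OF mix_bounds(2)])
        fix z
        have "(norm (X n))\<^sup>2 \<le> R\<^sup>2" by (rule power_mono[OF R]) simp
        then have "exp (\<alpha> * (norm (X n))\<^sup>2) \<le> exp (\<alpha> * R\<^sup>2)" using \<alpha> by (simp add: mult_left_mono)
        then show "B * exp (\<alpha> * (norm (X n))\<^sup>2) * weight z \<le> B * exp (\<alpha> * R\<^sup>2) * weight z"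
          using B_pos weight_ge(4)[of z] by (intro mult_right_mono mult_left_mono) auto
      qed
      show "AE z in gauss. (\<lambda>n. f (c *\<^sub>R X n + s *\<^sub>R z) *\<^sub>R z) \<longlonglongrightarrow> f (c *\<^sub>R x + s *\<^sub>R z) *\<^sub>R z"
      proof (rule AE_I2)
        fix z
        have ic: "isCont f (c *\<^sub>R x + s *\<^sub>R z)" using cont_f by (simp add: continuous_on_eq_continuous_at)
        have "(\<lambda>n. c *\<^sub>R X n + s *\<^sub>R z) \<longlonglongrightarrow> c *\<^sub>R x + s *\<^sub>R z" by (intro tendsto_intros X)
        from tendsto_scaleR[OF isCont_tendsto_compose[OF ic this] tendsto_const]
        show "(\<lambda>n. f (c *\<^sub>R X n + s *\<^sub>R z) *\<^sub>R z) \<longlonglongrightarrow> f (c *\<^sub>R x + s *\<^sub>R z) *\<^sub>R z" .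
      qed
    qed measurable
    then show "(\<lambda>n. G (X n)) \<longlonglongrightarrow> G x" unfolding G_def by (intro tendsto_intros)
  qed
  then show ?thesis by (simp add: continuous_on_eq_continuous_at)
qed

lemma meas_ft [measurable]: "ft \<in> borel_measurable borel" "G \<in> borel_measurable borel"
  using ft_has_derivative has_derivative_continuous_on[of UNIV ft "\<lambda>x v. G x \<bullet> v"] cont_G
  by (auto intro: borel_measurable_continuous_onI)

definition "W = (\<integral>z. weight z \<partial>gauss)"

text \<open>The delicate condition is the Fisher integrand: Cauchy-Schwarz bounds the squared norm
  of the integral of f z by \<open>ft\<close> times the integral of f |z|^2, and the factor
  \<open>ft\<close> cancels the denominator.\<close>

lemma nice_ft: "nice ft G"
  unfolding nice_def c1_growth_def
proof (intro conjI allI)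
  have Wb: "(\<integral>z. B * exp (\<alpha> * (norm x)\<^sup>2) * weight z \<partial>gauss) = B * W * exp (\<alpha> * (norm x)\<^sup>2)" for x :: "real^'n"
    by (simp add: W_def)
  have iW: "integrable gauss (\<lambda>z. B * exp (\<alpha> * (norm x)\<^sup>2) * weight z)" for x :: "real^'n"
    using integrable_weight by simp
  show "subgaussian_growth ft"
    by (rule subgaussian_growthI[OF \<alpha>]) (use ft_le ft_pos in simp)
  have "norm (\<integral>z. f (c *\<^sub>R x + s *\<^sub>R z) *\<^sub>R z \<partial>gauss) \<le> B * W * exp (\<alpha> * (norm x)\<^sup>2)" for x
  proof -
    have "norm (\<integral>z. f (c *\<^sub>R x + s *\<^sub>R z) *\<^sub>R z \<partial>gauss) \<le> (\<integral>z. norm (f (c *\<^sub>R x + s *\<^sub>R z) *\<^sub>R z) \<partial>gauss)" by (rule integral_norm_bound)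
    also have "\<dots> \<le> (\<integral>z. B * exp (\<alpha> * (norm x)\<^sup>2) * weight z \<partial>gauss)"
      by (rule integral_mono[OF integrable_norm[OF integrable_mix(2)] iW mix_bounds(2)])
    finally show ?thesis unfolding Wb .
  qed
  then have "subgaussian_growth (\<lambda>x. \<integral>z. f (c *\<^sub>R x + s *\<^sub>R z) *\<^sub>R z \<partial>gauss)" by (rule subgaussian_growthI[OF \<alpha>])
  from subgaussian_growth_cmult[OF this, of "c / s"] show "subgaussian_growth G" by (simp add: G_def[abs_def])
  have "norm ((norm (G x))\<^sup>2 / ft x) \<le> (c / s)\<^sup>2 * (B * W) * exp (\<alpha> * (norm x)\<^sup>2)" for x
  proof -
    have sq: "(norm (f (c *\<^sub>R x + s *\<^sub>R z) *\<^sub>R z))\<^sup>2 / f (c *\<^sub>R x + s *\<^sub>R z) = f (c *\<^sub>R x + s *\<^sub>R z) * (norm z)\<^sup>2" for z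
      using f_pos[of "c *\<^sub>R x + s *\<^sub>R z"] by (simp add: power_mult_distrib power2_eq_square[of "f _"])
    have "(norm (\<integral>z. f (c *\<^sub>R x + s *\<^sub>R z) *\<^sub>R z \<partial>gauss))\<^sup>2 \<le> ft x * (\<integral>z. (norm (f (c *\<^sub>R x + s *\<^sub>R z) *\<^sub>R z))\<^sup>2 / f (c *\<^sub>R x + s *\<^sub>R z) \<partial>gauss)"
      unfolding ft_def
      by (rule norm_integral_sq_le[OF integrable_mix(1) f_pos gauss.prob_space_axioms integrable_mix(2)])
        (unfold sq, rule integrable_mix(3))
    also have "(\<integral>z. (norm (f (c *\<^sub>R x + s *\<^sub>R z) *\<^sub>R z))\<^sup>2 / f (c *\<^sub>R x + s *\<^sub>R z) \<partial>gauss) \<le> (\<integral>z. B * exp (\<alpha> * (norm x)\<^sup>2) * weight z \<partial>gauss)"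
      unfolding sq by (rule integral_mono[OF integrable_mix(3) iW]) (rule order.trans[OF abs_ge_self mix_bounds(3)[unfolded real_norm_def]])
    finally have "(norm (\<integral>z. f (c *\<^sub>R x + s *\<^sub>R z) *\<^sub>R z \<partial>gauss))\<^sup>2 \<le> (B * W * exp (\<alpha> * (norm x)\<^sup>2)) * ft x"
      unfolding Wb using ft_pos[of x] by (simp add: mult_left_mono mult_ac)
    then have "(norm (\<integral>z. f (c *\<^sub>R x + s *\<^sub>R z) *\<^sub>R z \<partial>gauss))\<^sup>2 / ft x \<le> B * W * exp (\<alpha> * (norm x)\<^sup>2)"
      by (subst pos_divide_le_eq[OF ft_pos(1)])
    then have "(c / s)\<^sup>2 * ((norm (\<integral>z. f (c *\<^sub>R x + s *\<^sub>R z) *\<^sub>R z \<partial>gauss))\<^sup>2 / ft x) \<le> (c / s)\<^sup>2 * (B * W * exp (\<alpha> * (norm x)\<^sup>2))"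
      by (rule mult_left_mono) simp
    moreover have "norm ((norm (G x))\<^sup>2 / ft x) = (c / s)\<^sup>2 * ((norm (\<integral>z. f (c *\<^sub>R x + s *\<^sub>R z) *\<^sub>R z \<partial>gauss))\<^sup>2 / ft x)"
      using ft_pos[of x] by (simp add: G_def power_mult_distrib power_divide)
    ultimately show ?thesis by (simp only: mult.assoc)
  qed
  then show "subgaussian_growth (\<lambda>x. (norm (G x))\<^sup>2 / ft x)" by (rule subgaussian_growthI[OF \<alpha>])
qed (auto intro: ft_has_derivative cont_G ft_pos)

end

lemma integrable_gauss_ident: "integrable gauss (\<lambda>z::real^'n::finite. z)"
proof (rule integrable_gauss_growth)
  have g: "subgaussian_growth (\<lambda>z::real^'n. (1 + (norm z)\<^sup>2) *\<^sub>R (1::real))"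
    by (rule subgaussian_growth_weight[OF subgaussian_growth_const])
  have "norm z \<le> 1 + (norm z)\<^sup>2" for z :: "real^'n" using abs_mult_le_sum_squares[of 1 "norm z"] by simp
  then show "subgaussian_growth (\<lambda>z::real^'n. z)" by (intro subgaussian_growth_mono[OF g]) simp
qed simp

lemma integral_gauss_component: "(\<integral>z. z $ k \<partial>(gauss :: (real^'n::finite) measure)) = 0"
proof -
  have "(\<integral>z. (0::real^'n) \<partial>(gauss :: (real^'n) measure)) = (\<integral>z. 1 *\<^sub>R z \<partial>gauss)"
    by (rule gauss_parts[where g = "\<lambda>_. 1" and Dg = "\<lambda>_. 0"]) (use integrable_gauss_ident in auto)
  then have "(\<integral>z. z \<partial>(gauss :: (real^'n) measure)) = 0" by simp
  moreover have "(\<integral>z. z $ k \<partial>(gauss :: (real^'n) measure)) = (\<integral>z. z \<partial>gauss) $ k"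
    using integral_inner_left[OF integrable_gauss_ident, of "axis k (1::real)"] by (simp add: inner_axis)
  ultimately show ?thesis by simp
qed

lemma (in rough_density) mass_nn: "(\<integral>\<^sup>+x. ennreal (f x) \<partial>gauss) = 1"
  using nn_integral_eq_integral[OF integrable_f] f_pos mass by (simp add: less_imp_le)

context regularised
begin

lemma ft_mass: "(\<integral>x. ft x \<partial>gauss) = 1"
proof -
  have m: "(\<lambda>y. ennreal (f y)) \<in> borel_measurable borel" by measurable
  have "ennreal (ft x) = (\<integral>\<^sup>+z. ennreal (f (c *\<^sub>R x + s *\<^sub>R z)) \<partial>gauss)" for x
    unfolding ft_def by (rule nn_integral_eq_integral[OF integrable_mix(1), symmetric]) (use f_pos in \<open>simp add: less_imp_le\<close>)
  then have "(\<integral>\<^sup>+x. ennreal (ft x) \<partial>gauss) = 1" using nn_integral_ou_invariant[OF m] mass_nn by simp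
  moreover have "(\<integral>\<^sup>+x. ennreal (ft x) \<partial>gauss) = ennreal (\<integral>x. ft x \<partial>gauss)"
    by (rule nn_integral_eq_integral[OF nice_integrable(1)[OF nice_ft]]) (use ft_pos in simp)
  ultimately show ?thesis by simp
qed

text \<open>Gaussian Prekopa-Leindler in the integration variable. The squared distance of the mixed
  points is at most |x - y|^2 + |z - z'|^2, and since 1 - \<epsilon> <= 1 the Gaussian factor pays
  for the second summand. The parameter \<epsilon> is thus preserved.\<close>

lemma ft_midpoint: "ft x * ft y \<le> (ft ((1/2) *\<^sub>R (x + y)))\<^sup>2 * exp ((1 - \<epsilon>) / 4 * (norm (x - y))\<^sup>2)"
proof -
  define q where "q = exp ((1 - \<epsilon>) / 8 * (norm (x - y))\<^sup>2)"
  let ?m = "(1/2) *\<^sub>R (x + y)"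
  have q: "0 < q" "q\<^sup>2 = exp ((1 - \<epsilon>) / 4 * (norm (x - y))\<^sup>2)"
    unfolding q_def by (simp_all add: exp_double[symmetric])
  have ff: "(\<integral>\<^sup>+z. ennreal (f (c *\<^sub>R w + s *\<^sub>R z)) \<partial>gauss) = ennreal (ft w)" for w
    unfolding ft_def by (rule nn_integral_eq_integral[OF integrable_mix(1)]) (use f_pos in \<open>simp add: less_imp_le\<close>)
  have "(\<integral>\<^sup>+z. ennreal (f (c *\<^sub>R x + s *\<^sub>R z)) \<partial>gauss) * (\<integral>\<^sup>+z. ennreal (f (c *\<^sub>R y + s *\<^sub>R z)) \<partial>gauss)
     \<le> (\<integral>\<^sup>+z. ennreal q * ennreal (f (c *\<^sub>R ?m + s *\<^sub>R z)) \<partial>gauss)\<^sup>2"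
  proof (rule gaussian_PL_gauss[unfolded gaussian_PL_def, rule_format])
    fix z z' :: "real^'n"
    let ?a = "c *\<^sub>R x + s *\<^sub>R z" and ?b = "c *\<^sub>R y + s *\<^sub>R z'" and ?w = "c *\<^sub>R ?m + s *\<^sub>R ((1/2) *\<^sub>R (z + z'))"
    have w: "(1/2) *\<^sub>R (?a + ?b) = ?w" by (simp add: scaleR_add_right add_ac)
    have d: "?a - ?b = c *\<^sub>R (x - y) + s *\<^sub>R (z - z')" by (simp add: scaleR_diff_right)
    have "(1 - \<epsilon>) * (norm (?a - ?b))\<^sup>2 \<le> (1 - \<epsilon>) * ((norm (x - y))\<^sup>2 + (norm (z - z'))\<^sup>2)"
      unfolding d by (rule mult_left_mono[OF norm_mix_sq_le]) (use \<epsilon> in simp)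
    also have "\<dots> \<le> (1 - \<epsilon>) * (norm (x - y))\<^sup>2 + (norm (z - z'))\<^sup>2"
      unfolding distrib_left using \<epsilon> by (simp add: mult_left_le_one_le)
    finally have "(1 - \<epsilon>) / 4 * (norm (?a - ?b))\<^sup>2 + - (norm (z - z'))\<^sup>2 / 4 \<le> (1 - \<epsilon>) / 4 * (norm (x - y))\<^sup>2" by simp
    then have e: "exp ((1 - \<epsilon>) / 4 * (norm (?a - ?b))\<^sup>2) * exp (- (norm (z - z'))\<^sup>2 / 4) \<le> q\<^sup>2"
      unfolding q(2) exp_add[symmetric] by simp
    have "f ?a * f ?b * exp (- (norm (z - z'))\<^sup>2 / 4) \<le> (f ?w)\<^sup>2 * exp ((1 - \<epsilon>) / 4 * (norm (?a - ?b))\<^sup>2) * exp (- (norm (z - z'))\<^sup>2 / 4)"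
      using mid[of ?a ?b] unfolding w by (rule mult_right_mono) simp
    also have "\<dots> \<le> (f ?w)\<^sup>2 * q\<^sup>2" unfolding mult.assoc by (rule mult_left_mono[OF e]) simp
    finally have "ennreal (f ?a * f ?b * exp (- (norm (z - z'))\<^sup>2 / 4)) \<le> ennreal ((q * f ?w)\<^sup>2)"
      by (intro ennreal_leI) (simp add: power_mult_distrib mult.commute)
    then show "ennreal (f ?a) * ennreal (f ?b) * ennreal (exp (- (norm (z - z'))\<^sup>2 / 4)) \<le> (ennreal q * ennreal (f ?w))\<^sup>2"
      using f_pos q(1) by (simp add: ennreal_mult[symmetric] ennreal_power less_imp_le)
  qed measurable
  also have "(\<integral>\<^sup>+z. ennreal q * ennreal (f (c *\<^sub>R ?m + s *\<^sub>R z)) \<partial>gauss) = ennreal q * ennreal (ft ?m)"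
    unfolding ff[symmetric] by (rule nn_integral_cmult) measurable
  finally have "ennreal (ft x * ft y) \<le> ennreal ((q * ft ?m)\<^sup>2)"
    unfolding ff using ft_pos q(1) by (simp add: ennreal_mult[symmetric] ennreal_power less_imp_le)
  then have "ft x * ft y \<le> (q * ft ?m)\<^sup>2" by (simp add: ennreal_le_iff)
  then show ?thesis unfolding q(2)[symmetric] by (simp add: power_mult_distrib mult.commute)
qed

lemma semiconcave_ft: "semiconcave_density ft G \<epsilon>"
  by unfold_locales
    (rule nice_ft \<epsilon> ft_mass semiconcave_first_order[OF ft_pos(1) ft_has_derivative ft_midpoint])+

text \<open>By Fubini and symmetry of the kernel the coordinate function is averaged to c times
  itself, so the barycentre is scaled by c and a zero barycentre stays zero.\<close>

lemma ft_mean: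
  assumes i: "integrable gauss (\<lambda>x. x $ k * f x)" and m: "(\<integral>x. x $ k * f x \<partial>gauss) = 0"
  shows "(\<integral>x. x $ k * ft x \<partial>gauss) = 0"
proof -
  interpret pair_sigma_finite "gauss :: (real^'n) measure" "gauss :: (real^'n) measure" ..
  define \<Phi> where "\<Phi> x y = x $ k * (kern x y * f y)" for x y :: "real^'n"
  have kf: "(\<integral>y. kern x y * f y \<partial>gauss) = ft x" "integrable gauss (\<lambda>y. kern x y * f y)" for x
    using integral_kern(1)[OF meas_f(1), of x] integral_kern(2)[OF meas_f(1), of x] integrable_mix(1)[of x] by (simp_all add: ft_def)
  have "integrable (gauss \<Otimes>\<^sub>M gauss) (\<lambda>(x, y). \<Phi> x y)"
  proof (rule Fubini_integrable)
    show "(\<lambda>(x, y). \<Phi> x y) \<in> borel_measurable (gauss \<Otimes>\<^sub>M gauss)" unfolding \<Phi>_def by measurable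
    have "(\<integral>y. norm (case (x, y) of (x, y) \<Rightarrow> \<Phi> x y) \<partial>gauss) = norm (x $ k * ft x)" for x
    proof -
      have "norm (case (x, y) of (x, y) \<Rightarrow> \<Phi> x y) = \<bar>x $ k\<bar> * (kern x y * f y)" for y
        using kern_pos(2)[of x y] f_pos[of y] by (simp add: \<Phi>_def abs_mult)
      then show ?thesis using kf(1)[of x] ft_pos[of x] by (simp add: abs_mult)
    qed
    then show "integrable gauss (\<lambda>x. \<integral>y. norm (case (x, y) of (x, y) \<Rightarrow> \<Phi> x y) \<partial>gauss)"
      using integrable_norm[OF nice_integrable(6)[OF nice_ft, of k]] by simp
    show "AE x in gauss. integrable gauss (\<lambda>y. case (x, y) of (x, y) \<Rightarrow> \<Phi> x y)"
      unfolding \<Phi>_def using kf(2) by simp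
  qed
  from Fubini_integral[OF this]
  have F: "(\<integral>y. \<integral>x. \<Phi> x y \<partial>gauss \<partial>gauss) = (\<integral>x. \<integral>y. \<Phi> x y \<partial>gauss \<partial>gauss)" by simp
  have "(\<integral>x. \<Phi> x y \<partial>gauss) = c * (y $ k * f y)" for y
  proof -
    have g: "integrable gauss (\<lambda>z::real^'n. z $ k)"
      using integrable_inner_left[OF integrable_gauss_ident, of "axis k 1"] by (simp add: inner_axis)
    have "(\<integral>x. kern y x *\<^sub>R (x $ k) \<partial>gauss) = (\<integral>z. (c *\<^sub>R y + s *\<^sub>R z) $ k \<partial>gauss)"
      by (rule integral_kern(1)[symmetric]) measurable
    also have "\<dots> = c * y $ k" using g by (simp add: integral_gauss_component gauss.prob_space[unfolded space_gauss])
    finally have a: "(\<integral>x. kern y x *\<^sub>R (x $ k) \<partial>gauss) = c * y $ k" .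
    have "\<Phi> x y = f y * (kern y x *\<^sub>R (x $ k))" for x by (simp add: \<Phi>_def kern_commute[of x y])
    then have "(\<integral>x. \<Phi> x y \<partial>gauss) = f y * (c * y $ k)" using a by simp
    then show ?thesis by (simp only: mult_ac)
  qed
  moreover have "(\<integral>y. \<Phi> x y \<partial>gauss) = x $ k * ft x" for x unfolding \<Phi>_def using kf(1)[of x] by simp
  ultimately show ?thesis using F m by simp
qed

text \<open>If the right side is finite, Stein's identity moves the derivative back onto f, so that
  \<open>G\<close> is c times the average of \<open>Df\<close>, and Cauchy-Schwarz applies.
  Otherwise the right side is infinite.\<close>

lemma ft_fisher_pointwise:
  "ennreal ((norm (G x))\<^sup>2 / ft x) \<le> (\<integral>\<^sup>+z. ennreal ((norm (Df (c *\<^sub>R x + s *\<^sub>R z)))\<^sup>2 / f (c *\<^sub>R x + s *\<^sub>R z)) \<partial>gauss)"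
proof (cases "integrable gauss (\<lambda>z. (norm (Df (c *\<^sub>R x + s *\<^sub>R z)))\<^sup>2 / f (c *\<^sub>R x + s *\<^sub>R z))")
  case False
  have "(\<integral>\<^sup>+z. ennreal ((norm (Df (c *\<^sub>R x + s *\<^sub>R z)))\<^sup>2 / f (c *\<^sub>R x + s *\<^sub>R z)) \<partial>gauss) = \<infinity>"
  proof (rule ccontr)
    assume "\<not> ?thesis"
    then have "integrable gauss (\<lambda>z. (norm (Df (c *\<^sub>R x + s *\<^sub>R z)))\<^sup>2 / f (c *\<^sub>R x + s *\<^sub>R z))"
      using f_pos by (intro integrableI_nonneg) (auto simp: less_imp_le less_top)
    then show False using False by simp
  qed
  then show ?thesis by simp
next
  case True
  define g where "g z = f (c *\<^sub>R x + s *\<^sub>R z)" for z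
  define h where "h z = Df (c *\<^sub>R x + s *\<^sub>R z)" for z
  have [measurable]: "g \<in> borel_measurable borel" "h \<in> borel_measurable borel" unfolding g_def[abs_def] h_def[abs_def] by measurable
  have gp: "0 < g z" for z by (simp add: g_def f_pos)
  have iq: "integrable gauss (\<lambda>z. (norm (h z))\<^sup>2 / g z)" using True by (simp add: g_def h_def)
  have ig: "integrable gauss g" using integrable_mix(1) by (simp add: g_def[abs_def])
  have ih: "integrable gauss h"
  proof (rule Bochner_Integration.integrable_bound)
    show "integrable gauss (\<lambda>z. g z + (norm (h z))\<^sup>2 / g z)" using ig iq by simp
    have "norm (h z) \<le> g z + (norm (h z))\<^sup>2 / g z" for z
    proof -
      have s: "0 < sqrt (g z)" "(sqrt (g z))\<^sup>2 = g z" using gp[of z] by simp_all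
      have "norm (h z) = \<bar>sqrt (g z) * (norm (h z) / sqrt (g z))\<bar>" using s(1) by simp
      also have "\<dots> \<le> (sqrt (g z))\<^sup>2 + (norm (h z) / sqrt (g z))\<^sup>2" by (rule abs_mult_le_sum_squares)
      also have "\<dots> = g z + (norm (h z))\<^sup>2 / g z" unfolding power_divide s(2) ..
      finally show ?thesis .
    qed
    moreover have "0 \<le> g z + (norm (h z))\<^sup>2 / g z" for z using gp[of z] by simp
    ultimately show "AE z in gauss. norm (h z) \<le> norm (g z + (norm (h z))\<^sup>2 / g z)" by simp
  qed measurable
  have "(\<integral>z. s *\<^sub>R h z \<partial>gauss) = (\<integral>z. g z *\<^sub>R z \<partial>gauss)"
  proof (rule gauss_parts)
    show "(g has_derivative (\<lambda>v. (s *\<^sub>R h z) \<bullet> v)) (at z)" for z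
    proof -
      have "((\<lambda>z. c *\<^sub>R x + s *\<^sub>R z) has_derivative (\<lambda>v. s *\<^sub>R v)) (at z)" by (auto intro!: derivative_eq_intros)
      from has_derivative_compose[OF this f_der]
      show ?thesis unfolding g_def[abs_def] h_def by simp
    qed
    show "continuous_on UNIV (\<lambda>z. s *\<^sub>R h z)" unfolding h_def
      by (intro continuous_intros continuous_on_compose2[OF cont_Df]) auto
    show "integrable gauss (\<lambda>z. g z *\<^sub>R z)" using integrable_mix(2) by (simp add: g_def)
  qed (use ig ih in auto)
  then have gz: "(\<integral>z. g z *\<^sub>R z \<partial>gauss) = s *\<^sub>R (\<integral>z. h z \<partial>gauss)" by simp
  have "G x = c *\<^sub>R (\<integral>z. h z \<partial>gauss)" unfolding G_def g_def[symmetric] gz using s by simp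
  then have "(norm (G x))\<^sup>2 = c\<^sup>2 * (norm (\<integral>z. h z \<partial>gauss))\<^sup>2" using c by (simp add: power_mult_distrib)
  also have "\<dots> \<le> 1 * (norm (\<integral>z. h z \<partial>gauss))\<^sup>2"
  proof (rule mult_right_mono)
    show "c\<^sup>2 \<le> 1" using cs zero_le_power2[of s] by linarith
  qed simp
  also have "\<dots> \<le> ft x * (\<integral>z. (norm (h z))\<^sup>2 / g z \<partial>gauss)"
    using norm_integral_sq_le[OF ig gp gauss.prob_space_axioms ih iq] unfolding ft_def g_def[symmetric] by simp
  finally have "(norm (G x))\<^sup>2 / ft x \<le> (\<integral>z. (norm (h z))\<^sup>2 / g z \<partial>gauss)"
    using ft_pos(1)[of x] by (simp add: pos_divide_le_eq mult.commute)
  then have "ennreal ((norm (G x))\<^sup>2 / ft x) \<le> ennreal (\<integral>z. (norm (h z))\<^sup>2 / g z \<partial>gauss)" by (rule ennreal_leI)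
  also have "\<dots> = (\<integral>\<^sup>+z. ennreal ((norm (h z))\<^sup>2 / g z) \<partial>gauss)"
    by (rule nn_integral_eq_integral[OF iq, symmetric]) (use gp in \<open>simp add: less_imp_le\<close>)
  finally show ?thesis by (simp add: g_def h_def)
qed

lemma ft_fisher_le: "(\<integral>x. (norm (G x))\<^sup>2 / ft x \<partial>gauss) \<le> (\<integral>x. (norm (Df x))\<^sup>2 / f x \<partial>gauss)"
proof -
  have m: "(\<lambda>y. ennreal ((norm (Df y))\<^sup>2 / f y)) \<in> borel_measurable borel" by measurable
  have "ennreal (\<integral>x. (norm (G x))\<^sup>2 / ft x \<partial>gauss) = (\<integral>\<^sup>+x. ennreal ((norm (G x))\<^sup>2 / ft x) \<partial>gauss)"
    by (rule nn_integral_eq_integral[OF nice_integrable(3)[OF nice_ft], symmetric]) (use ft_pos in simp)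
  also have "\<dots> \<le> (\<integral>\<^sup>+x. \<integral>\<^sup>+z. ennreal ((norm (Df (c *\<^sub>R x + s *\<^sub>R z)))\<^sup>2 / f (c *\<^sub>R x + s *\<^sub>R z)) \<partial>gauss \<partial>gauss)"
    by (rule nn_integral_mono) (rule ft_fisher_pointwise)
  also have "\<dots> = (\<integral>\<^sup>+y. ennreal ((norm (Df y))\<^sup>2 / f y) \<partial>gauss)" by (rule nn_integral_ou_invariant[OF m])
  also have "\<dots> = ennreal (\<integral>x. (norm (Df x))\<^sup>2 / f x \<partial>gauss)"
    by (rule nn_integral_eq_integral[OF fisher_int]) (use f_pos in \<open>simp add: less_imp_le\<close>)
  finally show ?thesis using f_pos by (subst (asm) ennreal_le_iff) (auto intro!: integral_nonneg_AE simp: less_imp_le)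
qed

text \<open>The Gaussian Poincare inequality for sqrt \<open>ft\<close>: its variance is the left
  side, its Dirichlet energy a quarter of the Fisher information, which
  \<open>fisher_le_deficit\<close> bounds.\<close>

lemma ft_hellinger:
  assumes "\<And>k. integrable gauss (\<lambda>x. x $ k * f x)" "\<And>k. (\<integral>x. x $ k * f x \<partial>gauss) = 0"
  shows "1 - (\<integral>x. sqrt (ft x) \<partial>gauss)\<^sup>2 \<le> real CARD('n) * (8 / \<epsilon> + 4 / \<epsilon>\<^sup>2) / 4 *
    ((\<integral>x. (norm (Df x))\<^sup>2 / f x \<partial>gauss) / 2 - (\<integral>x. ft x * ln (ft x) \<partial>gauss))"
proof -
  interpret D: semiconcave_density ft G \<epsilon> by (rule semiconcave_ft)
  define K where "K = real CARD('n) * (8 / \<epsilon> + 4 / \<epsilon>\<^sup>2)"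
  have K: "0 \<le> K" using \<epsilon> by (simp add: K_def)
  have sq: "(norm ((1 / (2 * sqrt (ft x))) *\<^sub>R G x))\<^sup>2 = ((norm (G x))\<^sup>2 / ft x) / 4" for x
    using ft_pos[of x] by (simp add: power_mult_distrib power_divide)
  have tau: "property_tau 1 (gauss :: (real^'n) measure)"
    by (rule property_tau_gaussian[OF gaussian_PL_gauss gauss.prob_space_axioms]) simp
  have "(\<integral>x. (sqrt (ft x))\<^sup>2 \<partial>gauss) - (\<integral>x. sqrt (ft x) \<partial>gauss)\<^sup>2 \<le> (\<integral>x. (norm ((1 / (2 * sqrt (ft x))) *\<^sub>R G x))\<^sup>2 \<partial>gauss) / 1"
  proof (rule poincare_property_tau[OF tau _ gauss.prob_space_axioms])
    show "((\<lambda>x. sqrt (ft x)) has_derivative (\<lambda>v. ((1 / (2 * sqrt (ft x))) *\<^sub>R G x) \<bullet> v)) (at x)" for x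
    proof -
      have "(sqrt has_derivative (\<lambda>v. inverse (sqrt (ft x)) / 2 * v)) (at (ft x))"
        using DERIV_real_sqrt[OF ft_pos(1)[of x]] unfolding has_field_derivative_def .
      from has_derivative_compose[OF ft_has_derivative this]
      have "((\<lambda>x. sqrt (ft x)) has_derivative (\<lambda>v. inverse (sqrt (ft x)) / 2 * (G x \<bullet> v))) (at x)" .
      moreover have "inverse (sqrt (ft x)) / 2 * (G x \<bullet> v) = ((1 / (2 * sqrt (ft x))) *\<^sub>R G x) \<bullet> v" for v
        by (simp add: inverse_eq_divide)
      ultimately show ?thesis by (simp only:)
    qed
    have "continuous_on UNIV ft" using c1_growthD(3)[OF niceD(1)[OF nice_ft]] .
    then show "continuous_on UNIV (\<lambda>x. (1 / (2 * sqrt (ft x))) *\<^sub>R G x)"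
      using ft_pos(1) by (intro continuous_intros cont_G) (auto simp: less_imp_neq[THEN not_sym])
    show "integrable gauss (\<lambda>x. (sqrt (ft x))\<^sup>2)" using nice_integrable(1)[OF nice_ft] ft_pos by simp
    show "integrable gauss (\<lambda>x. (norm ((1 / (2 * sqrt (ft x))) *\<^sub>R G x))\<^sup>2)"
      unfolding sq by (intro integrable_divide_zero nice_integrable(3)[OF nice_ft])
  qed simp_all
  then have "1 - (\<integral>x. sqrt (ft x) \<partial>gauss)\<^sup>2 \<le> (\<integral>x. (norm (G x))\<^sup>2 / ft x \<partial>gauss) / 4"
    unfolding sq integral_divide_zero using ft_mass ft_pos by simp
  also have "\<dots> \<le> K * D.deficit_value / 4"
    using D.fisher_le_deficit[OF ft_mean[OF assms]] unfolding K_def by (rule divide_right_mono) simp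
  \<comment> \<open>Passing to the Fisher information of \<open>f\<close> itself leaves the entropy
    as the only term on the right that varies with the regularisation.\<close>
  also have "K * D.deficit_value \<le> K * ((\<integral>x. (norm (Df x))\<^sup>2 / f x \<partial>gauss) / 2 - (\<integral>x. ft x * ln (ft x) \<partial>gauss))"
    by (rule mult_left_mono[OF _ K]) (use ft_fisher_le in \<open>simp add: D.deficit_value_def\<close>)
  finally show ?thesis by (simp add: K_def)
qed

end

text \<open>The shift by 2 keeps s below 1 already at n = 0, so that c stays positive.\<close>

lemma ornstein_uhlenbeck_sequence:
  "ornstein_uhlenbeck (sqrt (1 - (1 / (real n + 2))\<^sup>2)) (1 / (real n + 2))"
proof
  have "(1 / (real n + 2))\<^sup>2 < 1\<^sup>2" by (rule power_strict_mono) (auto simp: divide_less_eq)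
  then show "0 < sqrt (1 - (1 / (real n + 2))\<^sup>2)" "(sqrt (1 - (1 / (real n + 2))\<^sup>2))\<^sup>2 + (1 / (real n + 2))\<^sup>2 = 1" by simp_all
qed simp

text \<open>Let the regularisation parameter s tend to 0 in \<open>ft_hellinger\<close>. The
  regularised densities converge pointwise and share a Gaussian majorant, so entropies and integrals
  of square roots converge.\<close>

theorem (in rough_density) hellinger_le_deficit:
  assumes "\<And>k. integrable gauss (\<lambda>x. x $ k * f x)" "\<And>k. (\<integral>x. x $ k * f x \<partial>gauss) = 0"
  shows "1 - (\<integral>x. sqrt (f x) \<partial>gauss)\<^sup>2 \<le> real CARD('n) * (8 / \<epsilon> + 4 / \<epsilon>\<^sup>2) / 4 *
    ((\<integral>x. (norm (Df x))\<^sup>2 / f x \<partial>gauss) / 2 - (\<integral>x. f x * ln (f x) \<partial>gauss))"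
proof -
  define s where "s n = 1 / (real n + 2)" for n
  define c where "c n = sqrt (1 - (s n)\<^sup>2)" for n
  define F where "F n x = (\<integral>z. f (c n *\<^sub>R x + s n *\<^sub>R z) \<partial>gauss)" for n x
  have R: "regularised f Df B \<alpha> \<epsilon> (c n) (s n)" for n
    unfolding regularised_def c_def s_def by (intro conjI rough_density_axioms ornstein_uhlenbeck_sequence)
  have Fft: "F n = regularised.ft f (c n) (s n)" for n
    by (rule ext) (simp add: F_def regularised.ft_def[OF R])
  have F_pos: "0 < F n x" for n x unfolding Fft by (rule regularised.ft_pos(1)[OF R])
  have [measurable]: "F n \<in> borel_measurable borel" for n unfolding Fft by (rule regularised.meas_ft(1)[OF R])
  have s0: "s \<longlonglongrightarrow> 0" unfolding s_def by real_asymp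
  then have "c \<longlonglongrightarrow> sqrt (1 - 0\<^sup>2)" unfolding c_def by (intro tendsto_intros)
  then have c1: "c \<longlonglongrightarrow> 1" by simp
  have lim: "(\<lambda>n. F n x) \<longlonglongrightarrow> f x" for x
  proof -
    have "(\<lambda>n. F n x) \<longlonglongrightarrow> (\<integral>z. f x \<partial>(gauss :: (real^'n) measure))"
      unfolding F_def
    proof (rule integral_dominated_convergence[where w = "\<lambda>z. B * exp (\<alpha> * (norm x)\<^sup>2) * weight z"])
      show "integrable gauss (\<lambda>z. B * exp (\<alpha> * (norm x)\<^sup>2) * weight z)" using integrable_weight by simp
      show "AE z in gauss. norm (f (c n *\<^sub>R x + s n *\<^sub>R z)) \<le> B * exp (\<alpha> * (norm x)\<^sup>2) * weight z" for n
        by (rule AE_I2) (rule regularised.mix_bounds(1)[OF R])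
      show "AE z in gauss. (\<lambda>n. f (c n *\<^sub>R x + s n *\<^sub>R z)) \<longlonglongrightarrow> f x"
      proof (rule AE_I2)
        fix z :: "real^'n"
        have "isCont f x" using cont_f by (simp add: continuous_on_eq_continuous_at)
        moreover have "(\<lambda>n. c n *\<^sub>R x + s n *\<^sub>R z) \<longlonglongrightarrow> 1 *\<^sub>R x + 0 *\<^sub>R z" by (intro tendsto_intros c1 s0)
        then have "(\<lambda>n. c n *\<^sub>R x + s n *\<^sub>R z) \<longlonglongrightarrow> x" by simp
        ultimately show "(\<lambda>n. f (c n *\<^sub>R x + s n *\<^sub>R z)) \<longlonglongrightarrow> f x" by (rule isCont_tendsto_compose)
      qed
    qed measurable
    then show ?thesis by (simp add: gauss.prob_space[unfolded space_gauss])
  qed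
  \<comment> \<open>The common majorant \<open>Z\<close> is kept at least 1 so that
    \<open>abs_mult_ln_le\<close> dominates the entropy integrands and sqrt F n <= Z.\<close>
  define A where "A = max 1 (B * (\<integral>z. exp (\<alpha> * (norm z)\<^sup>2) \<partial>(gauss :: (real^'n) measure)))"
  define Z where "Z x = A * exp (\<alpha> * (norm x)\<^sup>2)" for x :: "real^'n"
  have FZ: "F n x \<le> Z x" for n x
  proof -
    have "F n x \<le> B * (\<integral>z. exp (\<alpha> * (norm z)\<^sup>2) \<partial>(gauss :: (real^'n) measure)) * exp (\<alpha> * (norm x)\<^sup>2)"
      unfolding Fft by (rule regularised.ft_le[OF R])
    also have "\<dots> \<le> Z x" unfolding Z_def by (rule mult_right_mono) (auto simp: A_def)
    finally show ?thesis .
  qed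
  have Z1: "1 \<le> Z x" for x
  proof -
    have "1 * 1 \<le> A * exp (\<alpha> * (norm x)\<^sup>2)" by (rule mult_mono) (use \<alpha> in \<open>auto simp: A_def\<close>)
    then show ?thesis by (simp add: Z_def)
  qed
  have [measurable]: "Z \<in> borel_measurable borel" unfolding Z_def[abs_def] by measurable
  have Zg: "subgaussian_growth Z"
    by (rule subgaussian_growthI[OF \<alpha>, of _ A]) (simp add: Z_def A_def abs_mult)
  have Zi: "integrable gauss Z" by (rule integrable_gauss_growth[OF Zg]) measurable
  have Zpos: "0 < Z x" for x using Z1[of x] by linarith
  have "integrable gauss (\<lambda>x. Z x * ln (Z x))"
    by (rule integrable_gauss_growth[OF subgaussian_growth_mult_ln[OF Zg Zpos]]) measurable
  then have Zli: "integrable gauss (\<lambda>x. 1 + Z x * ln (Z x))" by simp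
  have "(\<lambda>n. \<integral>x. F n x * ln (F n x) \<partial>gauss) \<longlonglongrightarrow> (\<integral>x. f x * ln (f x) \<partial>gauss)"
  proof (rule integral_dominated_convergence[OF _ _ Zli])
    show "AE x in gauss. (\<lambda>n. F n x * ln (F n x)) \<longlonglongrightarrow> f x * ln (f x)"
      by (intro AE_I2 tendsto_intros lim) (rule less_imp_neq[THEN not_sym, OF f_pos])
    show "AE x in gauss. norm (F n x * ln (F n x)) \<le> 1 + Z x * ln (Z x)" for n
      unfolding real_norm_def by (intro AE_I2 abs_mult_ln_le F_pos FZ Z1)
  qed measurable
  moreover have "(\<lambda>n. \<integral>x. sqrt (F n x) \<partial>gauss) \<longlonglongrightarrow> (\<integral>x. sqrt (f x) \<partial>gauss)"
  proof (rule integral_dominated_convergence[OF _ _ Zi])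
    show "AE x in gauss. (\<lambda>n. sqrt (F n x)) \<longlonglongrightarrow> sqrt (f x)" by (intro AE_I2 tendsto_intros lim)
    show "AE x in gauss. norm (sqrt (F n x)) \<le> Z x" for n
    proof (rule AE_I2)
      fix x
      have "F n x \<le> (Z x)\<^sup>2" using FZ[of n x] self_le_power[OF Z1[of x], of 2] by simp
      then have "sqrt (F n x) \<le> Z x" using Zpos[of x] by (intro real_le_lsqrt) auto
      then show "norm (sqrt (F n x)) \<le> Z x" using F_pos[of n x] by simp
    qed
  qed measurable
  ultimately show ?thesis
  proof (intro LIMSEQ_le[OF _ _ exI[of _ 0]])
    assume 1: "(\<lambda>n. \<integral>x. F n x * ln (F n x) \<partial>gauss) \<longlonglongrightarrow> (\<integral>x. f x * ln (f x) \<partial>gauss)"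
      and 2: "(\<lambda>n. \<integral>x. sqrt (F n x) \<partial>gauss) \<longlonglongrightarrow> (\<integral>x. sqrt (f x) \<partial>gauss)"
    show "(\<lambda>n. 1 - (\<integral>x. sqrt (F n x) \<partial>gauss)\<^sup>2) \<longlonglongrightarrow> 1 - (\<integral>x. sqrt (f x) \<partial>gauss)\<^sup>2"
      by (intro tendsto_intros 2)
    show "(\<lambda>n. real CARD('n) * (8 / \<epsilon> + 4 / \<epsilon>\<^sup>2) / 4 *
        ((\<integral>x. (norm (Df x))\<^sup>2 / f x \<partial>gauss) / 2 - (\<integral>x. F n x * ln (F n x) \<partial>gauss)))
      \<longlonglongrightarrow> real CARD('n) * (8 / \<epsilon> + 4 / \<epsilon>\<^sup>2) / 4 *
        ((\<integral>x. (norm (Df x))\<^sup>2 / f x \<partial>gauss) / 2 - (\<integral>x. f x * ln (f x) \<partial>gauss))"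
      by (intro tendsto_mult_left tendsto_diff tendsto_const 1)
    show "\<forall>n\<ge>0. 1 - (\<integral>x. sqrt (F n x) \<partial>gauss)\<^sup>2 \<le> real CARD('n) * (8 / \<epsilon> + 4 / \<epsilon>\<^sup>2) / 4 *
        ((\<integral>x. (norm (Df x))\<^sup>2 / f x \<partial>gauss) / 2 - (\<integral>x. F n x * ln (F n x) \<partial>gauss))"
      using regularised.ft_hellinger[OF R assms] unfolding Fft by blast
  qed
qed

section \<open>From the Hellinger distance to the Wasserstein distance\<close>

text \<open>Two uses of the weighted Poincare inequality: coordinates have variance at most 1 /
  \<epsilon>, so the second moment is at most n / \<epsilon>; and |x|^2, with gradient 2 x, has
  variance at most 4 / \<epsilon> times the second moment.\<close>

lemma fourth_moment_le:
  fixes f :: "real^'n::finite \<Rightarrow> real"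
  assumes [measurable]: "f \<in> borel_measurable borel" and growth: "subgaussian_growth f"
    and nn: "\<And>x. 0 \<le> f x" and mass: "(\<integral>\<^sup>+x. ennreal (f x) \<partial>gauss) = 1" and \<epsilon>: "0 < \<epsilon>"
    and mid: "\<And>x y. f x * f y \<le> (f ((1/2) *\<^sub>R (x + y)))\<^sup>2 * exp ((1 - \<epsilon>) / 4 * (norm (x - y))\<^sup>2)"
    and mean: "\<And>k. (\<integral>x. x $ k * f x \<partial>gauss) = 0"
  shows "integrable gauss (\<lambda>x. f x * (norm x) ^ 4)"
    "(\<integral>x. f x * (norm x) ^ 4 \<partial>gauss) \<le> (real CARD('n) ^ 2 + 4 * real CARD('n)) / \<epsilon>\<^sup>2"
proof -
  have w: "subgaussian_growth (\<lambda>x. (1 + (norm x)\<^sup>2) *\<^sub>R ((1 + (norm x)\<^sup>2) *\<^sub>R f x))"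
    by (intro subgaussian_growth_weight growth)
  have int: "integrable gauss (\<lambda>x. f x * h x)" if [measurable]: "h \<in> borel_measurable borel" and "\<And>x. \<bar>h x\<bar> \<le> (1 + (norm x)\<^sup>2) * (1 + (norm x)\<^sup>2)" for h :: "real^'n \<Rightarrow> real"
  proof (rule integrable_gauss_growth[OF subgaussian_growth_mono[OF w]])
    fix x :: "real^'n"
    have "f x * \<bar>h x\<bar> \<le> f x * ((1 + (norm x)\<^sup>2) * (1 + (norm x)\<^sup>2))" by (rule mult_left_mono[OF that(2) nn])
    then show "norm (f x * h x) \<le> norm ((1 + (norm x)\<^sup>2) *\<^sub>R ((1 + (norm x)\<^sup>2) *\<^sub>R f x))"
      using nn[of x] by (simp add: abs_mult mult_ac)
  qed measurable
  have sq1: "(1 + (norm x)\<^sup>2) * (1 + (norm x)\<^sup>2) = 1 + 2 * (norm x)\<^sup>2 + (norm x) ^ 4" for x :: "real^'n"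
    by (simp add: distrib_left distrib_right power_add[symmetric])
  show i4: "integrable gauss (\<lambda>x. f x * (norm x) ^ 4)" by (rule int) (simp_all add: sq1)
  have i2: "integrable gauss (\<lambda>x. f x * (norm x)\<^sup>2)" by (rule int) (simp_all add: sq1)
  have ik: "integrable gauss (\<lambda>x. f x * (x $ k)\<^sup>2)" for k
  proof (rule int)
    fix x :: "real^'n"
    have "(x $ k)\<^sup>2 \<le> (norm x)\<^sup>2" using component_le_norm_cart[of x k] by (rule abs_le_square_iff[THEN iffD1, of "x $ k" "norm x", unfolded abs_norm_cancel])
    then show "\<bar>(x $ k)\<^sup>2\<bar> \<le> (1 + (norm x)\<^sup>2) * (1 + (norm x)\<^sup>2)"
      unfolding sq1 abs_of_nonneg[OF zero_le_power2]
      using zero_le_power[OF norm_ge_zero[of x], of 4] zero_le_power2[of "norm x"] by linarith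
  qed measurable
  have i1: "integrable gauss f" using int[of "\<lambda>_. 1"] by (simp add: sq1)
  have m1: "(\<integral>x. f x \<partial>gauss) = 1" using nn_integral_eq_integral[OF i1] nn mass by simp
  have "(\<integral>x. f x * (x $ k)\<^sup>2 \<partial>gauss) \<le> 1 / \<epsilon>" for k
  proof -
    have "(\<integral>x. f x * (x $ k)\<^sup>2 \<partial>gauss) - (\<integral>x. f x * x $ k \<partial>gauss)\<^sup>2 \<le> (\<integral>x. f x * (norm (axis k (1::real) :: real^'n))\<^sup>2 \<partial>gauss) / \<epsilon>"
    proof (rule weighted_poincare[OF assms(1) nn mass \<epsilon> mid])
      have "((\<lambda>x. x $ k) has_derivative (\<lambda>v. v $ k)) (at x)" for x :: "real^'n"
        by (rule bounded_linear_imp_has_derivative[OF bounded_linear_vec_nth])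
      then show "((\<lambda>x. x $ k) has_derivative (\<lambda>v. axis k 1 \<bullet> v)) (at x)" for x :: "real^'n"
        by (simp add: inner_axis')
    qed (use ik i1 in simp_all)
    then show ?thesis using mean[of k] m1 by (simp add: mult.commute[of "f _" "_ $ k"])
  qed
  note second = this
  have n2: "(norm x)\<^sup>2 = (\<Sum>k\<in>UNIV. (x $ k)\<^sup>2)" for x :: "real^'n"
    by (simp add: norm_vec_def L2_set_def sum_nonneg)
  have "(\<integral>x. f x * (norm x)\<^sup>2 \<partial>gauss) = (\<Sum>k\<in>UNIV. \<integral>x. f x * (x $ k)\<^sup>2 \<partial>gauss)"
    unfolding n2 sum_distrib_left by (rule Bochner_Integration.integral_sum) (rule ik)
  also have "\<dots> \<le> real CARD('n) * (1 / \<epsilon>)" by (rule sum_bounded_above) (rule second)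
  finally have s2: "(\<integral>x. f x * (norm x)\<^sup>2 \<partial>gauss) \<le> real CARD('n) / \<epsilon>" by simp
  have s0: "0 \<le> (\<integral>x. f x * (norm x)\<^sup>2 \<partial>gauss)" using nn by simp
  have "(\<integral>x. f x * (x \<bullet> x)\<^sup>2 \<partial>gauss) - (\<integral>x. f x * (x \<bullet> x) \<partial>gauss)\<^sup>2 \<le> (\<integral>x. f x * (norm (2 *\<^sub>R x))\<^sup>2 \<partial>gauss) / \<epsilon>"
  proof (rule weighted_poincare[OF assms(1) nn mass \<epsilon> mid])
    show "((\<lambda>x. x \<bullet> x) has_derivative (\<lambda>v. (2 *\<^sub>R x) \<bullet> v)) (at x)" for x :: "real^'n"
      using has_derivative_inner[OF has_derivative_ident has_derivative_ident, of x UNIV]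
      by (rule has_derivative_eq_rhs) (simp add: fun_eq_iff inner_commute)
    show "continuous_on UNIV (\<lambda>x::real^'n. 2 *\<^sub>R x)" by (intro continuous_intros)
    show "integrable gauss (\<lambda>x. f x * (x \<bullet> x)\<^sup>2)" using i4 by (simp add: power2_norm_eq_inner[symmetric])
    have "f x * (norm (2 *\<^sub>R x))\<^sup>2 = 4 * (f x * (norm x)\<^sup>2)" for x by (simp add: power_mult_distrib)
    then show "integrable gauss (\<lambda>x. f x * (norm (2 *\<^sub>R x))\<^sup>2)" by (simp only: integrable_mult_right[OF i2])
  qed
  moreover have "f x * (norm (2 *\<^sub>R x))\<^sup>2 = 4 * (f x * (norm x)\<^sup>2)" for x by (simp add: power_mult_distrib)
  then have "(\<integral>x. f x * (norm (2 *\<^sub>R x))\<^sup>2 \<partial>gauss) = 4 * (\<integral>x. f x * (norm x)\<^sup>2 \<partial>gauss)"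
    by (simp only: integral_mult_right_zero)
  moreover have "(x \<bullet> x)\<^sup>2 = (norm x) ^ 4" "x \<bullet> x = (norm x)\<^sup>2" for x :: "real^'n"
    by (simp_all add: power2_norm_eq_inner[symmetric])
  ultimately have "(\<integral>x. f x * (norm x) ^ 4 \<partial>gauss) \<le> (\<integral>x. f x * (norm x)\<^sup>2 \<partial>gauss)\<^sup>2 + 4 * (\<integral>x. f x * (norm x)\<^sup>2 \<partial>gauss) / \<epsilon>"
    by (simp only: diff_le_eq add.commute)
  also have "\<dots> \<le> (real CARD('n) / \<epsilon>)\<^sup>2 + 4 * (real CARD('n) / \<epsilon>) / \<epsilon>"
    using s0 s2 \<epsilon> by (intro add_mono power_mono divide_right_mono mult_left_mono) auto
  also have "\<dots> = (real CARD('n) ^ 2 + 4 * real CARD('n)) / \<epsilon>\<^sup>2"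
    by (simp add: power_divide add_divide_distrib power2_eq_square)
  finally show "(\<integral>x. f x * (norm x) ^ 4 \<partial>gauss) \<le> (real CARD('n) ^ 2 + 4 * real CARD('n)) / \<epsilon>\<^sup>2" .
qed

text \<open>The coupling leaves the common mass min f 1 in place and couples the excess of f over 1
  independently with the shortfall; both have the same mass t. Only the second part costs anything,
  and |x - y|^2 <= 2 |x|^2 + 2 |y|^2 separates the variables.\<close>

lemma W2_sq_density_le:
  fixes f :: "real^'n::finite \<Rightarrow> real"
  assumes [measurable]: "f \<in> borel_measurable borel" and nn: "\<And>x. 0 \<le> f x" and mass: "(\<integral>\<^sup>+x. ennreal (f x) \<partial>gauss) = 1"
  shows "W2_sq (density gauss (\<lambda>x. ennreal (f x))) gauss \<le> 2 * (\<integral>\<^sup>+x. ennreal ((norm x)\<^sup>2 * \<bar>f x - 1\<bar>) \<partial>gauss)"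
proof -
  let ?\<mu> = "gauss :: (real^'n) measure" and ?\<rho> = "density gauss (\<lambda>x::real^'n. ennreal (f x))"
  interpret PP: pair_prob_space ?\<mu> ?\<mu> ..
  define m p q where "m x = ennreal (min (f x) 1)" and "p x = ennreal (max (f x - 1) 0)" and "q x = ennreal (max (1 - f x) 0)" for x
  have [measurable]: "m \<in> borel_measurable borel" "p \<in> borel_measurable borel" "q \<in> borel_measurable borel"
    unfolding m_def[abs_def] p_def[abs_def] q_def[abs_def] by measurable
  have "m x + p x = ennreal (min (f x) 1 + max (f x - 1) 0)" "m x + q x = ennreal (min (f x) 1 + max (1 - f x) 0)"
    "p x + q x = ennreal (max (f x - 1) 0 + max (1 - f x) 0)" for x
    unfolding m_def p_def q_def by (rule ennreal_plus[symmetric]; use nn[of x] in simp)+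
  moreover have "min a 1 + max (a - 1) 0 = a" "min a 1 + max (1 - a) 0 = 1" "max (a - 1) 0 + max (1 - a) 0 = \<bar>a - 1\<bar>" for a :: real
    by (simp_all add: min_def max_def)
  ultimately have mp: "m x + p x = ennreal (f x)" and mq: "m x + q x = 1" and pq: "p x + q x = ennreal \<bar>f x - 1\<bar>" for x
    by simp_all
  define t where "t = (\<integral>\<^sup>+x. p x \<partial>?\<mu>)"
  have mfin: "(\<integral>\<^sup>+x. m x \<partial>?\<mu>) \<noteq> \<top>"
  proof -
    have "(\<integral>\<^sup>+x. m x \<partial>?\<mu>) \<le> (\<integral>\<^sup>+x. ennreal (f x) \<partial>?\<mu>)" by (rule nn_integral_mono) (simp add: mp[symmetric])
    then show ?thesis using mass by (auto simp: top_unique)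
  qed
  have e1: "(\<integral>\<^sup>+x. m x \<partial>?\<mu>) + t = 1"
    unfolding t_def by (subst nn_integral_add[symmetric]) (simp_all add: mp mass)
  have e2: "(\<integral>\<^sup>+x. m x \<partial>?\<mu>) + (\<integral>\<^sup>+x. q x \<partial>?\<mu>) = 1"
    using gauss.emeasure_space_1[where 'n = 'n] by (subst nn_integral_add[symmetric]) (simp_all add: mq)
  have tq: "(\<integral>\<^sup>+x. q x \<partial>?\<mu>) = t"
    using e1 e2 mfin ennreal_add_left_cancel[of "\<integral>\<^sup>+x. m x \<partial>?\<mu>" "\<integral>\<^sup>+x. q x \<partial>?\<mu>" t] by simp
  have t1: "t \<le> 1" unfolding e1[symmetric] by simp
  \<comment> \<open>If t = 0 then \<open>t * inverse t\<close> is 0 and not 1, but then the density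
    in front vanishes almost everywhere.\<close>
  have t_inv: "(\<integral>\<^sup>+x. g x * a x \<partial>?\<mu>) = (\<integral>\<^sup>+x. g x * a x * (t * inverse t) \<partial>?\<mu>)"
    if [measurable]: "g \<in> borel_measurable borel" and g: "(\<integral>\<^sup>+x. g x \<partial>?\<mu>) = t" for g a
  proof (cases "t = 0")
    case True
    then have "AE x in ?\<mu>. g x = 0" using g nn_integral_0_iff_AE[of g ?\<mu>] by simp
    then show ?thesis by (intro nn_integral_cong_AE) auto
  next
    case False
    then have "t * inverse t = 1"
      using ennreal_divide_self[OF _ le_less_trans[OF t1 ennreal_one_less_top]] by (simp add: divide_ennreal_def)
    then show ?thesis by simp
  qed
  \<comment> \<open>The Boolean tag chooses between the diagonal part of the coupling (weight
    \<open>m\<close>) and the product part (weight \<open>p x * q y * inverse t\<close>);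
    \<open>T\<close> forgets the tag.\<close>
  define M where "M = count_space (UNIV :: bool set) \<Otimes>\<^sub>M (?\<mu> \<Otimes>\<^sub>M ?\<mu>)"
  define h where "h w = (case w of (b, x, y) \<Rightarrow> if b then m x else p x * q y * inverse t)" for w :: "bool \<times> (real^'n) \<times> (real^'n)"
  define T where "T w = (case w of (b, x, y) \<Rightarrow> if b then (x, x) else (x, y))" for w :: "bool \<times> (real^'n) \<times> (real^'n)"
  have [measurable]: "h \<in> borel_measurable M" "T \<in> measurable M (borel \<Otimes>\<^sub>M borel)"
    unfolding h_def[abs_def] T_def[abs_def] M_def by measurable
  define \<pi> where "\<pi> = distr (density M h) (borel \<Otimes>\<^sub>M borel) T"
  have nn\<pi>: "(\<integral>\<^sup>+z. \<phi> z \<partial>\<pi>) = (\<integral>\<^sup>+x. m x * \<phi> (x, x) \<partial>?\<mu>) + (\<integral>\<^sup>+x. \<integral>\<^sup>+y. p x * q y * inverse t * \<phi> (x, y) \<partial>?\<mu> \<partial>?\<mu>)"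
    if [measurable]: "\<phi> \<in> borel_measurable (borel \<Otimes>\<^sub>M borel)" for \<phi>
  proof -
    have "(\<integral>\<^sup>+z. \<phi> z \<partial>\<pi>) = (\<integral>\<^sup>+w. h w * \<phi> (T w) \<partial>M)"
      unfolding \<pi>_def by (simp add: nn_integral_distr nn_integral_density)
    also have "\<dots> = (\<integral>\<^sup>+b. \<integral>\<^sup>+v. h (b, v) * \<phi> (T (b, v)) \<partial>(?\<mu> \<Otimes>\<^sub>M ?\<mu>) \<partial>count_space UNIV)"
    proof -
      have "(\<lambda>w. h w * \<phi> (T w)) \<in> borel_measurable M" by measurable
      then show ?thesis unfolding M_def by (rule PP.nn_integral_fst[symmetric])
    qed
    also have "\<dots> = (\<integral>\<^sup>+v. h (True, v) * \<phi> (T (True, v)) \<partial>(?\<mu> \<Otimes>\<^sub>M ?\<mu>)) + (\<integral>\<^sup>+v. h (False, v) * \<phi> (T (False, v)) \<partial>(?\<mu> \<Otimes>\<^sub>M ?\<mu>))"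
      by (simp add: nn_integral_count_space_finite UNIV_bool add.commute)
    also have "(\<integral>\<^sup>+v. h (True, v) * \<phi> (T (True, v)) \<partial>(?\<mu> \<Otimes>\<^sub>M ?\<mu>)) = (\<integral>\<^sup>+x. \<integral>\<^sup>+y. m x * \<phi> (x, x) \<partial>?\<mu> \<partial>?\<mu>)"
      by (subst gauss.nn_integral_fst[symmetric]) (simp_all add: h_def T_def case_prod_beta)
    also have "\<dots> = (\<integral>\<^sup>+x. m x * \<phi> (x, x) \<partial>?\<mu>)"
      using gauss.emeasure_space_1[where 'n = 'n] by simp
    also have "(\<integral>\<^sup>+v. h (False, v) * \<phi> (T (False, v)) \<partial>(?\<mu> \<Otimes>\<^sub>M ?\<mu>)) = (\<integral>\<^sup>+x. \<integral>\<^sup>+y. p x * q y * inverse t * \<phi> (x, y) \<partial>?\<mu> \<partial>?\<mu>)"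
      by (subst gauss.nn_integral_fst[symmetric]) (simp_all add: h_def T_def case_prod_beta)
    finally show ?thesis .
  qed
  have fst_part: "(\<integral>\<^sup>+x. \<integral>\<^sup>+y. p x * q y * inverse t * a x \<partial>?\<mu> \<partial>?\<mu>) = (\<integral>\<^sup>+x. p x * a x \<partial>?\<mu>)"
    if [measurable]: "a \<in> borel_measurable borel" for a
  proof -
    have "(\<integral>\<^sup>+y. p x * q y * inverse t * a x \<partial>?\<mu>) = p x * a x * (t * inverse t)" for x
    proof -
      have "(\<integral>\<^sup>+y. p x * q y * inverse t * a x \<partial>?\<mu>) = (\<integral>\<^sup>+y. (p x * a x * inverse t) * q y \<partial>?\<mu>)" by (simp only: mult_ac)
      also have "\<dots> = p x * a x * inverse t * t" unfolding tq[symmetric] by (rule nn_integral_cmult) simp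
      finally show ?thesis by (simp only: mult_ac)
    qed
    then show ?thesis using t_inv[of p a] by (simp add: t_def[symmetric])
  qed
  have snd_part: "(\<integral>\<^sup>+x. \<integral>\<^sup>+y. p x * q y * inverse t * a y \<partial>?\<mu> \<partial>?\<mu>) = (\<integral>\<^sup>+x. q x * a x \<partial>?\<mu>)"
    if [measurable]: "a \<in> borel_measurable borel" for a
  proof -
    have "(\<integral>\<^sup>+x. \<integral>\<^sup>+y. p x * q y * inverse t * a y \<partial>?\<mu> \<partial>?\<mu>) = (\<integral>\<^sup>+x. p x * (inverse t * (\<integral>\<^sup>+y. q y * a y \<partial>?\<mu>)) \<partial>?\<mu>)"
    proof (rule nn_integral_cong)
      fix x
      have "(\<integral>\<^sup>+y. p x * q y * inverse t * a y \<partial>?\<mu>) = (\<integral>\<^sup>+y. (p x * inverse t) * (q y * a y) \<partial>?\<mu>)" by (simp only: mult_ac)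
      also have "\<dots> = p x * inverse t * (\<integral>\<^sup>+y. q y * a y \<partial>?\<mu>)" by (rule nn_integral_cmult) simp
      finally show "(\<integral>\<^sup>+y. p x * q y * inverse t * a y \<partial>?\<mu>) = p x * (inverse t * (\<integral>\<^sup>+y. q y * a y \<partial>?\<mu>))" by (simp only: mult_ac)
    qed
    also have "\<dots> = t * (inverse t * (\<integral>\<^sup>+y. q y * a y \<partial>?\<mu>))" unfolding t_def by (rule nn_integral_multc) simp
    also have "\<dots> = (\<integral>\<^sup>+y. q y * a y * (t * inverse t) \<partial>?\<mu>)"
      by (subst nn_integral_multc) (simp_all add: mult_ac)
    finally show ?thesis using t_inv[of q a] tq by simp
  qed
  have "\<pi> \<in> couplings ?\<rho> ?\<mu>"
    unfolding couplings_def
  proof (intro CollectI conjI)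
    show s: "sets \<pi> = sets (?\<rho> \<Otimes>\<^sub>M ?\<mu>)" unfolding \<pi>_def sets_distr by (rule sets_pair_measure_cong) simp_all
    have [measurable]: "fst \<in> measurable \<pi> borel" "snd \<in> measurable \<pi> borel" by (simp_all add: \<pi>_def)
    show "distr \<pi> ?\<rho> fst = ?\<rho>"
    proof (rule measure_eqI)
      fix A assume "A \<in> sets (distr \<pi> ?\<rho> fst)"
      then have [measurable]: "A \<in> sets borel" by simp
      have f': "fst \<in> measurable \<pi> ?\<rho>" by (simp add: measurable_cong_sets[of \<pi> \<pi> ?\<rho> borel])
      have "emeasure (distr \<pi> ?\<rho> fst) A = (\<integral>\<^sup>+z. indicator A (fst z) \<partial>\<pi>)"
        by (subst nn_integral_indicator[symmetric], simp, subst nn_integral_distr[OF f']) simp_all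
      also have "\<dots> = (\<integral>\<^sup>+x. m x * indicator A x \<partial>?\<mu>) + (\<integral>\<^sup>+x. p x * indicator A x \<partial>?\<mu>)"
        by (subst nn\<pi>) (simp_all add: fst_part)
      also have "\<dots> = (\<integral>\<^sup>+x. ennreal (f x) * indicator A x \<partial>?\<mu>)"
        by (subst nn_integral_add[symmetric]) (simp_all add: distrib_right[symmetric] mp)
      finally show "emeasure (distr \<pi> ?\<rho> fst) A = emeasure ?\<rho> A" by (simp add: emeasure_density)
    qed simp
    show "distr \<pi> ?\<mu> snd = ?\<mu>"
    proof (rule measure_eqI)
      fix A assume "A \<in> sets (distr \<pi> ?\<mu> snd)"
      then have [measurable]: "A \<in> sets borel" by simp
      have f': "snd \<in> measurable \<pi> ?\<mu>" by (simp add: measurable_cong_sets[of \<pi> \<pi> ?\<mu> borel])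
      have "emeasure (distr \<pi> ?\<mu> snd) A = (\<integral>\<^sup>+z. indicator A (snd z) \<partial>\<pi>)"
        by (subst nn_integral_indicator[symmetric], simp, subst nn_integral_distr[OF f']) simp_all
      also have "\<dots> = (\<integral>\<^sup>+x. m x * indicator A x \<partial>?\<mu>) + (\<integral>\<^sup>+x. q x * indicator A x \<partial>?\<mu>)"
        by (subst nn\<pi>) (simp_all add: snd_part)
      also have "\<dots> = (\<integral>\<^sup>+x. indicator A x \<partial>?\<mu>)"
        by (subst nn_integral_add[symmetric]) (simp_all add: distrib_right[symmetric] mq)
      finally show "emeasure (distr \<pi> ?\<mu> snd) A = emeasure ?\<mu> A" by simp
    qed simp
  qed
  then have "W2_sq ?\<rho> ?\<mu> \<le> (\<integral>\<^sup>+z. ennreal ((norm (fst z - snd z))\<^sup>2) \<partial>\<pi>)"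
    unfolding W2_sq_def by (rule INF_lower)
  also have "\<dots> = (\<integral>\<^sup>+x. \<integral>\<^sup>+y. p x * q y * inverse t * ennreal ((norm (x - y))\<^sup>2) \<partial>?\<mu> \<partial>?\<mu>)"
    by (subst nn\<pi>) simp_all
  also have "\<dots> \<le> (\<integral>\<^sup>+x. \<integral>\<^sup>+y. p x * q y * inverse t * ennreal (2 * (norm x)\<^sup>2) + p x * q y * inverse t * ennreal (2 * (norm y)\<^sup>2) \<partial>?\<mu> \<partial>?\<mu>)"
  proof (intro nn_integral_mono)
    fix x y :: "real^'n"
    have "(norm (x - y))\<^sup>2 \<le> (norm x + norm y)\<^sup>2" by (rule power_mono[OF norm_triangle_ineq4]) simp
    also have "\<dots> \<le> 2 * (norm x)\<^sup>2 + 2 * (norm y)\<^sup>2" using zero_le_power2[of "norm x - norm y"] by (simp add: power2_sum power2_diff)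
    finally have "ennreal ((norm (x - y))\<^sup>2) \<le> ennreal (2 * (norm x)\<^sup>2 + 2 * (norm y)\<^sup>2)" by (rule ennreal_leI)
    also have "\<dots> = ennreal (2 * (norm x)\<^sup>2) + ennreal (2 * (norm y)\<^sup>2)" by (rule ennreal_plus) simp_all
    finally have "ennreal ((norm (x - y))\<^sup>2) \<le> ennreal (2 * (norm x)\<^sup>2) + ennreal (2 * (norm y)\<^sup>2)" .
    then show "p x * q y * inverse t * ennreal ((norm (x - y))\<^sup>2) \<le> p x * q y * inverse t * ennreal (2 * (norm x)\<^sup>2) + p x * q y * inverse t * ennreal (2 * (norm y)\<^sup>2)"
      unfolding distrib_left[symmetric] by (rule mult_left_mono) simp
  qed
  also have "\<dots> = (\<integral>\<^sup>+x. p x * ennreal (2 * (norm x)\<^sup>2) \<partial>?\<mu>) + (\<integral>\<^sup>+x. q x * ennreal (2 * (norm x)\<^sup>2) \<partial>?\<mu>)"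
    by (simp add: nn_integral_add fst_part snd_part)
  also have "\<dots> = (\<integral>\<^sup>+x. ennreal \<bar>f x - 1\<bar> * ennreal (2 * (norm x)\<^sup>2) \<partial>?\<mu>)"
    by (subst nn_integral_add[symmetric]) (simp_all add: distrib_right[symmetric] pq)
  also have "\<dots> = (\<integral>\<^sup>+x. 2 * ennreal ((norm x)\<^sup>2 * \<bar>f x - 1\<bar>) \<partial>?\<mu>)"
  proof (rule nn_integral_cong)
    fix x :: "real^'n"
    have "ennreal \<bar>f x - 1\<bar> * ennreal (2 * (norm x)\<^sup>2) = ennreal (2 * ((norm x)\<^sup>2 * \<bar>f x - 1\<bar>))"
      by (subst ennreal_mult[symmetric]) (simp_all add: mult_ac)
    then show "ennreal \<bar>f x - 1\<bar> * ennreal (2 * (norm x)\<^sup>2) = 2 * ennreal ((norm x)\<^sup>2 * \<bar>f x - 1\<bar>)"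
      by (simp add: ennreal_mult)
  qed
  also have "\<dots> = 2 * (\<integral>\<^sup>+x. ennreal ((norm x)\<^sup>2 * \<bar>f x - 1\<bar>) \<partial>?\<mu>)" by (rule nn_integral_cmult) simp
  finally show ?thesis .
qed

text \<open>Factor |f - 1| as (sqrt f + 1) |sqrt f - 1|. Cauchy-Schwarz bounds the weighted L^1
  distance in \<open>W2_sq_density_le\<close> by a fourth-moment factor and the Hellinger distance.
  \<open>X\<close> collects the fourth moments of f d\<gamma> and \<gamma> through (sqrt f + 1)^2 <=
  2 (f + 1), and \<open>K'\<close> is the constant of \<open>hellinger_le_deficit\<close>.\<close>

theorem (in rough_density) W2_sq_le_deficit:
  fixes N X K' \<delta> :: real
  defines "N \<equiv> real CARD('n)"
  defines "X \<equiv> 2 * ((N\<^sup>2 + 4 * N) / \<epsilon>\<^sup>2 + (N\<^sup>2 + 4 * N))" and "K' \<equiv> N * (8 / \<epsilon> + 4 / \<epsilon>\<^sup>2) / 4"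
    and "\<delta> \<equiv> (\<integral>x. (norm (Df x))\<^sup>2 / f x \<partial>gauss) / 2 - (\<integral>x. f x * ln (f x) \<partial>gauss)"
  assumes mean: "\<And>k. (\<integral>x. x $ k * f x \<partial>gauss) = 0"
  shows "0 \<le> \<delta>" "W2_sq (density gauss (\<lambda>x. ennreal (f x))) gauss \<le> ennreal (2 * sqrt (2 * X * K' * \<delta>))"
proof -
  have N: "1 \<le> N" by (simp add: N_def Suc_leI)
  have K': "0 < K'" unfolding K'_def using N \<epsilon> by (intro divide_pos_pos mult_pos_pos add_pos_pos) auto
  have L: "0 < N\<^sup>2 + 4 * N" using N by (intro add_pos_pos) auto
  have X: "0 < X" unfolding X_def using L N \<epsilon> by (intro mult_pos_pos add_pos_pos divide_pos_pos) auto
  have f0: "0 \<le> f x" for x using f_pos[of x] by simp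
  have sq: "(sqrt (f x))\<^sup>2 = f x" for x using f0 by simp
  have ik: "integrable gauss (\<lambda>x. x $ k * f x)" for k
  proof (rule integrable_gauss_growth[OF subgaussian_growth_mono[OF subgaussian_growth_weight[OF growth_f]]])
    fix x :: "real^'n"
    have "norm x \<le> 1 + (norm x)\<^sup>2" using abs_mult_le_sum_squares[of 1 "norm x"] by simp
    then have "\<bar>x $ k\<bar> \<le> 1 + (norm x)\<^sup>2" using component_le_norm_cart[of x k] by linarith
    then have "\<bar>x $ k\<bar> * f x \<le> (1 + (norm x)\<^sup>2) * f x" by (rule mult_right_mono[OF _ f0])
    then show "norm (x $ k * f x) \<le> norm ((1 + (norm x)\<^sup>2) *\<^sub>R f x)" using f0[of x] by (simp add: abs_mult)
  qed measurable
  define a where "a = (\<integral>x. sqrt (f x) \<partial>gauss)"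
  have isq: "integrable gauss (\<lambda>x. sqrt (f x))"
  proof (rule Bochner_Integration.integrable_bound)
    show "integrable gauss (\<lambda>x. 1 + f x)" using integrable_f by simp
    have "sqrt (f x) \<le> 1 + f x" for x using abs_mult_le_sum_squares[of 1 "sqrt (f x)"] sq[of x] f0[of x] by simp
    then show "AE x in gauss. norm (sqrt (f x)) \<le> norm (1 + f x)" using f0 by (intro AE_I2) simp
  qed measurable
  have Hd: "(sqrt (f x) - 1)\<^sup>2 = f x - 2 * sqrt (f x) + 1" for x using sq[of x] by (simp add: power2_diff)
  have iH: "integrable gauss (\<lambda>x. (sqrt (f x) - 1)\<^sup>2)" unfolding Hd using integrable_f isq by simp
  have H: "(\<integral>x. (sqrt (f x) - 1)\<^sup>2 \<partial>gauss) = 2 - 2 * a"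
    unfolding Hd using integrable_f isq mass by (simp add: a_def gauss.prob_space[unfolded space_gauss])
  have H0: "0 \<le> (\<integral>x. (sqrt (f x) - 1)\<^sup>2 \<partial>gauss)" by simp
  have a: "0 \<le> a" "a \<le> 1" using H H0 f0 by (auto simp: a_def intro!: integral_nonneg_AE)
  have "1 - a\<^sup>2 \<le> K' * \<delta>"
    using hellinger_le_deficit[OF ik mean] unfolding a_def K'_def N_def \<delta>_def .
  \<comment> \<open>Hence the squared Hellinger distance 2 - 2 a is at most 2 (1 - a^2).\<close>
  moreover have "a\<^sup>2 \<le> a" unfolding power2_eq_square using mult_left_mono[OF a(2,1)] by simp
  ultimately have HK: "(\<integral>x. (sqrt (f x) - 1)\<^sup>2 \<partial>gauss) \<le> 2 * K' * \<delta>" unfolding H by simp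
  then have "0 \<le> K' * \<delta>" using H0 by linarith
  then show \<delta>: "0 \<le> \<delta>" using K' by (simp add: zero_le_mult_iff)
  have mf: "integrable gauss (\<lambda>x. f x * (norm x) ^ 4)" "(\<integral>x. f x * (norm x) ^ 4 \<partial>gauss) \<le> (N\<^sup>2 + 4 * N) / \<epsilon>\<^sup>2"
    using fourth_moment_le[OF meas_f(1) growth_f f0 mass_nn \<epsilon>(1) mid mean] by (simp_all add: N_def)
  have mg: "integrable gauss (\<lambda>x::real^'n. (norm x) ^ 4)" "(\<integral>x. (norm x) ^ 4 \<partial>(gauss :: (real^'n) measure)) \<le> N\<^sup>2 + 4 * N"
  proof -
    have g: "(\<integral>\<^sup>+x. ennreal 1 \<partial>(gauss :: (real^'n) measure)) = 1" using gauss.emeasure_space_1[where 'n = 'n] by simp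
    have "integrable gauss (\<lambda>x::real^'n. 1 * (norm x) ^ 4)" "(\<integral>x. 1 * (norm x) ^ 4 \<partial>(gauss :: (real^'n) measure)) \<le> (real CARD('n) ^ 2 + 4 * real CARD('n)) / 1\<^sup>2"
      by (rule fourth_moment_le[OF _ _ _ g, of 1]; simp add: integral_gauss_component)+
    then show "integrable gauss (\<lambda>x::real^'n. (norm x) ^ 4)" "(\<integral>x. (norm x) ^ 4 \<partial>(gauss :: (real^'n) measure)) \<le> N\<^sup>2 + 4 * N"
      by (simp_all add: N_def)
  qed
  define w where "w x = (norm x)\<^sup>2 * (sqrt (f x) + 1)" for x
  have [measurable]: "w \<in> borel_measurable borel" unfolding w_def[abs_def] by measurable
  let ?b = "\<lambda>x. 2 * (f x * (norm x) ^ 4 + (norm x) ^ 4)"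
  have w2: "(w x)\<^sup>2 * 1 \<le> ?b x" for x
  proof -
    have "(sqrt (f x) + 1)\<^sup>2 \<le> 2 * (f x + 1)"
      using zero_le_power2[of "sqrt (f x) - 1"] sq[of x] by (simp add: power2_sum power2_diff)
    then have "(norm x) ^ 4 * (sqrt (f x) + 1)\<^sup>2 \<le> (norm x) ^ 4 * (2 * (f x + 1))" by (rule mult_left_mono) simp
    moreover have "(w x)\<^sup>2 = (norm x) ^ 4 * (sqrt (f x) + 1)\<^sup>2" unfolding w_def power_mult_distrib by simp
    moreover have "(norm x) ^ 4 * (2 * (f x + 1)) = ?b x" by (simp add: algebra_simps)
    ultimately show ?thesis by (simp only: mult_1_right)
  qed
  have ib: "integrable gauss ?b" using mf(1) mg(1) by simp
  have iw: "integrable gauss (\<lambda>x. (w x)\<^sup>2 * 1)"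
  proof (rule Bochner_Integration.integrable_bound[OF ib])
    show "AE x in gauss. norm ((w x)\<^sup>2 * 1) \<le> norm (?b x)"
      by (rule AE_I2, rule norm_mono_real[OF _ w2]) simp
  qed measurable
  have wX: "(\<integral>x. (w x)\<^sup>2 * 1 \<partial>gauss) \<le> X"
  proof -
    have "(\<integral>x. (w x)\<^sup>2 * 1 \<partial>gauss) \<le> (\<integral>x. ?b x \<partial>gauss)" by (rule integral_mono[OF iw ib w2])
    also have "\<dots> = 2 * ((\<integral>x. f x * (norm x) ^ 4 \<partial>gauss) + (\<integral>x. (norm x) ^ 4 \<partial>(gauss :: (real^'n) measure)))" using mf(1) mg(1) by simp
    also have "\<dots> \<le> X" unfolding X_def by (intro mult_left_mono add_mono mf(2) mg(2)) simp
    finally show ?thesis .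
  qed
  define A where "A = (\<integral>x. (norm x)\<^sup>2 * \<bar>f x - 1\<bar> \<partial>gauss)"
  have wv: "w x * \<bar>sqrt (f x) - 1\<bar> = (norm x)\<^sup>2 * \<bar>f x - 1\<bar>" for x
  proof -
    have "f x - 1 = (sqrt (f x) + 1) * (sqrt (f x) - 1)" using sq[of x] by (simp add: power2_eq_square algebra_simps)
    then have "\<bar>f x - 1\<bar> = (sqrt (f x) + 1) * \<bar>sqrt (f x) - 1\<bar>" using f0[of x] by (simp add: abs_mult)
    then show ?thesis by (simp add: w_def)
  qed
  have "(norm (\<integral>x. w x *\<^sub>R \<bar>sqrt (f x) - 1\<bar> \<partial>gauss))\<^sup>2 \<le> X * (\<integral>x. (norm \<bar>sqrt (f x) - 1\<bar>)\<^sup>2 / 1 \<partial>gauss)"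
    by (rule norm_integral_weighted_sq_le[OF _ iw _ wX X]) (use iH in simp_all)
  then have "A\<^sup>2 \<le> X * (\<integral>x. (sqrt (f x) - 1)\<^sup>2 \<partial>gauss)" by (simp add: wv A_def)
  also have "\<dots> \<le> X * (2 * K' * \<delta>)" by (rule mult_left_mono[OF HK]) (use X in simp)
  also have "\<dots> = 2 * X * K' * \<delta>" by simp
  finally have A: "A \<le> sqrt (2 * X * K' * \<delta>)" by (rule real_le_rsqrt)
  have iA: "integrable gauss (\<lambda>x. (norm x)\<^sup>2 * \<bar>f x - 1\<bar>)"
  proof (rule Bochner_Integration.integrable_bound)
    show "integrable gauss (\<lambda>x. (w x)\<^sup>2 * 1 + (sqrt (f x) - 1)\<^sup>2)" by (intro Bochner_Integration.integrable_add iw iH)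
    show "AE x in gauss. norm ((norm x)\<^sup>2 * \<bar>f x - 1\<bar>) \<le> norm ((w x)\<^sup>2 * 1 + (sqrt (f x) - 1)\<^sup>2)"
    proof (rule AE_I2)
      fix x
      show "norm ((norm x)\<^sup>2 * \<bar>f x - 1\<bar>) \<le> norm ((w x)\<^sup>2 * 1 + (sqrt (f x) - 1)\<^sup>2)"
        unfolding wv[symmetric] using abs_mult_le_sum_squares[of "w x" "\<bar>sqrt (f x) - 1\<bar>"] by simp
    qed
  qed measurable
  have "W2_sq (density gauss (\<lambda>x. ennreal (f x))) gauss \<le> 2 * (\<integral>\<^sup>+x. ennreal ((norm x)\<^sup>2 * \<bar>f x - 1\<bar>) \<partial>gauss)"
    by (rule W2_sq_density_le[OF meas_f(1) f0 mass_nn])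
  also have "(\<integral>\<^sup>+x. ennreal ((norm x)\<^sup>2 * \<bar>f x - 1\<bar>) \<partial>gauss) = ennreal A"
    unfolding A_def by (rule nn_integral_eq_integral[OF iA]) simp
  also have "2 * ennreal A = ennreal (2 * A)" by (simp add: ennreal_mult')
  also have "\<dots> \<le> ennreal (2 * sqrt (2 * X * K' * \<delta>))" using A by (intro ennreal_leI) simp
  finally show "W2_sq (density gauss (\<lambda>x. ennreal (f x))) gauss \<le> ennreal (2 * sqrt (2 * X * K' * \<delta>))" .
qed

section \<open>From the function class to the theorem\<close>

lemma has_derivative_inner_axis_sum:
  assumes "bounded_linear (L :: real^'n::finite \<Rightarrow> real)"
  shows "L v = (\<chi> i. L (axis i 1)) \<bullet> v"
proof -
  interpret L: bounded_linear L by fact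
  have b: "(\<Sum>i\<in>UNIV. v $ i *\<^sub>R axis i 1) = v" using basis_expansion[of v] by (simp add: scalar_mult_eq_scaleR)
  have "L v = L (\<Sum>i\<in>UNIV. v $ i *\<^sub>R axis i 1)" by (simp only: b)
  also have "\<dots> = (\<Sum>i\<in>UNIV. v $ i * L (axis i 1))" by (simp add: L.sum L.scaleR)
  finally show ?thesis by (simp add: inner_vec_def mult.commute)
qed

lemma has_derivative_grad:
  assumes "h differentiable (at x)"
  shows "(h has_derivative (\<lambda>v. grad h x \<bullet> v)) (at x)"
proof -
  have d: "(h has_derivative frechet_derivative h (at x)) (at x)" using assms by (simp add: frechet_derivative_works)
  have "frechet_derivative h (at x) v = grad h x \<bullet> v" for v
    using has_derivative_inner_axis_sum[OF has_derivative_bounded_linear[OF d], of v] by (simp add: grad_def partial_deriv_def)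
  then show ?thesis by (rule has_derivative_eq_rhs[OF d, OF ext])
qed

lemma grad_eqI:
  assumes "(h has_derivative (\<lambda>v. D \<bullet> v)) (at x)"
  shows "grad h x = D"
  unfolding grad_def partial_deriv_def frechet_derivative_at[OF assms, symmetric]
  by (simp add: vec_eq_iff inner_axis)

lemma smoothD:
  assumes "smooth h"
  shows "(h has_derivative (\<lambda>v. grad h x \<bullet> v)) (at x)" "smooth (partial_deriv i h)" "continuous_on UNIV (grad h)"
proof -
  have d: "h differentiable_on UNIV" "Ck k (partial_deriv i h)" if "smooth h" for h :: "real^'n::finite \<Rightarrow> real" and i k
    using that[unfolded smooth_def, rule_format, of "Suc k"] by auto
  have s: "smooth (partial_deriv i h)" for i unfolding smooth_def using d(2)[OF assms] by blast
  show "(h has_derivative (\<lambda>v. grad h x \<bullet> v)) (at x)"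
    using d(1)[OF assms] by (intro has_derivative_grad) (simp add: differentiable_on_def)
  show "smooth (partial_deriv i h)" by (rule s)
  have "continuous_on UNIV (partial_deriv i h)" for i
    by (rule differentiable_imp_continuous_on[OF d(1)[OF s]])
  then show "continuous_on UNIV (grad h)" unfolding grad_def by (intro continuous_on_vec_lambda) simp
qed

text \<open>Second-order Taylor expansion along the segment from x to x + w, by two monotonicity
  arguments: for the derivative minus its linear lower bound, and for the function minus its
  quadratic lower bound.\<close>

lemma hessian_lower_bound_quadratic:
  fixes h :: "real^'n::finite \<Rightarrow> real"
  assumes h: "smooth h" and lb: "\<And>x. loewner_le (mat a) (hessian h x)"
  shows "h x + grad h x \<bullet> w + a / 2 * (norm w)\<^sup>2 \<le> h (x + w)"
proof -
  define L where "L t = x + t *\<^sub>R w" for t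
  have L: "(L has_derivative (\<lambda>v. v *\<^sub>R w)) (at t)" for t unfolding L_def[abs_def] by (auto intro!: derivative_eq_intros)
  have line: "((\<lambda>t. g (L t)) has_real_derivative grad g (L t) \<bullet> w) (at t)" if "smooth g" for g t
    using has_derivative_compose[OF L smoothD(1)[OF that]] by (simp add: has_field_derivative_def mult_commute_abs)
  define \<psi> where "\<psi> t = grad h (L t) \<bullet> w" for t
  have \<psi>: "(\<psi> has_real_derivative (w \<bullet> (hessian h (L t) *v w))) (at t)" for t
  proof -
    have "\<psi> = (\<lambda>t. \<Sum>i\<in>UNIV. partial_deriv i h (L t) * w $ i)"
      by (rule ext) (simp add: \<psi>_def inner_vec_def grad_def)
    moreover have "((\<lambda>t. \<Sum>i\<in>UNIV. partial_deriv i h (L t) * w $ i) has_real_derivative (\<Sum>i\<in>UNIV. (grad (partial_deriv i h) (L t) \<bullet> w) * w $ i)) (at t)"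
      by (intro DERIV_sum DERIV_cmult_right line smoothD(2)[OF h])
    moreover have "(\<Sum>i\<in>UNIV. (grad (partial_deriv i h) (L t) \<bullet> w) * w $ i) = w \<bullet> (hessian h (L t) *v w)"
      by (simp add: inner_vec_def matrix_vector_mult_def hessian_def grad_def mult.commute)
    ultimately show ?thesis by simp
  qed
  have hess: "a * (norm w)\<^sup>2 \<le> w \<bullet> (hessian h y *v w)" for y
  proof -
    have "mat a *v w = a *\<^sub>R w"
      by (simp add: vec_eq_iff matrix_vector_mult_def mat_def if_distrib[where f = "\<lambda>b. b * _"] cong: if_cong)
    moreover have "w \<bullet> (mat a *v w) \<le> w \<bullet> (hessian h y *v w)" using lb[of y] unfolding loewner_le_def by blast
    ultimately show ?thesis by (simp add: power2_norm_eq_inner)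
  qed
  define \<chi>1 where "\<chi>1 t = \<psi> t - a * (norm w)\<^sup>2 * t" for t
  have chi: "\<chi>1 0 \<le> \<chi>1 t" if "0 \<le> t" for t
  proof (rule DERIV_nonneg_imp_nondecreasing[where f = \<chi>1, OF that])
    fix u :: real
    have "(\<chi>1 has_real_derivative (w \<bullet> (hessian h (L u) *v w) - a * (norm w)\<^sup>2)) (at u)"
      unfolding \<chi>1_def[abs_def] by (rule DERIV_cong[OF DERIV_diff[OF \<psi> DERIV_cmult[OF DERIV_ident]]]) simp
    then show "\<exists>y. (\<chi>1 has_real_derivative y) (at u) \<and> 0 \<le> y" using hess[of "L u"] by (intro exI conjI) auto
  qed
  define \<chi>2 where "\<chi>2 t = h (L t) - \<psi> 0 * t - a / 2 * (norm w)\<^sup>2 * t\<^sup>2" for t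
  have "\<chi>2 0 \<le> \<chi>2 1"
  proof (rule DERIV_nonneg_imp_nondecreasing[where f = \<chi>2])
    fix u :: real assume u: "0 \<le> u"
    have "((\<lambda>t::real. t\<^sup>2) has_real_derivative 2 * u) (at u)" by (auto intro!: derivative_eq_intros)
    then have "(\<chi>2 has_real_derivative (\<psi> u - \<psi> 0 * 1 - a / 2 * (norm w)\<^sup>2 * (2 * u))) (at u)"
      unfolding \<chi>2_def[abs_def] \<psi>_def[of u] by (intro DERIV_diff line[OF h] DERIV_cmult DERIV_ident)
    moreover have "0 \<le> \<psi> u - \<psi> 0 * 1 - a / 2 * (norm w)\<^sup>2 * (2 * u)" using chi[OF u] by (simp add: \<chi>1_def)
    ultimately show "\<exists>y. (\<chi>2 has_real_derivative y) (at u) \<and> 0 \<le> y" by blast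
  qed simp
  then show ?thesis by (simp add: \<chi>2_def \<psi>_def L_def)
qed

text \<open>The Hessian bound in integrated form gives the upper bound of f around each point: at
  midpoints it is the midpoint inequality, and at the origin it is Gaussian growth.\<close>

lemma class_F_rough_density:
  fixes f :: "real^'n::finite \<Rightarrow> real"
  assumes f: "f \<in> class_F \<epsilon> M r" and "\<epsilon> > 0" and mass: "(\<integral>x. f x \<partial>gauss) = 1" and fin: "fisher f \<noteq> \<infinity>"
  obtains B where "rough_density f (grad f) B (1/2 - min \<epsilon> 1 / 4) (min \<epsilon> 1)"
proof -
  \<comment> \<open>Lowering the parameter to at most 1 only weakens the curvature bound and puts it
    in the range of the preceding results.\<close>
  define e where "e = min \<epsilon> 1"
  have e: "0 < e" "e \<le> 1" "e \<le> \<epsilon>" using \<open>\<epsilon> > 0\<close> by (auto simp: e_def)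
  obtain h where h: "smooth h" and fh: "f = (\<lambda>x. exp (- h x))" and lb: "\<And>x. loewner_le (mat (-1 + \<epsilon>)) (hessian h x)"
    using f unfolding class_F_def by blast
  have pos: "0 < f x" "0 \<le> f x" for x by (simp_all add: fh)
  have "(f has_derivative (\<lambda>v. (- f x) *\<^sub>R grad h x \<bullet> v)) (at x)" for x
  proof -
    have "(f has_derivative (\<lambda>v. - (grad h x \<bullet> v) * exp (- h x))) (at x)"
      unfolding fh by (rule has_derivative_exp[OF has_derivative_minus[OF smoothD(1)[OF h]]])
    then show ?thesis by (rule has_derivative_eq_rhs) (simp add: fun_eq_iff fh)
  qed
  then have der: "(f has_derivative (\<lambda>v. grad f x \<bullet> v)) (at x)" and g: "grad f x = (- f x) *\<^sub>R grad h x" for x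
    using grad_eqI by metis+
  have contf: "continuous_on UNIV f" using der has_derivative_continuous_on[of UNIV f "\<lambda>x v. grad f x \<bullet> v"] by simp
  have contg: "continuous_on UNIV (grad f)"
    unfolding g[abs_def] by (intro continuous_intros contf smoothD(3)[OF h])
  have conc: "f y \<le> f x * exp (- grad h x \<bullet> (y - x) + (1 - e) / 2 * (norm (y - x))\<^sup>2)" for x y
  proof -
    have "(e - \<epsilon>) / 2 * (norm (y - x))\<^sup>2 \<le> 0" using e by (intro mult_nonpos_nonneg) auto
    moreover have "(-1 + \<epsilon>) / 2 * q = - ((1 - e) / 2 * q) - (e - \<epsilon>) / 2 * q" for q by (simp add: field_simps)
    moreover have "x + (y - x) = y" by simp
    note hessian_lower_bound_quadratic[OF h lb, of x "y - x", unfolded this]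
    ultimately have "- h y \<le> - h x + (- grad h x \<bullet> (y - x) + (1 - e) / 2 * (norm (y - x))\<^sup>2)"
      unfolding inner_minus_left by (smt (verit))
    then show ?thesis unfolding fh exp_add[symmetric] by simp
  qed
  \<comment> \<open>Young's inequality absorbs the linear term at 0: it costs e/4 in the exponent,
    taking (1 - e)/2 to 1/2 - e/4, and the remainder |grad h 0|^2 / e goes into
    \<open>B\<close>.\<close>
  define B where "B = f 0 * exp ((norm (grad h 0))\<^sup>2 / e)"
  have growth: "f y \<le> B * exp ((1/2 - e / 4) * (norm y)\<^sup>2)" for y
  proof -
    have "- grad h 0 \<bullet> y \<le> norm (grad h 0) * norm y" using Cauchy_Schwarz_ineq2[of "grad h 0" y] by simp
    also have "\<dots> \<le> (norm (grad h 0))\<^sup>2 / e + e / 4 * (norm y)\<^sup>2"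
    proof -
      have "0 \<le> (norm (grad h 0) - e / 2 * norm y)\<^sup>2 / e" using e by simp
      also have "\<dots> = (norm (grad h 0))\<^sup>2 / e + e / 4 * (norm y)\<^sup>2 - norm (grad h 0) * norm y"
        using e by (simp add: power2_eq_square field_simps)
      finally show ?thesis by simp
    qed
    finally have "- grad h 0 \<bullet> (y - 0) + (1 - e) / 2 * (norm (y - 0))\<^sup>2 \<le> (norm (grad h 0))\<^sup>2 / e + (1/2 - e / 4) * (norm y)\<^sup>2"
      by (simp add: field_simps)
    then have "f 0 * exp (- grad h 0 \<bullet> (y - 0) + (1 - e) / 2 * (norm (y - 0))\<^sup>2) \<le> f 0 * exp ((norm (grad h 0))\<^sup>2 / e + (1/2 - e / 4) * (norm y)\<^sup>2)"
      using pos by (intro mult_left_mono) simp_all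
    then show ?thesis using conc[of y 0] by (simp add: B_def exp_add)
  qed
  have mid: "f x * f y \<le> (f ((1/2) *\<^sub>R (x + y)))\<^sup>2 * exp ((1 - e) / 4 * (norm (x - y))\<^sup>2)" for x y
    by (rule semiconcave_midpoint[OF pos(2) conc])
  have fi: "integrable gauss (\<lambda>x. (norm (grad f x))\<^sup>2 / f x)"
  proof (rule integrableI_nonneg)
    have [measurable]: "f \<in> borel_measurable borel" "grad f \<in> borel_measurable borel"
      using contf contg by (auto intro: borel_measurable_continuous_onI)
    show "(\<lambda>x. (norm (grad f x))\<^sup>2 / f x) \<in> borel_measurable gauss" by measurable
    show "(\<integral>\<^sup>+x. ennreal ((norm (grad f x))\<^sup>2 / f x) \<partial>gauss) < \<infinity>" using fin unfolding fisher_def by (simp add: less_top)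
    show "AE x in gauss. 0 \<le> (norm (grad f x))\<^sup>2 / f x" using pos by simp
  qed
  have "rough_density f (grad f) B (1/2 - e / 4) e"
    by unfold_locales (rule pos(1) der contg growth mid mass fi e | use e in simp)+
  then show ?thesis using that unfolding e_def by blast
qed

theorem theorem1p3:
  fixes \<epsilon> M :: real
  assumes "\<epsilon> > 0" and "M > 0"
  shows "\<exists>C>0. \<exists>\<beta> :: real \<Rightarrow> real.
    (\<forall>r>1. \<beta> r > 0 \<and> \<beta> r = (r - 1) / (2 * (2 * r - 1))) \<and>
    (\<forall>r>1. \<forall>f :: real^'n::finite \<Rightarrow> real.
      f \<in> class_F \<epsilon> M r \<longrightarrow>
      (\<integral>x. f x \<partial>gauss) = 1 \<longrightarrow>
      (\<integral>x. f x *\<^sub>R x \<partial>gauss) = 0 \<longrightarrow>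
      deficit f \<le> 1 \<longrightarrow>
      W2 (density gauss (\<lambda>x. ennreal (f x))) gauss
        \<le> ennreal (C * real_of_ereal (deficit f) powr \<beta> r))"
proof -
  define e where "e = min \<epsilon> 1"
  have e: "0 < e" using assms by (simp add: e_def)
  define N where "N = real CARD('n)"
  have N: "1 \<le> N" by (simp add: N_def Suc_leI)
  define X where "X = 2 * ((N\<^sup>2 + 4 * N) / e\<^sup>2 + (N\<^sup>2 + 4 * N))"
  define K where "K = N * (8 / e + 4 / e\<^sup>2) / 4"
  have "0 < N\<^sup>2 + 4 * N" using N by (intro add_pos_pos) auto
  then have X: "0 < X" unfolding X_def using e N by (intro mult_pos_pos add_pos_pos divide_pos_pos) auto
  have K: "0 < K" unfolding K_def using N e by (intro divide_pos_pos mult_pos_pos add_pos_pos) auto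
  \<comment> \<open>The square root of the bound for W2^2 at deficit 1.\<close>
  define C where "C = sqrt (2 * sqrt (2 * X * K))"
  define \<beta> where "\<beta> r = (r - 1) / (2 * (2 * r - 1))" for r :: real
  have C: "0 < C" using X K by (simp add: C_def)
  \<comment> \<open>(r - 1)/(2 r - 1) stays below 1/2, so \<open>\<beta> r\<close> does not exceed
    the exponent 1/4 that the estimate delivers.\<close>
  have \<beta>: "0 < \<beta> r" "\<beta> r \<le> 1/4" if "1 < r" for r
    using that by (auto simp: \<beta>_def divide_le_eq)
  have main: "W2 (density gauss (\<lambda>x. ennreal (f x))) gauss \<le> ennreal (C * real_of_ereal (deficit f) powr \<beta> r)"
    if r: "1 < r" and f: "f \<in> class_F \<epsilon> M r" and mass: "(\<integral>x. f x \<partial>gauss) = 1" and mean: "(\<integral>x. f x *\<^sub>R x \<partial>gauss) = 0" and d1: "deficit f \<le> 1"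
    for r and f :: "real^'n \<Rightarrow> real"
  proof -
    \<comment> \<open>\<open>entropy f\<close> is a real number, so infinite Fisher information
      would make the deficit infinite.\<close>
    have fin: "fisher f \<noteq> \<infinity>"
    proof
      assume "fisher f = \<infinity>"
      then have "deficit f = \<infinity>" by (simp add: deficit_def)
      then show False using d1 by simp
    qed
    obtain B where "rough_density f (grad f) B (1/2 - e / 4) e"
      using class_F_rough_density[OF f assms(1) mass fin] unfolding e_def by blast
    then interpret rough_density f "grad f" B "1/2 - e / 4" e .
    have ix: "integrable gauss (\<lambda>x. f x *\<^sub>R x)"
    proof (rule integrable_gauss_growth[OF subgaussian_growth_mono[OF subgaussian_growth_weight[OF growth_f]]])
      fix x :: "real^'n"
      have "norm x \<le> 1 + (norm x)\<^sup>2" using abs_mult_le_sum_squares[of 1 "norm x"] by simp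
      then have "f x * norm x \<le> f x * (1 + (norm x)\<^sup>2)" by (rule mult_left_mono) (rule less_imp_le[OF f_pos])
      then show "norm (f x *\<^sub>R x) \<le> norm ((1 + (norm x)\<^sup>2) *\<^sub>R f x)" using f_pos[of x] by (simp add: abs_mult mult.commute)
    qed measurable
    have mean': "(\<integral>x. x $ k * f x \<partial>gauss) = 0" for k
    proof -
      have "(\<integral>x. x $ k * f x \<partial>gauss) = (\<integral>x. (f x *\<^sub>R x) \<bullet> axis k 1 \<partial>gauss)" by (simp add: inner_axis mult.commute)
      also have "\<dots> = (\<integral>x. f x *\<^sub>R x \<partial>gauss) \<bullet> axis k 1" by (rule integral_inner_left[OF ix])
      finally show ?thesis unfolding mean by simp
    qed
    define \<delta> where "\<delta> = (\<integral>x. (norm (grad f x))\<^sup>2 / f x \<partial>gauss) / 2 - (\<integral>x. f x * ln (f x) \<partial>gauss)"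
    have fp: "0 \<le> f x" for x using f_pos[of x] by simp
    have fi: "fisher f = ennreal (\<integral>x. (norm (grad f x))\<^sup>2 / f x \<partial>gauss)"
      unfolding fisher_def by (rule nn_integral_eq_integral[OF fisher_int]) (use fp in simp)
    have "entropy f = (\<integral>x. f x * ln (f x) \<partial>gauss)" unfolding entropy_def using mass fp by simp
    moreover have "0 \<le> (\<integral>x. (norm (grad f x))\<^sup>2 / f x \<partial>gauss)" using fp by (intro integral_nonneg_AE) simp
    ultimately have def: "deficit f = ereal \<delta>" unfolding deficit_def fi by (simp add: \<delta>_def enn2ereal_ennreal)
    have \<delta>1: "\<delta> \<le> 1" using d1 unfolding def by simp
    note W = W2_sq_le_deficit[OF mean', folded N_def, folded X_def K_def \<delta>_def]
    have \<delta>0: "0 \<le> \<delta>" by (rule W(1))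
    let ?W = "W2_sq (density gauss (\<lambda>x. ennreal (f x))) gauss"
    have fW: "?W \<noteq> \<infinity>" using W(2) by (auto simp: top_unique)
    have "enn2real ?W \<le> 2 * sqrt (2 * X * K * \<delta>)"
      using enn2real_mono[OF W(2)] X K \<delta>0 by simp
    then have "sqrt (enn2real ?W) \<le> sqrt (2 * sqrt (2 * X * K * \<delta>))" by simp
    also have "\<dots> = C * sqrt (sqrt \<delta>)" by (simp add: C_def real_sqrt_mult)
    also have "\<dots> \<le> C * \<delta> powr \<beta> r"
    proof (rule mult_left_mono)
      \<comment> \<open>For 0 < \<delta> <= 1 a smaller exponent gives a larger power; at \<delta> =
        0 both sides are 0.\<close>
      show "sqrt (sqrt \<delta>) \<le> \<delta> powr \<beta> r"
      proof (cases "\<delta> = 0")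
        case False
        then have "0 < \<delta>" using \<delta>0 by simp
        then have "sqrt (sqrt \<delta>) = \<delta> powr (1/4)" by (simp add: powr_half_sqrt[symmetric] powr_powr)
        also have "\<dots> \<le> \<delta> powr \<beta> r" using \<beta>(2)[OF r] \<open>0 < \<delta>\<close> \<delta>1 by (intro powr_mono') auto
        finally show ?thesis .
      qed simp
    qed (use C in simp)
    finally have "ennreal (sqrt (enn2real ?W)) \<le> ennreal (C * \<delta> powr \<beta> r)" by (rule ennreal_leI)
    then show ?thesis unfolding W2_def def using fW by simp
  qed
  show ?thesis
    by (rule exI[of _ C], rule conjI[OF C], rule exI[of _ \<beta>]) (use \<beta>(1) main in \<open>auto simp: \<beta>_def\<close>)
qed

end
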